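(* Let $\nu$ be a positive integer. The explicit real integral representation of the heat kernel $E_\nu(t,z,w)$ for the invariant magnetic Laplacian $\Delta_\nu$ on the quantized Riemann sphere $S^2$ is given by $$E_\nu(t,z,w)=\frac{2(1+z\overline{w})^{2\nu}e^{\nu t}}{\pi(1+|z|^2)^{\nu}(1+|w|^2)^{\nu}\cos^{2\nu}(d)}\int_{d}^{\pi/2}\frac{\frac{d}{du}\big(\theta_{2,\nu}(t,u)\big)}{\sqrt{\cos^2(d)-\cos^2(u)}}\;{}_2F_1\!\left(-2\nu,2\nu;\tfrac12;\frac{\cos(d)-\cos(u)}{2\cos(d)}\right)du,$$ where $d=d(z,w)$ and $\theta_{2,\nu}$ is given by $$\theta_{2,\nu}(t,u)=\sum_{l=0}^{+\infty}e^{-l(l+2\nu+1)t}\cos\big((2l+2\nu+1)u\big).$$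
   Context: The Riemann unit sphere $S^2$ is identified with the extended complex plane $\mathbb{C}\cup\{\infty\}$, with $L^2(S^2)=L^2(S^2,d\mu)$, $d\mu(z)=\frac{dx\,dy}{\pi(1+|z|^2)^2}$, $z=x+iy$. The invariant magnetic Laplacian is $$\Delta_\nu=-(1+|z|^2)^2\frac{\partial^2}{\partial z\,\partial\overline{z}}-\nu(1+|z|^2)\left(z\frac{\partial}{\partial z}-\overline{z}\frac{\partial}{\partial\overline{z}}\right)+\nu^2|z|^2,$$ acting on the sections of the $U(1)$-bundle over the (quantized) Riemann sphere $S^2$ and describing the Dirac monopole with charge $q=2\nu$ under the action of a constant quantized magnetic field of strength $\nu$. The heat kernel $E_\nu(t,z,w)$ is the solution of the heat problem $\Delta_\nu E_\nu(t,z,z_0)=\frac{\partial}{\partial t}E_\nu(t,z,z_0)$ for $t>0$, $z,z_0\in S^2$, with $\lim_{t\to0}\int_{S^2}E_\nu(t,z,w)f(w)\,d\mu(w)=f(z)$ for $f\in C^\infty(S^2)$. The quantity $d(z,w)$ is $d(z,w)=\frac{|1+z\overline{w}|}{(1+|z|)^2(1+|w|)^2}$. ${}_2F_1(a,b;c;x)=\sum_{k\ge0}\frac{(a)_k(b)_k}{(c)_k}\frac{x^k}{k!}$ is the Gauss hypergeometric function, where $(a)_k=a(a+1)\cdots(a+k-1)$, $(a)_0=1$.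
   Formalization: Corrected: the heat equation is −ΔE=∂E/∂t; e^{νt} becomes e^{−νt}; the right side gets a factor −1; d is given by cos d=|1+zw̄|/√((1+|z|²)(1+|w|²)); the initial limit is uniform in z, over smooth sections f, for kernels C¹ in t, C² in z. *)

theory Defs
  imports "HOL-Analysis.Analysis"
begin

section \<open>Calculus in the affine chart of the sphere\<close>

text \<open>
  The sphere is the plane \<open>complex\<close> together with the point at infinity.  Derivatives are real
  derivatives: \<open>dir_deriv f v z\<close> is the derivative of \<open>f\<close> at \<open>z\<close> in the direction \<open>v\<close>.
\<close>

definition dir_deriv :: "(complex \<Rightarrow> complex) \<Rightarrow> complex \<Rightarrow> complex \<Rightarrow> complex" where
  "dir_deriv f v z = frechet_derivative f (at z) v"

primrec C_k :: "nat \<Rightarrow> (complex \<Rightarrow> complex) \<Rightarrow> bool" where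
  "C_k 0 f \<longleftrightarrow> continuous_on UNIV f"
| "C_k (Suc k) f \<longleftrightarrow> (\<forall>z. f differentiable (at z)) \<and> (\<forall>v. C_k k (dir_deriv f v))"

definition smooth :: "(complex \<Rightarrow> complex) \<Rightarrow> bool" where
  "smooth f \<longleftrightarrow> (\<forall>k. C_k k f)"

definition wirtinger :: "(complex \<Rightarrow> complex) \<Rightarrow> complex \<Rightarrow> complex" where
  "wirtinger f z = (dir_deriv f 1 z - \<i> * dir_deriv f \<i> z) / 2"

definition wirtinger_bar :: "(complex \<Rightarrow> complex) \<Rightarrow> complex \<Rightarrow> complex" where
  "wirtinger_bar f z = (dir_deriv f 1 z + \<i> * dir_deriv f \<i> z) / 2"

definition magnetic_laplacian :: "nat \<Rightarrow> (complex \<Rightarrow> complex) \<Rightarrow> complex \<Rightarrow> complex" where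
  "magnetic_laplacian \<nu> f z =
     - of_real ((1 + (norm z)\<^sup>2)\<^sup>2) * wirtinger (wirtinger_bar f) z
     - of_nat \<nu> * of_real (1 + (norm z)\<^sup>2) * (z * wirtinger f z - cnj z * wirtinger_bar f z)
     + of_nat (\<nu>\<^sup>2) * of_real ((norm z)\<^sup>2) * f z"

definition sphere_measure :: "complex measure" where
  "sphere_measure = density lborel (\<lambda>z. ennreal (1 / (pi * (1 + (norm z)\<^sup>2)\<^sup>2)))"


section \<open>Sections of the bundle and the heat kernel\<close>

text \<open>
  A section of the \<open>U(1)\<close>-bundle of charge \<open>2 * \<nu>\<close> is given in the chart \<open>z\<close> by a function \<open>f\<close>.
  In the chart \<open>\<zeta> = 1 / z\<close> at infinity it becomes \<open>\<zeta> \<mapsto> (\<zeta> / cnj \<zeta>) ^ \<nu> * f (1 / \<zeta>)\<close>.  This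
  is the gluing under which the lowest eigensections \<open>z ^ k / (1 + (norm z)\<^sup>2) ^ \<nu>\<close>,
  \<open>k \<le> 2 * \<nu>\<close>, turn into \<open>\<zeta> ^ (2 * \<nu> - k) / (1 + (norm \<zeta>)\<^sup>2) ^ \<nu>\<close>, and under which the
  magnetic Laplacian extends smoothly over infinity.
\<close>

definition smooth_section :: "nat \<Rightarrow> (complex \<Rightarrow> complex) \<Rightarrow> bool" where
  "smooth_section \<nu> f \<longleftrightarrow> smooth f \<and>
     (\<exists>g. smooth g \<and> (\<forall>\<zeta>. \<zeta> \<noteq> 0 \<longrightarrow> g \<zeta> = (\<zeta> / cnj \<zeta>) ^ \<nu> * f (1 / \<zeta>)))"

text \<open>Class \<open>C\<^sup>1\<close> in \<open>t > 0\<close> and \<open>C\<^sup>2\<close> in \<open>z\<close>, with derivatives jointly continuous in \<open>(t, z, w)\<close>.\<close>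

definition heat_regular :: "(real \<Rightarrow> complex \<Rightarrow> complex \<Rightarrow> complex) \<Rightarrow> bool" where
  "heat_regular K \<longleftrightarrow>
     continuous_on ({0<..} \<times> UNIV \<times> UNIV) (\<lambda>(t, z, w). K t z w) \<and>
     (\<forall>t>0. \<forall>z w. (\<lambda>s. K s z w) differentiable (at t)) \<and>
     continuous_on ({0<..} \<times> UNIV \<times> UNIV)
       (\<lambda>(t, z, w). vector_derivative (\<lambda>s. K s z w) (at t)) \<and>
     (\<forall>t>0. \<forall>z w. (\<lambda>x. K t x w) differentiable (at z)) \<and>
     (\<forall>v. continuous_on ({0<..} \<times> UNIV \<times> UNIV)
       (\<lambda>(t, z, w). dir_deriv (\<lambda>x. K t x w) v z)) \<and>
     (\<forall>t>0. \<forall>z w v. dir_deriv (\<lambda>x. K t x w) v differentiable (at z)) \<and>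
     (\<forall>v v'. continuous_on ({0<..} \<times> UNIV \<times> UNIV)
       (\<lambda>(t, z, w). dir_deriv (dir_deriv (\<lambda>x. K t x w) v) v' z))"

text \<open>
  An integral kernel acting on sections is a section of the bundle in \<open>z\<close> and of the dual bundle
  in \<open>w\<close>; the four clauses are the regularity of \<open>E\<close> in the four products of charts.
\<close>

definition regular_section_kernel ::
    "nat \<Rightarrow> (real \<Rightarrow> complex \<Rightarrow> complex \<Rightarrow> complex) \<Rightarrow> bool" where
  "regular_section_kernel \<nu> E \<longleftrightarrow>
     heat_regular E \<and>
     (\<exists>K. heat_regular K \<and> (\<forall>t>0. \<forall>\<zeta> w. \<zeta> \<noteq> 0 \<longrightarrow>
        K t \<zeta> w = (\<zeta> / cnj \<zeta>) ^ \<nu> * E t (1 / \<zeta>) w)) \<and>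
     (\<exists>K. heat_regular K \<and> (\<forall>t>0. \<forall>z \<eta>. \<eta> \<noteq> 0 \<longrightarrow>
        K t z \<eta> = (cnj \<eta> / \<eta>) ^ \<nu> * E t z (1 / \<eta>))) \<and>
     (\<exists>K. heat_regular K \<and> (\<forall>t>0. \<forall>\<zeta> \<eta>. \<zeta> \<noteq> 0 \<longrightarrow> \<eta> \<noteq> 0 \<longrightarrow>
        K t \<zeta> \<eta> = (\<zeta> / cnj \<zeta>) ^ \<nu> * (cnj \<eta> / \<eta>) ^ \<nu> * E t (1 / \<zeta>) (1 / \<eta>)))"

text \<open>
  The magnetic Laplacian above is nonnegative, with eigenvalues \<open>l * (l + 2 * \<nu> + 1) + \<nu>\<close>, so the
  heat equation that is well posed for \<open>t > 0\<close> carries a minus sign.  The initial condition is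
  uniform on the sphere, tested on smooth sections (pointwise convergence would not determine the
  kernel); transition functions have modulus 1, so uniformity over the plane is uniformity over
  the sphere.
\<close>

definition is_heat_kernel :: "nat \<Rightarrow> (real \<Rightarrow> complex \<Rightarrow> complex \<Rightarrow> complex) \<Rightarrow> bool" where
  "is_heat_kernel \<nu> E \<longleftrightarrow>
     regular_section_kernel \<nu> E \<and>
     (\<forall>t>0. \<forall>z w. ((\<lambda>s. E s z w) has_vector_derivative
        - magnetic_laplacian \<nu> (\<lambda>x. E t x w) z) (at t)) \<and>
     (\<forall>f. smooth_section \<nu> f \<longrightarrow>
        uniform_limit UNIV (\<lambda>t z. \<integral>w. E t z w * f w \<partial>sphere_measure) f (at_right 0))"


section \<open>The ingredients of the integral representation\<close>

text \<open>
  Half the angle between \<open>z\<close> and \<open>w\<close> on the unit sphere, with values in \<open>{0..pi/2}\<close>; equal to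
  \<open>pi/2\<close> exactly for antipodal points, \<open>1 + z * cnj w = 0\<close>.
\<close>

definition sphere_dist :: "complex \<Rightarrow> complex \<Rightarrow> real" where
  "sphere_dist z w =
     arccos (norm (1 + z * cnj w) / (sqrt (1 + (norm z)\<^sup>2) * sqrt (1 + (norm w)\<^sup>2)))"

definition hypergeo_2F1 :: "real \<Rightarrow> real \<Rightarrow> real \<Rightarrow> real \<Rightarrow> real" where
  "hypergeo_2F1 a b c x =
     (\<Sum>k. pochhammer a k * pochhammer b k / pochhammer c k * (x ^ k / fact k))"

definition theta2 :: "nat \<Rightarrow> real \<Rightarrow> real \<Rightarrow> real" where
  "theta2 \<nu> t u =
     (\<Sum>l. exp (- (real l * (real l + 2 * real \<nu> + 1) * t)) * cos ((2 * real l + 2 * real \<nu> + 1) * u))"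

text \<open>
  Conventions for the integral representation itself.  The Jacobi polynomial of degree \<open>l\<close> with
  parameters \<open>0\<close> and \<open>2 * \<nu>\<close>, at \<open>cos (2 * d)\<close>, is \<open>2 / (pi * cos d ^ (2 * \<nu>))\<close> times the
  integral over \<open>{d..pi/2}\<close> of the weight \<open>1 / sqrt ((cos d)\<^sup>2 - (cos u)\<^sup>2)\<close>, the hypergeometric
  factor and \<open>sin ((2 * l + 2 * \<nu> + 1) * u)\<close>.  As the derivative of cosine is minus sine, the
  kernel is minus the integral of the derivative of \<open>theta2\<close>; the eigenvalues
  \<open>l * (l + 2 * \<nu> + 1) + \<nu>\<close> give the prefactor \<open>exp (- \<nu> * t)\<close>.

  At antipodal points the representation reads \<open>0 / 0\<close>; with \<open>x / 0 = 0\<close> its value is \<open>0\<close>, which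
  is also the value forced by continuity of the kernel when \<open>\<nu> > 0\<close>.
\<close>

end

theory Submission
  imports Defs
begin

text \<open>
  On functions \<open>B * \<phi> X\<close>, where \<open>X = (cos d)\<^sup>2\<close> is the overlap of \<open>z\<close> with a fixed point and \<open>B\<close> the
  matching section of modulus \<open>X ^ \<nu>\<close>, the magnetic Laplacian is the Jacobi operator in \<open>X\<close>.  This gives
  the candidate kernel \<open>B * (\<Sum>l. (2 * l + 2 * \<nu> + 1) * exp (- (l * (l + 2 * \<nu> + 1) + \<nu>) * t) * P l X)\<close>.
  The substitution \<open>cos u = cos d * cos \<phi>\<close> turns the hypergeometric factor into \<open>cos (2 * \<nu> * \<phi>)\<close> and
  the integral of each theta term into a Jacobi polynomial, so the right-hand side of the
  representation is the candidate.

  A diamagnetic maximum principle drives the rest.  By duality it bounds the \<open>L\<^sup>1\<close> norm of the candidate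
  by 1, which makes it an approximate identity.  For any heat kernel \<open>E\<close> and the candidate \<open>S\<close> it shows
  \<open>\<integral>w. E t z w * S s w y = S (t + s) z y\<close>, as both sides solve the heat equation with initial value
  \<open>S s z y\<close>; letting \<open>s\<close> tend to 0 gives \<open>E = S\<close>.
\<close>

section \<open>Jacobi polynomials\<close>

text \<open>Two obstacles shape the proof. The kernel carries a phase and no sign of its radial
  profile is available, so positivity cannot produce an approximate identity. Instead the lowest
  eigenvalue supplies one moment, \<open>exp (- real \<nu> * t)\<close>: the modulus has mass at
  most 1, a weighted integral of the profile tends to 1, so the mass must gather near
  \<open>X = 1\<close>. Secondly, an arbitrary heat kernel is only continuous in \<open>w\<close>,
  comes without Hermitian symmetry, and its initial condition may be tested on smooth sections only.
  Composition with the candidate, a smooth section in \<open>w\<close>, yields a solution within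
  reach of the maximum principle; symmetry is used for the candidate alone. The maximum principle
  lives in one chart: \<open>ln (1 + (norm z)\<^sup>2)\<close> grows at infinity and has constant
  sphere Laplacian 1, hence is a barrier for the missing point. Points enter the formulas as
  homogeneous pairs \<open>(\<alpha>, \<beta>)\<close>, with \<open>(1, cnj w)\<close> for
  \<open>w\<close>, so that one computation serves all four products of charts.\<close>

text \<open>Classically P_l^(0,a)(2x - 1), a Jacobi polynomial shifted to the interval from 0 to 1.
  Explicit coefficients allow both the differential equation and the later comparison with Chebyshev
  integrals to be checked coefficient by coefficient.\<close>

definition jacobi :: "nat \<Rightarrow> nat \<Rightarrow> real poly" where
  "jacobi a l = (\<Sum>i\<le>l. monom ((-1) ^ (l - i) * real (l choose i) * real ((a + l + i) choose l)) i)"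

lemma coeff_jacobi:
  "coeff (jacobi a l) i = (-1) ^ (l - i) * real (l choose i) * real ((a + l + i) choose l)"
  by (auto simp: jacobi_def coeff_sum coeff_monom sum.delta binomial_eq_0)

lemma degree_jacobi_le: "degree (jacobi a l) \<le> l"
  by (rule degree_le) (auto simp: coeff_jacobi binomial_eq_0)

text \<open>This is \<open>jacobi_ode\<close> read off on coefficients. Each binomial contributes
  one factor by an absorption identity, and the sign flips once.\<close>

lemma coeff_jacobi_rec:
  "real (i + 1) * real (i + a + 1) * coeff (jacobi a l) (Suc i)
     = - (real l - real i) * real (l + i + a + 1) * coeff (jacobi a l) i"
proof (cases "i < l")
  case True
  have 1: "real (i + 1) * real (l choose Suc i) = (real l - real i) * real (l choose i)"
  proof -
    have "Suc i * (l choose Suc i) = (l - i) * (l choose i)"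
      by (metis binomial_absorption binomial_absorb_comp)
    then have "real (Suc i * (l choose Suc i)) = real ((l - i) * (l choose i))" by simp
    then show ?thesis using True by (simp add: algebra_simps of_nat_diff)
  qed
  have 2: "real (i + a + 1) * real ((a + l + Suc i) choose l) = real (l + i + a + 1) * real ((a + l + i) choose l)"
  proof -
    have "(Suc (a + l + i) - l) * (Suc (a + l + i) choose l) = Suc (a + l + i) * ((a + l + i) choose l)"
      using binomial_absorb_comp[of "Suc (a+l+i)" l] by simp
    then have "real ((Suc (a + l + i) - l) * (Suc (a + l + i) choose l)) = real (Suc (a + l + i) * ((a + l + i) choose l))"
      by presburger
    moreover have "Suc (a + l + i) - l = i + a + 1" by simp
    ultimately show ?thesis by (simp add: algebra_simps)
  qed
  have s: "(-1::real) ^ (l - i) = - ((-1) ^ (l - Suc i))"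
    using True by (metis Suc_diff_Suc mult_minus1 power_Suc)
  have "real (i + 1) * real (i + a + 1) * coeff (jacobi a l) (Suc i)
     = (-1) ^ (l - Suc i) * (real (i + 1) * real (l choose Suc i)) * (real (i + a + 1) * real ((a + l + Suc i) choose l))"
    by (simp add: coeff_jacobi)
  also have "\<dots> = (-1) ^ (l - Suc i) * ((real l - real i) * real (l choose i)) * (real (l + i + a + 1) * real ((a + l + i) choose l))"
    unfolding 1 2 ..
  finally show ?thesis
    by (simp only: coeff_jacobi s mult_minus_left mult_minus_right minus_minus mult_ac)
next
  case False
  then show ?thesis by (cases "i = l") (auto simp: coeff_jacobi binomial_eq_0)
qed

text \<open>The coefficient of each power of \<open>x\<close> on the left is an instance of
  \<open>coeff_jacobi_rec\<close>.\<close>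

lemma jacobi_ode:
  "x * (1 - x) * poly (pderiv (pderiv (jacobi a l))) x
     + (real a + 1 - (real a + 2) * x) * poly (pderiv (jacobi a l)) x
     + real l * (real l + real a + 1) * poly (jacobi a l) x = 0"
proof -
  define c where "c = coeff (jacobi a l)"
  have rec: "(real i + 1) * (real i + real a + 1) * c (Suc i) = - (real l - real i) * (real l + real i + real a + 1) * c i" for i
    using coeff_jacobi_rec[of i a l] unfolding c_def by (simp add: algebra_simps)
  define P where "P = [:0, 1, -1:] * pderiv (pderiv (jacobi a l))
      + [:real a + 1, - (real a + 2):] * pderiv (jacobi a l)
      + smult (real l * (real l + real a + 1)) (jacobi a l)"
  \<comment> \<open>The cases 0, 1 and at least 2 are separated because multiplication by
    \<open>[:0, 1, -1:]\<close> reaches back two coefficients.\<close>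
  have "coeff P i = 0" for i
  proof (cases i)
    case 0
    show ?thesis using rec[of 0] unfolding P_def 0
      by (simp add: coeff_pderiv algebra_simps flip: c_def)
  next
    case (Suc j)
    show ?thesis
    proof (cases j)
      case 0
      show ?thesis using rec[of 1] unfolding P_def Suc 0
        by (simp add: coeff_pderiv coeff_pCons algebra_simps flip: c_def)
    next
      case (Suc k)
      show ?thesis using rec[of "Suc (Suc k)"] unfolding P_def \<open>i = Suc j\<close> Suc
        by (simp add: coeff_pderiv coeff_pCons algebra_simps flip: c_def)
    qed
  qed
  then have "P = 0" by (simp add: poly_eq_iff)
  then have "poly P x = 0" by simp
  then show ?thesis unfolding P_def by (simp add: algebra_simps)
qed

text \<open>The left side is the \<open>l\<close>-th finite difference of a binomial as a function
  of its upper index; by Pascal's rule every difference lowers the lower index by one.\<close>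

lemma alternating_binomial_sum:
  "(\<Sum>i\<le>l. (-1) ^ (l - i) * real (l choose i) * real ((n + i) choose (k + l))) = real (n choose k)"
proof (induction l arbitrary: k)
  case 0 then show ?case by simp
next
  case (Suc l)
  let ?f = "\<lambda>i. real ((n + i) choose (k + Suc l))"
  let ?s = "\<lambda>i. (-1::real) ^ (l - i) * real (l choose i)"
  have "(\<Sum>i\<le>Suc l. (-1) ^ (Suc l - i) * real (Suc l choose i) * ?f i)
      = (-1) ^ (Suc l) * ?f 0 + (\<Sum>i\<le>l. (-1) ^ (l - i) * (real (l choose i) + real (l choose Suc i)) * ?f (Suc i))"
    by (subst sum.atMost_Suc_shift) simp
  also have "(\<Sum>i\<le>l. (-1) ^ (l - i) * (real (l choose i) + real (l choose Suc i)) * ?f (Suc i))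
     = (\<Sum>i\<le>l. ?s i * ?f (Suc i)) + (\<Sum>i\<le>l. (-1) ^ (l - i) * real (l choose Suc i) * ?f (Suc i))"
    by (simp add: algebra_simps sum.distrib)
  also have "(\<Sum>i\<le>l. (-1) ^ (l - i) * real (l choose Suc i) * ?f (Suc i))
      = - (\<Sum>i<l. ?s (Suc i) * ?f (Suc i))"
  proof -
    have "(-1) ^ (l - i) * real (l choose Suc i) * ?f (Suc i) = - (?s (Suc i) * ?f (Suc i))" if "i < l" for i
    proof -
      have "l - i = Suc (l - Suc i)" using that by simp
      then show ?thesis by (simp only: power_Suc)
    qed
    then show ?thesis by (simp flip: lessThan_Suc_atMost add: binomial_eq_0 sum_negf)
  qed
  also have "(\<Sum>i<l. ?s (Suc i) * ?f (Suc i)) = (\<Sum>i\<le>l. ?s i * ?f i) - (-1) ^ l * ?f 0"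
    using sum.atMost_shift[of "\<lambda>i. ?s i * ?f i" l] by simp
  also have "(-1) ^ (Suc l) * ?f 0 + ((\<Sum>i\<le>l. ?s i * ?f (Suc i)) + - ((\<Sum>i\<le>l. ?s i * ?f i) - (-1) ^ l * ?f 0))
      = (\<Sum>i\<le>l. ?s i * ?f (Suc i)) - (\<Sum>i\<le>l. ?s i * ?f i)"
    by (simp only: power_Suc)
  also have "\<dots> = (\<Sum>i\<le>l. ?s i * (?f (Suc i) - ?f i))"
    by (simp only: right_diff_distrib sum_subtractf)
  also have "\<dots> = (\<Sum>i\<le>l. ?s i * real ((n + i) choose (k + l)))"
    by simp
  finally show ?case using Suc by simp
qed

text \<open>The alternating sum with \<open>k = 0\<close>. This normalisation makes the value of an
  eigensum at the pole \<open>X = 1\<close> the plain sum of its coefficients.\<close>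

lemma poly_jacobi_1: "poly (jacobi a l) 1 = 1"
  using alternating_binomial_sum[of l "a + l" 0]
  by (simp add: jacobi_def poly_sum poly_monom)

lemma lead_coeff_jacobi_nonzero: "coeff (jacobi a l) l \<noteq> 0"
  by (simp add: coeff_jacobi)

text \<open>The family is triangular with nonzero leading coefficients, so the leading terms can be
  eliminated one after the other.\<close>

lemma jacobi_expansion:
  assumes "\<And>i. i > n \<Longrightarrow> coeff q i = 0"
  shows "\<exists>c. q = (\<Sum>l\<le>n. smult (c l) (jacobi a l))"
  using assms
proof (induction n arbitrary: q)
  case 0
  have "q = smult (coeff q 0 / coeff (jacobi a 0) 0) (jacobi a 0)"
  proof (rule poly_eqI)
    fix i show "coeff q i = coeff (smult (coeff q 0 / coeff (jacobi a 0) 0) (jacobi a 0)) i"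
      using 0[of i] by (cases i) (auto simp: coeff_jacobi)
  qed
  then show ?case by (intro exI[of _ "\<lambda>_. coeff q 0 / coeff (jacobi a 0) 0"]) simp
next
  case (Suc n)
  define d where "d = coeff q (Suc n) / coeff (jacobi a (Suc n)) (Suc n)"
  have "coeff (q - smult d (jacobi a (Suc n))) i = 0" if "i > n" for i
    using that Suc.prems[of i] lead_coeff_jacobi_nonzero[of a "Suc n"]
    by (cases "i = Suc n") (auto simp: d_def coeff_jacobi[of _ _ i] binomial_eq_0)
  from Suc.IH[OF this] obtain c where c: "q - smult d (jacobi a (Suc n)) = (\<Sum>l\<le>n. smult (c l) (jacobi a l))"
    by blast
  have "q = (\<Sum>l\<le>Suc n. smult ((c(Suc n := d)) l) (jacobi a l))"
    using c by (simp add: algebra_simps)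
  then show ?case by blast
qed

text \<open>Green's identity for the equation in divergence form: the derivative of
  \<open>x ^ (a + 1) * (1 - x) * R'\<close> is \<open>- lam * x ^ a * R\<close>, and the flux
  vanishes at both ends. Testing against a power couples two consecutive moments, whence the
  induction.\<close>

lemma has_integral_jacobi_monom:
  assumes "j < l"
  shows "((\<lambda>x. x ^ a * poly (jacobi a l) x * x ^ j) has_integral 0) {0..1}"
  using assms
proof (induction j)
  case 0
  let ?R = "jacobi a l"
  let ?lam = "real l * (real l + real a + 1)"
  have "((\<lambda>x. - ?lam * (x ^ a * poly ?R x)) has_integral
      ((1::real) ^ (a + 1) * (1 - 1) * poly (pderiv ?R) 1 - 0 ^ (a + 1) * (1 - 0) * poly (pderiv ?R) 0)) {0..1}"
  proof (rule fundamental_theorem_of_calculus)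
    fix x :: real assume "x \<in> {0..1}"
    have "((\<lambda>x. x ^ (a + 1) * (1 - x) * poly (pderiv ?R) x) has_real_derivative
      x ^ a * (x * (1 - x) * poly (pderiv (pderiv ?R)) x + (real a + 1 - (real a + 2) * x) * poly (pderiv ?R) x)) (at x within {0..1})"
      by (rule derivative_eq_intros refl)+ (simp add: algebra_simps)
    also have "(x * (1 - x) * poly (pderiv (pderiv ?R)) x + (real a + 1 - (real a + 2) * x) * poly (pderiv ?R) x) = - ?lam * poly ?R x"
      using jacobi_ode[of x a l] by (simp add: eq_neg_iff_add_eq_0)
    finally show "((\<lambda>x. x ^ (a + 1) * (1 - x) * poly (pderiv ?R) x) has_vector_derivative - ?lam * (x ^ a * poly ?R x)) (at x within {0..1})"
      by (simp add: has_real_derivative_iff_has_vector_derivative algebra_simps)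
  qed simp
  from has_integral_mult_right[OF this, of "- 1 / ?lam"] show ?case using 0 by simp
next
  case (Suc j)
  let ?R = "jacobi a l"
  let ?lam = "real l * (real l + real a + 1)"
  let ?k = "real j + 1"
  \<comment> \<open>The flux of Green's identity for the pair consisting of the Jacobi polynomial
    and \<open>x ^ Suc j\<close>; its derivative involves only the moments of order \<open>j\<close>
    and \<open>Suc j\<close>.\<close>
  let ?F = "\<lambda>x. x ^ (a + 1) * (1 - x) * (x ^ Suc j * poly (pderiv ?R) x - ?k * x ^ j * poly ?R x)"
  have "((\<lambda>x. (- ?lam + ?k * (real a + ?k + 1)) * (x ^ a * poly ?R x * x ^ Suc j) - ?k * (real a + ?k) * (x ^ a * poly ?R x * x ^ j)) has_integral
      (?F 1 - ?F 0)) {0..1}"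
  proof (rule fundamental_theorem_of_calculus)
    fix x :: real assume "x \<in> {0..1}"
    have d: "((\<lambda>x. x ^ (a + 1) * (1 - x) * poly (pderiv ?R) x) has_real_derivative
      x ^ a * (x * (1 - x) * poly (pderiv (pderiv ?R)) x + (real a + 1 - (real a + 2) * x) * poly (pderiv ?R) x)) (at x within {0..1})"
      by (rule derivative_eq_intros refl)+ (simp add: algebra_simps)
    have e: "(x * (1 - x) * poly (pderiv (pderiv ?R)) x + (real a + 1 - (real a + 2) * x) * poly (pderiv ?R) x) = - ?lam * poly ?R x"
      using jacobi_ode[of x a l] by (simp add: eq_neg_iff_add_eq_0)
    have d2: "((\<lambda>x. (x ^ (a + 1) * (1 - x) * poly (pderiv ?R) x) * x ^ Suc j - ?k * (x ^ (a + 1 + j) * (1 - x)) * poly ?R x) has_real_derivative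
       (x ^ a * (- ?lam * poly ?R x)) * x ^ Suc j + (x ^ (a + 1) * (1 - x) * poly (pderiv ?R) x) * (?k * x ^ j)
        - ?k * (((real a + ?k) * x ^ (a + j)) * (1 - x) - x ^ (a + 1 + j)) * poly ?R x - ?k * (x ^ (a + 1 + j) * (1 - x)) * poly (pderiv ?R) x) (at x within {0..1})"
      by (rule derivative_eq_intros d[unfolded e] refl)+ (simp add: algebra_simps)
    show "(?F has_vector_derivative (- ?lam + ?k * (real a + ?k + 1)) * (x ^ a * poly ?R x * x ^ Suc j) - ?k * (real a + ?k) * (x ^ a * poly ?R x * x ^ j)) (at x within {0..1})"
      using d2 by (simp add: has_real_derivative_iff_has_vector_derivative algebra_simps power_add)
  qed simp
  then have "((\<lambda>x. (- ?lam + ?k * (real a + ?k + 1)) * (x ^ a * poly ?R x * x ^ Suc j) - ?k * (real a + ?k) * (x ^ a * poly ?R x * x ^ j)) has_integral 0) {0..1}"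
    by simp
  moreover have "((\<lambda>x. ?k * (real a + ?k) * (x ^ a * poly ?R x * x ^ j)) has_integral (?k * (real a + ?k) * 0)) {0..1}"
    using Suc by (intro has_integral_mult_right) auto
  ultimately have "((\<lambda>x. (- ?lam + ?k * (real a + ?k + 1)) * (x ^ a * poly ?R x * x ^ Suc j) - ?k * (real a + ?k) * (x ^ a * poly ?R x * x ^ j)
      + ?k * (real a + ?k) * (x ^ a * poly ?R x * x ^ j)) has_integral (0 + ?k * (real a + ?k) * 0)) {0..1}"
    by (rule has_integral_add)
  then have *: "((\<lambda>x. (- ?lam + ?k * (real a + ?k + 1)) * (x ^ a * poly ?R x * x ^ Suc j)) has_integral 0) {0..1}"
    by simp
  \<comment> \<open>The factor of the new moment is a difference of two eigenvalues, and it is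
    nonzero because \<open>Suc j < l\<close>.\<close>
  have "- ?lam + ?k * (real a + ?k + 1) = - ((real l - ?k) * (real l + ?k + real a + 1))"
    by (simp add: algebra_simps)
  moreover have "real l - ?k > 0" "real l + ?k + real a + 1 > 0" using Suc.prems by auto
  ultimately have "- ?lam + ?k * (real a + ?k + 1) \<noteq> 0" by simp
  then show ?case using has_integral_mult_right[OF *, of "1 / (- ?lam + ?k * (real a + ?k + 1))"] by simp
qed

lemma has_integral_jacobi_lower:
  assumes "\<And>i. i \<ge> l \<Longrightarrow> coeff q i = 0"
  shows "((\<lambda>x. x ^ a * poly (jacobi a l) x * poly q x) has_integral 0) {0..1}"
proof -
  have q: "poly q x = (\<Sum>i<l. coeff q i * x ^ i)" for x
  proof (cases "q = 0")
    case False
    then have "degree q < l" using assms[of "degree q"] by (meson leading_coeff_neq_0 not_le)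
    then show ?thesis by (auto simp: poly_altdef intro!: sum.mono_neutral_left coeff_eq_0)
  qed auto
  have "((\<lambda>x. \<Sum>i<l. coeff q i * (x ^ a * poly (jacobi a l) x * x ^ i)) has_integral (\<Sum>i<l. coeff q i * 0)) {0..1}"
    by (intro has_integral_sum has_integral_mult_right has_integral_jacobi_monom) auto
  then show ?thesis by (simp add: q sum_distrib_left mult_ac)
qed

text \<open>Integrate the derivative of \<open>x ^ (a + 1) * R ^ 2\<close>. Here
  \<open>x * R'\<close> equals \<open>l * R\<close> plus a polynomial \<open>q\<close> of lower
  degree, which is orthogonal to \<open>R\<close>; the boundary term is 1 because \<open>R\<close>
  is 1 at 1.\<close>

lemma has_integral_jacobi_norm:
  "((\<lambda>x. x ^ a * poly (jacobi a l) x * poly (jacobi a l) x) has_integral (1 / (2 * real l + real a + 1))) {0..1}"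
proof -
  let ?R = "jacobi a l"
  define q where "q = pCons 0 (pderiv ?R) - smult (real l) ?R"
  have q0: "coeff q i = 0" if "i \<ge> l" for i
    using that by (cases i; cases "i = l") (auto simp: q_def coeff_pderiv coeff_jacobi binomial_eq_0)
  have xR: "x * poly (pderiv ?R) x = real l * poly ?R x + poly q x" for x
    by (simp add: q_def)
  have "((\<lambda>x. (2 * real l + real a + 1) * (x ^ a * poly ?R x * poly ?R x) + 2 * (x ^ a * poly ?R x * poly q x)) has_integral
     (1 ^ (a + 1) * poly ?R 1 ^ 2 - 0 ^ (a + 1) * poly ?R 0 ^ 2)) {0..1}"
  proof (rule fundamental_theorem_of_calculus)
    fix x :: real
    have "((\<lambda>x. x ^ (a + 1) * poly ?R x ^ 2) has_real_derivative
       (real a + 1) * x ^ a * poly ?R x ^ 2 + 2 * x ^ a * poly ?R x * (x * poly (pderiv ?R) x)) (at x within {0..1})"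
      by (rule derivative_eq_intros refl)+ (simp add: algebra_simps power2_eq_square)
    then show "((\<lambda>x. x ^ (a + 1) * poly ?R x ^ 2) has_vector_derivative (2 * real l + real a + 1) * (x ^ a * poly ?R x * poly ?R x) + 2 * (x ^ a * poly ?R x * poly q x)) (at x within {0..1})"
      unfolding xR by (simp add: has_real_derivative_iff_has_vector_derivative algebra_simps power2_eq_square)
  qed simp
  moreover have "((\<lambda>x. 2 * (x ^ a * poly ?R x * poly q x)) has_integral (2 * 0)) {0..1}"
    by (intro has_integral_mult_right has_integral_jacobi_lower q0)
  ultimately have "((\<lambda>x. (2 * real l + real a + 1) * (x ^ a * poly ?R x * poly ?R x) + 2 * (x ^ a * poly ?R x * poly q x) - 2 * (x ^ a * poly ?R x * poly q x)) has_integral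
     (1 ^ (a + 1) * poly ?R 1 ^ 2 - 0 ^ (a + 1) * poly ?R 0 ^ 2 - 2 * 0)) {0..1}"
    by (rule has_integral_diff)
  then have *: "((\<lambda>x. (2 * real l + real a + 1) * (x ^ a * poly ?R x * poly ?R x)) has_integral 1) {0..1}"
    by (simp add: poly_jacobi_1)
  have "2 * real l + real a + 1 \<noteq> 0" by linarith
  then show ?thesis using has_integral_mult_right[OF *, of "1 / (2 * real l + real a + 1)"]
    by simp
qed

lemma has_integral_jacobi_orthogonal:
  "((\<lambda>x. x ^ a * poly (jacobi a l) x * poly (jacobi a m) x) has_integral
     (if l = m then 1 / (2 * real l + real a + 1) else 0)) {0..1}"
proof -
  consider "l = m" | "m < l" | "l < m" by linarith
  then show ?thesis
  proof cases
    case 1 then show ?thesis using has_integral_jacobi_norm[of a l] by simp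
  next
    case 2
    have "((\<lambda>x. x ^ a * poly (jacobi a l) x * poly (jacobi a m) x) has_integral 0) {0..1}"
      by (rule has_integral_jacobi_lower) (use 2 in \<open>auto simp: coeff_jacobi binomial_eq_0\<close>)
    then show ?thesis using 2 by simp
  next
    case 3
    have "((\<lambda>x. x ^ a * poly (jacobi a m) x * poly (jacobi a l) x) has_integral 0) {0..1}"
      by (rule has_integral_jacobi_lower) (use 3 in \<open>auto simp: coeff_jacobi binomial_eq_0\<close>)
    then show ?thesis using 3 by (simp add: mult_ac)
  qed
qed

section \<open>Heat series\<close>

text \<open>The product of power and Gaussian is \<open>exp (l * (ln D - l * \<delta>))\<close>, and
  the exponent is at most \<open>- l\<close> as soon as \<open>l * \<delta>\<close> exceeds
  \<open>ln D + 1\<close>.\<close>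

lemma summable_power_gauss:
  assumes "\<delta> > (0::real)" "D \<ge> 1"
  shows "summable (\<lambda>l. C * D ^ l * exp (- (real l)\<^sup>2 * \<delta>))"
proof (rule summable_comparison_test_ev)
  have "eventually (\<lambda>l. real l * \<delta> \<ge> ln D + 1) sequentially"
  proof -
    obtain N :: nat where N: "(ln D + 1) / \<delta> \<le> real N" using real_arch_simple by blast
    have "real l * \<delta> \<ge> ln D + 1" if "l \<ge> N" for l
    proof -
      have "(ln D + 1) / \<delta> \<le> real l" using N that by linarith
      then show ?thesis using assms(1) by (simp add: pos_divide_le_eq)
    qed
    then show ?thesis unfolding eventually_sequentially by blast
  qed
  then show "eventually (\<lambda>l. norm (C * D ^ l * exp (- (real l)\<^sup>2 * \<delta>)) \<le> \<bar>C\<bar> * exp (-1) ^ l) sequentially"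
  proof eventually_elim
    case (elim l)
    have "D ^ l = exp (real l * ln D)" using assms by (simp add: exp_of_nat_mult)
    then have "D ^ l * exp (- (real l)\<^sup>2 * \<delta>) = exp (real l * (ln D - real l * \<delta>))"
      by (simp add: algebra_simps power2_eq_square exp_diff exp_minus divide_simps)
    also have "\<dots> \<le> exp (real l * (-1))" using elim by (intro exp_le_cancel_iff[THEN iffD2] mult_left_mono) auto
    also have "\<dots> = exp (-1) ^ l" by (metis exp_of_nat_mult)
    finally show ?case using assms by (simp add: abs_mult mult.assoc mult_left_mono)
  qed
  show "summable (\<lambda>l. \<bar>C\<bar> * exp (-1) ^ l)"
    by (intro summable_mult summable_geometric) auto
qed

text \<open>This growth condition survives differentiation and multiplication by the eigenvalues,
  and any geometric rate loses against the decay of \<open>exp (- lam l * t)\<close>. One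
  convergence argument therefore covers a heat series and all its derivatives.\<close>

definition geo_polys :: "(nat \<Rightarrow> real poly) \<Rightarrow> bool" where
  "geo_polys Q \<longleftrightarrow> (\<exists>C D. D \<ge> 1 \<and> (\<forall>l. degree (Q l) \<le> l \<and> (\<forall>i. \<bar>coeff (Q l) i\<bar> \<le> C * D ^ l)))"

text \<open>Differentiation costs a factor of at most \<open>l\<close>, hence at most
  \<open>2 ^ l\<close>, which is absorbed by doubling the rate.\<close>

lemma geo_polys_pderiv:
  assumes "geo_polys Q" shows "geo_polys (\<lambda>l. pderiv (Q l))"
proof -
  obtain C D where D: "D \<ge> 1" and Q: "\<And>l. degree (Q l) \<le> l" "\<And>l i. \<bar>coeff (Q l) i\<bar> \<le> C * D ^ l"
    using assms unfolding geo_polys_def by blast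
  have C: "C * D ^ l \<ge> 0" for l using Q(2)[of l 0] by linarith
  have "\<bar>coeff (pderiv (Q l)) i\<bar> \<le> C * (2 * D) ^ l" for l i
  proof (cases "Suc i \<le> l")
    case True
    have "\<bar>coeff (pderiv (Q l)) i\<bar> = real (Suc i) * \<bar>coeff (Q l) (Suc i)\<bar>"
      by (simp add: coeff_pderiv abs_mult)
    also have "\<dots> \<le> 2 ^ l * (C * D ^ l)"
    proof (rule mult_mono[OF _ Q(2)])
      have "Suc i \<le> 2 ^ l" using True less_exp[of l] by linarith
      then have "real (Suc i) \<le> real (2 ^ l)" by (rule of_nat_mono)
      then show "real (Suc i) \<le> 2 ^ l" by simp
    qed auto
    finally show ?thesis by (simp add: power_mult_distrib mult_ac)
  next
    case False
    then have "coeff (Q l) (Suc i) = 0" using Q(1)[of l] by (intro coeff_eq_0) auto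
    moreover have "0 \<le> (C * D ^ l) * 2 ^ l" using C[of l] by simp
    ultimately show ?thesis by (simp add: coeff_pderiv power_mult_distrib mult_ac)
  qed
  moreover have "degree (pderiv (Q l)) \<le> l" for l using Q(1)[of l] by (simp add: degree_pderiv)
  ultimately show ?thesis unfolding geo_polys_def using D by (intro exI[of _ C] exI[of _ "2 * D"]) auto
qed

lemma geo_polys_smult:
  assumes "geo_polys Q" "\<And>l. \<bar>c l\<bar> \<le> A * B ^ l" "B \<ge> 1"
  shows "geo_polys (\<lambda>l. smult (c l) (Q l))"
proof -
  obtain C D where D: "D \<ge> 1" and Q: "\<And>l. degree (Q l) \<le> l" "\<And>l i. \<bar>coeff (Q l) i\<bar> \<le> C * D ^ l"
    using assms(1) unfolding geo_polys_def by blast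
  have "\<bar>coeff (smult (c l) (Q l)) i\<bar> \<le> (A * C) * (B * D) ^ l" for l i
  proof -
    have "\<bar>c l\<bar> * \<bar>coeff (Q l) i\<bar> \<le> (A * B ^ l) * (C * D ^ l)"
      by (rule mult_mono) (use assms(2)[of l] Q(2)[of l i] abs_ge_zero[of "c l"] in \<open>auto intro: order_trans\<close>)
    then show ?thesis by (simp add: abs_mult power_mult_distrib mult_ac)
  qed
  moreover have "B * D \<ge> 1" using mult_mono[of 1 B 1 D] assms(3) D by simp
  moreover have "degree (smult (c l) (Q l)) \<le> l" for l using Q(1)[of l] by (meson degree_smult_le order.trans)
  ultimately show ?thesis unfolding geo_polys_def by (intro exI[of _ "A * C"] exI[of _ "B * D"]) auto
qed

lemma geo_polys_jacobi: "geo_polys (jacobi a)"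
proof -
  have "\<bar>coeff (jacobi a l) i\<bar> \<le> 2 ^ a * 8 ^ l" for l i
  proof (cases "i \<le> l")
    case True
    have "(l choose i) * ((a + l + i) choose l) \<le> 2 ^ l * 2 ^ (a + l + i)"
      by (intro mult_mono binomial_le_pow2) auto
    also have "\<dots> \<le> 2 ^ l * 2 ^ (a + l + l)"
      using True by (intro mult_left_mono power_increasing) auto
    also have "\<dots> = 2 ^ a * (8 ^ l :: nat)"
      by (simp add: power_add mult_ac flip: power_mult_distrib)
    finally have "real ((l choose i) * ((a + l + i) choose l)) \<le> real (2 ^ a * 8 ^ l)" by (rule of_nat_mono)
    then show ?thesis by (simp add: coeff_jacobi abs_mult)
  qed (simp add: coeff_jacobi binomial_eq_0)
  then show ?thesis unfolding geo_polys_def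
    by (intro exI[of _ "2 ^ a"] exI[of _ 8]) (auto simp: degree_jacobi_le)
qed

text \<open>The range up to 2 contains a neighbourhood of the interval from 0 to 1, so that
  derivatives are two-sided at the extreme overlaps 0 and 1.\<close>

lemma geo_polys_bound:
  assumes "geo_polys Q"
  obtains C D where "D \<ge> 1" "\<And>l x. \<bar>x\<bar> \<le> 2 \<Longrightarrow> \<bar>poly (Q l) x\<bar> \<le> C * D ^ l"
proof -
  obtain C D where D: "D \<ge> 1" and Q: "\<And>l. degree (Q l) \<le> l" "\<And>l i. \<bar>coeff (Q l) i\<bar> \<le> C * D ^ l"
    using assms unfolding geo_polys_def by blast
  have "\<bar>poly (Q l) x\<bar> \<le> (2 * C) * (2 * D) ^ l" if x: "\<bar>x\<bar> \<le> 2" for l x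
  proof -
    have C: "C * D ^ l \<ge> 0" using Q(2)[of l 0] by linarith
    have "\<bar>poly (Q l) x\<bar> = \<bar>\<Sum>i\<le>degree (Q l). coeff (Q l) i * x ^ i\<bar>" by (simp add: poly_altdef)
    also have "\<dots> \<le> (\<Sum>i\<le>degree (Q l). \<bar>coeff (Q l) i * x ^ i\<bar>)" by (rule sum_abs)
    also have "\<dots> \<le> (\<Sum>i\<le>degree (Q l). C * D ^ l * 2 ^ i)"
      unfolding abs_mult power_abs using x by (intro sum_mono mult_mono Q(2) power_mono C) auto
    also have "\<dots> \<le> (\<Sum>i\<le>l. C * D ^ l * 2 ^ i)"
      using Q(1)[of l] C by (intro sum_mono2) auto
    also have "\<dots> = C * D ^ l * (2 ^ Suc l - 1)"
      by (simp add: geometric_sum flip: sum_distrib_left lessThan_Suc_atMost)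
    also have "\<dots> \<le> C * D ^ l * 2 ^ Suc l"
      using C by (intro mult_left_mono) auto
    finally show ?thesis by (simp add: power_mult_distrib mult_ac)
  qed
  then show ?thesis using D by (intro that[of "2 * D" "2 * C"]) auto
qed

definition heat_series :: "(nat \<Rightarrow> real) \<Rightarrow> (nat \<Rightarrow> real poly) \<Rightarrow> real \<Rightarrow> real \<Rightarrow> real" where
  "heat_series lam Q t x = (\<Sum>l. exp (- lam l * t) * poly (Q l) x)"

lemma heat_series_majorant:
  assumes "geo_polys Q" "\<And>l. (real l)\<^sup>2 \<le> lam l" "\<delta> > 0"
  obtains M where "summable M" "\<And>l t x. t \<ge> \<delta> \<Longrightarrow> \<bar>x\<bar> \<le> 2 \<Longrightarrow> norm (exp (- lam l * t) * poly (Q l) x) \<le> M l"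
proof -
  obtain C D where D: "D \<ge> 1" and Q: "\<And>l x. \<bar>x\<bar> \<le> 2 \<Longrightarrow> \<bar>poly (Q l) x\<bar> \<le> C * D ^ l"
    by (rule geo_polys_bound[OF assms(1)]) (rule that; blast)
  have "norm (exp (- lam l * t) * poly (Q l) x) \<le> C * D ^ l * exp (- (real l)\<^sup>2 * \<delta>)"
    if "t \<ge> \<delta>" "\<bar>x\<bar> \<le> 2" for l t x
  proof -
    have "0 \<le> lam l" using assms(2)[of l] zero_le_power2[of "real l"] by linarith
    then have "(real l)\<^sup>2 * \<delta> \<le> lam l * t" using assms(2)[of l] assms(3) that(1)
      by (intro mult_mono) auto
    then have "exp (- lam l * t) \<le> exp (- (real l)\<^sup>2 * \<delta>)" by simp
    then have "exp (- lam l * t) * \<bar>poly (Q l) x\<bar> \<le> exp (- (real l)\<^sup>2 * \<delta>) * (C * D ^ l)"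
      using Q[OF that(2)] by (intro mult_mono) auto
    then show ?thesis by (simp add: abs_mult mult_ac)
  qed
  then show ?thesis using that summable_power_gauss[OF assms(3) D, of C] by blast
qed

lemma summable_heat_series:
  assumes "geo_polys Q" "\<And>l. (real l)\<^sup>2 \<le> lam l" "t > 0" "\<bar>x\<bar> \<le> 2"
  shows "summable (\<lambda>l. exp (- lam l * t) * poly (Q l) x)"
proof -
  obtain M where M: "summable M" "\<And>l s x. s \<ge> t \<Longrightarrow> \<bar>x\<bar> \<le> 2 \<Longrightarrow> norm (exp (- lam l * s) * poly (Q l) x) \<le> M l"
    by (rule heat_series_majorant[OF assms(1-3)]) (rule that; blast)
  show ?thesis
    by (rule summable_comparison_test[OF _ M(1)], rule exI[of _ 0]) (use M(2)[OF order_refl assms(4)] in simp)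
qed

lemma uniform_limit_heat_series:
  assumes "geo_polys Q" "\<And>l. (real l)\<^sup>2 \<le> lam l" "t > 0"
  shows "uniform_limit {-2..2} (\<lambda>n x. \<Sum>l<n. exp (- lam l * t) * poly (Q l) x) (heat_series lam Q t) sequentially"
proof -
  obtain M where M: "summable M" "\<And>l s x. s \<ge> t \<Longrightarrow> \<bar>x\<bar> \<le> 2 \<Longrightarrow> norm (exp (- lam l * s) * poly (Q l) x) \<le> M l"
    by (rule heat_series_majorant[OF assms(1-3)]) (rule that; blast)
  show ?thesis unfolding heat_series_def[abs_def]
    by (rule Weierstrass_m_test[OF _ M(1)]) (use M(2)[of t] in auto)
qed

text \<open>A majorant exists only for times bounded away from 0; the open strips
  \<open>t > \<delta>\<close> cover all positive times.\<close>

lemma continuous_on_heat_series: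
  assumes "geo_polys Q" "\<And>l. (real l)\<^sup>2 \<le> lam l"
  shows "continuous_on ({0<..} \<times> {-2<..<2}) (\<lambda>(t, x). heat_series lam Q t x)"
proof -
  have "continuous_on ({\<delta><..} \<times> {-2<..<2}) (\<lambda>p. \<Sum>l. exp (- lam l * fst p) * poly (Q l) (snd p))" if \<delta>: "\<delta> > 0" for \<delta>
  proof -
    obtain M where M: "summable M" "\<And>l s x. s \<ge> \<delta> \<Longrightarrow> \<bar>x\<bar> \<le> 2 \<Longrightarrow> norm (exp (- lam l * s) * poly (Q l) x) \<le> M l"
      by (rule heat_series_majorant[OF assms \<delta>]) (rule that; blast)
    have "uniform_limit ({\<delta><..} \<times> {-2<..<2}) (\<lambda>n p. \<Sum>l<n. exp (- lam l * fst p) * poly (Q l) (snd p))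
      (\<lambda>p. \<Sum>l. exp (- lam l * fst p) * poly (Q l) (snd p)) sequentially"
      by (rule Weierstrass_m_test[OF _ M(1)]) (use M(2) in auto)
    then show ?thesis
      by (rule uniform_limit_theorem[rotated]) (auto intro!: always_eventually continuous_intros)
  qed
  then have "continuous_on (\<Union>\<delta>\<in>{0<..}. {\<delta><..} \<times> {-2<..<2}) (\<lambda>p. \<Sum>l. exp (- lam l * fst p) * poly (Q l) (snd p))"
    by (intro continuous_on_open_UN open_Times) auto
  moreover have "(\<Union>\<delta>\<in>{0<..}. {\<delta><..} \<times> {-2<..<2}) = ({0<..} \<times> {-2<..<2} :: (real \<times> real) set)"
    using dense by fastforce
  ultimately show ?thesis by (simp add: heat_series_def case_prod_unfold)
qed

lemma heat_series_x_derivative: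
  assumes "geo_polys Q" "\<And>l. (real l)\<^sup>2 \<le> lam l" "t > 0" "x \<in> {-2<..<2}"
  shows "(heat_series lam Q t has_real_derivative heat_series lam (\<lambda>l. pderiv (Q l)) t x) (at x)"
proof -
  obtain M where M: "summable M" "\<And>l s x. s \<ge> t \<Longrightarrow> \<bar>x\<bar> \<le> 2 \<Longrightarrow> norm (exp (- lam l * s) * poly (pderiv (Q l)) x) \<le> M l"
    by (rule heat_series_majorant[OF geo_polys_pderiv[OF assms(1)] assms(2,3)]) (rule that; blast)
  have "((\<lambda>x. \<Sum>l. exp (- lam l * t) * poly (Q l) x) has_real_derivative (\<Sum>l. exp (- lam l * t) * poly (pderiv (Q l)) x)) (at x)"
  proof (rule has_field_derivative_series'(2)[of "{-2<..<2}" _ _ 0])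
    show "uniformly_convergent_on {-2<..<2} (\<lambda>n x. \<Sum>l<n. exp (- lam l * t) * poly (pderiv (Q l)) x)"
      by (rule Weierstrass_m_test'[OF _ M(1)]) (use M(2) in auto)
    show "summable (\<lambda>l. exp (- lam l * t) * poly (Q l) 0)" using summable_heat_series[of Q lam t 0] assms by auto
  qed (use assms in \<open>auto intro!: derivative_eq_intros poly_DERIV[THEN DERIV_subset] simp: interior_open\<close>)
  then show ?thesis by (simp add: heat_series_def[abs_def])
qed

lemma heat_series_t_derivative:
  assumes "geo_polys Q" "\<And>l. (real l)\<^sup>2 \<le> lam l" "geo_polys (\<lambda>l. smult (- lam l) (Q l))" "t > 0" "\<bar>x\<bar> \<le> 2"
  shows "((\<lambda>t. heat_series lam Q t x) has_real_derivative heat_series lam (\<lambda>l. smult (- lam l) (Q l)) t x) (at t)"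
proof -
  \<comment> \<open>The majorant starts at half the time, which leaves a neighbourhood of
    \<open>t\<close> for differentiation.\<close>
  obtain M where M: "summable M" "\<And>l s x. s \<ge> t / 2 \<Longrightarrow> \<bar>x\<bar> \<le> 2 \<Longrightarrow> norm (exp (- lam l * s) * poly (smult (- lam l) (Q l)) x) \<le> M l"
    by (rule heat_series_majorant[OF assms(3,2) half_gt_zero[OF assms(4)]]) (rule that; blast)
  have "((\<lambda>t. \<Sum>l. exp (- lam l * t) * poly (Q l) x) has_real_derivative (\<Sum>l. exp (- lam l * t) * poly (smult (- lam l) (Q l)) x)) (at t)"
  proof (rule has_field_derivative_series'(2)[of "{t / 2<..}" _ _ t])
    show "uniformly_convergent_on {t/2<..} (\<lambda>n t. \<Sum>l<n. exp (- lam l * t) * poly (smult (- lam l) (Q l)) x)"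
      by (rule Weierstrass_m_test'[OF _ M(1)]) (use M(2) assms in auto)
    show "summable (\<lambda>l. exp (- lam l * t) * poly (Q l) x)" using summable_heat_series[of Q lam t x] assms by auto
  qed (use assms in \<open>auto intro!: derivative_eq_intros simp: interior_open\<close>)
  then show ?thesis by (simp add: heat_series_def[abs_def])
qed

definition mono_eigenvalue :: "nat \<Rightarrow> nat \<Rightarrow> real" where
  "mono_eigenvalue \<nu> l = real l * (real l + 2 * real \<nu> + 1) + real \<nu>"

lemma mono_eigenvalue_ge: "(real l)\<^sup>2 \<le> mono_eigenvalue \<nu> l"
  by (simp add: mono_eigenvalue_def algebra_simps power2_eq_square)

text \<open>Two kinds of coefficients occur: \<open>sphere_coeff\<close>, and finite sequences for
  the duality argument.\<close>

definition geo_coeffs :: "(nat \<Rightarrow> real) \<Rightarrow> bool" where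
  "geo_coeffs c \<longleftrightarrow> (\<exists>A B. B \<ge> 1 \<and> (\<forall>l. \<bar>c l\<bar> \<le> A * B ^ l))"

definition weighted_jacobi :: "nat \<Rightarrow> (nat \<Rightarrow> real) \<Rightarrow> nat \<Rightarrow> real poly" where
  "weighted_jacobi \<nu> c l = smult (c l) (jacobi (2 * \<nu>) l)"

lemma geo_polys_weighted_jacobi: "geo_coeffs c \<Longrightarrow> geo_polys (weighted_jacobi \<nu> c)"
  unfolding weighted_jacobi_def[abs_def] geo_coeffs_def
  by (blast intro: geo_polys_smult[OF geo_polys_jacobi])

lemma geo_coeffs_finite:
  assumes "\<And>l. l > n \<Longrightarrow> c l = 0"
  shows "geo_coeffs c"
proof -
  have "\<bar>c l\<bar> \<le> (\<Sum>k\<le>n. \<bar>c k\<bar>) * 1 ^ l" for l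
    using assms[of l] member_le_sum[of l "{..n}" "\<lambda>k. \<bar>c k\<bar>"] by (cases "l \<le> n") (auto intro: sum_nonneg)
  then show ?thesis unfolding geo_coeffs_def by blast
qed

text \<open>The reciprocal of the squared norm of \<open>jacobi (2 * \<nu>) l\<close> for the weight
  \<open>x ^ (2 * \<nu>)\<close>, see \<open>has_integral_jacobi_norm\<close>; formally these are
  the coefficients of a point mass at the pole.\<close>

definition sphere_coeff :: "nat \<Rightarrow> nat \<Rightarrow> real" where
  "sphere_coeff \<nu> l = 2 * real l + 2 * real \<nu> + 1"

lemma of_nat_le_two_power: "real n \<le> 2 ^ n"
  using less_exp[of n] by (metis less_eq_real_def of_nat_less_numeral_power_cancel_iff)

lemma geo_coeffs_sphere: "geo_coeffs (sphere_coeff \<nu>)"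
proof -
  have "\<bar>sphere_coeff \<nu> l\<bar> \<le> (2 * real \<nu> + 3) * 2 ^ l" for l
  proof -
    have "2 * real l + (2 * real \<nu> + 1) * 1 \<le> 2 * 2 ^ l + (2 * real \<nu> + 1) * 2 ^ l"
      by (intro add_mono mult_left_mono of_nat_le_two_power) auto
    then show ?thesis by (simp add: sphere_coeff_def algebra_simps)
  qed
  moreover have "(2::real) \<ge> 1" by simp
  ultimately show ?thesis unfolding geo_coeffs_def by blast
qed

lemma geo_polys_eigen:
  assumes "geo_polys Q" shows "geo_polys (\<lambda>l. smult (- mono_eigenvalue \<nu> l) (Q l))"
proof (rule geo_polys_smult[OF assms])
  fix l
  have nn: "mono_eigenvalue \<nu> l \<ge> 0" by (simp add: mono_eigenvalue_def)
  have "real l * real l \<le> 2 ^ l * 2 ^ l" by (intro mult_mono of_nat_le_two_power) auto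
  moreover have "real l \<le> 2 ^ l * 2 ^ l"
    using mult_mono[OF of_nat_le_two_power[of l] one_le_power[of "2::real" l]] by simp
  then have "(2 * real \<nu> + 1) * real l \<le> (2 * real \<nu> + 1) * (2 ^ l * 2 ^ l)" by (intro mult_left_mono) auto
  moreover have "real \<nu> * 1 \<le> real \<nu> * (2 ^ l * 2 ^ l)"
    by (intro mult_left_mono) (simp_all add: one_le_power flip: power_add)
  moreover have "(4::real) ^ l = 2 ^ l * 2 ^ l" by (simp flip: power_mult_distrib)
  ultimately have "mono_eigenvalue \<nu> l \<le> (3 * real \<nu> + 2) * 4 ^ l"
    by (simp add: mono_eigenvalue_def algebra_simps)
  then show "\<bar>- mono_eigenvalue \<nu> l\<bar> \<le> (3 * real \<nu> + 2) * 4 ^ l"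
    using nn by simp
qed simp

definition heat_profile :: "nat \<Rightarrow> (nat \<Rightarrow> real) \<Rightarrow> real \<Rightarrow> real \<Rightarrow> real" where
  "heat_profile \<nu> c = heat_series (mono_eigenvalue \<nu>) (weighted_jacobi \<nu> c)"

abbreviation "heat_profile' \<nu> c \<equiv> heat_series (mono_eigenvalue \<nu>) (\<lambda>l. pderiv (weighted_jacobi \<nu> c l))"
abbreviation "heat_profile'' \<nu> c \<equiv> heat_series (mono_eigenvalue \<nu>) (\<lambda>l. pderiv (pderiv (weighted_jacobi \<nu> c l)))"

text \<open>Every term is an eigenfunction of the Jacobi operator by \<open>jacobi_ode\<close>; the
  summand \<open>real \<nu>\<close> of the eigenvalue becomes the term of order zero.\<close>

lemma heat_profile_pde:
  assumes c: "geo_coeffs c" and "t > 0" "\<bar>x\<bar> \<le> 2"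
  shows "((\<lambda>t. heat_profile \<nu> c t x) has_real_derivative
     x * (1 - x) * heat_profile'' \<nu> c t x + (2 * real \<nu> + 1 - (2 * real \<nu> + 2) * x) * heat_profile' \<nu> c t x
       - real \<nu> * heat_profile \<nu> c t x) (at t)"
proof -
  have s: "summable (\<lambda>l. exp (- mono_eigenvalue \<nu> l * t) * poly (weighted_jacobi \<nu> c l) x)"
    "summable (\<lambda>l. exp (- mono_eigenvalue \<nu> l * t) * poly (pderiv (weighted_jacobi \<nu> c l)) x)"
    "summable (\<lambda>l. exp (- mono_eigenvalue \<nu> l * t) * poly (pderiv (pderiv (weighted_jacobi \<nu> c l))) x)"
    by (intro summable_heat_series geo_polys_pderiv geo_polys_weighted_jacobi[OF c] mono_eigenvalue_ge assms(2,3))+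
  have "exp (- mono_eigenvalue \<nu> l * t) * poly (smult (- mono_eigenvalue \<nu> l) (weighted_jacobi \<nu> c l)) x =
    x * (1 - x) * (exp (- mono_eigenvalue \<nu> l * t) * poly (pderiv (pderiv (weighted_jacobi \<nu> c l))) x)
     + (2 * real \<nu> + 1 - (2 * real \<nu> + 2) * x) * (exp (- mono_eigenvalue \<nu> l * t) * poly (pderiv (weighted_jacobi \<nu> c l)) x)
     - real \<nu> * (exp (- mono_eigenvalue \<nu> l * t) * poly (weighted_jacobi \<nu> c l) x)" for l
  proof -
    have j: "poly (weighted_jacobi \<nu> c l) x * (- mono_eigenvalue \<nu> l) =
       x * (1 - x) * poly (pderiv (pderiv (weighted_jacobi \<nu> c l))) x
       + (2 * real \<nu> + 1 - (2 * real \<nu> + 2) * x) * poly (pderiv (weighted_jacobi \<nu> c l)) x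
       - real \<nu> * poly (weighted_jacobi \<nu> c l) x"
    proof -
      define k where "k = c l"
      define P where "P = jacobi (2 * \<nu>) l"
      have "x * (1 - x) * poly (pderiv (pderiv P)) x
        + (2 * real \<nu> + 1 - (2 * real \<nu> + 2) * x) * poly (pderiv P) x
        + real l * (real l + 2 * real \<nu> + 1) * poly P x = 0"
        using jacobi_ode[of x "2 * \<nu>" l] unfolding P_def by simp
      then have "k * (x * (1 - x) * poly (pderiv (pderiv P)) x
        + (2 * real \<nu> + 1 - (2 * real \<nu> + 2) * x) * poly (pderiv P) x
        + real l * (real l + 2 * real \<nu> + 1) * poly P x) = 0" by simp
      then show ?thesis unfolding weighted_jacobi_def k_def[symmetric] P_def[symmetric]
        by (simp add: pderiv_smult mono_eigenvalue_def algebra_simps)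
    qed
    have "exp (- mono_eigenvalue \<nu> l * t) * poly (smult (- mono_eigenvalue \<nu> l) (weighted_jacobi \<nu> c l)) x
       = exp (- mono_eigenvalue \<nu> l * t) * (poly (weighted_jacobi \<nu> c l) x * (- mono_eigenvalue \<nu> l))" by simp
    then show ?thesis unfolding j by (simp add: algebra_simps)
  qed
  then have "heat_series (mono_eigenvalue \<nu>) (\<lambda>l. smult (- mono_eigenvalue \<nu> l) (weighted_jacobi \<nu> c l)) t x
    = (\<Sum>l. x * (1 - x) * (exp (- mono_eigenvalue \<nu> l * t) * poly (pderiv (pderiv (weighted_jacobi \<nu> c l))) x)
     + (2 * real \<nu> + 1 - (2 * real \<nu> + 2) * x) * (exp (- mono_eigenvalue \<nu> l * t) * poly (pderiv (weighted_jacobi \<nu> c l)) x)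
     - real \<nu> * (exp (- mono_eigenvalue \<nu> l * t) * poly (weighted_jacobi \<nu> c l) x))"
    by (simp add: heat_series_def)
  also have "\<dots> = x * (1 - x) * heat_profile'' \<nu> c t x + (2 * real \<nu> + 1 - (2 * real \<nu> + 2) * x) * heat_profile' \<nu> c t x
       - real \<nu> * heat_profile \<nu> c t x"
    unfolding heat_profile_def heat_series_def
    using s by (simp add: suminf_diff[symmetric] suminf_add[symmetric] suminf_mult[symmetric] summable_add summable_mult)
  finally have e: "heat_series (mono_eigenvalue \<nu>) (\<lambda>l. smult (- mono_eigenvalue \<nu> l) (weighted_jacobi \<nu> c l)) t x
     = x * (1 - x) * heat_profile'' \<nu> c t x + (2 * real \<nu> + 1 - (2 * real \<nu> + 2) * x) * heat_profile' \<nu> c t x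
       - real \<nu> * heat_profile \<nu> c t x" .
  have "((\<lambda>t. heat_profile \<nu> c t x) has_real_derivative
      heat_series (mono_eigenvalue \<nu>) (\<lambda>l. smult (- mono_eigenvalue \<nu> l) (weighted_jacobi \<nu> c l)) t x) (at t)"
    unfolding heat_profile_def
    by (intro heat_series_t_derivative geo_polys_weighted_jacobi[OF c] mono_eigenvalue_ge geo_polys_eigen assms(2,3))
  then show ?thesis unfolding e .
qed

section \<open>Sections depending on the overlap with a point\<close>

text \<open>Recording the total derivative, rather than two directional ones, makes the product and
  chain rules available and yields the derivatives in all directions at once.\<close>

definition has_wirtinger :: "(complex \<Rightarrow> complex) \<Rightarrow> complex \<Rightarrow> complex \<Rightarrow> complex \<Rightarrow> bool" where
  "has_wirtinger f a b z \<longleftrightarrow> (f has_derivative (\<lambda>h. a * h + b * cnj h)) (at z)"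

lemma has_wirtinger_dir_deriv:
  assumes "has_wirtinger f a b z" shows "dir_deriv f v z = a * v + b * cnj v"
  using frechet_derivative_at[OF assms[unfolded has_wirtinger_def]] by (metis dir_deriv_def)

lemma has_wirtinger_differentiable: "has_wirtinger f a b z \<Longrightarrow> f differentiable (at z)"
  by (auto simp: has_wirtinger_def differentiable_def)

lemma has_wirtinger_wirtinger:
  assumes "has_wirtinger f a b z" shows "wirtinger f z = a" "wirtinger_bar f z = b"
proof -
  have "(a + b - \<i> * (a * \<i> - b * \<i>)) / 2 = a" "(a + b + \<i> * (a * \<i> - b * \<i>)) / 2 = b"
    by (simp_all add: field_simps)
  then show "wirtinger f z = a" "wirtinger_bar f z = b"
    by (simp_all add: wirtinger_def wirtinger_bar_def has_wirtinger_dir_deriv[OF assms])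
qed

lemma has_wirtinger_const: "has_wirtinger (\<lambda>z. c) 0 0 z"
  by (simp add: has_wirtinger_def)

lemma has_wirtinger_ident: "has_wirtinger (\<lambda>z. z) 1 0 z"
  by (simp add: has_wirtinger_def)

lemma has_wirtinger_cnj_ident: "has_wirtinger cnj 0 1 z"
  by (simp add: has_wirtinger_def bounded_linear_imp_has_derivative bounded_linear_cnj)

lemma has_wirtinger_add:
  "has_wirtinger f a b z \<Longrightarrow> has_wirtinger g c d z \<Longrightarrow> has_wirtinger (\<lambda>z. f z + g z) (a + c) (b + d) z"
  unfolding has_wirtinger_def
  by (drule (1) has_derivative_add) (simp add: algebra_simps)

lemma has_wirtinger_mult:
  "has_wirtinger f a b z \<Longrightarrow> has_wirtinger g c d z
    \<Longrightarrow> has_wirtinger (\<lambda>z. f z * g z) (a * g z + f z * c) (b * g z + f z * d) z"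
  unfolding has_wirtinger_def
  by (drule (1) has_derivative_mult) (simp add: algebra_simps)

lemma has_wirtinger_power:
  assumes "has_wirtinger f a b z"
  shows "has_wirtinger (\<lambda>z. f z ^ n) (of_nat n * f z ^ (n - 1) * a) (of_nat n * f z ^ (n - 1) * b) z"
  using has_derivative_power[OF assms[unfolded has_wirtinger_def], of n]
  unfolding has_wirtinger_def by (simp add: algebra_simps)

lemma has_wirtinger_inverse:
  assumes "has_wirtinger f a b z" "f z \<noteq> 0"
  shows "has_wirtinger (\<lambda>z. 1 / f z) (- a / (f z)\<^sup>2) (- b / (f z)\<^sup>2) z"
proof -
  have "((\<lambda>z. inverse (f z)) has_derivative (\<lambda>h. - a / (f z)\<^sup>2 * h + - b / (f z)\<^sup>2 * cnj h)) (at z)"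
    by (rule has_derivative_eq_rhs[OF Deriv.has_derivative_inverse[OF assms(2) assms(1)[unfolded has_wirtinger_def]]])
      (use assms(2) in \<open>auto simp: fun_eq_iff field_simps power2_eq_square\<close>)
  then show ?thesis unfolding has_wirtinger_def by (simp add: inverse_eq_divide)
qed

lemma has_wirtinger_eq: "has_wirtinger f a b z \<Longrightarrow> a = a' \<Longrightarrow> b = b' \<Longrightarrow> has_wirtinger f a' b' z"
  by simp

lemma has_wirtinger_cnj:
  assumes "has_wirtinger f a b z" shows "has_wirtinger (\<lambda>z. cnj (f z)) (cnj b) (cnj a) z"
  using has_derivative_cnj[OF assms[unfolded has_wirtinger_def]]
  unfolding has_wirtinger_def by (simp add: algebra_simps)

text \<open>Uniqueness of derivatives shows that \<open>a * h + b * cnj h\<close> is real for a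
  real-valued function; only then can the real chain rule be applied and read back in Wirtinger
  form.\<close>

lemma has_wirtinger_of_real_compose:
  assumes g: "has_wirtinger (\<lambda>z. of_real (g z)) a b z" and \<phi>: "(\<phi> has_real_derivative d) (at (g z))"
  shows "has_wirtinger (\<lambda>z. of_real (\<phi> (g z))) (of_real d * a) (of_real d * b) z"
proof -
  have "((\<lambda>z. Re (of_real (g z))) has_derivative (\<lambda>h. Re (a * h + b * cnj h))) (at z)"
    using g unfolding has_wirtinger_def by (rule has_derivative_Re)
  then have gd: "(g has_derivative (\<lambda>h. Re (a * h + b * cnj h))) (at z)" by simp
  have "((\<lambda>z. complex_of_real (g z)) has_derivative (\<lambda>h. of_real (Re (a * h + b * cnj h)))) (at z)"
    using gd by (rule has_derivative_of_real)
  then have "(\<lambda>h. of_real (Re (a * h + b * cnj h))) = (\<lambda>h. a * h + b * cnj h)"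
    using g unfolding has_wirtinger_def by (rule has_derivative_unique)
  then have *: "of_real (Re (a * h + b * cnj h)) = a * h + b * cnj h" for h by metis
  have "((\<lambda>z. \<phi> (g z)) has_derivative (\<lambda>h. d * Re (a * h + b * cnj h))) (at z)"
    using has_derivative_compose[OF gd] \<phi> by (fastforce simp: has_field_derivative_def)
  then have "((\<lambda>z. complex_of_real (\<phi> (g z))) has_derivative (\<lambda>h. of_real (d * Re (a * h + b * cnj h)))) (at z)"
    by (rule has_derivative_of_real)
  then show ?thesis unfolding has_wirtinger_def of_real_mult * by (simp add: algebra_simps)
qed

section \<open>Overlap and bundle factor in homogeneous coordinates\<close>

definition rho :: "complex \<Rightarrow> complex" where "rho z = 1 + z * cnj z"

lemma rho_altdef: "rho z = of_real (1 + (norm z)\<^sup>2)"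
  by (simp add: rho_def complex_norm_square[symmetric])

lemma one_plus_norm_pos: "1 + (norm (z::complex))\<^sup>2 > 0" by (metis add_pos_nonneg zero_le_power2 zero_less_one)

lemma rho_nonzero [simp]: "rho z \<noteq> 0"
  unfolding rho_altdef using one_plus_norm_pos[of z] by (metis less_irrefl of_real_eq_0_iff)

lemma cnj_rho [simp]: "cnj (rho z) = rho z" by (simp add: rho_def)

lemma has_wirtinger_rho: "has_wirtinger rho (cnj z) z z"
  using has_wirtinger_add[OF has_wirtinger_const has_wirtinger_mult[OF has_wirtinger_ident has_wirtinger_cnj_ident], of 1 z]
  by (simp add: rho_def[abs_def])

text \<open>Squared modulus of the normalised Hermitian product of \<open>(1, z)\<close> with
  \<open>(cnj \<alpha>, cnj \<beta>)\<close>. The pair \<open>(1, cnj w)\<close> gives the squared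
  cosine of \<open>sphere_dist z w\<close>, and \<open>(0, 1)\<close> stands for the point at
  infinity.\<close>

definition overlap :: "complex \<Rightarrow> complex \<Rightarrow> complex \<Rightarrow> real" where
  "overlap \<alpha> \<beta> z = (norm (\<alpha> + \<beta> * z))\<^sup>2 / ((1 + (norm z)\<^sup>2) * ((norm \<alpha>)\<^sup>2 + (norm \<beta>)\<^sup>2))"

definition sig :: "complex \<Rightarrow> complex \<Rightarrow> complex" where
  "sig \<alpha> \<beta> = \<alpha> * cnj \<alpha> + \<beta> * cnj \<beta>"

lemma sig_altdef: "sig \<alpha> \<beta> = of_real ((norm \<alpha>)\<^sup>2 + (norm \<beta>)\<^sup>2)"
  by (simp add: sig_def complex_norm_square[symmetric])

lemma of_real_overlap:
  "of_real (overlap \<alpha> \<beta> z) = (\<alpha> + \<beta> * z) * (cnj \<alpha> + cnj \<beta> * cnj z) * (1 / rho z) * (1 / sig \<alpha> \<beta>)"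
proof -
  have "of_real ((norm (\<alpha> + \<beta> * z))\<^sup>2) = (\<alpha> + \<beta> * z) * (cnj \<alpha> + cnj \<beta> * cnj z)"
    unfolding complex_norm_square by simp
  then show ?thesis by (simp add: overlap_def rho_altdef sig_altdef)
qed

text \<open>Lagrange's identity; the second summand belongs to the antipodal point, so that the two
  overlaps add up to 1.\<close>

lemma overlap_complement:
  "(1 + (norm z)\<^sup>2) * ((norm \<alpha>)\<^sup>2 + (norm \<beta>)\<^sup>2) = (norm (\<alpha> + \<beta> * z))\<^sup>2 + (norm (cnj \<beta> - cnj \<alpha> * z))\<^sup>2"
proof -
  have "complex_of_real ((1 + (norm z)\<^sup>2) * ((norm \<alpha>)\<^sup>2 + (norm \<beta>)\<^sup>2))
     = of_real ((norm (\<alpha> + \<beta> * z))\<^sup>2 + (norm (cnj \<beta> - cnj \<alpha> * z))\<^sup>2)"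
    by (simp add: complex_norm_square algebra_simps del: of_real_power)
  then show ?thesis by (simp only: of_real_eq_iff)
qed

lemma overlap_bounds: "0 \<le> overlap \<alpha> \<beta> z" "overlap \<alpha> \<beta> z \<le> 1"
proof -
  show "0 \<le> overlap \<alpha> \<beta> z" by (simp add: overlap_def)
  have "(norm (\<alpha> + \<beta> * z))\<^sup>2 \<le> (1 + (norm z)\<^sup>2) * ((norm \<alpha>)\<^sup>2 + (norm \<beta>)\<^sup>2)"
    unfolding overlap_complement by simp
  then show "overlap \<alpha> \<beta> z \<le> 1" unfolding overlap_def
    by (smt (verit, best) divide_le_eq_1 div_by_0 mult_nonneg_nonneg zero_le_power2)
qed

definition overlap_z :: "complex \<Rightarrow> complex \<Rightarrow> complex \<Rightarrow> complex" where
  "overlap_z \<alpha> \<beta> z = (cnj \<alpha> + cnj \<beta> * cnj z) * (\<beta> - \<alpha> * cnj z) * (1 / rho z)\<^sup>2 * (1 / sig \<alpha> \<beta>)"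

definition overlap_zb :: "complex \<Rightarrow> complex \<Rightarrow> complex \<Rightarrow> complex" where
  "overlap_zb \<alpha> \<beta> z = (\<alpha> + \<beta> * z) * (cnj \<beta> - cnj \<alpha> * z) * (1 / rho z)\<^sup>2 * (1 / sig \<alpha> \<beta>)"

lemma has_wirtinger_inv_rho:
  "has_wirtinger (\<lambda>z. 1 / rho z) (- cnj z * (1 / rho z)\<^sup>2) (- z * (1 / rho z)\<^sup>2) z"
  using has_wirtinger_inverse[OF has_wirtinger_rho, of z] by (simp add: power_one_over)

lemma has_wirtinger_affine: "has_wirtinger (\<lambda>z. \<alpha> + \<beta> * z) \<beta> 0 z"
  using has_wirtinger_add[OF has_wirtinger_const has_wirtinger_mult[OF has_wirtinger_const has_wirtinger_ident], of \<alpha> \<beta> z]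
  by simp

lemma has_wirtinger_overlap:
  "has_wirtinger (\<lambda>z. of_real (overlap \<alpha> \<beta> z)) (overlap_z \<alpha> \<beta> z) (overlap_zb \<alpha> \<beta> z) z"
proof -
  have cN: "has_wirtinger (\<lambda>z. cnj \<alpha> + cnj \<beta> * cnj z) 0 (cnj \<beta>) z"
    using has_wirtinger_cnj[OF has_wirtinger_affine[of \<alpha> \<beta> z]] by simp
  note d = has_wirtinger_mult[OF has_wirtinger_mult[OF has_wirtinger_mult[OF has_wirtinger_affine cN] has_wirtinger_inv_rho]
      has_wirtinger_const, of \<alpha> \<beta> "1 / sig \<alpha> \<beta>"]
  have *: "(\<beta> * cN * R + N * cN * (- zb * R\<^sup>2)) * S = cN * (\<beta> - \<alpha> * zb) * R\<^sup>2 * S"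
    "(N * cb * R + N * cN * (- z * R\<^sup>2)) * S = N * (cb - ca * z) * R\<^sup>2 * S"
    if "(1 + z * zb) * R = 1" "N = \<alpha> + \<beta> * z" "cN = ca + cb * zb" for z zb cN N R S ca cb :: complex
    using that by algebra+
  show ?thesis
    unfolding of_real_overlap
  proof (rule has_wirtinger_eq[OF d])
    show "((\<beta> * (cnj \<alpha> + cnj \<beta> * cnj z) + (\<alpha> + \<beta> * z) * 0) * (1 / rho z)
      + (\<alpha> + \<beta> * z) * (cnj \<alpha> + cnj \<beta> * cnj z) * (- cnj z * (1 / rho z)\<^sup>2)) * (1 / sig \<alpha> \<beta>)
      + (\<alpha> + \<beta> * z) * (cnj \<alpha> + cnj \<beta> * cnj z) * (1 / rho z) * 0 = overlap_z \<alpha> \<beta> z"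
      unfolding overlap_z_def mult_zero_right add_0_right
      by (rule *(1)[where z = z]) (simp_all flip: rho_def)
    show "((0 * (cnj \<alpha> + cnj \<beta> * cnj z) + (\<alpha> + \<beta> * z) * cnj \<beta>) * (1 / rho z)
      + (\<alpha> + \<beta> * z) * (cnj \<alpha> + cnj \<beta> * cnj z) * (- z * (1 / rho z)\<^sup>2)) * (1 / sig \<alpha> \<beta>)
      + (\<alpha> + \<beta> * z) * (cnj \<alpha> + cnj \<beta> * cnj z) * (1 / rho z) * 0 = overlap_zb \<alpha> \<beta> z"
      unfolding overlap_zb_def mult_zero_right mult_zero_left add_0_right add_0_left
      by (rule *(2)[where zb = "cnj z"]) (simp_all flip: rho_def)
  qed
qed

text \<open>A section of the lowest eigenspace, the coherent state peaked at the chosen point,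
  scaled so that its modulus is \<open>X ^ \<nu>\<close>.\<close>

definition bundle_factor :: "nat \<Rightarrow> complex \<Rightarrow> complex \<Rightarrow> complex \<Rightarrow> complex" where
  "bundle_factor \<nu> \<alpha> \<beta> z = (\<alpha> + \<beta> * z) ^ (2 * \<nu>) * (1 / rho z) ^ \<nu> * (1 / sig \<alpha> \<beta>) ^ \<nu>"

text \<open>The derivative of the bundle factor with respect to
  \<open>N = \<alpha> + \<beta> * z\<close>. It is kept apart instead of being written as a quotient
  by \<open>N\<close>, so that the formulas stay valid at the antipodal point, where
  \<open>N = 0\<close>.\<close>

definition bundle_factor_N :: "nat \<Rightarrow> complex \<Rightarrow> complex \<Rightarrow> complex \<Rightarrow> complex" where
  "bundle_factor_N \<nu> \<alpha> \<beta> z = of_nat (2 * \<nu>) * (\<alpha> + \<beta> * z) ^ (2 * \<nu> - 1) * (1 / rho z) ^ \<nu> * (1 / sig \<alpha> \<beta>) ^ \<nu>"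

lemma bundle_factor_N_mult: "(\<alpha> + \<beta> * z) * bundle_factor_N \<nu> \<alpha> \<beta> z = of_nat (2 * \<nu>) * bundle_factor \<nu> \<alpha> \<beta> z"
proof (cases \<nu>)
  case (Suc n)
  have "(\<alpha> + \<beta> * z) ^ (2 * \<nu>) = (\<alpha> + \<beta> * z) * (\<alpha> + \<beta> * z) ^ (2 * \<nu> - 1)" by (simp add: Suc)
  then show ?thesis by (simp add: bundle_factor_def bundle_factor_N_def)
qed (simp add: bundle_factor_N_def)

lemma has_wirtinger_bundle_factor:
  "has_wirtinger (bundle_factor \<nu> \<alpha> \<beta>)
     (\<beta> * bundle_factor_N \<nu> \<alpha> \<beta> z - of_nat \<nu> * cnj z * (1 / rho z) * bundle_factor \<nu> \<alpha> \<beta> z)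
     (- of_nat \<nu> * z * (1 / rho z) * bundle_factor \<nu> \<alpha> \<beta> z) z"
proof -
  note d = has_wirtinger_mult[OF has_wirtinger_mult[OF has_wirtinger_power[OF has_wirtinger_affine[of \<alpha> \<beta> z], of "2 * \<nu>"]
      has_wirtinger_power[OF has_wirtinger_inv_rho[of z], of \<nu>]] has_wirtinger_const[of "(1 / sig \<alpha> \<beta>) ^ \<nu>" z]]
  \<comment> \<open>The truncated exponent \<open>\<nu> - 1\<close> is harmless because of the
    factor \<open>of_nat \<nu>\<close>.\<close>
  have p: "of_nat \<nu> * (1 / rho z) ^ (\<nu> - 1) * (c * (1 / rho z)\<^sup>2) = of_nat \<nu> * c * (1 / rho z) * (1 / rho z) ^ \<nu>" for c
    by (cases \<nu>) (simp_all add: power2_eq_square)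
  show ?thesis
    unfolding bundle_factor_def[abs_def]
    by (rule has_wirtinger_eq[OF d])
      (simp_all only: p[of "- cnj z"] p[of "- z"] bundle_factor_N_def, simp_all add: algebra_simps)
qed

text \<open>The profile stays abstract: it is instantiated by heat profiles, and for
  \<open>\<nu> = 0\<close> by powers when the moments of the overlap are computed.\<close>

locale bundle_kernel =
  fixes \<alpha> \<beta> :: complex and \<nu> :: nat and \<phi> \<phi>' \<phi>'' :: "real \<Rightarrow> real"
  assumes nz: "\<alpha> \<noteq> 0 \<or> \<beta> \<noteq> 0"
    and d1: "\<And>x. x \<in> {0..1} \<Longrightarrow> (\<phi> has_real_derivative \<phi>' x) (at x)"
    and d2: "\<And>x. x \<in> {0..1} \<Longrightarrow> (\<phi>' has_real_derivative \<phi>'' x) (at x)"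
begin

abbreviation "X \<equiv> overlap \<alpha> \<beta>"
abbreviation "B \<equiv> bundle_factor \<nu> \<alpha> \<beta>"
abbreviation "Xz \<equiv> overlap_z \<alpha> \<beta>"
abbreviation "Xb \<equiv> overlap_zb \<alpha> \<beta>"

lemma sig_nonzero: "sig \<alpha> \<beta> \<noteq> 0"
proof -
  have "(norm \<alpha>)\<^sup>2 + (norm \<beta>)\<^sup>2 \<noteq> 0" using nz by (simp add: add_nonneg_eq_0_iff)
  then show ?thesis unfolding sig_altdef by (simp only: of_real_eq_0_iff not_False_eq_True)
qed

definition F :: "complex \<Rightarrow> complex" where "F z = B z * of_real (\<phi> (X z))"

definition Fb :: "complex \<Rightarrow> complex" where
  "Fb z = - of_nat \<nu> * z * (1 / rho z) * (B z * of_real (\<phi> (X z))) + B z * of_real (\<phi>' (X z)) * Xb z"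

definition Fz :: "complex \<Rightarrow> complex" where
  "Fz z = (\<beta> * bundle_factor_N \<nu> \<alpha> \<beta> z - of_nat \<nu> * cnj z * (1 / rho z) * B z) * of_real (\<phi> (X z))
     + B z * of_real (\<phi>' (X z)) * Xz z"

lemma X_in: "X z \<in> {0..1}" using overlap_bounds by auto

lemma has_wirtinger_F: "has_wirtinger F (Fz z) (Fb z) z"
  unfolding F_def[abs_def]
  by (rule has_wirtinger_eq[OF has_wirtinger_mult[OF has_wirtinger_bundle_factor
        has_wirtinger_of_real_compose[where \<phi> = \<phi>, OF has_wirtinger_overlap d1[OF X_in]]]])
    (simp_all add: Fz_def Fb_def algebra_simps)

text \<open>Not a derivative of \<open>F\<close>, but the same product built from
  \<open>\<phi>'\<close>; \<open>Fb\<close> is a multiple of \<open>F\<close> plus \<open>F'\<close>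
  times \<open>Xb\<close>, which prepares the second differentiation.\<close>

definition F' :: "complex \<Rightarrow> complex" where "F' z = B z * of_real (\<phi>' (X z))"

definition F'z :: "complex \<Rightarrow> complex" where
  "F'z z = (\<beta> * bundle_factor_N \<nu> \<alpha> \<beta> z - of_nat \<nu> * cnj z * (1 / rho z) * B z) * of_real (\<phi>' (X z))
     + B z * of_real (\<phi>'' (X z)) * Xz z"

lemma has_wirtinger_F': "\<exists>b. has_wirtinger F' (F'z z) b z"
  unfolding F'_def[abs_def]
  by (rule exI, rule has_wirtinger_eq[OF has_wirtinger_mult[OF has_wirtinger_bundle_factor
        has_wirtinger_of_real_compose[where \<phi> = \<phi>', OF has_wirtinger_overlap d2[OF X_in]]] _ refl])
    (simp_all add: F'z_def algebra_simps)

definition Xbz :: "complex \<Rightarrow> complex" where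
  "Xbz z = ((\<beta> * (cnj \<beta> - cnj \<alpha> * z) - (\<alpha> + \<beta> * z) * cnj \<alpha>) * (1 / rho z)\<^sup>2
     - 2 * cnj z * (\<alpha> + \<beta> * z) * (cnj \<beta> - cnj \<alpha> * z) * (1 / rho z) ^ 3) * (1 / sig \<alpha> \<beta>)"

definition Xbb :: "complex \<Rightarrow> complex" where
  "Xbb z = (- (2 * z * (\<alpha> + \<beta> * z) * (cnj \<beta> - cnj \<alpha> * z) * (1 / rho z) ^ 3)) * (1 / sig \<alpha> \<beta>)"

lemma has_wirtinger_Xb: "has_wirtinger Xb (Xbz z) (Xbb z) z"
proof -
  have a: "has_wirtinger (\<lambda>z. cnj \<beta> - cnj \<alpha> * z) (- cnj \<alpha>) 0 z"
    using has_wirtinger_affine[of "cnj \<beta>" "- cnj \<alpha>" z] by simp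
  note d = has_wirtinger_mult[OF has_wirtinger_mult[OF has_wirtinger_mult[OF has_wirtinger_affine a]
      has_wirtinger_power[OF has_wirtinger_inv_rho, of 2]] has_wirtinger_const, of \<alpha> \<beta> "1 / sig \<alpha> \<beta>"]
  have *: "((\<beta> * A + N * (- ca)) * R\<^sup>2 + N * A * (of_nat 2 * R ^ (2 - 1) * (- zb * R\<^sup>2))) * S + T * 0
      = ((\<beta> * A - N * ca) * R\<^sup>2 - 2 * zb * N * A * R ^ 3) * S"
    "((0 * A + N * 0) * R\<^sup>2 + N * A * (of_nat 2 * R ^ (2 - 1) * (- z * R\<^sup>2))) * S + T * 0
      = (- (2 * z * N * A * R ^ 3)) * S" for N A ca R S T zb z :: complex
    by (simp_all add: algebra_simps power2_eq_square power3_eq_cube)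
  show ?thesis
    unfolding overlap_zb_def[abs_def] Xbz_def Xbb_def
    by (rule has_wirtinger_eq[OF d *])
qed

definition Fbz :: "complex \<Rightarrow> complex" where
  "Fbz z = (- of_nat \<nu> * (1 / rho z) + of_nat \<nu> * z * cnj z * (1 / rho z)\<^sup>2) * F z
     - of_nat \<nu> * z * (1 / rho z) * Fz z + F'z z * Xb z + F' z * Xbz z"

lemma has_wirtinger_Fb: "\<exists>b. has_wirtinger Fb (Fbz z) b z"
proof -
  obtain b1 where b1: "has_wirtinger F' (F'z z) b1 z" using has_wirtinger_F' by blast
  note d = has_wirtinger_add[OF has_wirtinger_mult[OF has_wirtinger_mult[OF has_wirtinger_mult[OF has_wirtinger_const has_wirtinger_ident]
     has_wirtinger_inv_rho] has_wirtinger_F] has_wirtinger_mult[OF b1 has_wirtinger_Xb], of "- of_nat \<nu>"]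
  have e: "Fb = (\<lambda>z. - of_nat \<nu> * z * (1 / rho z) * F z + F' z * Xb z)"
    by (simp add: Fb_def fun_eq_iff F_def F'_def)
  show ?thesis
    unfolding e by (rule exI, rule has_wirtinger_eq[OF d _ refl]) (simp add: Fbz_def algebra_simps)
qed

text \<open>The overlap behaves as a radial coordinate: \<open>rho^2 * Xz * Xb\<close> is
  \<open>X * (1 - X)\<close> and \<open>rho^2 * Xbz\<close> is \<open>1 - 2 * X\<close>. The
  derivatives of the bundle factor shift the first order coefficient to its Jacobi form and leave
  \<open>- real \<nu>\<close> in order zero.\<close>

lemma laplacian_F:
  "(rho z)\<^sup>2 * Fbz z + of_nat \<nu> * rho z * (z * Fz z - cnj z * Fb z) - (of_nat \<nu>)\<^sup>2 * (z * cnj z) * F z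
    = B z * of_real (X z * (1 - X z) * \<phi>'' (X z) + (2 * real \<nu> + 1 - (2 * real \<nu> + 2) * X z) * \<phi>' (X z)
        - real \<nu> * \<phi> (X z))"
proof -
  \<comment> \<open>A purely algebraic identity: \<open>R\<close> and \<open>S\<close> are the
    inverses of \<open>rho z\<close> and \<open>sig \<alpha> \<beta>\<close>, while the conjugates
    become independent variables, so that \<open>algebra\<close> settles each piece.\<close>
  have key: "r\<^sup>2 * ((- n * R + n * z * zb * R\<^sup>2) * (b * p)
        - n * z * R * ((\<beta> * c - n * zb * R * b) * p + b * p' * xz)
        + ((\<beta> * c - n * zb * R * b) * p' + b * p'' * xz) * xb + (b * p') * xbz)
      + n * r * (z * ((\<beta> * c - n * zb * R * b) * p + b * p' * xz) - zb * (- n * z * R * (b * p) + b * p' * xb))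
      - n\<^sup>2 * (z * zb) * (b * p)
    = b * (x * (1 - x) * p'' + (2 * n + 1 - (2 * n + 2) * x) * p' - n * p)"
    if R: "r * R = 1" "r = 1 + z * zb" and S: "s * S = 1" "s = \<alpha> * ca + \<beta> * cb"
      and N: "N = \<alpha> + \<beta> * z" "cN = ca + cb * zb" and c: "N * c = 2 * n * b"
      and x: "x = N * cN * R * S" "xz = cN * (\<beta> - \<alpha> * zb) * R\<^sup>2 * S" "xb = N * (cb - ca * z) * R\<^sup>2 * S"
      and xbz: "xbz = ((\<beta> * (cb - ca * z) - N * ca) * R\<^sup>2 - 2 * zb * N * (cb - ca * z) * R ^ 3) * S"
    for r R z zb n b c p p' p'' xz xb xbz x s S N cN ca cb :: complex
  proof -
    \<comment> \<open>The squared gradient of \<open>X\<close>, again by Lagrange's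
      identity.\<close>
    have 0: "r\<^sup>2 * (xz * xb) = x * (1 - x)"
    proof -
      have "(\<beta> - \<alpha> * zb) * (cb - ca * z) = r * s - N * cN"
        unfolding R S N by (simp add: algebra_simps)
      then have "r\<^sup>2 * (xz * xb) = r\<^sup>2 * (N * cN * (r * s - N * cN) * R ^ 4 * S\<^sup>2)"
        unfolding x by algebra
      also have "\<dots> = x * (1 - x)" unfolding x using R(1) S(1) by algebra
      finally show ?thesis .
    qed
    have 1: "zb * (N * (cb - ca * z)) * R * S = x - N * ca * S"
    proof -
      have "zb * (cb - ca * z) = cN - ca * r" unfolding R N by (simp add: algebra_simps)
      then have "zb * (N * (cb - ca * z)) * R * S = N * (cN - ca * r) * R * S" by algebra
      then show ?thesis unfolding x using R(1) by algebra
    qed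
    have 2: "\<beta> * (cb - ca * z) * S = 1 - N * ca * S"
    proof -
      have "\<beta> * (cb - ca * z) = s - N * ca" unfolding S N by (simp add: algebra_simps)
      then show ?thesis using S(1) by algebra
    qed
    \<comment> \<open>The scalar Laplacian of \<open>X\<close>.\<close>
    have 3: "r\<^sup>2 * xbz = 1 - 2 * x"
    proof -
      have "r\<^sup>2 * xbz = (\<beta> * (cb - ca * z) * S - N * ca * S) - 2 * (zb * (N * (cb - ca * z)) * R * S)"
        unfolding xbz using R(1) by algebra
      then show ?thesis unfolding 1 2 by (simp add: algebra_simps)
    qed
    \<comment> \<open>The mixed term between the bundle factor and \<open>X\<close>; the relation
      \<open>N * c = 2 * n * b\<close> removes \<open>c\<close> without dividing by
      \<open>N\<close>.\<close>
    have 4: "r\<^sup>2 * (\<beta> * c * xb) = 2 * n * b * (1 - N * ca * S)"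
    proof -
      have "r\<^sup>2 * (\<beta> * c * xb) = (N * c) * (\<beta> * (cb - ca * z) * S)"
        unfolding x using R(1) by algebra
      then show ?thesis unfolding c 2 .
    qed
    have 5: "r * zb * xb = x - N * ca * S"
      unfolding 1[symmetric] x(3) using R(1) by algebra
    have "r\<^sup>2 * ((- n * R + n * z * zb * R\<^sup>2) * (b * p)
        - n * z * R * ((\<beta> * c - n * zb * R * b) * p + b * p' * xz)
        + ((\<beta> * c - n * zb * R * b) * p' + b * p'' * xz) * xb + (b * p') * xbz)
      + n * r * (z * ((\<beta> * c - n * zb * R * b) * p + b * p' * xz) - zb * (- n * z * R * (b * p) + b * p' * xb))
      - n\<^sup>2 * (z * zb) * (b * p)
      = n * b * p * (z * zb - r) + p' * (r\<^sup>2 * (\<beta> * c * xb) - 2 * n * b * (r * zb * xb) + b * (r\<^sup>2 * xbz)) + b * p'' * (r\<^sup>2 * (xz * xb))"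
      using R(1) by algebra
    also have "\<dots> = b * (x * (1 - x) * p'' + (2 * n + 1 - (2 * n + 2) * x) * p' - n * p)"
    proof -
      have "z * zb - r = -1" using R(2) by simp
      then show ?thesis unfolding 0 3 4 5 by algebra
    qed
    finally show ?thesis .
  qed
  have e: "complex_of_real (X z * (1 - X z) * \<phi>'' (X z) + (2 * real \<nu> + 1 - (2 * real \<nu> + 2) * X z) * \<phi>' (X z)
        - real \<nu> * \<phi> (X z)) = of_real (X z) * (1 - of_real (X z)) * of_real (\<phi>'' (X z))
        + (2 * of_nat \<nu> + 1 - (2 * of_nat \<nu> + 2) * of_real (X z)) * of_real (\<phi>' (X z)) - of_nat \<nu> * of_real (\<phi> (X z))"
    by simp
  show ?thesis
    unfolding e Fbz_def Fz_def Fb_def F_def F'z_def F'_def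
    by (rule key[where r = "rho z" and s = "sig \<alpha> \<beta>" and S = "1 / sig \<alpha> \<beta>" and N = "\<alpha> + \<beta> * z"
          and cN = "cnj \<alpha> + cnj \<beta> * cnj z" and ca = "cnj \<alpha>" and cb = "cnj \<beta>"])
      (simp_all only: of_real_overlap overlap_z_def overlap_zb_def Xbz_def rho_def[of z] sig_def bundle_factor_N_mult of_nat_mult of_nat_numeral,
       use sig_nonzero rho_nonzero[of z] in \<open>simp_all add: rho_def sig_def\<close>)
qed

end

section \<open>The candidate kernel\<close>

lemma (in bundle_kernel) magnetic_laplacian_F:
  "magnetic_laplacian \<nu> F z = - (B z * of_real (X z * (1 - X z) * \<phi>'' (X z)
      + (2 * real \<nu> + 1 - (2 * real \<nu> + 2) * X z) * \<phi>' (X z) - real \<nu> * \<phi> (X z)))"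
proof -
  have w: "wirtinger F z = Fz z" "wirtinger_bar F = Fb"
    using has_wirtinger_wirtinger[OF has_wirtinger_F] by (auto simp: fun_eq_iff)
  obtain b where "has_wirtinger Fb (Fbz z) b z" using has_wirtinger_Fb by blast
  then have w': "wirtinger Fb z = Fbz z" by (rule has_wirtinger_wirtinger)
  have "magnetic_laplacian \<nu> F z = - ((rho z)\<^sup>2 * Fbz z + of_nat \<nu> * rho z * (z * Fz z - cnj z * Fb z)
     - (of_nat \<nu>)\<^sup>2 * (z * cnj z) * F z)"
    unfolding magnetic_laplacian_def w w'
    by (simp add: rho_altdef complex_norm_square[symmetric] algebra_simps)
  then show ?thesis unfolding laplacian_F .
qed

section \<open>The candidate and its heat equation\<close>

text \<open>General coefficients are allowed because the same kernel with finitely many terms is the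
  eigensum to which the maximum principle is applied in
  \<open>finite_eigensum_contraction\<close>.\<close>

definition mono_kernel :: "nat \<Rightarrow> (nat \<Rightarrow> real) \<Rightarrow> real \<Rightarrow> complex \<Rightarrow> complex \<Rightarrow> complex \<Rightarrow> complex" where
  "mono_kernel \<nu> c t \<alpha> \<beta> z = bundle_factor \<nu> \<alpha> \<beta> z * of_real (heat_profile \<nu> c t (overlap \<alpha> \<beta> z))"

lemma overlap_abs_le: "\<bar>overlap \<alpha> \<beta> z\<bar> \<le> 2" "overlap \<alpha> \<beta> z \<in> {-2<..<2}"
  using overlap_bounds[of \<alpha> \<beta> z] by auto

lemma mono_kernel_heat_equation:
  assumes c: "geo_coeffs c" and "t > 0" "\<alpha> \<noteq> 0 \<or> \<beta> \<noteq> 0"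
  shows "((\<lambda>s. mono_kernel \<nu> c s \<alpha> \<beta> z) has_vector_derivative - magnetic_laplacian \<nu> (mono_kernel \<nu> c t \<alpha> \<beta>) z) (at t)"
proof -
  interpret bundle_kernel \<alpha> \<beta> \<nu> "heat_profile \<nu> c t" "heat_profile' \<nu> c t" "heat_profile'' \<nu> c t"
  proof
    show "\<alpha> \<noteq> 0 \<or> \<beta> \<noteq> 0" by fact
    fix x :: real assume "x \<in> {0..1}"
    then have x: "x \<in> {-2<..<2}" by auto
    show "(heat_profile \<nu> c t has_real_derivative heat_profile' \<nu> c t x) (at x)"
      unfolding heat_profile_def
      by (rule heat_series_x_derivative[OF geo_polys_weighted_jacobi[OF c] mono_eigenvalue_ge assms(2) x])
    show "(heat_profile' \<nu> c t has_real_derivative heat_profile'' \<nu> c t x) (at x)"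
      by (rule heat_series_x_derivative[OF geo_polys_pderiv[OF geo_polys_weighted_jacobi[OF c]] mono_eigenvalue_ge assms(2) x])
  qed
  have e: "mono_kernel \<nu> c t \<alpha> \<beta> = F" by (simp add: fun_eq_iff F_def mono_kernel_def)
  have "((\<lambda>s. heat_profile \<nu> c s (X z)) has_real_derivative
      X z * (1 - X z) * heat_profile'' \<nu> c t (X z) + (2 * real \<nu> + 1 - (2 * real \<nu> + 2) * X z) * heat_profile' \<nu> c t (X z)
       - real \<nu> * heat_profile \<nu> c t (X z)) (at t)"
    by (rule heat_profile_pde[OF c assms(2) overlap_abs_le(1)])
  from has_vector_derivative_of_real[OF this, where ?'a = complex]
  moreover have "(\<lambda>s. mono_kernel \<nu> c s \<alpha> \<beta> z) = (\<lambda>s. B z * of_real (heat_profile \<nu> c s (X z)))"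
    by (simp add: mono_kernel_def)
  ultimately show ?thesis
    by (simp only: e magnetic_laplacian_F minus_minus has_vector_derivative_mult_right)
qed

section \<open>Regularity of the candidate\<close>

text \<open>An algebra of jointly continuous functions closed under both Wirtinger derivatives in
  \<open>z\<close>. Membership alone yields all space clauses of \<open>heat_regular\<close> as well
  as smoothness; \<open>w\<close> enters only through continuous coefficients.\<close>

inductive kernel_fun :: "(complex \<Rightarrow> complex) \<Rightarrow> (complex \<Rightarrow> complex) \<Rightarrow> (nat \<Rightarrow> real) \<Rightarrow>
    (real \<Rightarrow> complex \<Rightarrow> complex \<Rightarrow> complex) \<Rightarrow> bool" for \<alpha> \<beta> lam where
  coeff: "continuous_on UNIV c \<Longrightarrow> kernel_fun \<alpha> \<beta> lam (\<lambda>t z w. c w)"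
| var: "kernel_fun \<alpha> \<beta> lam (\<lambda>t z w. z)"
| cnj: "kernel_fun \<alpha> \<beta> lam (\<lambda>t z w. cnj z)"
| inv_rho: "kernel_fun \<alpha> \<beta> lam (\<lambda>t z w. 1 / rho z)"
| profile: "geo_polys Q \<Longrightarrow> kernel_fun \<alpha> \<beta> lam (\<lambda>t z w. of_real (heat_series lam Q t (overlap (\<alpha> w) (\<beta> w) z)))"
| add: "kernel_fun \<alpha> \<beta> lam f \<Longrightarrow> kernel_fun \<alpha> \<beta> lam g \<Longrightarrow> kernel_fun \<alpha> \<beta> lam (\<lambda>t z w. f t z w + g t z w)"
| mult: "kernel_fun \<alpha> \<beta> lam f \<Longrightarrow> kernel_fun \<alpha> \<beta> lam g \<Longrightarrow> kernel_fun \<alpha> \<beta> lam (\<lambda>t z w. f t z w * g t z w)"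

lemma kernel_fun_const: "kernel_fun \<alpha> \<beta> lam (\<lambda>t z w. c)"
  by (rule kernel_fun.coeff) simp

lemma kernel_fun_minus: "kernel_fun \<alpha> \<beta> lam f \<Longrightarrow> kernel_fun \<alpha> \<beta> lam (\<lambda>t z w. - f t z w)"
  using kernel_fun.mult[OF kernel_fun_const[of _ _ _ "-1"]] by simp

lemma kernel_fun_power: "kernel_fun \<alpha> \<beta> lam f \<Longrightarrow> kernel_fun \<alpha> \<beta> lam (\<lambda>t z w. f t z w ^ n)"
  by (induction n) (auto intro: kernel_fun_const kernel_fun.mult)

locale kernel_coeffs =
  fixes \<alpha> \<beta> :: "complex \<Rightarrow> complex" and lam :: "nat \<Rightarrow> real"
  assumes cont_\<alpha>: "continuous_on UNIV \<alpha>" and cont_\<beta>: "continuous_on UNIV \<beta>"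
    and nz: "\<And>w. \<alpha> w \<noteq> 0 \<or> \<beta> w \<noteq> 0" and lam: "\<And>l. (real l)\<^sup>2 \<le> lam l"
begin

abbreviation "\<F> \<equiv> kernel_fun \<alpha> \<beta> lam"

lemma sig_nonzero: "sig (\<alpha> w) (\<beta> w) \<noteq> 0"
proof -
  have "(norm (\<alpha> w))\<^sup>2 + (norm (\<beta> w))\<^sup>2 \<noteq> 0" using nz[of w] by (simp add: add_nonneg_eq_0_iff)
  then show ?thesis unfolding sig_altdef by (simp only: of_real_eq_0_iff not_False_eq_True)
qed

lemma kernel_fun_coeffs:
  "\<F> (\<lambda>t z w. \<alpha> w)" "\<F> (\<lambda>t z w. \<beta> w)" "\<F> (\<lambda>t z w. cnj (\<alpha> w))" "\<F> (\<lambda>t z w. cnj (\<beta> w))"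
  "\<F> (\<lambda>t z w. 1 / sig (\<alpha> w) (\<beta> w))"
  using sig_nonzero unfolding sig_def
  by (auto intro!: kernel_fun.coeff continuous_intros cont_\<alpha> cont_\<beta>)

lemma continuous_on_overlap: "continuous_on S (\<lambda>(t :: real, z, w). overlap (\<alpha> w) (\<beta> w) z)"
proof -
  have "(1 + (norm z)\<^sup>2) * ((norm (\<alpha> w))\<^sup>2 + (norm (\<beta> w))\<^sup>2) \<noteq> 0" for z w :: complex
    using nz[of w] one_plus_norm_pos[of z] by (auto simp: add_nonneg_eq_0_iff)
  then show ?thesis
    unfolding overlap_def case_prod_unfold
    by (intro continuous_intros continuous_on_compose2[OF cont_\<alpha>] continuous_on_compose2[OF cont_\<beta>]) auto
qed

lemma kernel_fun_continuous:
  "\<F> f \<Longrightarrow> continuous_on ({0<..} \<times> UNIV \<times> UNIV) (\<lambda>(t, z, w). f t z w)"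
proof (induction rule: kernel_fun.induct)
  case (coeff c)
  then show ?case unfolding case_prod_unfold
    by (intro continuous_on_compose2[OF coeff] continuous_intros) auto
next
  case (profile Q)
  have "continuous_on ({0<..} \<times> UNIV \<times> UNIV) (\<lambda>p. (\<lambda>(t, x). heat_series lam Q t x) (fst p, overlap (\<alpha> (snd (snd p))) (\<beta> (snd (snd p))) (fst (snd p))))"
    using continuous_on_overlap overlap_abs_le(2)
    by (intro continuous_on_compose2[OF continuous_on_heat_series[OF profile lam]] continuous_intros)
      (auto simp: case_prod_unfold)
  then show ?case unfolding case_prod_unfold by (auto intro!: continuous_on_of_real)
next
  case (add f g) then show ?case by (auto simp: case_prod_unfold intro!: continuous_intros)
next
  case (mult f g) then show ?case by (auto simp: case_prod_unfold intro!: continuous_intros)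
next
  case inv_rho show ?case unfolding rho_def case_prod_unfold
    using rho_nonzero by (intro continuous_intros) (auto simp flip: rho_def)
qed (auto simp: case_prod_unfold intro!: continuous_intros)

text \<open>The one analytic case is \<open>profile\<close>: the chain rule produces the series of
  the \<open>pderiv (Q l)\<close> times the derivatives of the overlap, which are built from the
  other generators.\<close>

lemma kernel_fun_wirtinger:
  "\<F> f \<Longrightarrow> \<exists>a b. \<F> a \<and> \<F> b \<and> (\<forall>t>0. \<forall>z w. has_wirtinger (\<lambda>z. f t z w) (a t z w) (b t z w) z)"
proof (induction rule: kernel_fun.induct)
  case (coeff c)
  show ?case
    by (rule exI[of _ "\<lambda>t z w. 0"], rule exI[of _ "\<lambda>t z w. 0"]) (auto intro: kernel_fun_const has_wirtinger_const)
next
  case var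
  show ?case
    by (rule exI[of _ "\<lambda>t z w. 1"], rule exI[of _ "\<lambda>t z w. 0"]) (auto intro: kernel_fun_const has_wirtinger_ident)
next
  case cnj
  show ?case
    by (rule exI[of _ "\<lambda>t z w. 0"], rule exI[of _ "\<lambda>t z w. 1"]) (auto intro: kernel_fun_const has_wirtinger_cnj_ident)
next
  case inv_rho
  show ?case
    by (rule exI[of _ "\<lambda>t z w. - cnj z * (1 / rho z)\<^sup>2"], rule exI[of _ "\<lambda>t z w. - z * (1 / rho z)\<^sup>2"])
      (intro conjI allI impI has_wirtinger_inv_rho kernel_fun.mult kernel_fun_minus kernel_fun_power kernel_fun.intros)
next
  case (profile Q)
  let ?d = "\<lambda>t z w. of_real (heat_series lam (\<lambda>l. pderiv (Q l)) t (overlap (\<alpha> w) (\<beta> w) z)) :: complex"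
  show ?case
  proof (rule exI[of _ "\<lambda>t z w. ?d t z w * overlap_z (\<alpha> w) (\<beta> w) z"],
         rule exI[of _ "\<lambda>t z w. ?d t z w * overlap_zb (\<alpha> w) (\<beta> w) z"], intro conjI allI impI)
    have d: "\<F> ?d" by (intro kernel_fun.profile geo_polys_pderiv profile)
    have n: "\<F> (\<lambda>t z w. \<beta> w - \<alpha> w * cnj z)" "\<F> (\<lambda>t z w. cnj (\<beta> w) - cnj (\<alpha> w) * z)"
      unfolding diff_conv_add_uminus by (intro kernel_fun.intros kernel_fun_minus kernel_fun_coeffs)+
    show "\<F> (\<lambda>t z w. ?d t z w * overlap_z (\<alpha> w) (\<beta> w) z)"
      unfolding overlap_z_def
      by (intro kernel_fun.mult[OF d] kernel_fun.mult kernel_fun.add n kernel_fun_power kernel_fun.var kernel_fun.cnj kernel_fun.inv_rho kernel_fun_coeffs)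
    show "\<F> (\<lambda>t z w. ?d t z w * overlap_zb (\<alpha> w) (\<beta> w) z)"
      unfolding overlap_zb_def
      by (intro kernel_fun.mult[OF d] kernel_fun.mult kernel_fun.add n kernel_fun_power kernel_fun.var kernel_fun.cnj kernel_fun.inv_rho kernel_fun_coeffs)
    fix t :: real and z w :: complex assume "t > 0"
    show "has_wirtinger (\<lambda>z. of_real (heat_series lam Q t (overlap (\<alpha> w) (\<beta> w) z)))
      (?d t z w * overlap_z (\<alpha> w) (\<beta> w) z) (?d t z w * overlap_zb (\<alpha> w) (\<beta> w) z) z"
      by (intro has_wirtinger_of_real_compose has_wirtinger_overlap heat_series_x_derivative profile lam \<open>t > 0\<close> overlap_abs_le)
  qed
next
  case (add f g)
  then obtain a b c d where "\<F> a" "\<F> b" "\<F> c" "\<F> d"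
    "\<forall>t>0. \<forall>z w. has_wirtinger (\<lambda>z. f t z w) (a t z w) (b t z w) z"
    "\<forall>t>0. \<forall>z w. has_wirtinger (\<lambda>z. g t z w) (c t z w) (d t z w) z" by blast
  then show ?case
    by (intro exI[of _ "\<lambda>t z w. a t z w + c t z w"] exI[of _ "\<lambda>t z w. b t z w + d t z w"] conjI allI impI)
      (auto intro: kernel_fun.add has_wirtinger_add)
next
  case (mult f g)
  then obtain a b c d where "\<F> a" "\<F> b" "\<F> c" "\<F> d"
    "\<forall>t>0. \<forall>z w. has_wirtinger (\<lambda>z. f t z w) (a t z w) (b t z w) z"
    "\<forall>t>0. \<forall>z w. has_wirtinger (\<lambda>z. g t z w) (c t z w) (d t z w) z" by blast
  with mult.hyps show ?case
    by (intro exI[of _ "\<lambda>t z w. a t z w * g t z w + f t z w * c t z w"]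
        exI[of _ "\<lambda>t z w. b t z w * g t z w + f t z w * d t z w"] conjI allI impI)
      (auto intro: kernel_fun.add kernel_fun.mult has_wirtinger_mult)
qed

lemma kernel_fun_dir_deriv:
  assumes "\<F> f"
  obtains g where "\<And>v. \<F> (g v)" "\<And>t z w v. t > 0 \<Longrightarrow> dir_deriv (\<lambda>z. f t z w) v z = g v t z w"
    "\<And>t z w. t > 0 \<Longrightarrow> (\<lambda>z. f t z w) differentiable (at z)"
proof -
  obtain a b where ab: "\<F> a" "\<F> b" "\<And>t z w. t > 0 \<Longrightarrow> has_wirtinger (\<lambda>z. f t z w) (a t z w) (b t z w) z"
    using kernel_fun_wirtinger[OF assms] by blast
  show ?thesis
  proof (rule that[of "\<lambda>v t z w. a t z w * v + b t z w * cnj v"])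
    show "\<F> (\<lambda>t z w. a t z w * v + b t z w * cnj v)" for v
      by (intro kernel_fun.add kernel_fun.mult ab kernel_fun_const)
    show "dir_deriv (\<lambda>z. f t z w) v z = a t z w * v + b t z w * cnj v" if "t > 0" for t z w v
      using has_wirtinger_dir_deriv[OF ab(3)[OF that]] .
    show "(\<lambda>z. f t z w) differentiable (at z)" if "t > 0" for t z w
      using has_wirtinger_differentiable[OF ab(3)[OF that]] .
  qed
qed

text \<open>Space derivatives come from the closure of the class, applied twice; the time derivative
  is supplied as a second member \<open>g\<close>. \<open>K\<close> need only agree with
  \<open>f\<close> at positive times.\<close>

lemma heat_regular_kernel_fun:
  assumes f: "\<F> f" and g: "\<F> g"
    and t: "\<And>t z w. t > 0 \<Longrightarrow> ((\<lambda>s. f s z w) has_vector_derivative g t z w) (at t)"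
    and K: "\<And>t z w. t > 0 \<Longrightarrow> K t z w = f t z w"
  shows "heat_regular K"
proof -
  have cong: "continuous_on ({0<..} \<times> UNIV \<times> UNIV) (\<lambda>(t, z, w). h t z w)"
    if "\<F> k" "\<And>t z w. t > 0 \<Longrightarrow> h t z w = k t z w" for h k
    by (rule continuous_on_eq[OF kernel_fun_continuous[OF that(1)]]) (auto simp: that(2))
  have Kt: "((\<lambda>s. K s z w) has_vector_derivative g t z w) (at t)" if "t > 0" for t z w
    by (rule has_vector_derivative_transform_within_open[OF t[OF that], of "{0<..}"]) (use that K in auto)
  have Kf: "(\<lambda>z. K t z w) = (\<lambda>z. f t z w)" if "t > 0" for t w
    using K[OF that] by blast
  obtain f1 where f1: "\<And>v. \<F> (f1 v)" "\<And>t z w v. t > 0 \<Longrightarrow> dir_deriv (\<lambda>z. f t z w) v z = f1 v t z w"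
    "\<And>t z w. t > 0 \<Longrightarrow> (\<lambda>z. f t z w) differentiable (at z)"
    using kernel_fun_dir_deriv[OF f] by metis
  have K1: "dir_deriv (\<lambda>z. K t z w) v = (\<lambda>z. f1 v t z w)" if "t > 0" for t w v
    using f1(2)[OF that] unfolding Kf[OF that] by blast
  have "\<exists>g. (\<forall>v'. \<F> (g v')) \<and> (\<forall>t>0. \<forall>z w v'. dir_deriv (\<lambda>z. f1 v t z w) v' z = g v' t z w) \<and>
    (\<forall>t>0. \<forall>z w. (\<lambda>z. f1 v t z w) differentiable (at z))" for v
    using kernel_fun_dir_deriv[OF f1(1)[of v]] by metis
  then obtain f2 where f2: "\<And>v v'. \<F> (f2 v v')" "\<And>v t z w v'. t > 0 \<Longrightarrow> dir_deriv (\<lambda>z. f1 v t z w) v' z = f2 v v' t z w"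
    "\<And>v t z w. t > 0 \<Longrightarrow> (\<lambda>z. f1 v t z w) differentiable (at z)"
    by metis
  show ?thesis
    unfolding heat_regular_def
  proof (intro conjI allI impI)
    show "continuous_on ({0<..} \<times> UNIV \<times> UNIV) (\<lambda>(t, z, w). K t z w)"
      by (rule cong[OF f K])
    show "(\<lambda>s. K s z w) differentiable (at t)" if "t > 0" for t z w
      using Kt[OF that] by (rule differentiableI_vector)
    show "continuous_on ({0<..} \<times> UNIV \<times> UNIV) (\<lambda>(t, z, w). vector_derivative (\<lambda>s. K s z w) (at t))"
      by (rule cong[OF g]) (use Kt in \<open>auto intro: vector_derivative_at\<close>)
    show "(\<lambda>x. K t x w) differentiable (at z)" if "t > 0" for t z w
      unfolding Kf[OF that] by (rule f1(3)[OF that])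
    show "continuous_on ({0<..} \<times> UNIV \<times> UNIV) (\<lambda>(t, z, w). dir_deriv (\<lambda>x. K t x w) v z)" for v
      by (rule cong[OF f1(1)[of v]]) (simp add: K1)
    show "dir_deriv (\<lambda>x. K t x w) v differentiable (at z)" if "t > 0" for t z w v
      unfolding K1[OF that] by (rule f2(3)[OF that])
    show "continuous_on ({0<..} \<times> UNIV \<times> UNIV) (\<lambda>(t, z, w). dir_deriv (dir_deriv (\<lambda>x. K t x w) v) v' z)" for v v'
      by (rule cong[OF f2(1)[of v v']]) (simp add: K1 f2(2))
  qed
qed

end

lemma heat_regular_mono_kernel:
  assumes "continuous_on UNIV \<alpha>" "continuous_on UNIV \<beta>" "\<And>w. \<alpha> w \<noteq> 0 \<or> \<beta> w \<noteq> 0"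
    and c: "geo_coeffs c"
    and K: "\<And>t z w. t > 0 \<Longrightarrow> K t z w = mono_kernel \<nu> c t (\<alpha> w) (\<beta> w) z"
  shows "heat_regular K"
proof -
  interpret kernel_coeffs \<alpha> \<beta> "mono_eigenvalue \<nu>"
    by standard (use assms mono_eigenvalue_ge in auto)
  let ?b = "\<lambda>z w. bundle_factor \<nu> (\<alpha> w) (\<beta> w) z"
  have b: "\<F> (\<lambda>t z w. ?b z w)"
    unfolding bundle_factor_def
    by (intro kernel_fun.mult kernel_fun_power kernel_fun.add kernel_fun.var kernel_fun.inv_rho kernel_fun_coeffs)
  let ?Q = "\<lambda>l. smult (- mono_eigenvalue \<nu> l) (weighted_jacobi \<nu> c l)"
  show ?thesis
  proof (rule heat_regular_kernel_fun[OF _ _ _ K])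
    show "\<F> (\<lambda>t z w. mono_kernel \<nu> c t (\<alpha> w) (\<beta> w) z)"
      unfolding mono_kernel_def heat_profile_def
      by (intro kernel_fun.mult[OF b] kernel_fun.profile geo_polys_weighted_jacobi c)
    show "\<F> (\<lambda>t z w. ?b z w * of_real (heat_series (mono_eigenvalue \<nu>) ?Q t (overlap (\<alpha> w) (\<beta> w) z)))"
      by (intro kernel_fun.mult[OF b] kernel_fun.profile geo_polys_eigen geo_polys_weighted_jacobi c)
    fix t :: real and z w :: complex assume t: "t > 0"
    have "((\<lambda>s. heat_series (mono_eigenvalue \<nu>) (weighted_jacobi \<nu> c) s (overlap (\<alpha> w) (\<beta> w) z)) has_real_derivative
      heat_series (mono_eigenvalue \<nu>) ?Q t (overlap (\<alpha> w) (\<beta> w) z)) (at t)"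
      by (intro heat_series_t_derivative geo_polys_weighted_jacobi lam geo_polys_eigen c t overlap_abs_le)
    from has_vector_derivative_of_real[OF this, where ?'a = complex]
    show "((\<lambda>s. mono_kernel \<nu> c s (\<alpha> w) (\<beta> w) z) has_vector_derivative
       ?b z w * of_real (heat_series (mono_eigenvalue \<nu>) ?Q t (overlap (\<alpha> w) (\<beta> w) z))) (at t)"
      unfolding mono_kernel_def heat_profile_def by (rule has_vector_derivative_mult_right)
  qed
qed

section \<open>Change of charts\<close>

definition sphere_kernel :: "nat \<Rightarrow> real \<Rightarrow> complex \<Rightarrow> complex \<Rightarrow> complex" where
  "sphere_kernel \<nu> t z w = mono_kernel \<nu> (sphere_coeff \<nu>) t 1 (cnj w) z"

text \<open>Inversion exchanges the two homogeneous coordinates of \<open>z\<close>, which amounts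
  to exchanging \<open>\<alpha>\<close> and \<open>\<beta>\<close>; the transition factor absorbs
  the resulting phase.\<close>

lemma mono_kernel_chart_z:
  assumes "\<zeta> \<noteq> 0"
  shows "(\<zeta> / cnj \<zeta>) ^ \<nu> * mono_kernel \<nu> c t \<alpha> \<beta> (1 / \<zeta>) = mono_kernel \<nu> c t \<beta> \<alpha> \<zeta>"
proof -
  have N: "\<alpha> + \<beta> * (1 / \<zeta>) = (\<beta> + \<alpha> * \<zeta>) / \<zeta>" using assms by (simp add: field_simps)
  have r: "rho (1 / \<zeta>) = rho \<zeta> / (\<zeta> * cnj \<zeta>)" using assms by (simp add: rho_def field_simps)
  have s: "sig \<beta> \<alpha> = sig \<alpha> \<beta>" by (simp add: sig_def)
  have "complex_of_real (overlap \<alpha> \<beta> (1 / \<zeta>)) = of_real (overlap \<beta> \<alpha> \<zeta>)"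
  proof -
    have c: "cnj \<alpha> + cnj \<beta> * cnj (1 / \<zeta>) = (cnj \<beta> + cnj \<alpha> * cnj \<zeta>) / cnj \<zeta>" using assms by (simp add: field_simps)
    show ?thesis unfolding of_real_overlap N r s c using assms by (simp add: divide_simps)
  qed
  then have o: "overlap \<alpha> \<beta> (1 / \<zeta>) = overlap \<beta> \<alpha> \<zeta>" by (simp only: of_real_eq_iff)
  have "(\<zeta> / cnj \<zeta>) ^ \<nu> * (((\<beta> + \<alpha> * \<zeta>) / \<zeta>) ^ (2 * \<nu>) * (1 / (rho \<zeta> / (\<zeta> * cnj \<zeta>))) ^ \<nu>)
     = (\<zeta> / cnj \<zeta> * ((\<beta> + \<alpha> * \<zeta>) / \<zeta>)\<^sup>2 * (1 / (rho \<zeta> / (\<zeta> * cnj \<zeta>)))) ^ \<nu>"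
    by (simp only: power_mult_distrib power_mult mult.assoc)
  also have "\<zeta> / cnj \<zeta> * ((\<beta> + \<alpha> * \<zeta>) / \<zeta>)\<^sup>2 * (1 / (rho \<zeta> / (\<zeta> * cnj \<zeta>))) = (\<beta> + \<alpha> * \<zeta>)\<^sup>2 * (1 / rho \<zeta>)"
    using assms by (simp add: divide_simps power2_eq_square)
  finally have "(\<zeta> / cnj \<zeta>) ^ \<nu> * bundle_factor \<nu> \<alpha> \<beta> (1 / \<zeta>) = bundle_factor \<nu> \<beta> \<alpha> \<zeta>"
    unfolding bundle_factor_def N r s by (simp only: power_mult_distrib power_mult mult.assoc[symmetric])
  then show ?thesis unfolding mono_kernel_def o by (simp only: mult.assoc[symmetric])
qed

text \<open>A pair matters up to scaling only, except for a phase, and this phase is the transition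
  factor in the second variable.\<close>

lemma mono_kernel_scale:
  assumes "k \<noteq> 0"
  shows "mono_kernel \<nu> c t (k * \<alpha>) (k * \<beta>) z = (k / cnj k) ^ \<nu> * mono_kernel \<nu> c t \<alpha> \<beta> z"
proof -
  have N: "k * \<alpha> + k * \<beta> * z = k * (\<alpha> + \<beta> * z)" by (simp add: algebra_simps)
  have s: "sig (k * \<alpha>) (k * \<beta>) = k * cnj k * sig \<alpha> \<beta>" by (simp add: sig_def algebra_simps)
  have "complex_of_real (overlap (k * \<alpha>) (k * \<beta>) z) = of_real (overlap \<alpha> \<beta> z)"
  proof -
    have e: "cnj (k * \<alpha>) + cnj (k * \<beta>) * cnj z = cnj k * (cnj \<alpha> + cnj \<beta> * cnj z)" by (simp add: algebra_simps)
    show ?thesis unfolding of_real_overlap N s e using assms by (simp add: divide_simps)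
  qed
  then have o: "overlap (k * \<alpha>) (k * \<beta>) z = overlap \<alpha> \<beta> z" by (simp only: of_real_eq_iff)
  have "(k * (\<alpha> + \<beta> * z)) ^ (2 * \<nu>) * (1 / (k * cnj k * sig \<alpha> \<beta>)) ^ \<nu>
     = ((k * (\<alpha> + \<beta> * z))\<^sup>2 * (1 / (k * cnj k * sig \<alpha> \<beta>))) ^ \<nu>"
    by (simp only: power_mult_distrib power_mult)
  also have "(k * (\<alpha> + \<beta> * z))\<^sup>2 * (1 / (k * cnj k * sig \<alpha> \<beta>)) = (k / cnj k) * (\<alpha> + \<beta> * z)\<^sup>2 * (1 / sig \<alpha> \<beta>)"
    using assms by (simp add: power2_eq_square)
  finally have "(k * (\<alpha> + \<beta> * z)) ^ (2 * \<nu>) * (1 / (k * cnj k * sig \<alpha> \<beta>)) ^ \<nu>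
    = (k / cnj k) ^ \<nu> * ((\<alpha> + \<beta> * z) ^ (2 * \<nu>) * (1 / sig \<alpha> \<beta>) ^ \<nu>)"
    by (simp only: power_mult_distrib power_mult mult.assoc)
  then have "bundle_factor \<nu> (k * \<alpha>) (k * \<beta>) z = (k / cnj k) ^ \<nu> * bundle_factor \<nu> \<alpha> \<beta> z"
    unfolding bundle_factor_def N s by (simp only: ac_simps)
  then show ?thesis unfolding mono_kernel_def o by (simp only: mult.assoc)
qed

text \<open>Scaling \<open>(1, cnj (1 / \<eta>))\<close> by \<open>cnj \<eta>\<close> gives
  \<open>(cnj \<eta>, 1)\<close>, which still makes sense at \<open>\<eta> = 0\<close>.\<close>

lemma sphere_kernel_chart_w:
  assumes "\<eta> \<noteq> 0"
  shows "(cnj \<eta> / \<eta>) ^ \<nu> * sphere_kernel \<nu> t z (1 / \<eta>) = mono_kernel \<nu> (sphere_coeff \<nu>) t (cnj \<eta>) 1 z"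
  using mono_kernel_scale[of "cnj \<eta>" \<nu> "sphere_coeff \<nu>" t 1 "cnj (1 / \<eta>)" z] assms by (simp add: sphere_kernel_def)

text \<open>In the four products of charts the kernel has the pairs \<open>(1, cnj w)\<close>,
  \<open>(cnj w, 1)\<close>, \<open>(cnj w, 1)\<close> and \<open>(1, cnj w)\<close>, all continuous
  and never zero.\<close>

lemma regular_section_kernel_sphere_kernel:
  assumes E: "\<And>t z w. t > 0 \<Longrightarrow> E t z w = sphere_kernel \<nu> t z w"
  shows "regular_section_kernel \<nu> E"
  unfolding regular_section_kernel_def
proof (intro conjI)
  have c: "continuous_on UNIV cnj" by (intro continuous_intros)
  show "heat_regular E"
    by (rule heat_regular_mono_kernel[of "\<lambda>_. 1" cnj]) (auto simp: E sphere_kernel_def c intro: geo_coeffs_sphere)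
  have 2: "heat_regular (\<lambda>t \<zeta> w. mono_kernel \<nu> (sphere_coeff \<nu>) t (cnj w) 1 \<zeta>)"
    by (rule heat_regular_mono_kernel[of cnj "\<lambda>_. 1"]) (auto simp: c intro: geo_coeffs_sphere)
  then show "\<exists>K. heat_regular K \<and> (\<forall>t>0. \<forall>\<zeta> w. \<zeta> \<noteq> 0 \<longrightarrow>
        K t \<zeta> w = (\<zeta> / cnj \<zeta>) ^ \<nu> * E t (1 / \<zeta>) w)"
    by (intro exI[of _ "\<lambda>t \<zeta> w. mono_kernel \<nu> (sphere_coeff \<nu>) t (cnj w) 1 \<zeta>"]) (auto simp: E sphere_kernel_def mono_kernel_chart_z)
  show "\<exists>K. heat_regular K \<and> (\<forall>t>0. \<forall>z \<eta>. \<eta> \<noteq> 0 \<longrightarrow>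
        K t z \<eta> = (cnj \<eta> / \<eta>) ^ \<nu> * E t z (1 / \<eta>))"
    using 2 by (intro exI[of _ "\<lambda>t \<zeta> w. mono_kernel \<nu> (sphere_coeff \<nu>) t (cnj w) 1 \<zeta>"]) (auto simp: E sphere_kernel_chart_w)
  have 4: "heat_regular (\<lambda>t \<zeta> w. mono_kernel \<nu> (sphere_coeff \<nu>) t 1 (cnj w) \<zeta>)"
    by (rule heat_regular_mono_kernel[of "\<lambda>_. 1" cnj]) (auto simp: c intro: geo_coeffs_sphere)
  have "mono_kernel \<nu> (sphere_coeff \<nu>) t 1 (cnj \<eta>) \<zeta> = (\<zeta> / cnj \<zeta>) ^ \<nu> * (cnj \<eta> / \<eta>) ^ \<nu> * E t (1 / \<zeta>) (1 / \<eta>)"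
    if "t > 0" "\<zeta> \<noteq> 0" "\<eta> \<noteq> 0" for t \<zeta> \<eta>
    using that by (simp add: mult.assoc E sphere_kernel_chart_w mono_kernel_chart_z)
  with 4 show "\<exists>K. heat_regular K \<and> (\<forall>t>0. \<forall>\<zeta> \<eta>. \<zeta> \<noteq> 0 \<longrightarrow> \<eta> \<noteq> 0 \<longrightarrow>
        K t \<zeta> \<eta> = (\<zeta> / cnj \<zeta>) ^ \<nu> * (cnj \<eta> / \<eta>) ^ \<nu> * E t (1 / \<zeta>) (1 / \<eta>))"
    by blast
qed

section \<open>Maximum principle\<close>

text \<open>A positive second derivative would make \<open>g'\<close> positive just to the right of
  the critical point, and the mean value theorem would push \<open>g\<close> above its
  maximum.\<close>

lemma second_derivative_local_max:
  fixes g :: "real \<Rightarrow> real"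
  assumes g: "\<And>s. (g has_real_derivative g' s) (at s)" and g': "(g' has_real_derivative g2) (at 0)"
    and "d > 0" and max: "\<And>s. \<bar>s\<bar> < d \<Longrightarrow> g s \<le> g 0"
  shows "g2 \<le> 0"
proof (rule ccontr)
  assume "\<not> g2 \<le> 0"
  then have "g2 > 0" by simp
  have "g' 0 = 0"
    by (rule DERIV_local_max[OF g \<open>d > 0\<close>]) (use max in auto)
  obtain e where e: "e > 0" "\<And>h. 0 < h \<Longrightarrow> h < e \<Longrightarrow> g' 0 < g' (0 + h)"
    using DERIV_pos_inc_right[OF g' \<open>g2 > 0\<close>] by auto
  define h where "h = min d e / 2"
  have h: "0 < h" "h < d" "h < e" using \<open>d > 0\<close> e(1) by (auto simp: h_def min_def)
  obtain x where x: "0 < x" "x < h" "g h - g 0 = (h - 0) * g' x"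
    using MVT2[OF h(1), of g g'] g by blast
  have "g' x > 0" using e(2)[of x] x h \<open>g' 0 = 0\<close> by auto
  then have "g h > g 0" using x h by (smt (verit) mult_pos_pos)
  then show False using max[of h] h by auto
qed

text \<open>One-sided, since the maximum in time may sit at the final time.\<close>

lemma left_max_derivative_nonneg:
  fixes g :: "real \<Rightarrow> real"
  assumes "(g has_real_derivative g') (at t)" "d > 0" "\<And>s. t - d < s \<Longrightarrow> s \<le> t \<Longrightarrow> g s \<le> g t"
  shows "g' \<ge> 0"
proof (rule ccontr)
  assume "\<not> g' \<ge> 0"
  then obtain e where e: "e > 0" "\<And>h. 0 < h \<Longrightarrow> h < e \<Longrightarrow> g t < g (t - h)"
    using DERIV_neg_dec_left[OF assms(1)] by auto
  have "g t < g (t - min d e / 2)" using e assms(2) by (intro e(2)) (auto simp: min_def)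
  moreover have "g (t - min d e / 2) \<le> g t" using e assms(2) by (intro assms(3)) (auto simp: min_def)
  ultimately show False by simp
qed

lemma has_real_derivative_norm_squared:
  fixes f :: "real \<Rightarrow> complex"
  assumes "(f has_vector_derivative f') (at s)"
  shows "((\<lambda>s. (norm (f s))\<^sup>2) has_real_derivative 2 * (f s \<bullet> f')) (at s)"
  using bounded_bilinear.has_vector_derivative[OF bounded_bilinear_inner assms assms]
  by (simp add: has_real_derivative_iff_has_vector_derivative dot_square_norm inner_commute)

text \<open>Derivatives are parameters along the coordinate lines instead of values of
  \<open>dir_deriv\<close>, so that kernels and differences involving integrals of kernels both fit.
  \<open>pde\<close> is the magnetic heat equation in real coordinates; the bound \<open>C\<close>
  controls infinity, and \<open>M\<close> is the limiting bound at time 0.\<close>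

locale bounded_heat_solution =
  fixes v vt v1 vi v11 vii :: "real \<Rightarrow> complex \<Rightarrow> complex" and \<nu> :: nat and T M C :: real
  assumes cont: "continuous_on ({0<..T} \<times> UNIV) (\<lambda>(t, z). v t z)"
    and bdd: "\<And>t z. 0 < t \<Longrightarrow> t \<le> T \<Longrightarrow> norm (v t z) \<le> C"
    and init: "\<And>e. e > 0 \<Longrightarrow> \<exists>\<delta>>0. \<forall>t z. 0 < t \<longrightarrow> t < \<delta> \<longrightarrow> norm (v t z) \<le> M + e"
    and M: "M \<ge> 0"
    and dt: "\<And>t z. 0 < t \<Longrightarrow> t \<le> T \<Longrightarrow> ((\<lambda>s. v s z) has_vector_derivative vt t z) (at t)"
    and d1: "\<And>t z s. 0 < t \<Longrightarrow> t \<le> T \<Longrightarrow> ((\<lambda>s. v t (z + of_real s)) has_vector_derivative v1 t (z + of_real s)) (at s)"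
    and di: "\<And>t z s. 0 < t \<Longrightarrow> t \<le> T \<Longrightarrow> ((\<lambda>s. v t (z + of_real s * \<i>)) has_vector_derivative vi t (z + of_real s * \<i>)) (at s)"
    and d11: "\<And>t z. 0 < t \<Longrightarrow> t \<le> T \<Longrightarrow> ((\<lambda>s. v1 t (z + of_real s)) has_vector_derivative v11 t z) (at 0)"
    and dii: "\<And>t z. 0 < t \<Longrightarrow> t \<le> T \<Longrightarrow> ((\<lambda>s. vi t (z + of_real s * \<i>)) has_vector_derivative vii t z) (at 0)"
    and pde: "\<And>t z. 0 < t \<Longrightarrow> t \<le> T \<Longrightarrow> vt t z = of_real ((1 + (norm z)\<^sup>2)\<^sup>2 / 4) * (v11 t z + vii t z)
        + of_nat \<nu> * of_real (1 + (norm z)\<^sup>2) * \<i> * (of_real (Im z) * v1 t z - of_real (Re z) * vi t z)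
        - of_real ((real \<nu>)\<^sup>2 * (norm z)\<^sup>2) * v t z"
begin

text \<open>The bracket on the right is half the flat Laplacian of the squared norm of
  \<open>v\<close>. The magnetic terms enter with a favourable sign: the difference of the two sides
  is the squared length of a covariant gradient.\<close>

lemma diamagnetic:
  assumes "0 < t" "t \<le> T"
  shows "v t z \<bullet> vt t z \<le> (1 + (norm z)\<^sup>2)\<^sup>2 / 4 *
     (v t z \<bullet> (v11 t z + vii t z) + (norm (v1 t z))\<^sup>2 + (norm (vi t z))\<^sup>2)"
proof -
  define r where "r = 1 + (norm z)\<^sup>2"
  define n where "n = real \<nu>"
  define x y where "x = Re z" and "y = Im z"
  have z2: "(norm z)\<^sup>2 = x\<^sup>2 + y\<^sup>2" unfolding x_def y_def by (rule cmod_power2)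
  define a b where "a = Re (v t z)" and "b = Im (v t z)"
  define c d where "c = Re (v1 t z)" and "d = Im (v1 t z)"
  define e f where "e = Re (vi t z)" and "f = Im (vi t z)"
  define p q where "p = Re (v11 t z + vii t z)" and "q = Im (v11 t z + vii t z)"
  have "vt t z = of_real (r\<^sup>2 / 4) * Complex p q + of_real (n * r) * \<i> * (of_real y * Complex c d - of_real x * Complex e f)
      - of_real (n\<^sup>2 * (x\<^sup>2 + y\<^sup>2)) * Complex a b"
  proof -
    have c: "v11 t z + vii t z = Complex p q" "v1 t z = Complex c d" "vi t z = Complex e f" "v t z = Complex a b"
      by (simp_all add: complex_eq_iff p_def q_def c_def d_def e_def f_def a_def b_def)
    show ?thesis using pde[OF assms, of z] unfolding c z2[symmetric] r_def n_def x_def[symmetric] y_def[symmetric] by simp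
  qed
  moreover have "Re (of_real A * Complex p q + of_real B * \<i> * (of_real y * Complex c d - of_real x * Complex e f) - of_real D * Complex a b)
       = A * p - B * (y * d - x * f) - D * a"
     "Im (of_real A * Complex p q + of_real B * \<i> * (of_real y * Complex c d - of_real x * Complex e f) - of_real D * Complex a b)
       = A * q + B * (y * c - x * e) - D * b" for A B D
    by (simp_all add: algebra_simps)
  ultimately have vt: "Re (vt t z) = r\<^sup>2 / 4 * p - n * r * (y * d - x * f) - n\<^sup>2 * (x\<^sup>2 + y\<^sup>2) * a"
     "Im (vt t z) = r\<^sup>2 / 4 * q + n * r * (y * c - x * e) - n\<^sup>2 * (x\<^sup>2 + y\<^sup>2) * b"
    by metis+
  \<comment> \<open>The four squares are the real and imaginary parts of
    \<open>r / 2 * v1 + \<i> * n * y * v\<close> and \<open>r / 2 * vi - \<i> * n * x * v\<close>,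
    the scaled covariant derivatives.\<close>
  have "r\<^sup>2 / 4 * (a * p + b * q + (c\<^sup>2 + d\<^sup>2) + (e\<^sup>2 + f\<^sup>2)) - (a * Re (vt t z) + b * Im (vt t z))
    = (r / 2 * c - n * y * b)\<^sup>2 + (r / 2 * d + n * y * a)\<^sup>2 + (r / 2 * e + n * x * b)\<^sup>2 + (r / 2 * f - n * x * a)\<^sup>2"
    unfolding vt by (simp add: power2_eq_square algebra_simps)
  then have "a * Re (vt t z) + b * Im (vt t z) \<le> r\<^sup>2 / 4 * (a * p + b * q + (c\<^sup>2 + d\<^sup>2) + (e\<^sup>2 + f\<^sup>2))"
    by (smt (verit) zero_le_power2)
  then show ?thesis
    by (fold r_def) (simp only: inner_complex_def cmod_power2, simp only: a_def b_def c_def d_def e_def f_def p_def q_def)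
qed

text \<open>The second derivative test on a line; the last bracket is the second derivative of
  \<open>ln (1 + (norm x)\<^sup>2)\<close> in the unit direction \<open>e\<close>.\<close>

lemma direction_second_derivative:
  assumes t: "0 < t" "t \<le> T" and e: "norm e = 1"
    and f: "\<And>s. ((\<lambda>s. v t (z + of_real s * e)) has_vector_derivative v' (z + of_real s * e)) (at s)"
    and f2: "((\<lambda>s. v' (z + of_real s * e)) has_vector_derivative v'') (at 0)"
    and d: "d > 0" and max: "\<And>x. norm (x - z) < d \<Longrightarrow> (norm (v t x))\<^sup>2 - \<epsilon> * ln (1 + (norm x)\<^sup>2) \<le> (norm (v t z))\<^sup>2 - \<epsilon> * ln (1 + (norm z)\<^sup>2)"
  shows "2 * ((norm (v' z))\<^sup>2 + v t z \<bullet> v'') - \<epsilon> * (2 / (1 + (norm z)\<^sup>2) - 4 * (z \<bullet> e)\<^sup>2 / (1 + (norm z)\<^sup>2)\<^sup>2) \<le> 0"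
proof -
  define L where "L = (\<lambda>s. z + of_real s * e)"
  have L: "(L has_vector_derivative e) (at s)" for s
  proof -
    have "((\<lambda>s. z + of_real s * e) has_vector_derivative 0 + of_real 1 * e) (at s)"
      by (intro has_vector_derivative_add has_vector_derivative_const has_vector_derivative_mult_left has_vector_derivative_of_real DERIV_ident)
    then show ?thesis by (simp add: L_def)
  qed
  have Lp: "1 + (norm (L s))\<^sup>2 > 0" for s by (rule one_plus_norm_pos)
  have L0: "L 0 = z" by (simp add: L_def)
  define g' where "g' = (\<lambda>s. 2 * (v t (L s) \<bullet> v' (L s)) - \<epsilon> * (2 * (L s \<bullet> e) / (1 + (norm (L s))\<^sup>2)))"
  have nd: "((\<lambda>s. 1 + (norm (L s))\<^sup>2) has_real_derivative 2 * (L s \<bullet> e)) (at s)" for s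
    using DERIV_add[OF DERIV_const has_real_derivative_norm_squared[OF L], of 1] by simp
  have lnd: "((\<lambda>s. ln (1 + (norm (L s))\<^sup>2)) has_real_derivative 2 * (L s \<bullet> e) / (1 + (norm (L s))\<^sup>2)) (at s)" for s
    using DERIV_chain2[OF DERIV_ln_divide[OF Lp] nd] by simp
  show ?thesis
  proof (rule second_derivative_local_max[of "\<lambda>s. (norm (v t (L s)))\<^sup>2 - \<epsilon> * ln (1 + (norm (L s))\<^sup>2)" g' _ d])
    show "((\<lambda>s. (norm (v t (L s)))\<^sup>2 - \<epsilon> * ln (1 + (norm (L s))\<^sup>2)) has_real_derivative g' s) (at s)" for s
      unfolding g'_def
      by (intro DERIV_diff DERIV_cmult lnd has_real_derivative_norm_squared) (use f in \<open>simp add: L_def\<close>)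
    have "((\<lambda>s. v t (L s) \<bullet> v' (L s)) has_vector_derivative (v t (L 0) \<bullet> v'' + v' (L 0) \<bullet> v' (L 0))) (at 0)"
      by (rule bounded_bilinear.has_vector_derivative[OF bounded_bilinear_inner]) (use f[of 0] f2 in \<open>auto simp: L_def\<close>)
    then have 1: "((\<lambda>s. v t (L s) \<bullet> v' (L s)) has_real_derivative (v t z \<bullet> v'' + (norm (v' z))\<^sup>2)) (at 0)"
      by (simp add: has_real_derivative_iff_has_vector_derivative L0 dot_square_norm)
    have "((\<lambda>s. L s \<bullet> e) has_vector_derivative (L 0 \<bullet> 0 + e \<bullet> e)) (at 0)"
      by (rule bounded_bilinear.has_vector_derivative[OF bounded_bilinear_inner]) (use L in auto)
    then have 2: "((\<lambda>s. L s \<bullet> e) has_real_derivative 1) (at 0)"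
      by (simp add: has_real_derivative_iff_has_vector_derivative dot_square_norm e)
    have 3: "((\<lambda>s. 2 * (L s \<bullet> e) / (1 + (norm (L s))\<^sup>2)) has_real_derivative
       (2 / (1 + (norm z)\<^sup>2) - 4 * (z \<bullet> e)\<^sup>2 / (1 + (norm z)\<^sup>2)\<^sup>2)) (at 0)"
    proof -
      have *: "(2 * 1 * r - k * (2 * a)) / (r * r) = 2 / r - 4 * a\<^sup>2 / r\<^sup>2" if "r > 0" "k = 2 * a" for a k r :: real
        using that by (simp add: field_simps power2_eq_square)
      show ?thesis
        using DERIV_divide[OF DERIV_cmult[OF 2, of 2] nd[of 0]] one_plus_norm_pos[of z]
        unfolding L0 *[OF one_plus_norm_pos refl] by simp
    qed
    show "(g' has_real_derivative 2 * ((norm (v' z))\<^sup>2 + v t z \<bullet> v'') - \<epsilon> * (2 / (1 + (norm z)\<^sup>2) - 4 * (z \<bullet> e)\<^sup>2 / (1 + (norm z)\<^sup>2)\<^sup>2)) (at 0)"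
      unfolding g'_def using DERIV_diff[OF DERIV_cmult[OF 1, of 2] DERIV_cmult[OF 3, of \<epsilon>]] by (simp add: add.commute)
    show "(norm (v t (L s)))\<^sup>2 - \<epsilon> * ln (1 + (norm (L s))\<^sup>2) \<le> (norm (v t (L 0)))\<^sup>2 - \<epsilon> * ln (1 + (norm (L 0))\<^sup>2)" if "\<bar>s\<bar> < d" for s
      unfolding L0 by (rule max) (use that e in \<open>simp add: L_def norm_mult\<close>)
  qed fact
qed

text \<open>A violation is tested at a maximum of the squared norm minus
  \<open>\<epsilon> * (ln (1 + (norm x)\<^sup>2) + 2 * s)\<close>. The logarithm confines the
  maximum to a disc and its sphere Laplacian is 1, so that the space derivatives force
  \<open>v \<bullet> vt\<close> to be at most \<open>\<epsilon> / 2\<close>; the slope 2 in time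
  forces it to be at least \<open>\<epsilon>\<close>.\<close>

theorem max_principle:
  assumes "0 < t" "t \<le> T"
  shows "norm (v t z) \<le> M"
proof (rule ccontr)
  assume "\<not> norm (v t z) \<le> M"
  then have gt: "(norm (v t z))\<^sup>2 > M\<^sup>2" using M by (simp add: power_strict_mono)
  define \<kappa> where "\<kappa> = (norm (v t z))\<^sup>2 - M\<^sup>2"
  have \<kappa>: "\<kappa> > 0" using gt by (simp add: \<kappa>_def)
  define p where "p = ln (1 + (norm z)\<^sup>2) + 2 * t"
  have p: "p > 0" using assms one_plus_norm_pos[of z] by (simp add: p_def add_nonneg_pos)
  \<comment> \<open>The barrier then costs only a quarter of the excess \<open>\<kappa>\<close> at
    the violating point.\<close>
  define \<epsilon> where "\<epsilon> = \<kappa> / (4 * p)"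
  have \<epsilon>: "\<epsilon> > 0" using \<kappa> p by (simp add: \<epsilon>_def)
  define F where "F = (\<lambda>(s, x). (norm (v s x))\<^sup>2 - \<epsilon> * (ln (1 + (norm x)\<^sup>2) + 2 * s))"
  have "\<epsilon> * p < \<kappa> / 2" using \<kappa> p by (simp add: \<epsilon>_def)
  moreover have "F (t, z) = M\<^sup>2 + \<kappa> - \<epsilon> * p" by (simp add: F_def \<kappa>_def p_def)
  ultimately have Ftz: "F (t, z) > M\<^sup>2 + \<kappa> / 2" by linarith
  have "eventually (\<lambda>e. (M + e)\<^sup>2 < M\<^sup>2 + \<kappa> / 4) (at_right 0)"
  proof (rule order_tendstoD)
    have "((\<lambda>e. (M + e)\<^sup>2) \<longlongrightarrow> (M + 0)\<^sup>2) (at_right 0)" by (intro tendsto_intros)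
    then show "((\<lambda>e. (M + e)\<^sup>2) \<longlongrightarrow> M\<^sup>2) (at_right 0)" by simp
  qed (use \<kappa> in auto)
  then have "eventually (\<lambda>e. (M + e)\<^sup>2 < M\<^sup>2 + \<kappa> / 4 \<and> e > 0) (at_right 0)"
    using eventually_at_right_less[of 0] by (rule eventually_conj)
  then obtain e where e: "e > 0" "(M + e)\<^sup>2 < M\<^sup>2 + \<kappa> / 4"
    using eventually_happens trivial_limit_at_right_real by blast
  obtain \<delta> where \<delta>: "\<delta> > 0" "\<And>s x. 0 < s \<Longrightarrow> s < \<delta> \<Longrightarrow> norm (v s x) \<le> M + e"
    using init[OF e(1)] by blast
  \<comment> \<open>At this early time the function \<open>F\<close> is still below
    \<open>M\<^sup>2 + \<kappa> / 4\<close>, so the maximum cannot lie on the initial face.\<close>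
  define \<delta>' where "\<delta>' = min (\<delta> / 2) t"
  have \<delta>': "\<delta>' > 0" "\<delta>' < \<delta>" "\<delta>' \<le> t" using \<delta>(1) assms by (auto simp: \<delta>'_def)
  \<comment> \<open>On the circle of radius \<open>R\<close> the barrier exceeds the global bound
    \<open>C\<^sup>2\<close>, which keeps the maximum off the lateral boundary.\<close>
  have "filterlim (\<lambda>R::real. \<epsilon> * ln (1 + R\<^sup>2)) at_top at_top"
    using \<epsilon>
    by (intro filterlim_tendsto_pos_mult_at_top[OF tendsto_const] filterlim_compose[OF ln_at_top]
        filterlim_tendsto_add_at_top[OF tendsto_const] filterlim_pow_at_top filterlim_ident) auto
  then have "eventually (\<lambda>R. \<epsilon> * ln (1 + R\<^sup>2) > C\<^sup>2 \<and> R > norm z) at_top"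
    using eventually_gt_at_top[of "norm z"] by (auto simp: filterlim_at_top_dense intro: eventually_conj)
  then obtain R where R: "\<epsilon> * ln (1 + R\<^sup>2) > C\<^sup>2" "R > norm z"
    using eventually_happens trivial_limit_at_top_linorder by blast
  define K where "K = {\<delta>'..T} \<times> cball (0::complex) R"
  have "compact K" unfolding K_def by (intro compact_Times compact_Icc compact_cball)
  moreover have tzK: "(t, z) \<in> K" using \<delta>' assms R by (simp add: K_def)
  moreover have "continuous_on K F"
  proof -
    have "continuous_on K (\<lambda>(s, x). v s x)"
      by (rule continuous_on_subset[OF cont]) (use \<delta>' in \<open>auto simp: K_def\<close>)
    then show ?thesis unfolding F_def case_prod_unfold
      by (intro continuous_intros) (use one_plus_norm_pos in \<open>auto simp: less_imp_neq[symmetric]\<close>)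
  qed
  ultimately obtain q where q: "q \<in> K" "\<And>y. y \<in> K \<Longrightarrow> F y \<le> F q"
    using continuous_attains_sup[of K F] by blast
  obtain t0 z0 where q_def: "q = (t0, z0)" by (cases q)
  have Fq: "F (t0, z0) > M\<^sup>2 + \<kappa> / 2" using q(2)[OF tzK] Ftz by (simp add: q_def)
  have t0: "\<delta>' \<le> t0" "t0 \<le> T" "0 < t0" and z0: "norm z0 \<le> R" using q(1) \<delta>' by (auto simp: q_def K_def)
  have ln0: "ln (1 + (norm x)\<^sup>2) \<ge> 0" for x :: complex by simp
  have Fle: "F (s, x) \<le> (norm (v s x))\<^sup>2" if "s > 0" for s x
    using \<epsilon> that ln0[of x] by (simp add: F_def)
  have "t0 \<noteq> \<delta>'"
  proof
    assume "t0 = \<delta>'"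
    then have "norm (v t0 z0) \<le> M + e" using \<delta>(2)[of t0 z0] \<delta>' by simp
    then have "(norm (v t0 z0))\<^sup>2 \<le> (M + e)\<^sup>2" by (intro power_mono) auto
    then show False using e Fq Fle[OF t0(3), of z0] \<kappa> by linarith
  qed
  then have t0': "\<delta>' < t0" using t0 by simp
  have "norm z0 \<noteq> R"
  proof
    assume "norm z0 = R"
    moreover have "(norm (v t0 z0))\<^sup>2 \<le> C\<^sup>2" using bdd[OF t0(3,2)] by (intro power_mono) auto
    ultimately have "F (t0, z0) < - \<epsilon> * (2 * t0)" using R(1) by (simp add: F_def algebra_simps)
    also have "\<dots> < 0" using \<epsilon> t0 by simp
    finally show False using Fq \<kappa> zero_le_power2[of M] by linarith
  qed
  then have z0': "norm z0 < R" using z0 by simp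
  have time: "v t0 z0 \<bullet> vt t0 z0 \<ge> \<epsilon>"
  proof -
    have "2 * (v t0 z0 \<bullet> vt t0 z0) - \<epsilon> * (0 + 2 * 1) \<ge> 0"
    proof (rule left_max_derivative_nonneg[of "\<lambda>s. F (s, z0)" _ t0 "t0 - \<delta>'"])
      show "((\<lambda>s. F (s, z0)) has_real_derivative 2 * (v t0 z0 \<bullet> vt t0 z0) - \<epsilon> * (0 + 2 * 1)) (at t0)"
        unfolding F_def prod.case
        by (intro DERIV_diff DERIV_cmult DERIV_add DERIV_const DERIV_ident has_real_derivative_norm_squared dt t0)
      show "F (s, z0) \<le> F (t0, z0)" if "t0 - (t0 - \<delta>') < s" "s \<le> t0" for s
        using q(2)[of "(s, z0)"] that t0 z0 by (simp add: q_def K_def)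
    qed (use t0' in simp)
    then show ?thesis by simp
  qed
  have max: "(norm (v t0 x))\<^sup>2 - \<epsilon> * ln (1 + (norm x)\<^sup>2) \<le> (norm (v t0 z0))\<^sup>2 - \<epsilon> * ln (1 + (norm z0)\<^sup>2)"
    if "norm (x - z0) < R - norm z0" for x
  proof -
    have "norm x \<le> R" using that norm_triangle_sub[of x z0] by linarith
    then have "F (t0, x) \<le> F (t0, z0)" using q(2)[of "(t0, x)"] t0 by (simp add: q_def K_def)
    then show ?thesis by (simp add: F_def algebra_simps)
  qed
  define r where "r = 1 + (norm z0)\<^sup>2"
  have r: "r > 0" unfolding r_def by (rule one_plus_norm_pos)
  have A: "2 * ((norm (v1 t0 z0))\<^sup>2 + v t0 z0 \<bullet> v11 t0 z0) - \<epsilon> * (2 / r - 4 * (z0 \<bullet> 1)\<^sup>2 / r\<^sup>2) \<le> 0"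
    unfolding r_def
    by (rule direction_second_derivative[OF t0(3,2) _ _ _ _ max]) (use z0' d1[OF t0(3,2)] d11[OF t0(3,2)] in auto)
  have B: "2 * ((norm (vi t0 z0))\<^sup>2 + v t0 z0 \<bullet> vii t0 z0) - \<epsilon> * (2 / r - 4 * (z0 \<bullet> \<i>)\<^sup>2 / r\<^sup>2) \<le> 0"
    unfolding r_def
    by (rule direction_second_derivative[OF t0(3,2) _ _ _ _ max]) (use z0' di[OF t0(3,2)] dii[OF t0(3,2)] in auto)
  define S where "S = v t0 z0 \<bullet> (v11 t0 z0 + vii t0 z0) + (norm (v1 t0 z0))\<^sup>2 + (norm (vi t0 z0))\<^sup>2"
  \<comment> \<open>Adding the two directions gives the flat Laplacian of the logarithm, namely
    \<open>4 / r\<^sup>2\<close>.\<close>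
  have "(z0 \<bullet> 1)\<^sup>2 + (z0 \<bullet> \<i>)\<^sup>2 = r - 1"
    by (simp add: inner_complex_def r_def cmod_power2)
  moreover have "(2 / r - 4 * a / r\<^sup>2) + (2 / r - 4 * b / r\<^sup>2) = 4 / r - 4 * (a + b) / r\<^sup>2" for a b
    by (simp add: add_divide_distrib algebra_simps)
  ultimately have "(2 / r - 4 * (z0 \<bullet> 1)\<^sup>2 / r\<^sup>2) + (2 / r - 4 * (z0 \<bullet> \<i>)\<^sup>2 / r\<^sup>2) = 4 / r - 4 * (r - 1) / r\<^sup>2"
    by metis
  also have "\<dots> = 4 / r\<^sup>2" using r by (simp add: field_simps power2_eq_square)
  finally have "\<epsilon> * (2 / r - 4 * (z0 \<bullet> 1)\<^sup>2 / r\<^sup>2) + \<epsilon> * (2 / r - 4 * (z0 \<bullet> \<i>)\<^sup>2 / r\<^sup>2) = \<epsilon> * (4 / r\<^sup>2)"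
    by (metis distrib_left)
  moreover have "2 * (b + d + a + c) \<le> E" if "2 * (a + b) - E1 \<le> 0" "2 * (c + d) - E2 \<le> 0" "E1 + E2 = E" for a b c d E1 E2 E :: real
    using that by (simp add: algebra_simps)
  ultimately have "2 * S \<le> \<epsilon> * (4 / r\<^sup>2)" using A B unfolding S_def inner_add_right by metis
  then have "r\<^sup>2 / 8 * (2 * S) \<le> r\<^sup>2 / 8 * (\<epsilon> * (4 / r\<^sup>2))" using r by (intro mult_left_mono) auto
  then have "r\<^sup>2 / 4 * S \<le> \<epsilon> / 2" using r by simp
  then have "v t0 z0 \<bullet> vt t0 z0 \<le> \<epsilon> / 2"
    using diamagnetic[OF t0(3,2), of z0] unfolding S_def r_def by linarith
  then show False using time \<epsilon> by linarith
qed

end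

section \<open>The measure of the sphere\<close>

lemma lborel_complex_eq: "(lborel :: complex measure) = distr (lborel :: (real \<times> real) measure) borel (\<lambda>(x, y). Complex x y)"
proof (rule lborel_eqI)
  have "(\<lambda>(x, y). Complex x y) \<in> borel_measurable (borel :: (real \<times> real) measure)"
    by (intro borel_measurable_continuous_onI) (auto simp: case_prod_unfold intro!: continuous_intros)
  then have m: "(\<lambda>(x, y). Complex x y) \<in> borel_measurable (lborel :: (real \<times> real) measure)" by simp
  fix l u :: complex assume lu: "\<And>b. b \<in> Basis \<Longrightarrow> l \<bullet> b \<le> u \<bullet> b"
  have le: "Re l \<le> Re u" "Im l \<le> Im u" using lu[of 1] lu[of \<i>] by (auto simp: Basis_complex_def)
  have "(\<lambda>(x, y). Complex x y) -` box l u \<inter> space lborel = box (Re l, Im l) (Re u, Im u)"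
    by (auto simp: box_def Basis_complex_def Basis_prod_def inner_complex_def)
  then have "emeasure (distr lborel borel (\<lambda>(x, y). Complex x y)) (box l u) = emeasure lborel (box (Re l, Im l) (Re u, Im u))"
    using m by (simp add: emeasure_distr)
  also have "\<dots> = (\<Prod>b\<in>Basis. ((Re u, Im u) - (Re l, Im l)) \<bullet> b)"
    using le by (intro emeasure_lborel_box) (auto simp: Basis_prod_def)
  also have "(\<Prod>b\<in>Basis. ((Re u, Im u) - (Re l, Im l)) \<bullet> b) = (\<Prod>b\<in>Basis. (u - l) \<bullet> b)"
    by (simp add: Basis_prod_def Basis_complex_def prod.union_disjoint inner_complex_def)
  finally show "emeasure (distr lborel borel (\<lambda>(x, y). Complex x y)) (box l u) = (\<Prod>b\<in>Basis. (u - l) \<bullet> b)" .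
qed simp

text \<open>The sides of a square are coordinate lines, so the divergence theorem reduces to
  iterated integration and the fundamental theorem of calculus.\<close>

definition square :: "real \<Rightarrow> complex set" where
  "square R = {w. \<bar>Re w\<bar> \<le> R \<and> \<bar>Im w\<bar> \<le> R}"

lemma square_sets [measurable]: "square R \<in> sets borel"
proof -
  have "closed (square R)" unfolding square_def by (intro closed_Collect_conj closed_Collect_le continuous_intros)
  then show ?thesis by simp
qed

lemma compact_square: "compact (square R)"
proof -
  have "square R = cbox (Complex (-R) (-R)) (Complex R R)"
    by (auto simp: square_def cbox_def Basis_complex_def inner_complex_def)
  then show ?thesis by simp
qed

lemma integral_square_iterated:
  fixes f :: "complex \<Rightarrow> real"
  assumes f: "continuous_on UNIV f"
  shows "(LINT w|lborel. indicator (square R) w * f w)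
     = integral {-R..R} (\<lambda>x. integral {-R..R} (\<lambda>y. f (Complex x y)))"
proof -
  let ?T = "\<lambda>(x, y). Complex x y"
  have "?T \<in> borel_measurable (borel :: (real \<times> real) measure)"
    by (intro borel_measurable_continuous_onI) (auto simp: case_prod_unfold intro!: continuous_intros)
  then have m: "?T \<in> borel_measurable (lborel :: (real \<times> real) measure)" by simp
  have mf: "f \<in> borel_measurable borel" using f by (rule borel_measurable_continuous_onI)
  have c: "continuous_on S (\<lambda>p. f (?T p))" for S
    by (rule continuous_on_compose2[OF f]) (auto simp: case_prod_unfold intro!: continuous_intros)
  have "(LINT w|lborel. indicator (square R) w * f w) = (LINT p|lborel. indicator (square R) (?T p) * f (?T p))"
    unfolding lborel_complex_eq by (rule integral_distr[OF m]) (use mf in measurable)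
  also have "\<dots> = (LINT p:cbox (-R, -R) (R, R)|lborel. f (?T p))"
  proof -
    have "indicator (square R) (?T p) = (indicator (cbox (-R, -R) (R, R)) p :: real)" for p
      by (cases p) (auto simp: square_def indicator_def cbox_Pair_eq)
    then show ?thesis by (simp add: set_lebesgue_integral_def)
  qed
  also have "\<dots> = integral (cbox (-R, -R) (R, R)) (\<lambda>p. f (?T p))"
    by (rule set_borel_integral_eq_integral)
      (use borel_integrable_compact[OF compact_cbox c] in \<open>simp add: set_integrable_def\<close>)
  also have "\<dots> = integral (cbox (-R) R) (\<lambda>x. integral (cbox (-R) R) (\<lambda>y. f (?T (x, y))))"
    by (rule integral_prod_continuous[OF c])
  finally show ?thesis by simp
qed

lemma divergence_square:
  fixes P Q p q :: "complex \<Rightarrow> real"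
  assumes P: "\<And>x y. ((\<lambda>s. P (Complex s y)) has_real_derivative p (Complex x y)) (at x)"
    and Q: "\<And>x y. ((\<lambda>s. Q (Complex x s)) has_real_derivative q (Complex x y)) (at y)"
    and p: "continuous_on UNIV p" and q: "continuous_on UNIV q" and R: "R \<ge> 0"
  shows "(LINT w|lborel. indicator (square R) w * (p w + q w))
    = integral {-R..R} (\<lambda>y. P (Complex R y) - P (Complex (-R) y)) + integral {-R..R} (\<lambda>x. Q (Complex x R) - Q (Complex x (-R)))"
proof -
  have c: "continuous_on S (\<lambda>(x, y). f (Complex x y))" if "continuous_on UNIV f" for f :: "complex \<Rightarrow> real" and S
    unfolding case_prod_unfold by (rule continuous_on_compose2[OF that]) (auto intro!: continuous_intros)
  have i: "integrable lborel (\<lambda>w. indicator (square R) w * f w)" if "continuous_on UNIV f" for f :: "complex \<Rightarrow> real"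
    using borel_integrable_compact[OF compact_square continuous_on_subset[OF that]] by auto
  have sw: "integral {-R..R} (\<lambda>x. integral {-R..R} (\<lambda>y. p (Complex x y))) = integral {-R..R} (\<lambda>y. integral {-R..R} (\<lambda>x. p (Complex x y)))"
    using integral_swap_continuous[of "-R" "-R" R R "\<lambda>x y. p (Complex x y)"] c[OF p] by simp
  have "integral {-R..R} (\<lambda>x. p (Complex x y)) = P (Complex R y) - P (Complex (-R) y)" for y
    by (intro integral_unique fundamental_theorem_of_calculus)
      (use R P in \<open>auto simp: has_real_derivative_iff_has_vector_derivative[symmetric] intro: has_field_derivative_at_within\<close>)
  then have 1: "integral {-R..R} (\<lambda>x. integral {-R..R} (\<lambda>y. p (Complex x y))) = integral {-R..R} (\<lambda>y. P (Complex R y) - P (Complex (-R) y))"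
    unfolding sw by simp
  have 2: "integral {-R..R} (\<lambda>y. q (Complex x y)) = Q (Complex x R) - Q (Complex x (-R))" for x
    by (intro integral_unique fundamental_theorem_of_calculus)
      (use R Q in \<open>auto simp: has_real_derivative_iff_has_vector_derivative[symmetric] intro: has_field_derivative_at_within\<close>)
  have "(LINT w|lborel. indicator (square R) w * (p w + q w))
     = (LINT w|lborel. indicator (square R) w * p w) + (LINT w|lborel. indicator (square R) w * q w)"
    using i[OF p] i[OF q] by (simp add: distrib_left)
  then show ?thesis unfolding integral_square_iterated[OF p] integral_square_iterated[OF q] 1 2 .
qed

lemma square_exhaustion: "(\<lambda>n. indicator (square (real n)) w * f w) \<longlonglongrightarrow> (f w :: real)"
proof (rule tendsto_eventually)
  obtain N :: nat where "norm w \<le> real N" using real_arch_simple by blast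
  then show "eventually (\<lambda>n. indicator (square (real n)) w * f w = f w) sequentially"
    unfolding eventually_sequentially
    by (intro exI[of _ N] allI impI) (use abs_Re_le_cmod[of w] abs_Im_le_cmod[of w] in \<open>auto simp: square_def indicator_def\<close>)
qed

text \<open>The density is the flat divergence of \<open>2 * w / (1 + (norm w)\<^sup>2)\<close>. Its
  flux through a square is an explicit arctangent expression that tends to
  \<open>16 * arctan 1\<close>, and monotone convergence passes to the plane.\<close>

lemma sphere_density_integral:
  "integrable lborel (\<lambda>w::complex. 4 / (1 + (norm w)\<^sup>2)\<^sup>2)"
  "(LINT w|lborel. 4 / (1 + (norm (w::complex))\<^sup>2)\<^sup>2) = 4 * pi"
proof -
  let ?f = "\<lambda>w::complex. 4 / (1 + (norm w)\<^sup>2)\<^sup>2"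
  let ?P = "\<lambda>w. 2 * Re w / (1 + (norm w)\<^sup>2)" and ?Q = "\<lambda>w. 2 * Im w / (1 + (norm w)\<^sup>2)"
  let ?p = "\<lambda>w. 2 / (1 + (norm w)\<^sup>2) - 4 * (Re w)\<^sup>2 / (1 + (norm w)\<^sup>2)\<^sup>2"
  let ?q = "\<lambda>w. 2 / (1 + (norm w)\<^sup>2) - 4 * (Im w)\<^sup>2 / (1 + (norm w)\<^sup>2)\<^sup>2"
  have nz: "1 + (norm (w::complex))\<^sup>2 \<noteq> 0" for w using one_plus_norm_pos[of w] by simp
  have nz': "1 + (x\<^sup>2 + y\<^sup>2) > 0" for x y :: real by (simp add: add_pos_nonneg)
  have deriv: "((\<lambda>s. 2 * s / (1 + (s\<^sup>2 + y))) has_real_derivative (2 / (1 + (x\<^sup>2 + y)) - 4 * x\<^sup>2 / (1 + (x\<^sup>2 + y))\<^sup>2)) (at x)"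
    if "1 + (x\<^sup>2 + y) > 0" for x y :: real
  proof -
    have *: "(2 * r - 2 * x * k) / (r * r) = 2 / r - 4 * x\<^sup>2 / r\<^sup>2" if "r > 0" "k = 2 * x" for r k :: real
      using that by (simp add: field_simps power2_eq_square)
    have "((\<lambda>s. 2 * s / (1 + (s\<^sup>2 + y))) has_real_derivative (2 * (1 + (x\<^sup>2 + y)) - 2 * x * (2 * x)) / ((1 + (x\<^sup>2 + y)) * (1 + (x\<^sup>2 + y)))) (at x)"
      using that by (auto intro!: derivative_eq_intros)
    then show ?thesis unfolding *[OF that refl] .
  qed
  have eq: "?p w + ?q w = ?f w" for w
  proof -
    have "?p w + ?q w = 4 / (1 + (norm w)\<^sup>2) - 4 * ((Re w)\<^sup>2 + (Im w)\<^sup>2) / (1 + (norm w)\<^sup>2)\<^sup>2"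
      by (simp add: add_divide_distrib algebra_simps)
    also have "\<dots> = ?f w"
    proof -
      have "4 / r - 4 * (r - 1) / r\<^sup>2 = 4 / r\<^sup>2" if "r \<noteq> 0" for r :: real
        using that by (simp add: field_simps power2_eq_square)
      from this[OF nz[of w]] show ?thesis by (simp add: cmod_power2)
    qed
    finally show ?thesis .
  qed
  \<comment> \<open>Each of the two pairs of opposite sides contributes one half of the right-hand
    side.\<close>
  have box: "(LINT w|lborel. indicator (square R) w * ?f w) = 16 * (R / sqrt (1 + R\<^sup>2)) * arctan (R / sqrt (1 + R\<^sup>2))" if R: "R \<ge> 0" for R
  proof -
    let ?a = "sqrt (1 + R\<^sup>2)"
    have a: "?a > 0" "?a\<^sup>2 = 1 + R\<^sup>2" by (auto simp: add_pos_nonneg)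
    have "integral {-R..R} (\<lambda>y. 4 * R / (1 + R\<^sup>2 + y\<^sup>2)) = 4 * R / ?a * arctan (R / ?a) - 4 * R / ?a * arctan (- R / ?a)"
    proof (intro integral_unique fundamental_theorem_of_calculus)
      fix y :: real
      have "((\<lambda>y. 4 * R / ?a * arctan (y / ?a)) has_real_derivative 4 * R / ?a * (inverse (1 + (y / ?a)\<^sup>2) * (1 / ?a))) (at y)"
        by (intro DERIV_cmult DERIV_chain2[OF DERIV_arctan] DERIV_cdivide DERIV_ident)
      also have "4 * R / ?a * (inverse (1 + (y / ?a)\<^sup>2) * (1 / ?a)) = 4 * R / (?a\<^sup>2 + y\<^sup>2)"
      proof -
        have "1 + (y / b)\<^sup>2 = (b\<^sup>2 + y\<^sup>2) / b\<^sup>2" if "b > 0" for b :: real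
          using that by (simp add: field_simps)
        from this[OF a(1)] show ?thesis using a(1) by (simp add: power2_eq_square del: real_sqrt_mult_self real_sqrt_pow2)
      qed
      finally show "((\<lambda>y. 4 * R / ?a * arctan (y / ?a)) has_vector_derivative 4 * R / (1 + R\<^sup>2 + y\<^sup>2)) (at y within {-R..R})"
        unfolding a(2) by (simp add: has_real_derivative_iff_has_vector_derivative[symmetric] has_field_derivative_at_within)
    qed (use R in auto)
    also have "\<dots> = 8 * (R / ?a) * arctan (R / ?a)" by (simp add: arctan_minus)
    finally have 1: "integral {-R..R} (\<lambda>y. 4 * R / (1 + R\<^sup>2 + y\<^sup>2)) = 8 * (R / ?a) * arctan (R / ?a)" .
    have "(LINT w|lborel. indicator (square R) w * ?f w) = (LINT w|lborel. indicator (square R) w * (?p w + ?q w))"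
      unfolding eq ..
    also have "\<dots> = integral {-R..R} (\<lambda>y. ?P (Complex R y) - ?P (Complex (-R) y)) + integral {-R..R} (\<lambda>x. ?Q (Complex x R) - ?Q (Complex x (-R)))"
    proof (rule divergence_square[OF _ _ _ _ R])
      show "continuous_on UNIV ?p" "continuous_on UNIV ?q" by (intro continuous_intros; simp add: nz)+
      show "((\<lambda>s. ?P (Complex s y)) has_real_derivative ?p (Complex x y)) (at x)" for x y
        using deriv[OF nz'[of x y]] by (simp add: cmod_power2)
      show "((\<lambda>s. ?Q (Complex x s)) has_real_derivative ?q (Complex x y)) (at y)" for x y
        using deriv[of y "x\<^sup>2"] nz'[of x y] by (simp add: cmod_power2 add.commute add.left_commute)
    qed
    also have "\<dots> = integral {-R..R} (\<lambda>y. 4 * R / (1 + R\<^sup>2 + y\<^sup>2)) + integral {-R..R} (\<lambda>y. 4 * R / (1 + R\<^sup>2 + y\<^sup>2))"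
      by (simp add: cmod_power2 add_divide_distrib[symmetric] add.commute add.left_commute)
    finally show ?thesis unfolding 1 by simp
  qed
  have lim: "(\<lambda>n. LINT w|lborel. indicator (square (real n)) w * ?f w) \<longlonglongrightarrow> 4 * pi"
  proof -
    have "(\<lambda>n. real n / sqrt (1 + (real n)\<^sup>2)) \<longlonglongrightarrow> 1"
    proof -
      have "(\<lambda>n. 1 / sqrt (1 + (1 / real n)\<^sup>2)) \<longlonglongrightarrow> 1 / sqrt (1 + 0\<^sup>2)"
        by (intro tendsto_intros lim_1_over_n) auto
      moreover have "eventually (\<lambda>n. 1 / sqrt (1 + (1 / real n)\<^sup>2) = real n / sqrt (1 + (real n)\<^sup>2)) sequentially"
        using eventually_gt_at_top[of 0]
      proof eventually_elim
        case (elim n)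
        have "1 + (real n)\<^sup>2 = (real n)\<^sup>2 * (1 + (1 / real n)\<^sup>2)" using elim by (simp add: field_simps power2_eq_square)
        then show ?case using elim by (simp add: real_sqrt_mult)
      qed
      ultimately show ?thesis by (simp cong: filterlim_cong add: tendsto_cong)
    qed
    then have "(\<lambda>n. 16 * (real n / sqrt (1 + (real n)\<^sup>2)) * arctan (real n / sqrt (1 + (real n)\<^sup>2))) \<longlonglongrightarrow> 16 * 1 * arctan 1"
      by (intro tendsto_intros)
    then show ?thesis unfolding box[OF of_nat_0_le_iff] arctan_one by simp
  qed
  have int: "integrable lborel (\<lambda>w. indicator (square (real n)) w * ?f w)" for n
  proof -
    have "continuous_on (square (real n)) ?f" by (intro continuous_intros) (simp add: nz)
    from borel_integrable_compact[OF compact_square this] show ?thesis by simp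
  qed
  have mono: "mono (\<lambda>n. indicator (square (real n)) w * ?f w)" for w
    by (rule monoI) (auto simp: indicator_def square_def)
  show "integrable lborel ?f" "(LINT w|lborel. ?f w) = 4 * pi"
  proof -
    have 1: "AE w in lborel. mono (\<lambda>n. indicator (square (real n)) w * ?f w)" by (rule AE_I2[OF mono])
    have 2: "AE w in lborel. (\<lambda>n. indicator (square (real n)) w * ?f w) \<longlonglongrightarrow> ?f w" by (rule AE_I2[OF square_exhaustion])
    have 3: "?f \<in> borel_measurable lborel" by measurable
    show "integrable lborel ?f" by (rule integrable_monotone_convergence[OF int 1 2 lim 3])
    show "(LINT w|lborel. ?f w) = 4 * pi" by (rule integral_monotone_convergence[OF int 1 2 lim 3])
  qed
qed

lemma sphere_measure_density: "1 / (pi * (1 + (norm (z::complex))\<^sup>2)\<^sup>2) = 4 / (1 + (norm z)\<^sup>2)\<^sup>2 / (4 * pi)"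
  by simp

lemma sets_sphere_measure [measurable_cong, simp]: "sets sphere_measure = sets borel"
  by (simp add: sphere_measure_def)

lemma space_sphere_measure [simp]: "space sphere_measure = UNIV"
  by (simp add: sphere_measure_def)

lemma integral_sphere_measure:
  fixes f :: "complex \<Rightarrow> 'b::{banach, second_countable_topology}"
  assumes "f \<in> borel_measurable borel"
  shows "(\<integral>z. f z \<partial>sphere_measure) = (LINT z|lborel. (1 / (pi * (1 + (norm z)\<^sup>2)\<^sup>2)) *\<^sub>R f z)"
  unfolding sphere_measure_def by (rule integral_density) (use assms in auto)

lemma sphere_measure_UNIV: "emeasure sphere_measure UNIV = 1"
proof -
  have "emeasure sphere_measure UNIV = (\<integral>\<^sup>+ z. ennreal (1 / (pi * (1 + (norm (z::complex))\<^sup>2)\<^sup>2)) \<partial>lborel)"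
    unfolding sphere_measure_def by (subst emeasure_density) auto
  also have "\<dots> = ennreal (LINT z|lborel. 1 / (pi * (1 + (norm (z::complex))\<^sup>2)\<^sup>2))"
    unfolding sphere_measure_density
    by (intro nn_integral_eq_integral integrable_divide sphere_density_integral) auto
  also have "(LINT z|lborel. 1 / (pi * (1 + (norm (z::complex))\<^sup>2)\<^sup>2)) = 1"
    unfolding sphere_measure_density
    by (simp add: sphere_density_integral(2) del: divide_divide_eq_left divide_divide_eq_right)
  finally show ?thesis by simp
qed

lemma finite_measure_sphere: "finite_measure sphere_measure"
  by (rule finite_measureI) (simp add: sphere_measure_UNIV)

lemma measure_sphere_UNIV: "measure sphere_measure UNIV = 1"
  by (simp add: measure_def sphere_measure_UNIV)

lemma integrable_sphere_bounded:
  fixes f :: "complex \<Rightarrow> 'b::{banach, second_countable_topology}"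
  assumes "f \<in> borel_measurable borel" "\<And>z. norm (f z) \<le> C"
  shows "integrable sphere_measure f"
  using assms by (intro finite_measure.integrable_const_bound[OF finite_measure_sphere, of _ C]) auto

lemma integral_sphere_const [simp]: "(\<integral>z. c \<partial>sphere_measure) = (c :: 'b::{banach, second_countable_topology})"
  by (simp add: measure_sphere_UNIV)

lemma integral_sphere_norm_bound:
  fixes f :: "complex \<Rightarrow> 'b::{banach, second_countable_topology}"
  assumes "f \<in> borel_measurable borel" "\<And>z. norm (f z) \<le> C"
  shows "norm (\<integral>z. f z \<partial>sphere_measure) \<le> C"
proof -
  have "norm (\<integral>z. f z \<partial>sphere_measure) \<le> (\<integral>z. norm (f z) \<partial>sphere_measure)" by (rule integral_norm_bound)
  also have "\<dots> \<le> (\<integral>z. C \<partial>sphere_measure)"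
    using assms order_trans[OF norm_ge_zero assms(2)]
    by (intro integral_mono integrable_sphere_bounded[where C = C]) auto
  finally show ?thesis by (simp add: measure_sphere_UNIV)
qed

section \<open>Distribution of the overlap under the sphere measure\<close>

lemma continuous_overlap: "\<alpha> \<noteq> 0 \<or> \<beta> \<noteq> 0 \<Longrightarrow> continuous_on UNIV (overlap \<alpha> \<beta>)"
proof -
  assume a: "\<alpha> \<noteq> 0 \<or> \<beta> \<noteq> 0"
  have "(1 + (norm z)\<^sup>2) * ((norm \<alpha>)\<^sup>2 + (norm \<beta>)\<^sup>2) \<noteq> 0" for z :: complex
    using a one_plus_norm_pos[of z] by (auto simp: add_nonneg_eq_0_iff)
  then show ?thesis unfolding overlap_def[abs_def] by (intro continuous_intros) auto
qed

text \<open>For \<open>\<nu> = 0\<close> the operator is a scalar Laplacian, hence a divergence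
  against the sphere density. The field decays like \<open>1 / (1 + R\<^sup>2)\<close> on the
  boundary of a square of perimeter \<open>8 * R\<close>, so the flux dies out.\<close>

lemma (in bundle_kernel) integral_laplacian_zero:
  assumes nu: "\<nu> = 0" and cont: "continuous_on UNIV \<phi>''" "continuous_on UNIV \<phi>'"
  shows "(\<integral>z. X z * (1 - X z) * \<phi>'' (X z) + (1 - 2 * X z) * \<phi>' (X z) \<partial>sphere_measure) = 0"
proof -
  define G where "G = (\<lambda>z. X z * (1 - X z) * \<phi>'' (X z) + (1 - 2 * X z) * \<phi>' (X z))"
  have Bone: "B z = 1" for z by (simp add: bundle_factor_def nu)
  have cX: "continuous_on UNIV X" by (rule continuous_overlap[OF nz])
  have cG: "continuous_on UNIV G" unfolding G_def
    by (intro continuous_intros cX continuous_on_compose2[OF cont(1) cX] continuous_on_compose2[OF cont(2) cX]) auto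
  obtain H where H: "\<And>x. x \<in> {0..1} \<Longrightarrow> \<bar>\<phi>' x\<bar> \<le> H"
  proof -
    have "bounded (\<phi>' ` {0..1})"
      by (intro compact_imp_bounded compact_continuous_image continuous_on_subset[OF cont(2)]) auto
    then obtain a where "\<forall>y\<in>\<phi>' ` {0..1}. norm y \<le> a" unfolding bounded_iff by blast
    then show ?thesis by (intro that[of a]) auto
  qed
  obtain H2 where H2: "\<And>x. x \<in> {0..1} \<Longrightarrow> \<bar>x * (1 - x) * \<phi>'' x + (1 - 2 * x) * \<phi>' x\<bar> \<le> H2"
  proof -
    have "continuous_on {0..1} (\<lambda>x. x * (1 - x) * \<phi>'' x + (1 - 2 * x) * \<phi>' x)"
      by (intro continuous_intros continuous_on_subset[OF cont(1)] continuous_on_subset[OF cont(2)]) auto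
    then have "bounded ((\<lambda>x. x * (1 - x) * \<phi>'' x + (1 - 2 * x) * \<phi>' x) ` {0..1})"
      by (intro compact_imp_bounded compact_continuous_image) auto
    then obtain a where "\<forall>y\<in>(\<lambda>x. x * (1 - x) * \<phi>'' x + (1 - 2 * x) * \<phi>' x) ` {0..1}. norm y \<le> a"
      unfolding bounded_iff by blast
    then show ?thesis by (intro that[of a]) auto
  qed
  have Gb: "\<bar>G z\<bar> \<le> H2" for z unfolding G_def by (rule H2[OF X_in])
  have r: "rho z = of_real (1 + (norm z)\<^sup>2)" for z by (rule rho_altdef)
  have lap: "Re (Fbz z) = G z / (1 + (norm z)\<^sup>2)\<^sup>2" for z
  proof -
    have "(rho z)\<^sup>2 * Fbz z = of_real (G z)"
      using laplacian_F[of z] unfolding Bone by (simp add: nu G_def)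
    then have "Fbz z = of_real (G z) / (rho z)\<^sup>2" by (simp add: field_simps)
    then have "Fbz z = of_real (G z / (1 + (norm z)\<^sup>2)\<^sup>2)"
      unfolding r by (simp only: of_real_divide of_real_power)
    then show ?thesis by simp
  qed
  \<comment> \<open>By Lagrange's identity \<open>a\<^sup>2 + b\<^sup>2 = D\<close>, hence
    \<open>a * b \<le> D\<close>, which bounds the derivative of the overlap.\<close>
  have Fbbound: "norm (Fb z) \<le> H / (1 + (norm z)\<^sup>2)" for z
  proof -
    define D where "D = (1 + (norm z)\<^sup>2) * ((norm \<alpha>)\<^sup>2 + (norm \<beta>)\<^sup>2)"
    have D: "D > 0" using sig_nonzero one_plus_norm_pos[of z] unfolding sig_altdef D_def
      by (intro mult_pos_pos) (auto simp: add_nonneg_pos add_pos_nonneg less_le)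
    define a b where "a = norm (\<alpha> + \<beta> * z)" and "b = norm (cnj \<beta> - cnj \<alpha> * z)"
    have ab: "a\<^sup>2 + b\<^sup>2 = D" unfolding a_def b_def D_def overlap_complement ..
    have "2 * (a * b) \<le> a\<^sup>2 + b\<^sup>2" using sum_squares_bound[of a b] by simp
    moreover have "0 \<le> a * b" by (simp add: a_def b_def)
    ultimately have "a * b \<le> D" using ab by linarith
    have "norm (Xb z) = a * b / ((1 + (norm z)\<^sup>2) * D)"
    proof -
      have "norm (rho z) = 1 + (norm z)\<^sup>2" "norm (sig \<alpha> \<beta>) = (norm \<alpha>)\<^sup>2 + (norm \<beta>)\<^sup>2"
        unfolding rho_altdef sig_altdef norm_of_real by (simp_all add: add_nonneg_nonneg)
      then show ?thesis
        by (simp add: overlap_zb_def norm_mult norm_divide norm_power a_def b_def D_def power2_eq_square)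
    qed
    also have "\<dots> \<le> D / ((1 + (norm z)\<^sup>2) * D)"
      using \<open>a * b \<le> D\<close> D one_plus_norm_pos[of z] by (intro divide_right_mono) auto
    also have "\<dots> = 1 / (1 + (norm z)\<^sup>2)" using D by simp
    finally have "norm (Xb z) \<le> 1 / (1 + (norm z)\<^sup>2)" .
    then have "\<bar>\<phi>' (X z)\<bar> * norm (Xb z) \<le> H * (1 / (1 + (norm z)\<^sup>2))"
      using H[of 0] by (intro mult_mono H X_in) auto
    moreover have "Fb z = of_real (\<phi>' (X z)) * Xb z" unfolding Fb_def Bone using nu by simp
    ultimately show ?thesis by (simp add: norm_mult)
  qed
  define Fbb where "Fbb = (\<lambda>z. of_real (\<phi>'' (X z)) * Xb z * Xb z + of_real (\<phi>' (X z)) * Xbb z)"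
  have e: "Fb = (\<lambda>z. of_real (\<phi>' (X z)) * Xb z)" unfolding fun_eq_iff Fb_def Bone using nu by simp
  have Fbz: "Fbz z = of_real (\<phi>'' (X z)) * Xz z * Xb z + of_real (\<phi>' (X z)) * Xbz z" for z
  proof -
    have n: "complex_of_nat \<nu> = 0" using nu by simp
    show ?thesis unfolding Fbz_def F'z_def F'_def Bone bundle_factor_N_def of_nat_mult n by simp
  qed
  have der: "(Fb has_derivative (\<lambda>h. Fbz z * h + Fbb z * cnj h)) (at z)" for z
    using has_wirtinger_mult[OF has_wirtinger_of_real_compose[where \<phi> = \<phi>', OF has_wirtinger_overlap d2[OF X_in]] has_wirtinger_Xb, of z]
    by (simp only: has_wirtinger_def e Fbz Fbb_def)
  have crho: "continuous_on UNIV (\<lambda>z. 1 / rho z)"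
    unfolding rho_def using rho_nonzero by (intro continuous_intros) (auto simp flip: rho_def)
  have cXs: "continuous_on UNIV Xz" "continuous_on UNIV Xb" "continuous_on UNIV Xbz" "continuous_on UNIV Xbb"
    unfolding overlap_z_def[abs_def] overlap_zb_def[abs_def] Xbz_def[abs_def] Xbb_def[abs_def]
    by (intro crho continuous_on_const continuous_on_id continuous_on_mult continuous_on_diff continuous_on_add
        continuous_on_minus continuous_on_power continuous_on_cnj)+
  have cd: "continuous_on UNIV (\<lambda>z. complex_of_real (\<phi>'' (X z)))" "continuous_on UNIV (\<lambda>z. complex_of_real (\<phi>' (X z)))"
    by (intro continuous_intros continuous_on_compose2[OF cont(1) cX] continuous_on_compose2[OF cont(2) cX]; simp)+
  have cF: "continuous_on UNIV Fb" "continuous_on UNIV Fbz" "continuous_on UNIV Fbb"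
    unfolding e Fbb_def Fbz[abs_def] by (intro cXs cd continuous_on_mult continuous_on_add)+
  have line: "((\<lambda>s. Fb (g s)) has_vector_derivative (Fbz (g s) * d + Fbb (g s) * cnj d)) (at s)"
    if "(g has_vector_derivative d) (at s)" for g d s
    using has_derivative_compose[OF that[unfolded has_vector_derivative_def] der]
    unfolding has_vector_derivative_def by (simp add: algebra_simps scaleR_conv_of_real)
  have cR: "((\<lambda>s. Complex s y) has_vector_derivative 1) (at x)" for x y
  proof -
    have "((\<lambda>s. of_real s + \<i> * of_real y) has_vector_derivative of_real 1 + 0) (at x)"
      by (intro has_vector_derivative_add has_vector_derivative_of_real DERIV_ident has_vector_derivative_const)
    then show ?thesis by (simp add: Complex_eq)
  qed
  have cI: "((\<lambda>s. Complex x s) has_vector_derivative \<i>) (at y)" for x y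
  proof -
    have "((\<lambda>s. of_real x + \<i> * of_real s) has_vector_derivative 0 + \<i> * of_real 1) (at y)"
      by (intro has_vector_derivative_add has_vector_derivative_mult_right has_vector_derivative_of_real DERIV_ident has_vector_derivative_const)
    then show ?thesis by (simp add: Complex_eq)
  qed
  \<comment> \<open>\<open>(P, Q)\<close> is the real gradient of \<open>\<phi> (X z)\<close>; its
    divergence \<open>p + q\<close> is 4 times the real part of \<open>Fbz\<close>.\<close>
  define P Q where "P = (\<lambda>z. 2 * Re (Fb z))" and "Q = (\<lambda>z. 2 * Im (Fb z))"
  define p q where "p = (\<lambda>z. 2 * Re (Fbz z + Fbb z))" and "q = (\<lambda>z. 2 * Re (Fbz z - Fbb z))"
  have P: "((\<lambda>s. P (Complex s y)) has_real_derivative p (Complex x y)) (at x)" for x y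
  proof -
    have "((\<lambda>s. 2 *\<^sub>R Re (Fb (Complex s y))) has_vector_derivative 2 *\<^sub>R Re (Fbz (Complex x y) * 1 + Fbb (Complex x y) * cnj 1)) (at x)"
      by (intro bounded_linear.has_vector_derivative[OF bounded_linear_scaleR_right] bounded_linear.has_vector_derivative[OF bounded_linear_Re] line cR)
    then show ?thesis by (simp add: P_def p_def has_real_derivative_iff_has_vector_derivative)
  qed
  have Q: "((\<lambda>s. Q (Complex x s)) has_real_derivative q (Complex x y)) (at y)" for x y
  proof -
    have "((\<lambda>s. 2 *\<^sub>R Im (Fb (Complex x s))) has_vector_derivative 2 *\<^sub>R Im (Fbz (Complex x y) * \<i> + Fbb (Complex x y) * cnj \<i>)) (at y)"
      by (intro bounded_linear.has_vector_derivative[OF bounded_linear_scaleR_right] bounded_linear.has_vector_derivative[OF bounded_linear_Im] line cI)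
    then show ?thesis by (simp add: Q_def q_def has_real_derivative_iff_has_vector_derivative)
  qed
  have pq: "p z + q z = 4 / (1 + (norm z)\<^sup>2)\<^sup>2 * G z" for z
    using lap[of z] by (simp add: p_def q_def)
  have H0: "H \<ge> 0" using H[of 0] by auto
  have PQ: "\<bar>P z\<bar> \<le> 2 * (H / (1 + (norm z)\<^sup>2))" "\<bar>Q z\<bar> \<le> 2 * (H / (1 + (norm z)\<^sup>2))" for z
    using Fbbound[of z] abs_Re_le_cmod[of "Fb z"] abs_Im_le_cmod[of "Fb z"] unfolding P_def Q_def by linarith+
  have le: "2 * (H / (1 + (norm z)\<^sup>2)) \<le> 2 * (H / (1 + R\<^sup>2))" if "\<bar>Re z\<bar> = R \<or> \<bar>Im z\<bar> = R" for R z
  proof -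
    have "R\<^sup>2 = (Re z)\<^sup>2 \<or> R\<^sup>2 = (Im z)\<^sup>2" using that by (metis power2_abs)
    then have "R\<^sup>2 \<le> (norm z)\<^sup>2" unfolding cmod_power2 by (elim disjE) simp_all
    then show ?thesis using H0 by (intro mult_left_mono divide_left_mono mult_pos_pos one_plus_norm_pos) (auto simp: add_pos_nonneg)
  qed
  have cPQ: "continuous_on UNIV P" "continuous_on UNIV Q" "continuous_on UNIV p" "continuous_on UNIV q"
    unfolding P_def Q_def p_def q_def by (intro continuous_intros cF)+
  have bnd: "\<bar>LINT w|lborel. indicator (square R) w * (p w + q w)\<bar> \<le> 16 * H * (R / (1 + R\<^sup>2))" if R: "R \<ge> 0" for R
  proof -
    have "\<bar>integral {-R..R} (\<lambda>y. P (Complex R y) - P (Complex (-R) y))\<bar> \<le> (4 * (H / (1 + R\<^sup>2))) * (R - (-R))"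
      unfolding real_norm_def[symmetric]
    proof (rule integral_bound)
      show "continuous_on {-R..R} (\<lambda>y. P (Complex R y) - P (Complex (-R) y))"
        by (intro continuous_intros continuous_on_compose2[OF cPQ(1)]) auto
      show "norm (P (Complex R y) - P (Complex (-R) y)) \<le> 4 * (H / (1 + R\<^sup>2))" for y
        using PQ(1)[of "Complex R y"] PQ(1)[of "Complex (-R) y"] le[of "Complex R y" R] le[of "Complex (-R) y" R] R by simp
    qed (use R in simp)
    moreover have "\<bar>integral {-R..R} (\<lambda>x. Q (Complex x R) - Q (Complex x (-R)))\<bar> \<le> (4 * (H / (1 + R\<^sup>2))) * (R - (-R))"
      unfolding real_norm_def[symmetric]
    proof (rule integral_bound)
      show "continuous_on {-R..R} (\<lambda>x. Q (Complex x R) - Q (Complex x (-R)))"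
        by (intro continuous_intros continuous_on_compose2[OF cPQ(2)]) auto
      show "norm (Q (Complex x R) - Q (Complex x (-R))) \<le> 4 * (H / (1 + R\<^sup>2))" for x
        using PQ(2)[of "Complex x R"] PQ(2)[of "Complex x (-R)"] le[of "Complex x R" R] le[of "Complex x (-R)" R] R by simp
    qed (use R in simp)
    ultimately have "\<bar>LINT w|lborel. indicator (square R) w * (p w + q w)\<bar>
        \<le> (4 * (H / (1 + R\<^sup>2))) * (R - (-R)) + (4 * (H / (1 + R\<^sup>2))) * (R - (-R))"
      unfolding divergence_square[OF P Q cPQ(3,4) R] by (intro order_trans[OF abs_triangle_ineq] add_mono)
    then show ?thesis by simp
  qed
  have "(\<lambda>n. LINT w|lborel. indicator (square (real n)) w * (p w + q w)) \<longlonglongrightarrow> 0"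
  proof (rule Lim_null_comparison)
    show "eventually (\<lambda>n. norm (LINT w|lborel. indicator (square (real n)) w * (p w + q w)) \<le> 16 * H * (real n / (1 + (real n)\<^sup>2))) sequentially"
      using bnd by (intro always_eventually) simp
    have "(\<lambda>n. real n / (1 + (real n)\<^sup>2)) \<longlonglongrightarrow> 0"
    proof (rule Lim_null_comparison[OF _ lim_1_over_n])
      have "norm (real n / (1 + (real n)\<^sup>2)) \<le> 1 / real n" if "n > 0" for n
        using that by (simp add: field_simps power2_eq_square add_pos_nonneg)
      then show "eventually (\<lambda>n. norm (real n / (1 + (real n)\<^sup>2)) \<le> 1 / real n) sequentially"
        by (rule eventually_mono[OF eventually_gt_at_top[of 0]])
    qed
    then show "(\<lambda>n. 16 * H * (real n / (1 + (real n)\<^sup>2))) \<longlonglongrightarrow> 0"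
      by (rule tendsto_mult_right_zero)
  qed
  moreover have "(\<lambda>n. LINT w|lborel. indicator (square (real n)) w * (p w + q w)) \<longlonglongrightarrow> (LINT w|lborel. p w + q w)"
  proof (rule integral_dominated_convergence[where w = "\<lambda>w. H2 * (4 / (1 + (norm w)\<^sup>2)\<^sup>2)"])
    have "(\<lambda>w. p w + q w) \<in> borel_measurable borel"
      by (intro borel_measurable_continuous_onI continuous_intros cPQ)
    then show m: "(\<lambda>w. p w + q w) \<in> borel_measurable lborel" by simp
    then show "(\<lambda>w. indicator (square (real n)) w * (p w + q w)) \<in> borel_measurable lborel" for n
      by measurable
    show "integrable lborel (\<lambda>w::complex. H2 * (4 / (1 + (norm w)\<^sup>2)\<^sup>2))"
      by (intro integrable_mult_right sphere_density_integral)
    show "AE w in lborel. norm (indicator (square (real n)) w * (p w + q w)) \<le> H2 * (4 / (1 + (norm w)\<^sup>2)\<^sup>2)" for n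
    proof (rule AE_I2)
      fix w :: complex
      have "\<bar>4 / (1 + (norm w)\<^sup>2)\<^sup>2 * G w\<bar> \<le> 4 / (1 + (norm w)\<^sup>2)\<^sup>2 * H2"
        unfolding abs_mult using Gb[of w] by (intro mult_mono) auto
      then show "norm (indicator (square (real n)) w * (p w + q w)) \<le> H2 * (4 / (1 + (norm w)\<^sup>2)\<^sup>2)"
        unfolding pq using Gb[of w] by (auto simp: indicator_def mult.commute)
    qed
    show "AE w in lborel. (\<lambda>n. indicator (square (real n)) w * (p w + q w)) \<longlonglongrightarrow> p w + q w"
      by (intro AE_I2 square_exhaustion)
  qed
  ultimately have z: "(LINT w|lborel. p w + q w) = 0" by (rule LIMSEQ_unique[symmetric])
  have "(\<integral>z. G z \<partial>sphere_measure) = (LINT w|lborel. (p w + q w) / (4 * pi))"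
    using integral_sphere_measure[OF borel_measurable_continuous_onI[OF cG]] unfolding pq by (simp add: mult.commute)
  also have "\<dots> = 0" by (simp only: integral_divide_zero z)
  finally show ?thesis unfolding G_def .
qed

lemma overlap_measurable [measurable]:
  "\<alpha> \<noteq> 0 \<or> \<beta> \<noteq> 0 \<Longrightarrow> overlap \<alpha> \<beta> \<in> borel_measurable borel"
  by (intro borel_measurable_continuous_onI continuous_overlap)

lemma integrable_overlap_power:
  assumes "\<alpha> \<noteq> 0 \<or> \<beta> \<noteq> 0"
  shows "integrable sphere_measure (\<lambda>z. overlap \<alpha> \<beta> z ^ n)"
proof (rule integrable_sphere_bounded[where C = 1])
  show "(\<lambda>z. overlap \<alpha> \<beta> z ^ n) \<in> borel_measurable borel"
    by (intro borel_measurable_power overlap_measurable assms)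
  show "norm (overlap \<alpha> \<beta> z ^ n) \<le> 1" for z
    using overlap_bounds[of \<alpha> \<beta> z] by (simp add: power_abs power_le_one)
qed

lemma power_antiderivative: "((\<lambda>x. x ^ Suc n / (real n + 1)) has_real_derivative x ^ n) (at x within S)"
proof -
  have "real n + 1 \<noteq> 0" by linarith
  then show ?thesis using DERIV_cdivide[OF DERIV_pow[of "Suc n" x S], of "real n + 1"]
    by (simp add: add.commute)
qed

text \<open>The vanishing integral for the profile \<open>x ^ Suc n / (n + 1)\<close> says that
  \<open>n + 1\<close> times the moment of order \<open>n\<close> is \<open>n + 2\<close> times the
  next one.\<close>

lemma overlap_moment:
  assumes nz: "\<alpha> \<noteq> 0 \<or> \<beta> \<noteq> 0"
  shows "(\<integral>z. overlap \<alpha> \<beta> z ^ n \<partial>sphere_measure) = 1 / (real n + 1)"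
proof (induction n)
  case 0
  show ?case by (simp add: measure_sphere_UNIV)
next
  case (Suc n)
  interpret bundle_kernel \<alpha> \<beta> 0 "\<lambda>x. x ^ Suc n / (real n + 1)" "\<lambda>x. x ^ n" "\<lambda>x. real n * x ^ (n - 1)"
  proof
    show "((\<lambda>x. x ^ n) has_real_derivative real n * x ^ (n - 1)) (at x)" for x :: real
      using DERIV_pow[of n x UNIV] by simp
  qed (use nz power_antiderivative in auto)
  have e: "X z * (1 - X z) * (real n * X z ^ (n - 1)) + (1 - 2 * X z) * X z ^ n
      = (real n + 1) * X z ^ n - (real n + 2) * X z ^ Suc n" for z
    by (cases n) (simp_all add: algebra_simps)
  have "(\<integral>z. (real n + 1) * X z ^ n - (real n + 2) * X z ^ Suc n \<partial>sphere_measure) = 0"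
    using integral_laplacian_zero unfolding e by (simp add: continuous_intros)
  then have "(real n + 1) * (\<integral>z. X z ^ n \<partial>sphere_measure) - (real n + 2) * (\<integral>z. X z ^ Suc n \<partial>sphere_measure) = 0"
    by (subst (asm) Bochner_Integration.integral_diff)
      (auto intro: integrable_overlap_power[OF nz] integrable_mult_right simp del: power_Suc)
  then show ?case unfolding Suc by (simp add: field_simps)
qed

lemma integral_poly_overlap:
  assumes "\<alpha> \<noteq> 0 \<or> \<beta> \<noteq> 0"
  shows "(\<integral>z. poly p (overlap \<alpha> \<beta> z) \<partial>sphere_measure) = integral {0..1} (poly p)"
proof -
  have "(\<integral>z. poly p (overlap \<alpha> \<beta> z) \<partial>sphere_measure)
      = (\<Sum>i\<le>degree p. coeff p i * (1 / (real i + 1)))"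
    unfolding poly_altdef
    by (subst Bochner_Integration.integral_sum)
      (auto intro!: integrable_mult_right integrable_overlap_power assms simp: overlap_moment[OF assms])
  moreover have "((\<lambda>x. \<Sum>i\<le>degree p. coeff p i * x ^ i) has_integral (\<Sum>i\<le>degree p. coeff p i * (1 / (real i + 1)))) {0..1}"
  proof (intro has_integral_sum has_integral_mult_right)
    fix i
    have "((\<lambda>x::real. x ^ i) has_integral (1 ^ Suc i / (real i + 1) - 0 ^ Suc i / (real i + 1))) {0..1}"
      by (rule fundamental_theorem_of_calculus)
        (auto simp only: has_real_derivative_iff_has_vector_derivative[symmetric] power_antiderivative)
    then show "((\<lambda>x::real. x ^ i) has_integral 1 / (real i + 1)) {0..1}" by simp
  qed simp
  ultimately show ?thesis unfolding poly_altdef[abs_def] by (simp add: integral_unique)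
qed

text \<open>Bernstein approximation in terms of \<open>real poly\<close>, the form to which the
  moments and the Jacobi expansion apply.\<close>

lemma polynomial_approximation:
  fixes f :: "real \<Rightarrow> real"
  assumes "continuous_on {0..1} f" "e > 0"
  obtains p where "\<And>x. x \<in> {0..1} \<Longrightarrow> \<bar>f x - poly p x\<bar> < e"
proof -
  obtain N where N: "\<And>n x. N \<le> n \<Longrightarrow> x \<in> {0..1} \<Longrightarrow> \<bar>f x - (\<Sum>k\<le>n. f (real k / real n) * Bernstein n k x)\<bar> < e"
    using Bernstein_Weierstrass[OF assms] by blast
  define p where "p = (\<Sum>k\<le>N. smult (f (real k / real N)) (smult (real (N choose k)) (monom 1 k * [:1, -1:] ^ (N - k))))"
  have "poly p x = (\<Sum>k\<le>N. f (real k / real N) * Bernstein N k x)" for x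
    by (simp add: p_def poly_sum poly_monom Bernstein_def poly_power mult.assoc)
  then show ?thesis using N[of N] by (intro that[of p]) simp
qed

text \<open>Archimedes' hat-box theorem.\<close>

theorem integral_overlap:
  fixes f :: "real \<Rightarrow> real"
  assumes nz: "\<alpha> \<noteq> 0 \<or> \<beta> \<noteq> 0" and f: "continuous_on {0..1} f"
  shows "(\<integral>z. f (overlap \<alpha> \<beta> z) \<partial>sphere_measure) = integral {0..1} f"
proof -
  let ?X = "overlap \<alpha> \<beta>"
  have X: "?X z \<in> {0..1}" for z using overlap_bounds by auto
  have cf: "continuous_on UNIV (\<lambda>z. f (?X z))"
    by (rule continuous_on_compose2[OF f continuous_overlap[OF nz]]) (use X in auto)
  have "\<bar>(\<integral>z. f (?X z) \<partial>sphere_measure) - integral {0..1} f\<bar> \<le> e" if e: "e > 0" for e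
  proof -
    obtain p where p: "\<And>x. x \<in> {0..1} \<Longrightarrow> \<bar>f x - poly p x\<bar> < e / 2"
      using polynomial_approximation[OF f, of "e / 2"] e by (metis half_gt_zero)
    have cp: "continuous_on UNIV (\<lambda>z. poly p (?X z))"
      by (rule continuous_on_compose2[OF _ continuous_overlap[OF nz], of UNIV]) (auto intro!: continuous_intros)
    have bounded_int: "integrable sphere_measure (\<lambda>z. g (?X z))" if g: "continuous_on {0..1} g" "continuous_on UNIV (\<lambda>z. g (?X z))" for g :: "real \<Rightarrow> real"
    proof -
      have "bounded (g ` {0..1})" by (intro compact_imp_bounded compact_continuous_image g) auto
      then obtain C where "\<forall>y\<in>g ` {0..1}. norm y \<le> C" unfolding bounded_iff by blast
      then show ?thesis
        using X by (intro integrable_sphere_bounded[where C = C] borel_measurable_continuous_onI[OF g(2)]) auto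
    qed
    have "\<bar>(\<integral>z. f (?X z) \<partial>sphere_measure) - (\<integral>z. poly p (?X z) \<partial>sphere_measure)\<bar>
       = norm (\<integral>z. f (?X z) - poly p (?X z) \<partial>sphere_measure)"
      by (subst Bochner_Integration.integral_diff) (auto intro!: bounded_int f cf cp continuous_intros)
    also have "\<dots> \<le> e / 2"
      using p[OF X] by (intro integral_sphere_norm_bound borel_measurable_continuous_onI continuous_intros cf cp) (auto intro: less_imp_le)
    finally have 1: "\<bar>(\<integral>z. f (?X z) \<partial>sphere_measure) - integral {0..1} (poly p)\<bar> \<le> e / 2"
      unfolding integral_poly_overlap[OF nz] .
    have "\<bar>integral {0..1} f - integral {0..1} (poly p)\<bar> = norm (integral {0..1} (\<lambda>x. f x - poly p x))"
      by (subst Henstock_Kurzweil_Integration.integral_diff)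
        (auto intro!: integrable_continuous_real f continuous_intros)
    also have "\<dots> \<le> e / 2 * (1 - 0)"
      by (rule integral_bound) (use p in \<open>auto intro!: continuous_intros f less_imp_le\<close>)
    finally have 2: "\<bar>integral {0..1} f - integral {0..1} (poly p)\<bar> \<le> e / 2" by simp
    have "\<bar>a - b\<bar> \<le> e" if "\<bar>a - c\<bar> \<le> e / 2" "\<bar>b - c\<bar> \<le> e / 2" for a b c :: real
      using that by (smt (verit) field_sum_of_halves)
    from this[OF 1 2] show ?thesis .
  qed
  then have "\<bar>(\<integral>z. f (?X z) \<partial>sphere_measure) - integral {0..1} f\<bar> \<le> 0"
    by (rule field_le_epsilon[of _ 0, simplified])
  then show ?thesis by simp
qed

section \<open>Second derivatives and the magnetic Laplacian\<close>

text \<open>Schwarz's theorem. The second difference over a square of side \<open>h\<close> is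
  evaluated by mean values in both orders; the intermediate points converge to \<open>(x, y)\<close>
  as \<open>h\<close> tends to 0.\<close>

lemma mixed_partials_real:
  fixes f fx fy fxy fyx :: "real \<Rightarrow> real \<Rightarrow> real"
  assumes fx: "\<And>x y. ((\<lambda>s. f s y) has_real_derivative fx x y) (at x)"
    and fy: "\<And>x y. ((\<lambda>s. f x s) has_real_derivative fy x y) (at y)"
    and fxy: "\<And>x y. ((\<lambda>s. fx x s) has_real_derivative fxy x y) (at y)"
    and fyx: "\<And>x y. ((\<lambda>s. fy s y) has_real_derivative fyx x y) (at x)"
    and c: "continuous_on UNIV (\<lambda>(x, y). fxy x y)" "continuous_on UNIV (\<lambda>(x, y). fyx x y)"
  shows "fxy x y = fyx x y"
proof -
  have "\<exists>a b a' b'. x < a \<and> a < x + h \<and> y < b \<and> b < y + h \<and> x < a' \<and> a' < x + h \<and> y < b' \<and> b' < y + h \<and> fxy a b = fyx a' b'"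
    if h: "h > 0" for h
  proof -
    have "\<exists>a>x. a < x + h \<and> (f (x + h) (y + h) - f (x + h) y) - (f x (y + h) - f x y) = (x + h - x) * (fx a (y + h) - fx a y)"
      by (rule MVT2) (use h in simp, rule DERIV_diff[OF fx fx])
    then obtain a where a: "x < a" "a < x + h"
      "(f (x + h) (y + h) - f (x + h) y) - (f x (y + h) - f x y) = (x + h - x) * (fx a (y + h) - fx a y)" by blast
    have "\<exists>b>y. b < y + h \<and> fx a (y + h) - fx a y = (y + h - y) * fxy a b"
      by (rule MVT2) (use h in simp, rule fxy)
    then obtain b where b: "y < b" "b < y + h" "fx a (y + h) - fx a y = (y + h - y) * fxy a b" by blast
    have "\<exists>b'>y. b' < y + h \<and> (f (x + h) (y + h) - f x (y + h)) - (f (x + h) y - f x y) = (y + h - y) * (fy (x + h) b' - fy x b')"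
      by (rule MVT2) (use h in simp, rule DERIV_diff[OF fy fy])
    then obtain b' where b': "y < b'" "b' < y + h"
      "(f (x + h) (y + h) - f x (y + h)) - (f (x + h) y - f x y) = (y + h - y) * (fy (x + h) b' - fy x b')" by blast
    have "\<exists>a'>x. a' < x + h \<and> fy (x + h) b' - fy x b' = (x + h - x) * fyx a' b'"
      by (rule MVT2) (use h in simp, rule fyx)
    then obtain a' where a': "x < a'" "a' < x + h" "fy (x + h) b' - fy x b' = (x + h - x) * fyx a' b'" by blast
    have "(f (x + h) (y + h) - f (x + h) y) - (f x (y + h) - f x y) = (f (x + h) (y + h) - f x (y + h)) - (f (x + h) y - f x y)"
      by simp
    then have "h * (h * fxy a b) = h * (h * fyx a' b')"
      unfolding a(3) b(3) b'(3) a'(3) by simp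
    then have "fxy a b = fyx a' b'" using h by simp
    then show ?thesis using a b a' b' by blast
  qed
  then have "\<forall>n. \<exists>a b a' b'. x < a \<and> a < x + 1 / real (Suc n) \<and> y < b \<and> b < y + 1 / real (Suc n)
     \<and> x < a' \<and> a' < x + 1 / real (Suc n) \<and> y < b' \<and> b' < y + 1 / real (Suc n) \<and> fxy a b = fyx a' b'"
    by (meson of_nat_0_less_iff zero_less_Suc zero_less_divide_1_iff)
  then obtain a b a' b' where ab: "\<And>n. x < a n" "\<And>n. a n < x + 1 / real (Suc n)" "\<And>n. y < b n" "\<And>n. b n < y + 1 / real (Suc n)"
    "\<And>n. x < a' n" "\<And>n. a' n < x + 1 / real (Suc n)" "\<And>n. y < b' n" "\<And>n. b' n < y + 1 / real (Suc n)" "\<And>n. fxy (a n) (b n) = fyx (a' n) (b' n)"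
    by metis
  have lim: "s \<longlonglongrightarrow> u" if "\<And>n. u < s n" "\<And>n. s n < u + 1 / real (Suc n)" for s and u :: real
  proof (rule tendsto_sandwich[of "\<lambda>_. u" _ _ "\<lambda>n. u + 1 / real (Suc n)"])
    have "(\<lambda>n. u + 1 / real (Suc n)) \<longlonglongrightarrow> u + 0" by (intro tendsto_intros LIMSEQ_Suc[OF lim_1_over_n])
    then show "(\<lambda>n. u + 1 / real (Suc n)) \<longlonglongrightarrow> u" by simp
  qed (use that in \<open>auto intro!: always_eventually less_imp_le\<close>)
  have seq: "(\<lambda>n. g (s n) (r n)) \<longlonglongrightarrow> g x y" if "continuous_on UNIV (\<lambda>(x, y). g x y)" "s \<longlonglongrightarrow> x" "r \<longlonglongrightarrow> y"
    for g :: "real \<Rightarrow> real \<Rightarrow> real" and s r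
  proof -
    have "((\<lambda>p. (\<lambda>(x, y). g x y) p) \<longlongrightarrow> (\<lambda>(x, y). g x y) (x, y)) (at (x, y))"
      using that(1) by (simp add: continuous_on_def)
    then have "isCont (\<lambda>(x, y). g x y) (x, y)" by (simp add: isCont_def)
    from isCont_tendsto_compose[OF this tendsto_Pair[OF that(2,3)]] show ?thesis by simp
  qed
  have "(\<lambda>n. fxy (a n) (b n)) \<longlonglongrightarrow> fxy x y" by (rule seq[OF c(1) lim[OF ab(1,2)] lim[OF ab(3,4)]])
  moreover have "(\<lambda>n. fxy (a n) (b n)) \<longlonglongrightarrow> fyx x y" unfolding ab(9) by (rule seq[OF c(2) lim[OF ab(5,6)] lim[OF ab(7,8)]])
  ultimately show ?thesis by (rule LIMSEQ_unique)
qed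

lemma dir_deriv_line:
  assumes "f differentiable (at (z + of_real s * e))"
  shows "((\<lambda>s. f (z + of_real s * e)) has_vector_derivative dir_deriv f e (z + of_real s * e)) (at s)"
proof -
  have "((\<lambda>s. z + of_real s * e) has_vector_derivative 0 + of_real 1 * e) (at s)"
    by (intro has_vector_derivative_add has_vector_derivative_const has_vector_derivative_mult_left has_vector_derivative_of_real DERIV_ident)
  then have L: "((\<lambda>s. z + of_real s * e) has_derivative (\<lambda>h. h *\<^sub>R e)) (at s)" by (simp add: has_vector_derivative_def)
  have D: "(f has_derivative frechet_derivative f (at (z + of_real s * e))) (at (z + of_real s * e))"
    using assms frechet_derivative_works by blast
  have "((\<lambda>s. f (z + of_real s * e)) has_derivative (\<lambda>h. frechet_derivative f (at (z + of_real s * e)) (h *\<^sub>R e))) (at s)"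
    by (rule has_derivative_compose[OF L D])
  moreover have "frechet_derivative f (at (z + of_real s * e)) (h *\<^sub>R e) = h *\<^sub>R dir_deriv f e (z + of_real s * e)" for h
    unfolding dir_deriv_def using has_derivative_bounded_linear[OF D] by (simp add: bounded_linear.axioms(1) linear_simps(5) bounded_linear.linear linear.scaleR)
  ultimately show ?thesis by (simp add: has_vector_derivative_def)
qed

definition C2 :: "(complex \<Rightarrow> complex) \<Rightarrow> bool" where
  "C2 f \<longleftrightarrow> (\<forall>z. f differentiable (at z)) \<and> (\<forall>v z. dir_deriv f v differentiable (at z)) \<and>
     (\<forall>v v'. continuous_on UNIV (dir_deriv (dir_deriv f v) v'))"

lemma C2_lines:
  assumes "C2 f"
  shows "((\<lambda>s. f (z + of_real s * e)) has_vector_derivative dir_deriv f e (z + of_real s * e)) (at s)"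
    "((\<lambda>s. dir_deriv f v (z + of_real s * e)) has_vector_derivative dir_deriv (dir_deriv f v) e (z + of_real s * e)) (at s)"
proof -
  have "f differentiable (at p)" "dir_deriv f v differentiable (at p)" for p
    using assms unfolding C2_def by simp_all
  then show "((\<lambda>s. f (z + of_real s * e)) has_vector_derivative dir_deriv f e (z + of_real s * e)) (at s)"
    "((\<lambda>s. dir_deriv f v (z + of_real s * e)) has_vector_derivative dir_deriv (dir_deriv f v) e (z + of_real s * e)) (at s)"
    by (simp_all only: dir_deriv_line)
qed

text \<open>Mean values are a real tool, so the real version is applied to the real and the
  imaginary part through the functional \<open>L\<close>.\<close>

lemma C2_mixed:
  assumes f: "C2 f"
  shows "dir_deriv (dir_deriv f 1) \<i> z = dir_deriv (dir_deriv f \<i>) 1 z"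
proof -
  have re: "((\<lambda>s. g (Complex s y)) has_vector_derivative dir_deriv g 1 (Complex x y)) (at x)"
    if "\<And>z s. ((\<lambda>s. g (z + of_real s * 1)) has_vector_derivative dir_deriv g 1 (z + of_real s * 1)) (at s)" for g x y
    using that[of "\<i> * of_real y" x] by (simp add: Complex_eq add.commute)
  have im: "((\<lambda>s. g (Complex x s)) has_vector_derivative dir_deriv g \<i> (Complex x y)) (at y)"
    if "\<And>z s. ((\<lambda>s. g (z + of_real s * \<i>)) has_vector_derivative dir_deriv g \<i> (z + of_real s * \<i>)) (at s)" for g x y
    using that[of "of_real x" y] by (simp add: Complex_eq mult.commute)
  have c: "continuous_on UNIV (\<lambda>(x, y). L (dir_deriv (dir_deriv f v) v' (Complex x y)))" if "bounded_linear L" for v v' and L :: "complex \<Rightarrow> real"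
  proof -
    have cc: "continuous_on UNIV (\<lambda>p. Complex (fst p) (snd p))" by (intro continuous_intros)
    have "continuous_on UNIV (dir_deriv (dir_deriv f v) v')" using f unfolding C2_def by blast
    from continuous_on_compose2[OF this cc]
    have "continuous_on UNIV (\<lambda>p. dir_deriv (dir_deriv f v) v' (Complex (fst p) (snd p)))" by simp
    from bounded_linear.continuous_on[OF that this] show ?thesis by (simp add: case_prod_unfold)
  qed
  have L: "L (dir_deriv (dir_deriv f 1) \<i> (Complex x y)) = L (dir_deriv (dir_deriv f \<i>) 1 (Complex x y))" if L: "bounded_linear L" for L :: "complex \<Rightarrow> real" and x y
  proof (rule mixed_partials_real[of "\<lambda>x y. L (f (Complex x y))" "\<lambda>x y. L (dir_deriv f 1 (Complex x y))" "\<lambda>x y. L (dir_deriv f \<i> (Complex x y))"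
        "\<lambda>x y. L (dir_deriv (dir_deriv f 1) \<i> (Complex x y))" "\<lambda>x y. L (dir_deriv (dir_deriv f \<i>) 1 (Complex x y))"])
    show "((\<lambda>s. L (f (Complex s y))) has_real_derivative L (dir_deriv f 1 (Complex x y))) (at x)" for x y
      unfolding has_real_derivative_iff_has_vector_derivative
      by (intro bounded_linear.has_vector_derivative[OF L] re C2_lines[OF f])
    show "((\<lambda>s. L (f (Complex x s))) has_real_derivative L (dir_deriv f \<i> (Complex x y))) (at y)" for x y
      unfolding has_real_derivative_iff_has_vector_derivative
      by (intro bounded_linear.has_vector_derivative[OF L] im C2_lines[OF f])
    show "((\<lambda>s. L (dir_deriv f 1 (Complex x s))) has_real_derivative L (dir_deriv (dir_deriv f 1) \<i> (Complex x y))) (at y)" for x y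
      unfolding has_real_derivative_iff_has_vector_derivative
      by (intro bounded_linear.has_vector_derivative[OF L] im C2_lines[OF f])
    show "((\<lambda>s. L (dir_deriv f \<i> (Complex s y))) has_real_derivative L (dir_deriv (dir_deriv f \<i>) 1 (Complex x y))) (at x)" for x y
      unfolding has_real_derivative_iff_has_vector_derivative
      by (intro bounded_linear.has_vector_derivative[OF L] re C2_lines[OF f])
  qed (rule c[OF L])+
  from L[OF bounded_linear_Re, of "Re z" "Im z"] L[OF bounded_linear_Im, of "Re z" "Im z"]
  show ?thesis by (simp add: complex_eq_iff)
qed

text \<open>Equality of the mixed derivatives turns the second Wirtinger derivative into a quarter
  of the flat Laplacian, and the first order term becomes a rotation field. This is the shape of
  \<open>pde\<close> in \<open>bounded_heat_solution\<close>.\<close>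

lemma magnetic_laplacian_C2:
  assumes f: "C2 f"
  shows "- magnetic_laplacian \<nu> f z = of_real ((1 + (norm z)\<^sup>2)\<^sup>2 / 4) * (dir_deriv (dir_deriv f 1) 1 z + dir_deriv (dir_deriv f \<i>) \<i> z)
        + of_nat \<nu> * of_real (1 + (norm z)\<^sup>2) * \<i> * (of_real (Im z) * dir_deriv f 1 z - of_real (Re z) * dir_deriv f \<i> z)
        - of_real ((real \<nu>)\<^sup>2 * (norm z)\<^sup>2) * f z"
proof -
  have d: "dir_deriv (wirtinger_bar f) v z = (dir_deriv (dir_deriv f 1) v z + \<i> * dir_deriv (dir_deriv f \<i>) v z) / 2" for v
  proof -
    have D: "(dir_deriv f u has_derivative frechet_derivative (dir_deriv f u) (at z)) (at z)" for u
      using f frechet_derivative_works unfolding C2_def by blast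
    have "((\<lambda>z. 1 / 2 * (dir_deriv f 1 z + \<i> * dir_deriv f \<i> z)) has_derivative
        (\<lambda>h. 1 / 2 * (frechet_derivative (dir_deriv f 1) (at z) h + \<i> * frechet_derivative (dir_deriv f \<i>) (at z) h))) (at z)"
      by (intro has_derivative_mult_right has_derivative_add D)
    moreover have "wirtinger_bar f = (\<lambda>z. 1 / 2 * (dir_deriv f 1 z + \<i> * dir_deriv f \<i> z))"
      by (simp add: wirtinger_bar_def fun_eq_iff)
    ultimately have "(wirtinger_bar f has_derivative
        (\<lambda>h. 1 / 2 * (frechet_derivative (dir_deriv f 1) (at z) h + \<i> * frechet_derivative (dir_deriv f \<i>) (at z) h))) (at z)"
      by simp
    from fun_cong[OF frechet_derivative_at[OF this], of v] show ?thesis by (simp add: dir_deriv_def)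
  qed
  have w: "wirtinger (wirtinger_bar f) z = (dir_deriv (dir_deriv f 1) 1 z + dir_deriv (dir_deriv f \<i>) \<i> z) / 4"
    unfolding wirtinger_def d C2_mixed[OF f] by (simp add: field_simps)
  have z: "z = of_real (Re z) + \<i> * of_real (Im z)" by (simp add: complex_eq)
  have cnj_eq: "cnj z = of_real (Re z) - \<i> * of_real (Im z)" by (simp add: complex_eq_iff)
  have w1: "z * wirtinger f z - cnj z * wirtinger_bar f z = \<i> * (of_real (Im z) * dir_deriv f 1 z - of_real (Re z) * dir_deriv f \<i> z)"
  proof -
    have "(x + \<i> * y) * ((p - \<i> * q) / 2) - (x - \<i> * y) * ((p + \<i> * q) / 2) = \<i> * (y * p - x * q)" for x y p q :: complex
      by (simp add: field_simps)
    from this[of "of_real (Re z)" "of_real (Im z)", folded z cnj_eq] show ?thesis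
      unfolding wirtinger_def wirtinger_bar_def .
  qed
  show ?thesis unfolding magnetic_laplacian_def w w1 by (simp add: algebra_simps add_divide_distrib diff_divide_distrib)
qed

lemma heat_regular_C2:
  assumes "heat_regular K" "t > 0"
  shows "C2 (\<lambda>x. K t x w)"
proof -
  have "continuous_on UNIV (dir_deriv (dir_deriv (\<lambda>x. K t x w) v) v')" for v v'
  proof -
    have "continuous_on ({0<..} \<times> UNIV \<times> UNIV) (\<lambda>(t, z, w). dir_deriv (dir_deriv (\<lambda>x. K t x w) v) v' z)"
      using assms unfolding heat_regular_def by blast
    then have "continuous_on UNIV (\<lambda>z. (\<lambda>(t, z, w). dir_deriv (dir_deriv (\<lambda>x. K t x w) v) v' z) (t, z, w))"
      by (rule continuous_on_compose2) (use assms in \<open>auto intro!: continuous_intros\<close>)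
    then show ?thesis by simp
  qed
  moreover have "(\<lambda>x. K t x w) differentiable (at z)" "dir_deriv (\<lambda>x. K t x w) v differentiable (at z)" for v z
    using assms by (simp_all add: heat_regular_def)
  ultimately show ?thesis unfolding C2_def by simp
qed

lemma heat_regular_max_principle:
  assumes K: "heat_regular K"
    and heat: "\<And>t z. t > 0 \<Longrightarrow> ((\<lambda>s. K s z w) has_vector_derivative - magnetic_laplacian \<nu> (\<lambda>x. K t x w) z) (at t)"
    and bdd: "\<And>t z. 0 < t \<Longrightarrow> t \<le> T \<Longrightarrow> norm (K t z w) \<le> C"
    and init: "\<And>e. e > 0 \<Longrightarrow> \<exists>\<delta>>0. \<forall>t z. 0 < t \<longrightarrow> t < \<delta> \<longrightarrow> norm (K t z w) \<le> M + e"
    and M: "M \<ge> 0" and t: "0 < t" "t \<le> T"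
  shows "norm (K t z w) \<le> M"
proof -
  note C2 = heat_regular_C2[OF K]
  interpret bounded_heat_solution "\<lambda>t z. K t z w" "\<lambda>t z. - magnetic_laplacian \<nu> (\<lambda>x. K t x w) z"
    "\<lambda>t. dir_deriv (\<lambda>x. K t x w) 1" "\<lambda>t. dir_deriv (\<lambda>x. K t x w) \<i>"
    "\<lambda>t. dir_deriv (dir_deriv (\<lambda>x. K t x w) 1) 1" "\<lambda>t. dir_deriv (dir_deriv (\<lambda>x. K t x w) \<i>) \<i>" \<nu> T M C
  proof
    have "continuous_on ({0<..} \<times> UNIV \<times> UNIV) (\<lambda>(t, z, w). K t z w)" using K unfolding heat_regular_def by blast
    then have "continuous_on ({0<..T} \<times> UNIV) (\<lambda>p. (\<lambda>(t, z, w). K t z w) (fst p, snd p, w))"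
      by (rule continuous_on_compose2) (auto intro!: continuous_intros)
    then show "continuous_on ({0<..T} \<times> UNIV) (\<lambda>(t, z). K t z w)" by (simp add: case_prod_unfold)
    fix t :: real and z :: complex and s :: real
    assume t: "0 < t"
    show "((\<lambda>s. K t (z + of_real s) w) has_vector_derivative dir_deriv (\<lambda>x. K t x w) 1 (z + of_real s)) (at s)"
      using C2_lines(1)[OF C2[OF t], where e = 1 and z = z and s = s] by simp
    show "((\<lambda>s. K t (z + of_real s * \<i>) w) has_vector_derivative dir_deriv (\<lambda>x. K t x w) \<i> (z + of_real s * \<i>)) (at s)"
      using C2_lines(1)[OF C2[OF t], where e = \<i> and z = z and s = s] by simp
    show "((\<lambda>s. dir_deriv (\<lambda>x. K t x w) 1 (z + of_real s)) has_vector_derivative dir_deriv (dir_deriv (\<lambda>x. K t x w) 1) 1 z) (at 0)"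
      using C2_lines(2)[OF C2[OF t], where v = 1 and e = 1 and z = z and s = 0] by simp
    show "((\<lambda>s. dir_deriv (\<lambda>x. K t x w) \<i> (z + of_real s * \<i>)) has_vector_derivative dir_deriv (dir_deriv (\<lambda>x. K t x w) \<i>) \<i> z) (at 0)"
      using C2_lines(2)[OF C2[OF t], where v = \<i> and e = \<i> and z = z and s = 0] by simp
    show "- magnetic_laplacian \<nu> (\<lambda>x. K t x w) z = of_real ((1 + (norm z)\<^sup>2)\<^sup>2 / 4) *
        (dir_deriv (dir_deriv (\<lambda>x. K t x w) 1) 1 z + dir_deriv (dir_deriv (\<lambda>x. K t x w) \<i>) \<i> z)
        + of_nat \<nu> * of_real (1 + (norm z)\<^sup>2) * \<i> * (of_real (Im z) * dir_deriv (\<lambda>x. K t x w) 1 z - of_real (Re z) * dir_deriv (\<lambda>x. K t x w) \<i> z)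
        - of_real ((real \<nu>)\<^sup>2 * (norm z)\<^sup>2) * K t z w"
      by (rule magnetic_laplacian_C2[OF C2[OF t]])
    show "norm (K t z w) \<le> C" if "t \<le> T" by (rule bdd[OF t that])
    show "((\<lambda>s. K s z w) has_vector_derivative - magnetic_laplacian \<nu> (\<lambda>x. K t x w) z) (at t)" by (rule heat[OF t])
  next
    show "\<exists>\<delta>>0. \<forall>t z. 0 < t \<longrightarrow> t < \<delta> \<longrightarrow> norm (K t z w) \<le> M + e" if "e > 0" for e
      by (rule init[OF that])
    show "M \<ge> 0" by (rule M)
  qed
  show ?thesis by (rule max_principle[OF t])
qed

section \<open>Bounds for the radial profile\<close>

lemma norm_bundle_factor: "norm (bundle_factor \<nu> \<alpha> \<beta> z) = overlap \<alpha> \<beta> z ^ \<nu>"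
proof -
  have "norm (rho z) = 1 + (norm z)\<^sup>2" "norm (sig \<alpha> \<beta>) = (norm \<alpha>)\<^sup>2 + (norm \<beta>)\<^sup>2"
    unfolding rho_altdef sig_altdef norm_of_real by (simp_all add: add_nonneg_nonneg)
  then show ?thesis
    by (simp add: bundle_factor_def overlap_def norm_mult norm_power norm_divide power_mult power_divide power_mult_distrib)
qed

lemma norm_mono_kernel: "norm (mono_kernel \<nu> c t \<alpha> \<beta> z) = \<bar>overlap \<alpha> \<beta> z ^ \<nu> * heat_profile \<nu> c t (overlap \<alpha> \<beta> z)\<bar>"
  using overlap_bounds(1)[of \<alpha> \<beta> z] by (simp add: mono_kernel_def norm_mult norm_bundle_factor abs_mult)

lemma heat_profile_finite:
  assumes "\<And>l. l > n \<Longrightarrow> c l = 0"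
  shows "heat_profile \<nu> c t x = (\<Sum>l\<le>n. exp (- mono_eigenvalue \<nu> l * t) * (c l * poly (jacobi (2 * \<nu>) l) x))"
  unfolding heat_profile_def heat_series_def weighted_jacobi_def
  by (subst suminf_finite[of "{..n}"]) (use assms in auto)

text \<open>The eigensum times the bundle factor of the point 0 solves the heat equation and starts
  below \<open>M\<close>. At the pole \<open>z = 0\<close> the bundle factor and all Jacobi
  polynomials are 1, so the maximum principle there bounds the sum of the damped
  coefficients.\<close>

lemma finite_eigensum_contraction:
  assumes c: "\<And>l. l > n \<Longrightarrow> c l = 0" and t: "t > 0"
    and M: "\<And>x. x \<in> {0..1} \<Longrightarrow> \<bar>x ^ \<nu> * (\<Sum>l\<le>n. c l * poly (jacobi (2 * \<nu>) l) x)\<bar> \<le> M"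
  shows "\<bar>\<Sum>l\<le>n. exp (- mono_eigenvalue \<nu> l * t) * c l\<bar> \<le> M"
proof -
  let ?R = "jacobi (2 * \<nu>)"
  let ?e = "\<lambda>l t. exp (- mono_eigenvalue \<nu> l * t)"
  have gc: "geo_coeffs c" by (rule geo_coeffs_finite[OF c])
  obtain A D where AD: "\<And>l x. \<bar>x\<bar> \<le> 2 \<Longrightarrow> \<bar>poly (?R l) x\<bar> \<le> A * D ^ l"
    by (rule geo_polys_bound[OF geo_polys_jacobi]) (rule that; blast)
  define b where "b l = A * D ^ l" for l
  have b: "\<bar>poly (?R l) x\<bar> \<le> b l" if "x \<in> {0..1}" for l x using AD[of x l] that by (simp add: b_def)
  have b0: "b l \<ge> 0" for l using b[of 0 l] by simp
  have lam0: "mono_eigenvalue \<nu> l \<ge> 0" for l by (simp add: mono_eigenvalue_def)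
  define C where "C = (\<Sum>l\<le>n. \<bar>c l\<bar> * b l)"
  \<comment> \<open>The pair \<open>(1, 0)\<close> represents the point 0; the third argument is a
    dummy that fits the type of a kernel.\<close>
  define K where "K = (\<lambda>t z (w::complex). mono_kernel \<nu> c t 1 0 z)"
  have X: "overlap 1 0 z \<in> {0..1}" for z using overlap_bounds by auto
  have Kn: "norm (K s z w) = \<bar>overlap 1 0 z ^ \<nu> * (\<Sum>l\<le>n. ?e l s * (c l * poly (?R l) (overlap 1 0 z)))\<bar>" for s z w
  proof -
    have "heat_profile \<nu> c s x = (\<Sum>l\<le>n. ?e l s * (c l * poly (?R l) x))" for x
      by (rule heat_profile_finite) (rule c)
    then show ?thesis by (simp add: K_def norm_mono_kernel)
  qed
  have pow: "\<bar>overlap 1 0 z ^ \<nu> * y\<bar> \<le> \<bar>y\<bar>" for z y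
    using overlap_bounds[of 1 0 z] by (simp add: abs_mult power_le_one mult_left_le_one_le)
  have M0: "M \<ge> 0" using M[of 0] by (meson abs_ge_zero atLeastAtMost_iff order_refl order_trans zero_le_one)
  have "norm (K t 0 0) \<le> M"
  proof (rule heat_regular_max_principle[where K = K and w = 0 and \<nu> = \<nu> and T = t and C = C])
    show "heat_regular K"
      by (rule heat_regular_mono_kernel[of "\<lambda>_. 1" "\<lambda>_. 0" c]) (auto simp: K_def gc)
    show "((\<lambda>s. K s z 0) has_vector_derivative - magnetic_laplacian \<nu> (\<lambda>x. K t x 0) z) (at t)" if "t > 0" for t z
      unfolding K_def using mono_kernel_heat_equation[OF gc that, of 1 0] by simp
    show "norm (K s z 0) \<le> C" if s: "0 < s" for s z
    proof -
      have "norm (K s z 0) \<le> (\<Sum>l\<le>n. \<bar>?e l s * (c l * poly (?R l) (overlap 1 0 z))\<bar>)"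
        unfolding Kn by (rule order_trans[OF pow sum_abs])
      also have "\<dots> \<le> C" unfolding C_def
      proof (rule sum_mono)
        fix l
        have "?e l s * (\<bar>c l\<bar> * \<bar>poly (?R l) (overlap 1 0 z)\<bar>) \<le> 1 * (\<bar>c l\<bar> * b l)"
          using lam0[of l] s b0 by (intro mult_mono mult_nonneg_nonneg b X) auto
        then show "\<bar>?e l s * (c l * poly (?R l) (overlap 1 0 z))\<bar> \<le> \<bar>c l\<bar> * b l" by (simp add: abs_mult)
      qed
      finally show ?thesis .
    qed
    show "\<exists>\<delta>>0. \<forall>s z. 0 < s \<longrightarrow> s < \<delta> \<longrightarrow> norm (K s z 0) \<le> M + e" if e: "e > 0" for e
    proof -
      have "((\<lambda>s. \<Sum>l\<le>n. (1 - ?e l s) * (\<bar>c l\<bar> * b l)) \<longlongrightarrow> (\<Sum>l\<le>n. (1 - ?e l 0) * (\<bar>c l\<bar> * b l))) (at_right 0)"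
        by (intro tendsto_intros)
      then have "((\<lambda>s. \<Sum>l\<le>n. (1 - ?e l s) * (\<bar>c l\<bar> * b l)) \<longlongrightarrow> 0) (at_right 0)" by simp
      then have "eventually (\<lambda>s. (\<Sum>l\<le>n. (1 - ?e l s) * (\<bar>c l\<bar> * b l)) < e) (at_right 0)"
        using e by (rule order_tendstoD)
      then obtain \<delta> where \<delta>: "\<delta> > 0" "\<And>s. 0 < s \<Longrightarrow> s < \<delta> \<Longrightarrow> (\<Sum>l\<le>n. (1 - ?e l s) * (\<bar>c l\<bar> * b l)) < e"
        unfolding eventually_at_right_field by auto
      have "norm (K s z 0) \<le> M + e" if s: "0 < s" "s < \<delta>" for s z
      proof -
        let ?x = "overlap 1 0 z"
        have eq: "?x ^ \<nu> * (\<Sum>l\<le>n. ?e l s * (c l * poly (?R l) ?x))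
           = ?x ^ \<nu> * (\<Sum>l\<le>n. c l * poly (?R l) ?x) - ?x ^ \<nu> * (\<Sum>l\<le>n. (1 - ?e l s) * (c l * poly (?R l) ?x))"
          by (simp add: algebra_simps sum_subtractf)
        have "norm (K s z 0) \<le> \<bar>?x ^ \<nu> * (\<Sum>l\<le>n. c l * poly (?R l) ?x)\<bar> + \<bar>?x ^ \<nu> * (\<Sum>l\<le>n. (1 - ?e l s) * (c l * poly (?R l) ?x))\<bar>"
          unfolding Kn eq by (rule abs_triangle_ineq4)
        also have "\<bar>?x ^ \<nu> * (\<Sum>l\<le>n. (1 - ?e l s) * (c l * poly (?R l) ?x))\<bar> \<le> (\<Sum>l\<le>n. \<bar>(1 - ?e l s) * (c l * poly (?R l) ?x)\<bar>)"
          by (rule order_trans[OF pow sum_abs])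
        also have "\<dots> \<le> (\<Sum>l\<le>n. (1 - ?e l s) * (\<bar>c l\<bar> * b l))"
        proof (rule sum_mono)
          fix l
          have p: "0 \<le> 1 - ?e l s" using lam0[of l] s by simp
          then have "(1 - ?e l s) * (\<bar>c l\<bar> * \<bar>poly (?R l) ?x\<bar>) \<le> (1 - ?e l s) * (\<bar>c l\<bar> * b l)"
            by (intro mult_left_mono b X) auto
          then show "\<bar>(1 - ?e l s) * (c l * poly (?R l) ?x)\<bar> \<le> (1 - ?e l s) * (\<bar>c l\<bar> * b l)"
            using p by (simp add: abs_mult)
        qed
        also have "\<dots> \<le> e" using \<delta>(2)[OF s] by simp
        finally show ?thesis using M[OF X[of z]] by simp
      qed
      then show ?thesis using \<delta>(1) by blast
    qed
  qed (use M0 t in auto)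
  moreover have "overlap 1 0 0 = 1" by (simp add: overlap_def)
  ultimately show ?thesis unfolding Kn by (simp add: poly_jacobi_1)
qed

abbreviation sphere_profile :: "nat \<Rightarrow> real \<Rightarrow> real \<Rightarrow> real" where
  "sphere_profile \<nu> \<equiv> heat_profile \<nu> (sphere_coeff \<nu>)"

lemma continuous_on_heat_profile:
  assumes "geo_coeffs c" "t > 0"
  shows "continuous_on {0..1} (heat_profile \<nu> c t)"
proof -
  have "continuous_on {0..1} (\<lambda>x. (\<lambda>(t, x). heat_profile \<nu> c t x) (t, x))"
    unfolding heat_profile_def
    by (rule continuous_on_compose2[OF continuous_on_heat_series[OF geo_polys_weighted_jacobi[OF assms(1)] mono_eigenvalue_ge]])
      (use assms in \<open>auto intro!: continuous_intros\<close>)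
  then show ?thesis by simp
qed

text \<open>\<open>sphere_coeff\<close> cancels the norms in the orthogonality relations, so pairing
  with the profile reproduces the evolved eigensum at the pole. Uniform convergence permits the
  termwise integration.\<close>

lemma integral_profile_eigensum:
  assumes t: "t > 0"
  shows "integral {0..1} (\<lambda>x. x ^ (2 * \<nu>) * sphere_profile \<nu> t x * (\<Sum>l\<le>n. c l * poly (jacobi (2 * \<nu>) l) x))
     = (\<Sum>l\<le>n. exp (- mono_eigenvalue \<nu> l * t) * c l)"
proof -
  let ?R = "jacobi (2 * \<nu>)" and ?e = "\<lambda>l. exp (- mono_eigenvalue \<nu> l * t)"
  let ?q = "\<lambda>x. \<Sum>l\<le>n. c l * poly (?R l) x"
  let ?S = "\<lambda>N x. \<Sum>m<N. ?e m * poly (weighted_jacobi \<nu> (sphere_coeff \<nu>) m) x"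
  have u: "uniform_limit {0..1} ?S (sphere_profile \<nu> t) sequentially"
    unfolding heat_profile_def
    by (rule uniform_limit_on_subset[OF uniform_limit_heat_series[OF geo_polys_weighted_jacobi[OF geo_coeffs_sphere] mono_eigenvalue_ge t]]) auto
  have bnd: "bounded (f ` {0..1})" if "continuous_on {0..1} f" for f :: "real \<Rightarrow> real"
    by (intro compact_imp_bounded compact_continuous_image that) auto
  have cq: "continuous_on {0..1} (\<lambda>x. x ^ (2 * \<nu>) * ?q x)" by (intro continuous_intros)
  have "uniform_limit {0..1} (\<lambda>N x. ?S N x * (x ^ (2 * \<nu>) * ?q x)) (\<lambda>x. sphere_profile \<nu> t x * (x ^ (2 * \<nu>) * ?q x)) sequentially"
    by (intro uniform_lim_mult u uniform_limit_const bnd cq continuous_on_heat_profile geo_coeffs_sphere t)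
  then obtain I J where IJ: "\<And>N. ((\<lambda>x. ?S N x * (x ^ (2 * \<nu>) * ?q x)) has_integral I N) {0..1}"
    "((\<lambda>x. sphere_profile \<nu> t x * (x ^ (2 * \<nu>) * ?q x)) has_integral J) {0..1}" "I \<longlonglongrightarrow> J"
    by (rule uniform_limit_integral) (auto intro!: continuous_intros)
  have "I N = (\<Sum>l\<le>n. ?e l * c l)" if N: "N > n" for N
  proof -
    have "((\<lambda>x. \<Sum>m<N. \<Sum>l\<le>n. ?e m * sphere_coeff \<nu> m * c l * (x ^ (2 * \<nu>) * poly (?R m) x * poly (?R l) x)) has_integral
        (\<Sum>m<N. \<Sum>l\<le>n. ?e m * sphere_coeff \<nu> m * c l * (if m = l then 1 / (2 * real m + real (2 * \<nu>) + 1) else 0))) {0..1}"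
      by (intro has_integral_sum has_integral_mult_right has_integral_jacobi_orthogonal) auto
    moreover have "(\<Sum>m<N. \<Sum>l\<le>n. ?e m * sphere_coeff \<nu> m * c l * (if m = l then 1 / (2 * real m + real (2 * \<nu>) + 1) else 0))
       = (\<Sum>l\<le>n. ?e l * c l)"
    proof -
      have nz: "sphere_coeff \<nu> m * (1 / (2 * real m + real (2 * \<nu>) + 1)) = 1" for m
      proof -
        have "2 * real m + real (2 * \<nu>) + 1 \<noteq> 0" by linarith
        then show ?thesis by (simp add: sphere_coeff_def)
      qed
      have "(\<Sum>m<N. ?e m * sphere_coeff \<nu> m * c l * (if m = l then 1 / (2 * real m + real (2 * \<nu>) + 1) else 0)) = ?e l * c l"
        if "l \<le> n" for l
      proof -
        have "(\<Sum>m<N. ?e m * sphere_coeff \<nu> m * c l * (if m = l then 1 / (2 * real m + real (2 * \<nu>) + 1) else 0))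
          = (\<Sum>m<N. if m = l then ?e m * c l * (sphere_coeff \<nu> m * (1 / (2 * real m + real (2 * \<nu>) + 1))) else 0)"
          by (intro sum.cong) auto
        then show ?thesis unfolding nz using N that by (simp add: sum.delta)
      qed
      then show ?thesis by (subst sum.swap) simp
    qed
    moreover have "(\<Sum>m<N. \<Sum>l\<le>n. ?e m * sphere_coeff \<nu> m * c l * (x ^ (2 * \<nu>) * poly (?R m) x * poly (?R l) x))
       = ?S N x * (x ^ (2 * \<nu>) * ?q x)" for x
      by (simp add: weighted_jacobi_def sum_distrib_left sum_distrib_right mult_ac)
    ultimately show ?thesis using IJ(1)[of N] by (simp add: has_integral_unique)
  qed
  then have "I \<longlonglongrightarrow> (\<Sum>l\<le>n. ?e l * c l)"
    by (intro tendsto_eventually) (auto simp: eventually_at_top_dense)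
  then have "J = (\<Sum>l\<le>n. ?e l * c l)" using IJ(3) LIMSEQ_unique by blast
  then show ?thesis using integral_unique[OF IJ(2)] by (simp add: mult_ac)
qed

text \<open>The dual form of the contraction: pairing with the profile is a functional of norm at
  most 1 for the supremum of \<open>x ^ \<nu> * q\<close>.\<close>

lemma integral_profile_poly_bound:
  assumes t: "t > 0" and M: "\<And>x. x \<in> {0..1} \<Longrightarrow> \<bar>x ^ \<nu> * poly q x\<bar> \<le> M"
  shows "\<bar>integral {0..1} (\<lambda>x. x ^ (2 * \<nu>) * sphere_profile \<nu> t x * poly q x)\<bar> \<le> M"
proof -
  obtain c where c: "q = (\<Sum>l\<le>degree q. smult (c l) (jacobi (2 * \<nu>) l))"
    using jacobi_expansion[of "degree q" q "2 * \<nu>"] coeff_eq_0 by blast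
  define n where "n = degree q"
  define c' where "c' l = (if l \<le> n then c l else 0)" for l
  have q: "poly q x = (\<Sum>l\<le>n. c' l * poly (jacobi (2 * \<nu>) l) x)" for x
    by (subst c) (simp add: n_def c'_def poly_sum)
  have "\<bar>\<Sum>l\<le>n. exp (- mono_eigenvalue \<nu> l * t) * c' l\<bar> \<le> M"
    by (rule finite_eigensum_contraction[OF _ t]) (use M q in \<open>auto simp: c'_def\<close>)
  then show ?thesis unfolding q integral_profile_eigensum[OF t] .
qed

text \<open>The functional is tested on a polynomial close to a smoothed sign of \<open>k\<close>,
  divided by \<open>x ^ \<nu>\<close>.\<close>

lemma integral_profile_L1:
  assumes t: "t > 0"
  shows "integral {0..1} (\<lambda>x. \<bar>x ^ \<nu> * sphere_profile \<nu> t x\<bar>) \<le> 1"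
proof -
  define P where "P = sphere_profile \<nu> t"
  define k where "k x = x ^ \<nu> * P x" for x
  have cP: "continuous_on {0..1} P" unfolding P_def by (rule continuous_on_heat_profile[OF geo_coeffs_sphere t])
  have ck: "continuous_on {0..1} k" unfolding k_def by (intro continuous_intros cP)
  have "bounded (P ` {0..1})" by (intro compact_imp_bounded compact_continuous_image cP) auto
  then obtain A where "\<forall>y\<in>P ` {0..1}. norm y \<le> A" unfolding bounded_iff by blast
  then have A: "\<And>x. x \<in> {0..1} \<Longrightarrow> \<bar>P x\<bar> \<le> A" by simp
  have A0: "A \<ge> 0" using A[of 0] by auto
  have pow: "x ^ m \<le> 1" "x ^ m \<ge> 0" if "x \<in> {0..1}" for x :: real and m using that by (auto simp: power_le_one)
  have main: "integral {0..1} (\<lambda>x. \<bar>k x\<bar>) \<le> 1 + (2 + A) * \<delta>" if \<delta>: "\<delta> > 0" for \<delta>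
  proof -
    \<comment> \<open>With \<open>P\<close> in the numerator instead of \<open>k\<close>, the
      division by \<open>x ^ \<nu>\<close> is built in and \<open>g\<close> is continuous at 0
      too.\<close>
    define g where "g x = P x / (\<bar>k x\<bar> + \<delta>)" for x
    have den: "\<bar>k x\<bar> + \<delta> > 0" for x using \<delta> by (simp add: add_nonneg_pos)
    have cg: "continuous_on {0..1} g" unfolding g_def
      by (intro continuous_intros cP ck) (use den in \<open>auto simp: less_imp_neq[symmetric]\<close>)
    obtain p where p: "\<And>x. x \<in> {0..1} \<Longrightarrow> \<bar>g x - poly p x\<bar> < \<delta>"
      by (rule polynomial_approximation[OF cg \<delta>]) (rule that; blast)
    have xg: "\<bar>x ^ \<nu> * g x\<bar> \<le> 1" for x
    proof -
      have "x ^ \<nu> * g x = k x / (\<bar>k x\<bar> + \<delta>)" by (simp add: g_def k_def)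
      moreover have "\<bar>k x / (\<bar>k x\<bar> + \<delta>)\<bar> = \<bar>k x\<bar> / (\<bar>k x\<bar> + \<delta>)"
        unfolding abs_divide abs_of_pos[OF den] ..
      moreover have "\<dots> \<le> 1" unfolding divide_le_eq_1_pos[OF den] using \<delta> by simp
      ultimately show ?thesis by (simp only:)
    qed
    have 1: "\<bar>integral {0..1} (\<lambda>x. x ^ (2 * \<nu>) * P x * poly p x)\<bar> \<le> 1 + \<delta>"
      unfolding P_def
    proof (rule integral_profile_poly_bound[OF t])
      fix x :: real assume x: "x \<in> {0..1}"
      have "\<bar>x ^ \<nu> * (poly p x - g x)\<bar> \<le> 1 * \<delta>"
        unfolding abs_mult using pow[OF x, of \<nu>] p[OF x] by (intro mult_mono) auto
      moreover have "x ^ \<nu> * poly p x = x ^ \<nu> * g x + x ^ \<nu> * (poly p x - g x)" by (simp add: algebra_simps)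
      ultimately show "\<bar>x ^ \<nu> * poly p x\<bar> \<le> 1 + \<delta>"
        using xg[of x] abs_triangle_ineq[of "x ^ \<nu> * g x" "x ^ \<nu> * (poly p x - g x)"] by linarith
    qed
    \<comment> \<open>The error has two sources: \<open>\<delta>\<close> from smoothing the sign and
      \<open>A * \<delta>\<close> from replacing \<open>g\<close> by a polynomial.\<close>
    have pt: "\<bar>k x\<bar> \<le> x ^ (2 * \<nu>) * P x * poly p x + (1 + A) * \<delta>" if x: "x \<in> {0..1}" for x
    proof -
      have "\<bar>x ^ (2 * \<nu>) * P x * (g x - poly p x)\<bar> \<le> (1 * A) * \<delta>"
        unfolding abs_mult using pow[OF x, of "2 * \<nu>"] p[OF x] A[OF x] A0 by (intro mult_mono) auto
      then have "x ^ (2 * \<nu>) * P x * g x \<le> x ^ (2 * \<nu>) * P x * poly p x + A * \<delta>"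
        by (simp add: algebra_simps abs_le_iff)
      moreover have "x ^ (2 * \<nu>) * P x * g x = (k x)\<^sup>2 / (\<bar>k x\<bar> + \<delta>)"
        by (simp add: g_def k_def power_mult power2_eq_square power_mult_distrib mult_ac)
      moreover have "\<bar>k x\<bar> \<le> (k x)\<^sup>2 / (\<bar>k x\<bar> + \<delta>) + \<delta>"
      proof -
        have "\<bar>k x\<bar> - \<delta> = (\<bar>k x\<bar>\<^sup>2 - \<delta>\<^sup>2) / (\<bar>k x\<bar> + \<delta>)" using den[of x] by (simp add: field_simps power2_eq_square)
        also have "\<dots> \<le> (k x)\<^sup>2 / (\<bar>k x\<bar> + \<delta>)" using den[of x] by (intro divide_right_mono) auto
        finally show ?thesis by simp
      qed
      ultimately show ?thesis by (simp add: algebra_simps)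
    qed
    have "integral {0..1} (\<lambda>x. \<bar>k x\<bar>) \<le> integral {0..1} (\<lambda>x. x ^ (2 * \<nu>) * P x * poly p x + (1 + A) * \<delta>)"
      by (intro integral_le integrable_continuous_real continuous_intros ck cP pt)
    also have "\<dots> = integral {0..1} (\<lambda>x. x ^ (2 * \<nu>) * P x * poly p x) + (1 + A) * \<delta>"
      by (subst Henstock_Kurzweil_Integration.integral_add) (auto intro!: integrable_continuous_real continuous_intros cP)
    finally show ?thesis using 1 by (simp add: algebra_simps)
  qed
  have "integral {0..1} (\<lambda>x. \<bar>k x\<bar>) \<le> 1"
  proof (rule field_le_epsilon)
    fix e :: real assume "e > 0"
    then show "integral {0..1} (\<lambda>x. \<bar>k x\<bar>) \<le> 1 + e"
      using main[of "e / (2 + A)"] A0 by simp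
  qed
  then show ?thesis unfolding k_def P_def .
qed

text \<open>The constant polynomial is the Jacobi polynomial of degree 0, and its eigenvalue is
  \<open>real \<nu>\<close>.\<close>

lemma integral_profile_moment:
  assumes t: "t > 0"
  shows "integral {0..1} (\<lambda>x. x ^ (2 * \<nu>) * sphere_profile \<nu> t x) = exp (- real \<nu> * t)"
proof -
  have "jacobi (2 * \<nu>) 0 = 1" by (simp add: jacobi_def monom_0 one_pCons)
  then show ?thesis using integral_profile_eigensum[OF t, of \<nu> "\<lambda>_. 1" 0] by (simp add: mono_eigenvalue_def)
qed

text \<open>As \<open>\<nu> > 0\<close>, \<open>x ^ \<nu> \<le> x\<close> on the interval, so the
  left integrand is at most \<open>\<bar>k\<bar> - x ^ \<nu> * k\<close>. The first part integrates
  to at most 1, the second is the moment.\<close>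

lemma integral_profile_concentration:
  assumes t: "t > 0" and \<nu>: "\<nu> > 0"
  shows "integral {0..1} (\<lambda>x. \<bar>x ^ \<nu> * sphere_profile \<nu> t x\<bar> * (1 - x)) \<le> 1 - exp (- real \<nu> * t)"
proof -
  define k where "k x = x ^ \<nu> * sphere_profile \<nu> t x" for x
  have ck: "continuous_on {0..1} k" unfolding k_def
    by (intro continuous_intros continuous_on_heat_profile[OF geo_coeffs_sphere t])
  have "integral {0..1} (\<lambda>x. \<bar>k x\<bar> * (1 - x)) \<le> integral {0..1} (\<lambda>x. \<bar>k x\<bar> - x ^ \<nu> * k x)"
  proof (intro integral_le integrable_continuous_real continuous_intros ck)
    fix x :: real assume x: "x \<in> {0..1}"
    obtain m where m: "\<nu> = Suc m" using \<nu> gr0_implies_Suc by blast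
    have "x ^ m \<le> 1" "0 \<le> x ^ \<nu>" using x by (auto simp: power_le_one)
    then have "x ^ \<nu> \<le> x" using x by (simp add: m mult_left_le)
    then have "\<bar>k x\<bar> * x ^ \<nu> \<le> \<bar>k x\<bar> * x" by (intro mult_left_mono) auto
    moreover have "x ^ \<nu> * k x \<le> \<bar>k x\<bar> * x ^ \<nu>" using mult_left_mono[OF abs_ge_self \<open>0 \<le> x ^ \<nu>\<close>, of "k x"] by (simp add: mult.commute)
    ultimately show "\<bar>k x\<bar> * (1 - x) \<le> \<bar>k x\<bar> - x ^ \<nu> * k x" by (simp add: algebra_simps)
  qed
  also have "\<dots> = integral {0..1} (\<lambda>x. \<bar>k x\<bar>) - integral {0..1} (\<lambda>x. x ^ \<nu> * k x)"
    by (rule Henstock_Kurzweil_Integration.integral_diff) (auto intro!: integrable_continuous_real continuous_intros ck)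
  also have "(\<lambda>x. x ^ \<nu> * k x) = (\<lambda>x. x ^ (2 * \<nu>) * sphere_profile \<nu> t x)"
    by (simp add: k_def fun_eq_iff power_mult power2_eq_square power_mult_distrib)
  finally show ?thesis using integral_profile_L1[OF t, of \<nu>] unfolding integral_profile_moment[OF t] k_def by linarith
qed

section \<open>Approximate identity\<close>

lemma integrable_sphere_continuous:
  fixes f :: "complex \<Rightarrow> 'b::{banach, second_countable_topology}"
  assumes "continuous_on UNIV f" "\<And>z. norm (f z) \<le> C"
  shows "integrable sphere_measure f"
  by (rule integrable_sphere_bounded[OF borel_measurable_continuous_onI[OF assms(1)] assms(2)])

text \<open>Continuity is all that an arbitrary heat kernel offers in its second variable, and
  uniqueness applies the approximate identity to the conjugate of such a kernel.\<close>

definition continuous_section :: "nat \<Rightarrow> (complex \<Rightarrow> complex) \<Rightarrow> bool" where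
  "continuous_section \<nu> f \<longleftrightarrow> continuous_on UNIV f \<and>
     (\<exists>g. continuous_on UNIV g \<and> (\<forall>\<zeta>. \<zeta> \<noteq> 0 \<longrightarrow> g \<zeta> = (\<zeta> / cnj \<zeta>) ^ \<nu> * f (1 / \<zeta>)))"

lemma unimodular_quotient: "\<zeta> \<noteq> 0 \<Longrightarrow> norm (\<zeta> / cnj \<zeta>) = 1" "\<zeta> \<noteq> 0 \<Longrightarrow> norm (cnj \<zeta> / \<zeta>) = 1"
  by (simp_all add: norm_divide)

text \<open>The closed unit disc and its inversion cover the sphere, and the transition factor has
  modulus 1.\<close>

lemma continuous_section_bounded:
  assumes "continuous_section \<nu> f"
  obtains B where "\<And>z. norm (f z) \<le> B"
proof -
  obtain g where f: "continuous_on UNIV f" and g: "continuous_on UNIV g" "\<And>\<zeta>. \<zeta> \<noteq> 0 \<Longrightarrow> g \<zeta> = (\<zeta> / cnj \<zeta>) ^ \<nu> * f (1 / \<zeta>)"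
    using assms unfolding continuous_section_def by blast
  have "bounded (h ` cball 0 1)" if "continuous_on UNIV h" for h :: "complex \<Rightarrow> complex"
    by (intro compact_imp_bounded compact_continuous_image continuous_on_subset[OF that]) auto
  from this[OF f] this[OF g(1)] obtain A B where
    "\<forall>y\<in>f ` cball 0 1. norm y \<le> A" "\<forall>y\<in>g ` cball 0 1. norm y \<le> B" unfolding bounded_iff by blast
  then have AB: "norm (f z) \<le> A" "norm (g z) \<le> B" if "norm z \<le> 1" for z using that by auto
  have "norm (f z) \<le> max A B" for z
  proof (cases "norm z \<le> 1")
    case True
    then show ?thesis using AB(1) by fastforce
  next
    case False
    then have z: "z \<noteq> 0" "norm (1 / z) \<le> 1" by (auto simp: norm_divide divide_le_eq_1)
    have "norm (g (1 / z)) = norm (f z)"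
      using z(1) unimodular_quotient(1)[of "1 / z"] by (simp add: g(2) norm_mult norm_power)
    then show ?thesis using AB(2)[OF z(2)] by simp
  qed
  then show ?thesis using that by blast
qed

text \<open>A section of charge \<open>2 * \<nu>\<close> lifted to an equivariant function of homogeneous coordinates.\<close>

definition lift_section :: "nat \<Rightarrow> (complex \<Rightarrow> complex) \<Rightarrow> (complex \<Rightarrow> complex) \<Rightarrow> complex \<times> complex \<Rightarrow> complex" where
  "lift_section \<nu> f g = (\<lambda>(p, q). if q \<noteq> 0 then (q / cnj q) ^ \<nu> * f (p / q) else (p / cnj p) ^ \<nu> * g 0)"

lemma lift_section_p:
  assumes g: "\<And>\<zeta>. \<zeta> \<noteq> 0 \<Longrightarrow> g \<zeta> = (\<zeta> / cnj \<zeta>) ^ \<nu> * f (1 / \<zeta>)" and p: "p \<noteq> 0"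
  shows "lift_section \<nu> f g (p, q) = (p / cnj p) ^ \<nu> * g (q / p)"
proof (cases "q = 0")
  case False
  have "(p / cnj p) ^ \<nu> * ((q / p) / cnj (q / p)) ^ \<nu> = (q / cnj q) ^ \<nu>"
    using p False by (simp add: power_mult_distrib[symmetric])
  then show ?thesis using p False by (simp add: lift_section_def g mult.assoc[symmetric])
qed (simp add: lift_section_def)

lemma lift_section_scale:
  assumes "norm c = 1"
  shows "lift_section \<nu> f g (c * p, c * q) = c ^ (2 * \<nu>) * lift_section \<nu> f g (p, q)"
proof -
  have c: "c \<noteq> 0" "cnj c = 1 / c" using assms by (auto simp: divide_conv_cnj)
  have "(c * x / cnj (c * x)) ^ \<nu> = c ^ (2 * \<nu>) * (x / cnj x) ^ \<nu>" for x
  proof -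
    have "c * x / cnj (c * x) = c\<^sup>2 * (x / cnj x)" using c by (simp add: power2_eq_square)
    then show ?thesis by (simp only: power_mult_distrib power_mult)
  qed
  then show ?thesis using c(1) by (simp add: lift_section_def)
qed

lemma continuous_on_lift_section:
  assumes f: "continuous_on UNIV f" and g: "continuous_on UNIV g" "\<And>\<zeta>. \<zeta> \<noteq> 0 \<Longrightarrow> g \<zeta> = (\<zeta> / cnj \<zeta>) ^ \<nu> * f (1 / \<zeta>)"
  shows "continuous_on (- {(0, 0)}) (lift_section \<nu> f g)"
proof -
  have "continuous_on {x. snd x \<noteq> 0} (\<lambda>x::complex\<times>complex. (snd x / cnj (snd x)) ^ \<nu> * f (fst x / snd x))"
    by (intro continuous_intros continuous_on_compose2[OF f]) auto
  then have 1: "continuous_on {x. snd x \<noteq> 0} (lift_section \<nu> f g)"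
    by (rule continuous_on_eq) (auto simp: lift_section_def)
  have "continuous_on {x. fst x \<noteq> 0} (\<lambda>x::complex\<times>complex. (fst x / cnj (fst x)) ^ \<nu> * g (snd x / fst x))"
    by (intro continuous_intros continuous_on_compose2[OF g(1)]) auto
  then have 2: "continuous_on {x. fst x \<noteq> 0} (lift_section \<nu> f g)"
    by (rule continuous_on_eq) (auto simp: lift_section_p[OF g(2)])
  have "open {x::complex\<times>complex. snd x \<noteq> 0}" "open {x::complex\<times>complex. fst x \<noteq> 0}"
    by (intro open_Collect_neq continuous_intros)+
  from continuous_on_open_Un[OF this 1 2]
  show ?thesis by (rule continuous_on_subset) auto
qed

text \<open>On the compact set where \<open>G\<close> is at least \<open>e\<close>, the function
  \<open>h\<close> has a positive minimum; \<open>C\<close> is the maximum of \<open>G\<close>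
  divided by it.\<close>

lemma compact_domination:
  fixes G h :: "'a::topological_space \<Rightarrow> real"
  assumes K: "compact K" and G: "continuous_on K G" and h: "continuous_on K h"
    and h0: "\<And>x. x \<in> K \<Longrightarrow> h x \<ge> 0" and z: "\<And>x. x \<in> K \<Longrightarrow> h x = 0 \<Longrightarrow> G x \<le> 0" and e: "e > 0"
  obtains C where "C \<ge> 0" "\<And>x. x \<in> K \<Longrightarrow> G x \<le> e + C * h x"
proof -
  define K' where "K' = {x \<in> K. G x \<ge> e}"
  have cK: "compact K'"
  proof -
    have "closedin (top_of_set K) {x \<in> K. e \<le> G x}" by (intro continuous_closedin_preimage[OF G, of "{e..}", unfolded vimage_def Int_def, simplified] ) 
    then show ?thesis unfolding K'_def using K closedin_compact by blast
  qed
  show ?thesis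
  proof (cases "K' = {}")
    case True
    then show ?thesis using that[of 0] by (force simp: K'_def)
  next
    case False
    have sub: "K' \<subseteq> K" by (auto simp: K'_def)
    obtain x0 where x0: "x0 \<in> K'" "\<And>y. y \<in> K' \<Longrightarrow> h x0 \<le> h y"
      using continuous_attains_inf[OF cK False continuous_on_subset[OF h sub]] by blast
    obtain x1 where x1: "x1 \<in> K'" "\<And>y. y \<in> K' \<Longrightarrow> G y \<le> G x1"
      using continuous_attains_sup[OF cK False continuous_on_subset[OF G sub]] by blast
    have "h x0 \<noteq> 0" using z[of x0] x0(1) e by (auto simp: K'_def)
    then have hp: "h x0 > 0" using h0[of x0] x0(1) sub by force
    have Gp: "G x1 \<ge> 0" using x1(1) e by (auto simp: K'_def)
    show ?thesis
    proof (rule that[of "G x1 / h x0"])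
      show "G x1 / h x0 \<ge> 0" using hp Gp by simp
      fix x assume x: "x \<in> K"
      have nn: "0 \<le> G x1 / h x0 * h x" using hp Gp h0[OF x] by simp
      show "G x \<le> e + G x1 / h x0 * h x"
      proof (cases "x \<in> K'")
        case True
        have "G x1 / h x0 * h x0 \<le> G x1 / h x0 * h x"
          using x0(2)[OF True] hp Gp by (intro mult_left_mono) auto
        then have "G x1 \<le> G x1 / h x0 * h x" using hp by simp
        then show ?thesis using x1(2)[OF True] e by linarith
      next
        case False
        then show ?thesis using x nn by (simp add: K'_def)
      qed
    qed
  qed
qed

text \<open>Values in different fibres can be compared only after transport, which is done by the
  conjugate bundle factor. In normalised homogeneous coordinates the claim is
  \<open>compact_domination\<close> on a product of two 3-spheres, with \<open>h\<close> equal to 1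
  minus the overlap.\<close>

lemma continuous_section_modulus:
  assumes f: "continuous_section \<nu> f" and e: "e > 0"
  obtains C where "C \<ge> 0" "\<And>z w. norm (f w - cnj (bundle_factor \<nu> 1 (cnj w) z) * f z) \<le> e + C * (1 - overlap 1 (cnj w) z)"
proof -
  obtain g where cf: "continuous_on UNIV f" and g: "continuous_on UNIV g" "\<And>\<zeta>. \<zeta> \<noteq> 0 \<Longrightarrow> g \<zeta> = (\<zeta> / cnj \<zeta>) ^ \<nu> * f (1 / \<zeta>)"
    using f unfolding continuous_section_def by blast
  define L where "L = lift_section \<nu> f g"
  define S where "S = sphere (0 :: complex \<times> complex) 1"
  have S: "(norm p)\<^sup>2 + (norm q)\<^sup>2 = 1" if "(p, q) \<in> S" for p q
    using that by (simp add: S_def norm_Pair real_sqrt_eq_1_iff)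
  define pr where "pr = (\<lambda>P Q :: complex \<times> complex. fst P * cnj (fst Q) + snd P * cnj (snd Q))"
  define G where "G = (\<lambda>(P, Q). norm (L Q - cnj (pr P Q ^ (2 * \<nu>)) * L P))"
  define h where "h = (\<lambda>(P, Q). 1 - (norm (pr P Q))\<^sup>2)"
  have cL: "continuous_on S L"
    unfolding L_def by (rule continuous_on_subset[OF continuous_on_lift_section[OF cf g]]) (auto simp: S_def)
  have cpr: "continuous_on A (\<lambda>x. pr (fst x) (snd x))" for A
    unfolding pr_def by (intro continuous_intros)
  have lagrange: "1 - (norm (pr (p1, q1) (p2, q2)))\<^sup>2 = (norm (p1 * q2 - p2 * q1))\<^sup>2"
    if "(p1, q1) \<in> S" "(p2, q2) \<in> S" for p1 q1 p2 q2
  proof -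
    have "complex_of_real (((norm p1)\<^sup>2 + (norm q1)\<^sup>2) * ((norm p2)\<^sup>2 + (norm q2)\<^sup>2) - (norm (pr (p1, q1) (p2, q2)))\<^sup>2)
       = of_real ((norm (p1 * q2 - p2 * q1))\<^sup>2)"
      unfolding of_real_diff of_real_mult of_real_add complex_norm_square pr_def
      by (simp add: algebra_simps)
    then have "((norm p1)\<^sup>2 + (norm q1)\<^sup>2) * ((norm p2)\<^sup>2 + (norm q2)\<^sup>2) - (norm (pr (p1, q1) (p2, q2)))\<^sup>2 = (norm (p1 * q2 - p2 * q1))\<^sup>2"
      by (simp only: of_real_eq_iff)
    then show ?thesis unfolding S[OF that(1)] S[OF that(2)] by simp
  qed
  obtain C where C: "C \<ge> 0" "\<And>x. x \<in> S \<times> S \<Longrightarrow> G x \<le> e + C * h x"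
  proof (rule compact_domination[of "S \<times> S" G h e])
    show "compact (S \<times> S)" unfolding S_def by (intro compact_Times compact_sphere)
    show "continuous_on (S \<times> S) G"
      unfolding G_def case_prod_unfold
      by (intro continuous_intros cpr continuous_on_compose2[OF cL]) auto
    show "continuous_on (S \<times> S) h"
      unfolding h_def case_prod_unfold by (intro continuous_intros cpr)
    show "h x \<ge> 0" if "x \<in> S \<times> S" for x
      using that lagrange by (auto simp: h_def)
    show "G x \<le> 0" if xS: "x \<in> S \<times> S" and hx: "h x = 0" for x
    proof -
      obtain P Q where "x = (P, Q)" "P \<in> S" "Q \<in> S" using xS by blast
      moreover obtain p1 q1 p2 q2 where "P = (p1, q1)" "Q = (p2, q2)" by fastforce
      ultimately have x: "x = ((p1, q1), (p2, q2))" "(p1, q1) \<in> S" "(p2, q2) \<in> S" by simp_all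
      \<comment> \<open>Overlap 1 means that the two unit vectors differ by a unimodular factor
        \<open>c\<close>, and then the equivariance of the lift makes the compared values
        equal.\<close>
      have 0: "p1 * q2 = p2 * q1" using hx lagrange[OF x(2,3)] by (simp add: h_def x(1))
      have n1: "p1 * cnj p1 + q1 * cnj q1 = 1"
      proof -
        have "complex_of_real ((norm p1)\<^sup>2 + (norm q1)\<^sup>2) = 1" unfolding S[OF x(2)] by simp
        then show ?thesis by (simp add: complex_norm_square[symmetric])
      qed
      define c where "c = cnj (pr (p1, q1) (p2, q2))"
      have c: "c = cnj p1 * p2 + cnj q1 * q2" by (simp add: c_def pr_def)
      have "norm c = 1"
      proof -
        have "(norm c)\<^sup>2 = 1" using hx by (simp add: h_def x(1) c_def)
        then show ?thesis by (metis norm_ge_zero power2_eq_1_iff neg_equal_zero not_one_le_zero zero_le_one le_minus_one_simps(3))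
      qed
      have "c * p1 = p2" "c * q1 = q2" unfolding c using 0 n1 by algebra+
      then have "L (p2, q2) = c ^ (2 * \<nu>) * L (p1, q1)"
        using lift_section_scale[OF \<open>norm c = 1\<close>, of \<nu> f g p1 q1] by (simp add: L_def)
      then show ?thesis by (simp add: G_def x(1) c_def)
    qed
  qed (use e that in auto)
  have "norm (f w - cnj (bundle_factor \<nu> 1 (cnj w) z) * f z) \<le> e + C * (1 - overlap 1 (cnj w) z)" for z w
  proof -
    define r s where "r = sqrt (1 + (norm z)\<^sup>2)" and "s = sqrt (1 + (norm w)\<^sup>2)"
    have rs: "r > 0" "s > 0" "r\<^sup>2 = 1 + (norm z)\<^sup>2" "s\<^sup>2 = 1 + (norm w)\<^sup>2"
      using one_plus_norm_pos[of z] one_plus_norm_pos[of w] by (auto simp: r_def s_def)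
    define P where "P = (z / of_real r, 1 / complex_of_real r)"
    define Q where "Q = (w / of_real s, 1 / complex_of_real s)"
    have inS: "(x / of_real a, 1 / complex_of_real a) \<in> S" if "a > 0" "a\<^sup>2 = 1 + (norm x)\<^sup>2" for x :: complex and a :: real
    proof -
      have "(norm (x / of_real a))\<^sup>2 + (norm (1 / complex_of_real a))\<^sup>2 = ((norm x)\<^sup>2 + 1) / a\<^sup>2"
        using that(1) by (simp add: norm_divide power_divide add_divide_distrib)
      also have "\<dots> = 1" using that one_plus_norm_pos[of x] by (simp add: add.commute)
      finally show ?thesis by (simp add: S_def norm_Pair)
    qed
    have LP: "L (x / of_real a, 1 / complex_of_real a) = f x" if "a > 0" for x :: complex and a :: real
      using that by (simp add: L_def lift_section_def)
    have pr: "pr P Q = (1 + cnj w * z) / of_real (r * s)"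
      using rs by (simp add: pr_def P_def Q_def field_simps)
    have "sig 1 (cnj w) = of_real (s\<^sup>2)" unfolding rs sig_altdef by simp
    moreover have "rho z = of_real (r\<^sup>2)" unfolding rs rho_altdef ..
    ultimately have B: "bundle_factor \<nu> 1 (cnj w) z = pr P Q ^ (2 * \<nu>)"
      unfolding bundle_factor_def pr using rs(1,2)
      by (simp add: power_mult power_divide power_mult_distrib)
    have X: "overlap 1 (cnj w) z = (norm (pr P Q))\<^sup>2"
      unfolding pr overlap_def using rs(1,2) by (simp add: norm_divide norm_mult power_divide power_mult_distrib rs)
    have "G (P, Q) \<le> e + C * h (P, Q)"
      by (rule C(2)) (use inS rs in \<open>auto simp: P_def Q_def\<close>)
    then show ?thesis
      unfolding G_def h_def prod.case B X using LP[OF rs(1), of z] LP[OF rs(2), of w] by (simp add: P_def Q_def)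
  qed
  then show ?thesis using that C(1) by blast
qed

lemma overlap_swap: "overlap 1 (cnj w) z = overlap 1 (cnj z) w"
proof -
  have "norm (1 + cnj w * z) = norm (cnj (1 + cnj w * z))" by (rule complex_mod_cnj[symmetric])
  then show ?thesis by (simp add: overlap_def mult.commute)
qed

lemma sphere_kernel_swap: "sphere_kernel \<nu> t w z = cnj (sphere_kernel \<nu> t z w)"
proof -
  have "bundle_factor \<nu> 1 (cnj z) w = cnj (bundle_factor \<nu> 1 (cnj w) z)"
    by (simp add: bundle_factor_def sig_def rho_def mult.commute mult.left_commute)
  then show ?thesis by (simp add: sphere_kernel_def mono_kernel_def overlap_swap[of z w])
qed

lemma sphere_kernel_continuous_w:
  assumes "t > 0"
  shows "continuous_on UNIV (\<lambda>w. sphere_kernel \<nu> t z w)"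
proof -
  have "heat_regular (sphere_kernel \<nu>)"
    using regular_section_kernel_sphere_kernel[of "sphere_kernel \<nu>" \<nu>] unfolding regular_section_kernel_def by blast
  then have "continuous_on ({0<..} \<times> UNIV \<times> UNIV) (\<lambda>(t, z, w). sphere_kernel \<nu> t z w)"
    unfolding heat_regular_def by blast
  then have "continuous_on UNIV (\<lambda>w. (\<lambda>(t, z, w). sphere_kernel \<nu> t z w) (t, z, w))"
    by (rule continuous_on_compose2) (use assms in \<open>auto intro!: continuous_intros\<close>)
  then show ?thesis by simp
qed

text \<open>The section is split into the transport of \<open>f z\<close> and a remainder. The
  transported part integrates to \<open>exp (- real \<nu> * t) * f z\<close>; the remainder is at
  most \<open>e / 2 + C * (1 - X)\<close> and is handled by the L1 bound and the concentration
  estimate.\<close>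

theorem sphere_kernel_approximate_identity:
  assumes \<nu>: "\<nu> > 0" and f: "continuous_section \<nu> f"
  shows "uniform_limit UNIV (\<lambda>t z. \<integral>w. sphere_kernel \<nu> t z w * f w \<partial>sphere_measure) f (at_right 0)"
proof (rule uniform_limitI)
  fix e :: real assume e: "e > 0"
  obtain M where M: "\<And>z. norm (f z) \<le> M" by (rule continuous_section_bounded[OF f]) (rule that; blast)
  have M0: "M \<ge> 0" using order_trans[OF norm_ge_zero M] .
  obtain C where C: "C \<ge> 0" "\<And>z w. norm (f w - cnj (bundle_factor \<nu> 1 (cnj w) z) * f z) \<le> e / 2 + C * (1 - overlap 1 (cnj w) z)"
    by (rule continuous_section_modulus[OF f half_gt_zero[OF e]]) (rule that; blast)
  have cf: "continuous_on UNIV f" using f unfolding continuous_section_def by blast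
  have bound: "norm ((\<integral>w. sphere_kernel \<nu> t z w * f w \<partial>sphere_measure) - f z) \<le> e / 2 + (C + M) * (1 - exp (- real \<nu> * t))"
    if t: "t > 0" for t z
  proof -
    define B where "B w = bundle_factor \<nu> 1 (cnj w) z" for w
    define X where "X = overlap 1 (cnj z)"
    define k where "k x = x ^ \<nu> * sphere_profile \<nu> t x" for x
    have X01: "X w \<in> {0..1}" for w using overlap_bounds by (auto simp: X_def)
    have cX: "continuous_on UNIV X" unfolding X_def by (rule continuous_overlap) simp
    have ck: "continuous_on {0..1} k" unfolding k_def
      by (intro continuous_intros continuous_on_heat_profile[OF geo_coeffs_sphere t])
    have cE: "continuous_on UNIV (\<lambda>w. sphere_kernel \<nu> t z w)" by (rule sphere_kernel_continuous_w[OF t])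
    have E: "sphere_kernel \<nu> t z w = B w * of_real (sphere_profile \<nu> t (X w))" for w
      by (simp add: sphere_kernel_def mono_kernel_def B_def X_def overlap_swap[of w z])
    have nB: "norm (B w) = X w ^ \<nu>" for w by (simp add: B_def norm_bundle_factor X_def overlap_swap[of w z])
    have nE: "norm (sphere_kernel \<nu> t z w) = \<bar>k (X w)\<bar>" for w
      by (simp add: sphere_kernel_def norm_mono_kernel k_def X_def overlap_swap[of w z])
    have cB: "continuous_on UNIV B"
    proof -
      have "sig 1 (cnj w) \<noteq> 0" for w using rho_nonzero[of w] by (simp add: sig_def rho_def mult.commute)
      then show ?thesis unfolding B_def bundle_factor_def sig_def by (intro continuous_intros) auto
    qed
    have compk: "continuous_on UNIV (\<lambda>w. u (X w))" if "continuous_on {0..1} u" for u :: "real \<Rightarrow> real"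
      by (rule continuous_on_compose2[OF that cX]) (use X01 in auto)
    obtain A where A: "\<And>x. x \<in> {0..1} \<Longrightarrow> \<bar>k x\<bar> \<le> A"
    proof -
      have "bounded (k ` {0..1})" by (intro compact_imp_bounded compact_continuous_image ck) auto
      then obtain a where "\<forall>y\<in>k ` {0..1}. norm y \<le> a" unfolding bounded_iff by blast
      then show ?thesis by (intro that[of a]) auto
    qed
    have A0: "A \<ge> 0" using A[of 0] by auto
    have i1: "integrable sphere_measure (\<lambda>w. sphere_kernel \<nu> t z w * f w)"
      by (rule integrable_sphere_continuous[where C = "A * M"])
        (use A[OF X01] M A0 in \<open>auto intro!: continuous_intros cE cf mult_mono simp: norm_mult nE\<close>)
    have i2: "integrable sphere_measure (\<lambda>w. sphere_kernel \<nu> t z w * (cnj (B w) * f z))"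
    proof (rule integrable_sphere_continuous[where C = "A * (1 * M)"])
      show "continuous_on UNIV (\<lambda>w. sphere_kernel \<nu> t z w * (cnj (B w) * f z))" by (intro continuous_intros cE cB)
      show "norm (sphere_kernel \<nu> t z w * (cnj (B w) * f z)) \<le> A * (1 * M)" for w
        unfolding norm_mult nE complex_mod_cnj nB
        using X01[of w] A0 by (intro mult_mono A[OF X01] M) (auto simp: power_le_one)
    qed
    \<comment> \<open>The phases of kernel and transport cancel to \<open>X ^ (2 * \<nu>)\<close>,
      and the hat-box theorem reduces the integral to the moment.\<close>
    have J: "(\<integral>w. sphere_kernel \<nu> t z w * (cnj (B w) * f z) \<partial>sphere_measure) = of_real (exp (- real \<nu> * t)) * f z"
    proof -
      have "sphere_kernel \<nu> t z w * (cnj (B w) * f z) = of_real (X w ^ (2 * \<nu>) * sphere_profile \<nu> t (X w)) * f z" for w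
      proof -
        have "B w * cnj (B w) = of_real (X w ^ (2 * \<nu>))"
          unfolding complex_norm_square[symmetric] nB by (simp add: power_mult[symmetric] mult.commute)
        then show ?thesis unfolding E by (simp add: mult_ac)
      qed
      then have "(\<integral>w. sphere_kernel \<nu> t z w * (cnj (B w) * f z) \<partial>sphere_measure)
         = of_real (\<integral>w. X w ^ (2 * \<nu>) * sphere_profile \<nu> t (X w) \<partial>sphere_measure) * f z"
        by (simp only: integral_mult_left_zero integral_complex_of_real)
      also have "(\<integral>w. X w ^ (2 * \<nu>) * sphere_profile \<nu> t (X w) \<partial>sphere_measure) = exp (- real \<nu> * t)"
        unfolding X_def integral_profile_moment[OF t, symmetric]
        by (rule integral_overlap) (auto intro!: continuous_intros continuous_on_heat_profile[OF geo_coeffs_sphere t])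
      finally show ?thesis .
    qed
    have split: "(\<integral>w. sphere_kernel \<nu> t z w * f w \<partial>sphere_measure) - f z
       = (\<integral>w. sphere_kernel \<nu> t z w * (f w - cnj (B w) * f z) \<partial>sphere_measure) - of_real (1 - exp (- real \<nu> * t)) * f z"
      unfolding right_diff_distrib Bochner_Integration.integral_diff[OF i1 i2] J by (simp add: algebra_simps)
    have "norm (\<integral>w. sphere_kernel \<nu> t z w * (f w - cnj (B w) * f z) \<partial>sphere_measure)
       \<le> (\<integral>w. norm (sphere_kernel \<nu> t z w * (f w - cnj (B w) * f z)) \<partial>sphere_measure)"
      by (rule integral_norm_bound)
    also have "\<dots> \<le> (\<integral>w. e / 2 * \<bar>k (X w)\<bar> + C * (\<bar>k (X w)\<bar> * (1 - X w)) \<partial>sphere_measure)"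
    proof (rule integral_mono)
      have "integrable sphere_measure (\<lambda>w. sphere_kernel \<nu> t z w * f w - sphere_kernel \<nu> t z w * (cnj (B w) * f z))"
        by (intro Bochner_Integration.integrable_diff i1 i2)
      then show "integrable sphere_measure (\<lambda>w. norm (sphere_kernel \<nu> t z w * (f w - cnj (B w) * f z)))"
        by (simp add: algebra_simps)
      show "integrable sphere_measure (\<lambda>w. e / 2 * \<bar>k (X w)\<bar> + C * (\<bar>k (X w)\<bar> * (1 - X w)))"
      proof (rule integrable_sphere_continuous[where C = "e / 2 * A + C * (A * 1)"])
        show "continuous_on UNIV (\<lambda>w. e / 2 * \<bar>k (X w)\<bar> + C * (\<bar>k (X w)\<bar> * (1 - X w)))"
          by (intro continuous_intros compk ck cX)
        fix w
        have nn: "0 \<le> e / 2 * \<bar>k (X w)\<bar>" "0 \<le> C * (\<bar>k (X w)\<bar> * (1 - X w))" using e C(1) X01[of w] by auto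
        have "e / 2 * \<bar>k (X w)\<bar> \<le> e / 2 * A" using A[OF X01] e by (intro mult_left_mono) auto
        moreover have "C * (\<bar>k (X w)\<bar> * (1 - X w)) \<le> C * (A * 1)"
          using A[OF X01] A0 C(1) X01[of w] by (intro mult_left_mono mult_mono) auto
        ultimately show "norm (e / 2 * \<bar>k (X w)\<bar> + C * (\<bar>k (X w)\<bar> * (1 - X w))) \<le> e / 2 * A + C * (A * 1)"
          using nn by simp
      qed
      fix w
      have "norm (f w - cnj (B w) * f z) \<le> e / 2 + C * (1 - X w)"
        using C(2)[of w z] by (simp add: B_def X_def overlap_swap[of w z])
      then have "\<bar>k (X w)\<bar> * norm (f w - cnj (B w) * f z) \<le> \<bar>k (X w)\<bar> * (e / 2 + C * (1 - X w))"
        by (rule mult_left_mono) simp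
      then show "norm (sphere_kernel \<nu> t z w * (f w - cnj (B w) * f z)) \<le> e / 2 * \<bar>k (X w)\<bar> + C * (\<bar>k (X w)\<bar> * (1 - X w))"
        unfolding norm_mult nE by (simp add: distrib_left mult_ac)
    qed
    also have "\<dots> = integral {0..1} (\<lambda>x. e / 2 * \<bar>k x\<bar> + C * (\<bar>k x\<bar> * (1 - x)))"
      unfolding X_def by (rule integral_overlap) (auto intro!: continuous_intros ck)
    also have "\<dots> = e / 2 * integral {0..1} (\<lambda>x. \<bar>k x\<bar>) + C * integral {0..1} (\<lambda>x. \<bar>k x\<bar> * (1 - x))"
      by (subst Henstock_Kurzweil_Integration.integral_add)
        (auto intro!: integrable_continuous_real continuous_intros ck)
    also have "\<dots> \<le> e / 2 * 1 + C * (1 - exp (- real \<nu> * t))"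
      using integral_profile_L1[OF t, of \<nu>] integral_profile_concentration[OF t \<nu>] e C(1)
      by (intro add_mono mult_left_mono) (auto simp: k_def)
    finally have 1: "norm (\<integral>w. sphere_kernel \<nu> t z w * (f w - cnj (B w) * f z) \<partial>sphere_measure) \<le> e / 2 + C * (1 - exp (- real \<nu> * t))"
      by simp
    have "norm (of_real (1 - exp (- real \<nu> * t)) * f z) = (1 - exp (- real \<nu> * t)) * norm (f z)"
      unfolding norm_mult norm_of_real using t by simp
    also have "\<dots> \<le> (1 - exp (- real \<nu> * t)) * M" using M t by (intro mult_left_mono) auto
    finally have 2: "norm (of_real (1 - exp (- real \<nu> * t)) * f z) \<le> (1 - exp (- real \<nu> * t)) * M" .
    have "norm (a - b) \<le> e / 2 + (C + M) * y" if "norm a \<le> e / 2 + C * y" "norm b \<le> y * M" for a b :: complex and y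
      using norm_triangle_ineq4[of a b] that by (simp add: algebra_simps)
    from this[OF 1 2] show ?thesis unfolding split .
  qed
  have "((\<lambda>t. e / 2 + (C + M) * (1 - exp (- real \<nu> * t))) \<longlongrightarrow> e / 2 + (C + M) * (1 - exp (- real \<nu> * 0))) (at_right 0)"
    by (intro tendsto_intros)
  then have "((\<lambda>t. e / 2 + (C + M) * (1 - exp (- real \<nu> * t))) \<longlongrightarrow> e / 2) (at_right 0)" by simp
  then have "eventually (\<lambda>t. e / 2 + (C + M) * (1 - exp (- real \<nu> * t)) < e) (at_right 0)"
    by (rule order_tendstoD(2)) (use e in simp)
  then show "eventually (\<lambda>t. \<forall>z\<in>UNIV. dist (\<integral>w. sphere_kernel \<nu> t z w * f w \<partial>sphere_measure) (f z) < e) (at_right 0)"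
    using eventually_at_right_less[of 0]
  proof eventually_elim
    case (elim t)
    then show ?case using bound[of t] by (auto simp: dist_norm intro: le_less_trans)
  qed
qed

section \<open>Chebyshev polynomials and the hypergeometric factor\<close>

text \<open>The coefficients of the Chebyshev polynomial U of degree \<open>2 * m\<close>, in powers
  of \<open>4 * x\<^sup>2\<close>.\<close>

definition cheb_coeff :: "nat \<Rightarrow> nat \<Rightarrow> real" where
  "cheb_coeff m p = (-1) ^ (m + p) * real ((m + p) choose (2 * p))"

definition cheb :: "nat \<Rightarrow> real \<Rightarrow> real" where
  "cheb m x = (\<Sum>p\<le>m. cheb_coeff m p * (4 * x\<^sup>2) ^ p)"

lemma cheb_coeff_eq_0: "p > m \<Longrightarrow> cheb_coeff m p = 0"
  by (simp add: cheb_coeff_def binomial_eq_0)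

text \<open>A common summation range, so that polynomials of different index can be
  combined.\<close>

lemma cheb_extend: "N > m \<Longrightarrow> cheb m x = (\<Sum>p<N. cheb_coeff m p * (4 * x\<^sup>2) ^ p)"
  unfolding cheb_def by (rule sum.mono_neutral_left) (auto simp: cheb_coeff_eq_0)

text \<open>Pascal's rule, applied repeatedly.\<close>

lemma cheb_coeff_rec:
  "cheb_coeff (Suc (Suc m)) (Suc p) = cheb_coeff (Suc m) p - 2 * cheb_coeff (Suc m) (Suc p) - cheb_coeff m (Suc p)"
proof -
  have K: "real (Suc (Suc (Suc (m + p))) choose Suc (Suc (2 * p)))
    = real (Suc (m + p) choose (2 * p)) + 2 * real (Suc (Suc (m + p)) choose Suc (Suc (2 * p))) - real (Suc (m + p) choose Suc (Suc (2 * p)))"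
    by simp
  show ?thesis by (simp add: cheb_coeff_def K ring_distribs del: binomial_Suc_Suc)
qed

lemma cheb_rec: "cheb (Suc (Suc m)) x = (4 * x\<^sup>2 - 2) * cheb (Suc m) x - cheb m x"
proof -
  let ?y = "4 * x\<^sup>2"
  have 0: "cheb_coeff (Suc (Suc m)) 0 = - 2 * cheb_coeff (Suc m) 0 - cheb_coeff m 0"
    by (simp add: cheb_coeff_def)
  have "cheb (Suc (Suc m)) x = cheb_coeff (Suc (Suc m)) 0 + (\<Sum>p<Suc (Suc m). cheb_coeff (Suc (Suc m)) (Suc p) * ?y ^ Suc p)"
    by (subst cheb_extend[of _ "Suc (Suc (Suc m))"]) (simp_all only: lessI sum.lessThan_Suc_shift power_0 mult_1_right)
  also have "(\<Sum>p<Suc (Suc m). cheb_coeff (Suc (Suc m)) (Suc p) * ?y ^ Suc p)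
      = ?y * (\<Sum>p<Suc (Suc m). cheb_coeff (Suc m) p * ?y ^ p)
        - 2 * (\<Sum>p<Suc (Suc m). cheb_coeff (Suc m) (Suc p) * ?y ^ Suc p)
        - (\<Sum>p<Suc (Suc m). cheb_coeff m (Suc p) * ?y ^ Suc p)"
    unfolding cheb_coeff_rec sum_distrib_left sum_subtractf[symmetric]
    by (rule sum.cong) (simp_all add: algebra_simps)
  also have "(\<Sum>p<Suc (Suc m). cheb_coeff (Suc m) p * ?y ^ p) = cheb (Suc m) x"
    by (rule cheb_extend[symmetric]) simp
  also have "(\<Sum>p<Suc (Suc m). cheb_coeff (Suc m) (Suc p) * ?y ^ Suc p) = cheb (Suc m) x - cheb_coeff (Suc m) 0"
    by (subst cheb_extend[of "Suc m" "Suc (Suc (Suc m))"]) (simp_all only: lessI less_SucI sum.lessThan_Suc_shift[of _ "Suc (Suc m)"] power_0 mult_1_right add_diff_cancel_left')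
  also have "(\<Sum>p<Suc (Suc m). cheb_coeff m (Suc p) * ?y ^ Suc p) = cheb m x - cheb_coeff m 0"
    by (subst cheb_extend[of m "Suc (Suc (Suc m))"]) (simp_all only: lessI less_SucI sum.lessThan_Suc_shift[of _ "Suc (Suc m)"] power_0 mult_1_right add_diff_cancel_left')
  finally show ?thesis unfolding 0 by (simp add: algebra_simps)
qed

lemma sin_odd_multiple: "sin ((2 * real m + 1) * u) = sin u * cheb m (cos u)"
proof (induction m rule: induct_nat_012)
  case 0
  show ?case by (simp add: cheb_def cheb_coeff_def)
next
  case 1
  have "sin (3 * u) = sin u * (4 * (cos u)\<^sup>2 - 1)"
  proof -
    have "sin (3 * u) = sin (2 * u + u)" by (simp add: algebra_simps)
    also have "\<dots> = sin u * (4 * (cos u)\<^sup>2 - 1)"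
      unfolding sin_add sin_double cos_double_cos by (simp add: power2_eq_square algebra_simps)
    finally show ?thesis .
  qed
  then show ?case by (simp add: cheb_def cheb_coeff_def algebra_simps)
next
  case (ge2 m)
  let ?a = "(2 * real (Suc m) + 1) * u"
  have e: "?a + 2 * u = (2 * real (Suc (Suc m)) + 1) * u" "?a - 2 * u = (2 * real m + 1) * u"
    by (simp_all add: algebra_simps)
  have "sin (?a + 2 * u) + sin (?a - 2 * u) = 2 * sin ?a * cos (2 * u)" by (simp add: sin_add sin_diff)
  then have "sin ((2 * real (Suc (Suc m)) + 1) * u) = 2 * sin ?a * cos (2 * u) - sin ((2 * real m + 1) * u)"
    unfolding e by linarith
  also have "\<dots> = sin u * ((4 * (cos u)\<^sup>2 - 2) * cheb (Suc m) (cos u) - cheb m (cos u))"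
    unfolding ge2 cos_double_cos by (simp add: algebra_simps)
  finally show ?case unfolding cheb_rec .
qed

text \<open>A crude count: \<open>m + 1\<close> terms of size at most \<open>16 ^ m\<close>. A
  geometric bound is enough against the Gaussian decay of the theta series.\<close>

lemma abs_cheb_le:
  assumes "\<bar>x\<bar> \<le> 1"
  shows "\<bar>cheb m x\<bar> \<le> 32 ^ m"
proof -
  have "\<bar>cheb m x\<bar> \<le> (\<Sum>p\<le>m. \<bar>cheb_coeff m p * (4 * x\<^sup>2) ^ p\<bar>)" unfolding cheb_def by (rule sum_abs)
  also have "\<dots> \<le> (\<Sum>p\<le>m. 4 ^ m * 4 ^ m)"
  proof (rule sum_mono)
    fix p assume "p \<in> {..m}"
    then have p: "p \<le> m" by simp
    have x2: "x\<^sup>2 \<le> 1" using assms by (simp add: abs_square_le_1)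
    have "(m + p) choose (2 * p) \<le> 2 ^ (m + p)" by (rule binomial_le_pow2)
    also have "\<dots> \<le> 2 ^ (m + m)" using p by (intro power_increasing) auto
    also have "\<dots> = (4 ^ m :: nat)" by (simp add: power_add flip: power_mult_distrib)
    finally have "real ((m + p) choose (2 * p)) \<le> real (4 ^ m)" by (rule of_nat_mono)
    then have "\<bar>cheb_coeff m p\<bar> \<le> 4 ^ m" by (simp add: cheb_coeff_def abs_mult)
    moreover have "\<bar>(4 * x\<^sup>2) ^ p\<bar> \<le> 4 ^ m"
    proof -
      have "(4 * x\<^sup>2) ^ p \<le> 4 ^ p" using x2 by (intro power_mono) auto
      also have "\<dots> \<le> 4 ^ m" using p by (intro power_increasing) auto
      finally show ?thesis by simp
    qed
    ultimately show "\<bar>cheb_coeff m p * (4 * x\<^sup>2) ^ p\<bar> \<le> 4 ^ m * 4 ^ m"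
      unfolding abs_mult by (intro mult_mono) auto
  qed
  also have "\<dots> = real (Suc m) * 16 ^ m" by (simp flip: power_mult_distrib)
  also have "\<dots> \<le> 2 ^ m * 16 ^ m"
  proof -
    have "Suc m \<le> 2 ^ m" using less_exp[of m] by linarith
    then have "real (Suc m) \<le> real (2 ^ m)" by (rule of_nat_mono)
    then show ?thesis by (intro mult_right_mono) auto
  qed
  finally show ?thesis by (simp flip: power_mult_distrib)
qed

text \<open>A Fourier coefficient of an even power of \<open>2 * cos \<phi>\<close>. Writing
  \<open>4 * (cos \<phi>)\<^sup>2\<close> as \<open>2 + 2 * cos (2 * \<phi>)\<close> mirrors two
  steps of Pascal's rule.\<close>

lemma has_integral_cos_power:
  "((\<lambda>\<phi>. (4 * (cos \<phi>)\<^sup>2) ^ p * cos (2 * real n * \<phi>)) has_integral (pi / 2 * real ((2 * p) choose (p + n)))) {0..pi / 2}"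
proof (induction p arbitrary: n)
  case 0
  show ?case
  proof (cases "n = 0")
    case True
    then show ?thesis using has_integral_const_real[of "1::real" 0 "pi / 2"] by simp
  next
    case False
    have "((\<lambda>\<phi>. cos (2 * real n * \<phi>)) has_integral (sin (2 * real n * (pi / 2)) / (2 * real n) - sin (2 * real n * 0) / (2 * real n))) {0..pi / 2}"
      by (rule fundamental_theorem_of_calculus)
        (use False in \<open>auto intro!: derivative_eq_intros simp: has_real_derivative_iff_has_vector_derivative[symmetric]\<close>)
    then show ?thesis using False by (simp add: sin_npi binomial_eq_0)
  qed
next
  case (Suc p)
  have dbl: "4 * (cos \<phi>)\<^sup>2 = 2 + 2 * cos (2 * \<phi>)" for \<phi> :: real by (simp add: cos_double_cos)
  show ?case
  proof (cases n)
    case 0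
    have main: "((\<lambda>\<phi>. 2 * ((4 * (cos \<phi>)\<^sup>2) ^ p * cos (2 * real 0 * \<phi>)) + 2 * ((4 * (cos \<phi>)\<^sup>2) ^ p * cos (2 * real 1 * \<phi>))) has_integral
       (2 * (pi / 2 * real ((2 * p) choose (p + 0))) + 2 * (pi / 2 * real ((2 * p) choose (p + 1))))) {0..pi / 2}"
      by (intro has_integral_add has_integral_mult_right Suc.IH)
    have fe: "2 * ((4 * (cos \<phi>)\<^sup>2) ^ p * cos (2 * real 0 * \<phi>)) + 2 * ((4 * (cos \<phi>)\<^sup>2) ^ p * cos (2 * real 1 * \<phi>))
      = (4 * (cos \<phi>)\<^sup>2) ^ Suc p * cos (2 * real n * \<phi>)" for \<phi>
      unfolding power_Suc by (subst (3) dbl) (simp add: 0 algebra_simps)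
    \<comment> \<open>For \<open>n = 0\<close> the left neighbour is replaced by its mirror image
      under the symmetry of the binomials.\<close>
    have "2 * real ((2 * p) choose p) + 2 * real ((2 * p) choose (p + 1)) = real ((2 * Suc p) choose (Suc p))"
    proof (cases p)
      case (Suc q)
      have "(2 * p) choose q = (2 * p) choose (p + 1)" by (subst binomial_symmetric) (simp_all add: Suc)
      then show ?thesis by (simp add: Suc)
    qed simp
    then have "2 * (pi / 2 * real ((2 * p) choose (p + 0))) + 2 * (pi / 2 * real ((2 * p) choose (p + 1))) = pi / 2 * real ((2 * Suc p) choose (Suc p + n))"
      unfolding 0 add_0_right by (metis (no_types, opaque_lifting) distrib_left mult.left_commute)
    with main show ?thesis unfolding fe by (simp only:)
  next
    case (Suc k)
    have main: "((\<lambda>\<phi>. 2 * ((4 * (cos \<phi>)\<^sup>2) ^ p * cos (2 * real n * \<phi>)) + ((4 * (cos \<phi>)\<^sup>2) ^ p * cos (2 * real (Suc n) * \<phi>) + (4 * (cos \<phi>)\<^sup>2) ^ p * cos (2 * real k * \<phi>))) has_integral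
       (2 * (pi / 2 * real ((2 * p) choose (p + n))) + (pi / 2 * real ((2 * p) choose (p + Suc n)) + pi / 2 * real ((2 * p) choose (p + k))))) {0..pi / 2}"
      by (intro has_integral_add has_integral_mult_right Suc.IH)
    have fe: "2 * ((4 * (cos \<phi>)\<^sup>2) ^ p * cos (2 * real n * \<phi>)) + ((4 * (cos \<phi>)\<^sup>2) ^ p * cos (2 * real (Suc n) * \<phi>) + (4 * (cos \<phi>)\<^sup>2) ^ p * cos (2 * real k * \<phi>))
      = (4 * (cos \<phi>)\<^sup>2) ^ Suc p * cos (2 * real n * \<phi>)" for \<phi>
    proof -
      have "cos (2 * real (Suc n) * \<phi>) + cos (2 * real k * \<phi>) = 2 * cos (2 * \<phi>) * cos (2 * real n * \<phi>)"
      proof -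
        have "2 * real (Suc n) * \<phi> = 2 * real n * \<phi> + 2 * \<phi>" "2 * real k * \<phi> = 2 * real n * \<phi> - 2 * \<phi>"
          by (simp_all add: Suc algebra_simps)
        then show ?thesis by (simp only: cos_add cos_diff) simp
      qed
      then have "2 * cos (2 * real n * \<phi>) + (cos (2 * real (Suc n) * \<phi>) + cos (2 * real k * \<phi>)) = 4 * (cos \<phi>)\<^sup>2 * cos (2 * real n * \<phi>)"
        unfolding dbl by (simp add: algebra_simps)
      then have "(4 * (cos \<phi>)\<^sup>2) ^ p * (2 * cos (2 * real n * \<phi>) + (cos (2 * real (Suc n) * \<phi>) + cos (2 * real k * \<phi>)))
        = (4 * (cos \<phi>)\<^sup>2) ^ p * (4 * (cos \<phi>)\<^sup>2 * cos (2 * real n * \<phi>))" by simp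
      then show ?thesis unfolding power_Suc by (simp only: distrib_left mult_ac)
    qed
    have "2 * real ((2 * p) choose (p + n)) + (real ((2 * p) choose (p + Suc n)) + real ((2 * p) choose (p + k))) = real ((2 * Suc p) choose (Suc p + n))"
      by (simp add: Suc)
    moreover have "2 * (a * x) + (a * y + a * z) = a * (2 * x + (y + z))" for a x y z :: real by (simp add: algebra_simps)
    ultimately have "2 * (pi / 2 * real ((2 * p) choose (p + n))) + (pi / 2 * real ((2 * p) choose (p + Suc n)) + pi / 2 * real ((2 * p) choose (p + k)))
       = pi / 2 * real ((2 * Suc p) choose (Suc p + n))" by (simp only:)
    with main show ?thesis unfolding fe by (simp only:)
  qed
qed

text \<open>Expanding the Chebyshev polynomial leaves the Fourier coefficients of even cosine
  powers, which vanish for \<open>p < \<nu>\<close>. After the shift \<open>p = i + \<nu>\<close>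
  the products of binomials are the Jacobi coefficients.\<close>

lemma has_integral_cheb_cos:
  "((\<lambda>\<phi>. cheb (l + \<nu>) (c * cos \<phi>) * cos (2 * real \<nu> * \<phi>)) has_integral
      (pi / 2 * (c ^ (2 * \<nu>) * poly (jacobi (2 * \<nu>) l) (c\<^sup>2)))) {0..pi / 2}"
proof -
  let ?m = "l + \<nu>"
  have "((\<lambda>\<phi>. \<Sum>p\<le>?m. cheb_coeff ?m p * c ^ (2 * p) * ((4 * (cos \<phi>)\<^sup>2) ^ p * cos (2 * real \<nu> * \<phi>))) has_integral
     (\<Sum>p\<le>?m. cheb_coeff ?m p * c ^ (2 * p) * (pi / 2 * real ((2 * p) choose (p + \<nu>))))) {0..pi / 2}"
    by (intro has_integral_sum has_integral_mult_right has_integral_cos_power) simp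
  moreover have "(\<Sum>p\<le>?m. cheb_coeff ?m p * c ^ (2 * p) * ((4 * (cos \<phi>)\<^sup>2) ^ p * cos (2 * real \<nu> * \<phi>)))
     = cheb ?m (c * cos \<phi>) * cos (2 * real \<nu> * \<phi>)" for \<phi>
  proof -
    have "c ^ (2 * p) * ((4 * (cos \<phi>)\<^sup>2) ^ p * D) = (4 * (c * cos \<phi>)\<^sup>2) ^ p * D" for p D
      by (simp add: power_mult power_mult_distrib)
    then show ?thesis unfolding cheb_def sum_distrib_right by (simp only: mult.assoc)
  qed
  moreover have "(\<Sum>p\<le>?m. cheb_coeff ?m p * c ^ (2 * p) * (pi / 2 * real ((2 * p) choose (p + \<nu>))))
     = pi / 2 * (c ^ (2 * \<nu>) * poly (jacobi (2 * \<nu>) l) (c\<^sup>2))"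
  proof -
    have "(\<Sum>p\<le>?m. cheb_coeff ?m p * c ^ (2 * p) * (pi / 2 * real ((2 * p) choose (p + \<nu>))))
      = (\<Sum>p\<in>{\<nu>..?m}. cheb_coeff ?m p * c ^ (2 * p) * (pi / 2 * real ((2 * p) choose (p + \<nu>))))"
      by (rule sum.mono_neutral_right) (auto simp: binomial_eq_0)
    also have "\<dots> = (\<Sum>i\<le>l. cheb_coeff ?m (i + \<nu>) * c ^ (2 * (i + \<nu>)) * (pi / 2 * real ((2 * (i + \<nu>)) choose (i + \<nu> + \<nu>))))"
      using sum.shift_bounds_cl_nat_ivl[of "\<lambda>p. cheb_coeff ?m p * c ^ (2 * p) * (pi / 2 * real ((2 * p) choose (p + \<nu>)))" 0 \<nu> l]
      by (simp add: atMost_atLeast0)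
    also have "\<dots> = (\<Sum>i\<le>l. pi / 2 * (c ^ (2 * \<nu>) * (coeff (jacobi (2 * \<nu>) l) i * (c\<^sup>2) ^ i)))"
    proof (rule sum.cong[OF refl])
      fix i assume "i \<in> {..l}"
      then have i: "i \<le> l" by simp
      \<comment> \<open>Trinomial revision.\<close>
      have "((2 * \<nu> + l + i) choose (2 * \<nu> + 2 * i)) * ((2 * \<nu> + 2 * i) choose (2 * \<nu> + i))
         = ((2 * \<nu> + l + i) choose (2 * \<nu> + i)) * ((2 * \<nu> + l + i - (2 * \<nu> + i)) choose (2 * \<nu> + 2 * i - (2 * \<nu> + i)))"
        by (rule choose_mult) (use i in auto)
      also have "(2 * \<nu> + l + i) choose (2 * \<nu> + i) = (2 * \<nu> + l + i) choose l"
        by (subst binomial_symmetric) auto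
      finally have b: "((2 * \<nu> + l + i) choose (2 * \<nu> + 2 * i)) * ((2 * \<nu> + 2 * i) choose (2 * \<nu> + i)) = ((2 * \<nu> + l + i) choose l) * (l choose i)"
        by simp
      have n1: "l + \<nu> + (i + \<nu>) = 2 * \<nu> + l + i" "2 * (i + \<nu>) = 2 * \<nu> + 2 * i" "i + \<nu> + \<nu> = 2 * \<nu> + i"
        by simp_all
      have s: "(-1::real) ^ (l + \<nu> + (i + \<nu>)) = (-1) ^ (l - i)"
      proof -
        have "l + \<nu> + (i + \<nu>) = (l - i) + 2 * (i + \<nu>)" using i by simp
        then show ?thesis by (simp only: power_add power_mult) simp
      qed
      have "cheb_coeff ?m (i + \<nu>) * real ((2 * (i + \<nu>)) choose (i + \<nu> + \<nu>))
         = (-1) ^ (l - i) * real (((2 * \<nu> + l + i) choose (2 * \<nu> + 2 * i)) * ((2 * \<nu> + 2 * i) choose (2 * \<nu> + i)))"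
        unfolding cheb_coeff_def s unfolding n1 by simp
      also have "\<dots> = coeff (jacobi (2 * \<nu>) l) i"
        unfolding b by (simp add: coeff_jacobi)
      finally have e: "cheb_coeff ?m (i + \<nu>) * real ((2 * (i + \<nu>)) choose (i + \<nu> + \<nu>)) = coeff (jacobi (2 * \<nu>) l) i" .
      have "c ^ (2 * (i + \<nu>)) = c ^ (2 * \<nu>) * (c\<^sup>2) ^ i" by (simp add: power_add power_mult[symmetric] algebra_simps)
      then show "cheb_coeff ?m (i + \<nu>) * c ^ (2 * (i + \<nu>)) * (pi / 2 * real ((2 * (i + \<nu>)) choose (i + \<nu> + \<nu>)))
         = pi / 2 * (c ^ (2 * \<nu>) * (coeff (jacobi (2 * \<nu>) l) i * (c\<^sup>2) ^ i))"
        unfolding e[symmetric] by (simp only: mult_ac)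
    qed
    also have "\<dots> = pi / 2 * (c ^ (2 * \<nu>) * (\<Sum>i\<le>l. coeff (jacobi (2 * \<nu>) l) i * (c\<^sup>2) ^ i))"
      by (simp only: sum_distrib_left)
    also have "(\<Sum>i\<le>l. coeff (jacobi (2 * \<nu>) l) i * (c\<^sup>2) ^ i) = poly (jacobi (2 * \<nu>) l) (c\<^sup>2)"
      unfolding poly_altdef
      by (rule sum.mono_neutral_right) (use degree_jacobi_le[of "2 * \<nu>" l] in \<open>auto intro: coeff_eq_0\<close>)
    finally show ?thesis .
  qed
  ultimately show ?thesis by (simp only:)
qed

section \<open>Chebyshev polynomials of the first kind as hypergeometric sums\<close>

text \<open>\<open>pochhammer (- m) k * pochhammer m k\<close> is the product of \<open>i\<^sup>2 - m\<^sup>2\<close> over \<open>i < k\<close>; the first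
  and second central differences in \<open>m\<close> have to be treated together.\<close>

definition square_product :: "real \<Rightarrow> nat \<Rightarrow> real" where
  "square_product m k = (\<Prod>i<k. (real i)\<^sup>2 - m\<^sup>2)"

lemma square_product_simps [simp]:
  "square_product m 0 = 1" "square_product m (Suc k) = square_product m k * ((real k)\<^sup>2 - m\<^sup>2)"
  by (simp_all add: square_product_def)

lemma pochhammer_square_product: "pochhammer (- m) k * pochhammer m k = square_product m k"
  by (induction k) (simp_all add: pochhammer_Suc power2_eq_square algebra_simps)

lemma square_product_differences:
  "square_product (m + 1) (Suc k) + square_product (m - 1) (Suc k)
      = 2 * square_product m (Suc k) - 2 * (real k + 1) * (2 * real k + 1) * square_product m k
   \<and> m * (square_product (m + 1) (Suc k) - square_product (m - 1) (Suc k))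
      = - (4 * (real k + 1) * m\<^sup>2 + 2 * (real k + 1) * real k) * square_product m k"
proof (induction k)
  case 0
  show ?case by (simp add: power2_eq_square algebra_simps)
next
  case (Suc k)
  define a b c f where "a = square_product (m + 1) (Suc k)" and "b = square_product (m - 1) (Suc k)"
    and "c = square_product m k" and "f = real k + 1"
  have IH: "a + b = 2 * (c * ((f - 1)\<^sup>2 - m\<^sup>2)) - 2 * f * (2 * f - 1) * c"
    "m * (a - b) = - (4 * f * m\<^sup>2 + 2 * f * (f - 1)) * c"
    using Suc by (simp_all add: a_def b_def c_def f_def algebra_simps)
  have s: "real (Suc k) = f" "real k = f - 1" by (simp_all add: f_def)
  have 1: "a * (f\<^sup>2 - (m + 1)\<^sup>2) + b * (f\<^sup>2 - (m - 1)\<^sup>2)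
     = 2 * (c * ((f - 1)\<^sup>2 - m\<^sup>2) * (f\<^sup>2 - m\<^sup>2)) - 2 * (f + 1) * (2 * f + 1) * (c * ((f - 1)\<^sup>2 - m\<^sup>2))"
    using IH by algebra
  have 2: "m * (a * (f\<^sup>2 - (m + 1)\<^sup>2) - b * (f\<^sup>2 - (m - 1)\<^sup>2))
     = - (4 * (f + 1) * m\<^sup>2 + 2 * (f + 1) * f) * (c * ((f - 1)\<^sup>2 - m\<^sup>2))"
    using IH by algebra
  show ?case
    unfolding square_product_simps(2)[of _ "Suc k"] a_def[symmetric] b_def[symmetric] s
    using 1 2 unfolding square_product_simps(2)[of m k] c_def[symmetric] s by simp
qed

text \<open>For natural \<open>m\<close> these are the coefficients of the Chebyshev polynomial T of
  degree \<open>m\<close> in powers of \<open>s\<close>, at the argument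
  \<open>1 - 2 * s\<close>.\<close>

definition chebT_coeff :: "real \<Rightarrow> nat \<Rightarrow> real" where
  "chebT_coeff m k = square_product m k / (pochhammer (1 / 2) k * fact k)"

text \<open>The three-term recurrence of the Chebyshev polynomials at \<open>1 - 2 * s\<close>, read
  on coefficients.\<close>

lemma chebT_coeff_rec:
  "chebT_coeff (m + 1) (Suc k) + chebT_coeff (m - 1) (Suc k) = 2 * chebT_coeff m (Suc k) - 4 * chebT_coeff m k"
proof -
  define D where "D = pochhammer (1 / 2 :: real) k * fact k"
  have D: "D \<noteq> 0" unfolding D_def by (simp add: pochhammer_eq_0_iff)
  have DS: "pochhammer (1 / 2 :: real) (Suc k) * fact (Suc k) = D * ((1 / 2 + real k) * (real k + 1))"
    by (simp add: D_def pochhammer_Suc algebra_simps)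
  define E where "E = (1 / 2 + real k) * (real k + 1)"
  have E: "E \<noteq> 0" unfolding E_def by (auto simp: add_eq_0_iff)
  have "square_product (m + 1) (Suc k) + square_product (m - 1) (Suc k) = 2 * square_product m (Suc k) - 4 * E * square_product m k"
  proof -
    have "2 * (real k + 1) * (2 * real k + 1) = 4 * E" by (simp add: E_def algebra_simps)
    then show ?thesis using square_product_differences[of m k] by simp
  qed
  then have "(square_product (m + 1) (Suc k) + square_product (m - 1) (Suc k)) / (D * E)
    = (2 * square_product m (Suc k) - 4 * E * square_product m k) / (D * E)" by simp
  also have "\<dots> = 2 * (square_product m (Suc k) / (D * E)) - 4 * (square_product m k / D)"
    using D E by (simp add: field_simps)
  finally show ?thesis unfolding chebT_coeff_def DS D_def[symmetric] E_def[symmetric] by (simp only: add_divide_distrib)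
qed

lemma chebT_coeff_eq_0: "k > n \<Longrightarrow> chebT_coeff (real n) k = 0"
  by (auto simp: chebT_coeff_def square_product_def)

lemma chebT_sum:
  "N > n \<Longrightarrow> (\<Sum>k<N. chebT_coeff (real n) k * ((1 - cos \<phi>) / 2) ^ k) = cos (real n * \<phi>)"
proof (induction n arbitrary: N rule: induct_nat_012)
  case 0
  have "(\<Sum>k<N. chebT_coeff (real 0) k * ((1 - cos \<phi>) / 2) ^ k) = (\<Sum>k<1. chebT_coeff (real 0) k * ((1 - cos \<phi>) / 2) ^ k)"
    by (rule sum.mono_neutral_right) (use 0 chebT_coeff_eq_0[of 0] in auto)
  then show ?case by (simp add: chebT_coeff_def)
next
  case 1
  have "(\<Sum>k<N. chebT_coeff (real (Suc 0)) k * ((1 - cos \<phi>) / 2) ^ k) = (\<Sum>k<2. chebT_coeff (real (Suc 0)) k * ((1 - cos \<phi>) / 2) ^ k)"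
    by (rule sum.mono_neutral_right) (use 1 chebT_coeff_eq_0[of "Suc 0"] in auto)
  then show ?case by (simp add: chebT_coeff_def numeral_2_eq_2 field_simps)
next
  case (ge2 n)
  obtain N' where N: "N = Suc N'" "N' > Suc n" using ge2.prems by (cases N) auto
  let ?s = "(1 - cos \<phi>) / 2"
  let ?c = "\<lambda>n k. chebT_coeff (real n) k"
  have r: "?c (Suc (Suc n)) (Suc k) = 2 * ?c (Suc n) (Suc k) - ?c n (Suc k) - 4 * ?c (Suc n) k" for k
    using chebT_coeff_rec[of "real (Suc n)" k] by (simp add: algebra_simps)
  have 0: "?c m 0 = 1" for m by (simp add: chebT_coeff_def)
  have sh: "(\<Sum>k<N'. ?c m (Suc k) * ?s ^ Suc k) = (\<Sum>k<N. ?c m k * ?s ^ k) - 1" for m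
    unfolding N(1) sum.lessThan_Suc_shift by (simp add: 0)
  have alg: "(2 * A - B - 4 * C) * (u * p) = 2 * (A * (u * p)) - B * (u * p) - 4 * u * (C * p)" for A B C u p :: real
    by (simp add: algebra_simps)
  have "(\<Sum>k<N. ?c (Suc (Suc n)) k * ?s ^ k) - 1 = (\<Sum>k<N'. 2 * (?c (Suc n) (Suc k) * ?s ^ Suc k) - ?c n (Suc k) * ?s ^ Suc k - 4 * ?s * (?c (Suc n) k * ?s ^ k))"
    unfolding sh[symmetric] by (rule sum.cong) (simp_all only: r power_Suc alg)
  also have "\<dots> = 2 * (\<Sum>k<N'. ?c (Suc n) (Suc k) * ?s ^ Suc k) - (\<Sum>k<N'. ?c n (Suc k) * ?s ^ Suc k) - 4 * ?s * (\<Sum>k<N'. ?c (Suc n) k * ?s ^ k)"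
    by (simp only: sum_subtractf sum_distrib_left)
  also have "\<dots> = 2 * (cos (real (Suc n) * \<phi>) - 1) - (cos (real n * \<phi>) - 1) - 4 * ?s * cos (real (Suc n) * \<phi>)"
    unfolding sh using ge2.IH(1)[of N] ge2.IH(2)[of N] ge2.IH(2)[of N'] N by simp
  finally have "(\<Sum>k<N. ?c (Suc (Suc n)) k * ?s ^ k) = 2 * cos (real (Suc n) * \<phi>) * cos \<phi> - cos (real n * \<phi>)"
    by (simp add: field_simps)
  also have "\<dots> = cos (real (Suc (Suc n)) * \<phi>)"
  proof -
    have "real (Suc (Suc n)) * \<phi> = real (Suc n) * \<phi> + \<phi>" "real n * \<phi> = real (Suc n) * \<phi> - \<phi>"
      by (simp_all add: algebra_simps)
    then show ?thesis by (simp only: cos_add cos_diff)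
  qed
  finally show ?case .
qed

lemma hypergeo_2F1_finite:
  "hypergeo_2F1 (- real n) (real n) (1 / 2) x = (\<Sum>k\<le>n. chebT_coeff (real n) k * x ^ k)"
proof -
  have "hypergeo_2F1 (- real n) (real n) (1 / 2) x = (\<Sum>k. chebT_coeff (real n) k * x ^ k)"
    unfolding hypergeo_2F1_def chebT_coeff_def pochhammer_square_product by simp
  also have "\<dots> = (\<Sum>k\<le>n. chebT_coeff (real n) k * x ^ k)"
    by (rule suminf_finite) (auto simp: chebT_coeff_eq_0)
  finally show ?thesis .
qed

text \<open>With \<open>n = 2 * \<nu>\<close> and \<open>cos u = cos d * cos \<phi>\<close> this
  argument is the one in the representation.\<close>

lemma hypergeo_2F1_cos: "hypergeo_2F1 (- real n) (real n) (1 / 2) ((1 - cos \<phi>) / 2) = cos (real n * \<phi>)"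
  unfolding hypergeo_2F1_finite using chebT_sum[of n "Suc n" \<phi>] by (simp add: lessThan_Suc_atMost)

section \<open>The integral representation\<close>

definition theta_weight :: "nat \<Rightarrow> real \<Rightarrow> nat \<Rightarrow> real" where
  "theta_weight \<nu> t l = exp (- (real l * (real l + 2 * real \<nu> + 1) * t)) * sphere_coeff \<nu> l"

text \<open>The derivative of \<open>theta2\<close> divided by \<open>- sin u\<close>, as a function
  of \<open>cos u\<close>. The factor \<open>sin u\<close> will cancel against the Jacobian of the
  substitution.\<close>

definition theta_kernel :: "nat \<Rightarrow> real \<Rightarrow> real \<Rightarrow> real" where
  "theta_kernel \<nu> t x = (\<Sum>l. theta_weight \<nu> t l * cheb (l + \<nu>) x)"

text \<open>The second bound, without the Chebyshev factor, serves the sine series that arises when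
  \<open>theta2\<close> is differentiated term by term.\<close>

lemma theta_weight_majorant:
  assumes "t > 0"
  shows "\<exists>M. summable M \<and> (\<forall>l x. \<bar>x\<bar> \<le> 1 \<longrightarrow> norm (theta_weight \<nu> t l * cheb (l + \<nu>) x) \<le> M l) \<and>
    (\<forall>l. norm (theta_weight \<nu> t l) \<le> M l)"
proof (intro exI conjI allI impI)
  \<comment> \<open>The rate 64 combines \<open>2 ^ l\<close> from \<open>sphere_coeff\<close> with
    \<open>32 ^ l\<close> from \<open>abs_cheb_le\<close>.\<close>
  let ?M = "\<lambda>l. ((2 * real \<nu> + 3) * 32 ^ \<nu>) * 64 ^ l * exp (- (real l)\<^sup>2 * t)"
  show "summable ?M" by (rule summable_power_gauss) (use assms in auto)
  have w: "\<bar>theta_weight \<nu> t l\<bar> \<le> (2 * real \<nu> + 3) * 2 ^ l * exp (- (real l)\<^sup>2 * t)" for l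
  proof -
    have "2 * real l + (2 * real \<nu> + 1) * 1 \<le> 2 * 2 ^ l + (2 * real \<nu> + 1) * 2 ^ l"
      by (intro add_mono mult_left_mono of_nat_le_two_power) auto
    then have "\<bar>sphere_coeff \<nu> l\<bar> \<le> (2 * real \<nu> + 3) * 2 ^ l" by (simp add: sphere_coeff_def algebra_simps)
    moreover have "exp (- (real l * (real l + 2 * real \<nu> + 1) * t)) \<le> exp (- (real l)\<^sup>2 * t)"
      using assms by (simp add: power2_eq_square mult_left_mono mult_right_mono)
    ultimately have "exp (- (real l * (real l + 2 * real \<nu> + 1) * t)) * \<bar>sphere_coeff \<nu> l\<bar> \<le> exp (- (real l)\<^sup>2 * t) * ((2 * real \<nu> + 3) * 2 ^ l)"
      by (intro mult_mono) auto
    then show ?thesis by (simp add: theta_weight_def abs_mult mult_ac)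
  qed
  have pw: "(2::real) ^ l * 32 ^ (l + \<nu>) = 32 ^ \<nu> * 64 ^ l" for l
    by (simp add: power_add mult_ac flip: power_mult_distrib)
  show "norm (theta_weight \<nu> t l * cheb (l + \<nu>) x) \<le> ?M l" if "\<bar>x\<bar> \<le> 1" for l x
  proof -
    have "\<bar>theta_weight \<nu> t l\<bar> * \<bar>cheb (l + \<nu>) x\<bar> \<le> ((2 * real \<nu> + 3) * 2 ^ l * exp (- (real l)\<^sup>2 * t)) * 32 ^ (l + \<nu>)"
      by (intro mult_mono w abs_cheb_le that) auto
    also have "\<dots> = (2 * real \<nu> + 3) * (2 ^ l * 32 ^ (l + \<nu>)) * exp (- (real l)\<^sup>2 * t)" by (simp only: mult_ac)
    finally show ?thesis unfolding pw by (simp add: abs_mult mult_ac)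
  qed
  show "norm (theta_weight \<nu> t l) \<le> ?M l" for l
  proof -
    have "(2::real) ^ l * 1 \<le> 2 ^ l * 32 ^ (l + \<nu>)" by (intro mult_left_mono one_le_power) auto
    then have "(2 * real \<nu> + 3) * 2 ^ l * exp (- (real l)\<^sup>2 * t) \<le> (2 * real \<nu> + 3) * (2 ^ l * 32 ^ (l + \<nu>)) * exp (- (real l)\<^sup>2 * t)"
      by (intro mult_right_mono mult_left_mono) auto
    from order_trans[OF w this] have "\<bar>theta_weight \<nu> t l\<bar> \<le> (2 * real \<nu> + 3) * (2 ^ l * 32 ^ (l + \<nu>)) * exp (- (real l)\<^sup>2 * t)" .
    then show ?thesis unfolding pw by (simp add: mult_ac)
  qed
qed

lemma uniform_limit_theta_kernel:
  assumes "t > 0"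
  shows "uniform_limit {-1..1} (\<lambda>n x. \<Sum>l<n. theta_weight \<nu> t l * cheb (l + \<nu>) x) (theta_kernel \<nu> t) sequentially"
proof -
  obtain M where M: "summable M" "\<And>l x. \<bar>x\<bar> \<le> 1 \<Longrightarrow> norm (theta_weight \<nu> t l * cheb (l + \<nu>) x) \<le> M l"
    using theta_weight_majorant[OF assms, of \<nu>] by blast
  show ?thesis unfolding theta_kernel_def[abs_def]
    by (rule Weierstrass_m_test[OF _ M(1)]) (use M(2) in auto)
qed

lemma continuous_on_theta_kernel:
  assumes "t > 0"
  shows "continuous_on {-1..1} (theta_kernel \<nu> t)"
proof (rule uniform_limit_theorem[OF _ uniform_limit_theta_kernel[OF assms]])
  have "continuous_on {-1..1} (\<lambda>x. \<Sum>l<n. theta_weight \<nu> t l * cheb (l + \<nu>) x)" for n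
    unfolding cheb_def by (intro continuous_intros)
  then show "eventually (\<lambda>n. continuous_on {-1..1} (\<lambda>x. \<Sum>l<n. theta_weight \<nu> t l * cheb (l + \<nu>) x)) sequentially"
    by (rule always_eventually[OF allI])
qed simp

lemma deriv_theta2:
  assumes "t > 0"
  shows "deriv (theta2 \<nu> t) u = - sin u * theta_kernel \<nu> t (cos u)"
proof -
  let ?e = "\<lambda>l. exp (- (real l * (real l + 2 * real \<nu> + 1) * t))"
  let ?k = "\<lambda>l. 2 * real l + 2 * real \<nu> + 1"
  obtain M where M: "summable M" "\<And>l x. \<bar>x\<bar> \<le> 1 \<Longrightarrow> norm (theta_weight \<nu> t l * cheb (l + \<nu>) x) \<le> M l"
    "\<And>l. norm (theta_weight \<nu> t l) \<le> M l"
    using theta_weight_majorant[OF assms, of \<nu>] by blast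
  have M': "norm (?e l * (- (sin (?k l * x) * ?k l))) \<le> M l" for l x
  proof -
    have "\<bar>theta_weight \<nu> t l\<bar> * \<bar>sin (?k l * x)\<bar> \<le> \<bar>theta_weight \<nu> t l\<bar> * 1" by (intro mult_left_mono) auto
    also have "\<dots> \<le> M l" using M(3)[of l] by simp
    finally show ?thesis by (simp add: theta_weight_def sphere_coeff_def abs_mult mult_ac)
  qed
  have "((\<lambda>u. \<Sum>l. ?e l * cos (?k l * u)) has_real_derivative (\<Sum>l. ?e l * (- (sin (?k l * u) * ?k l)))) (at u)"
  proof (rule has_field_derivative_series'(2)[of UNIV _ _ u])
    show "uniformly_convergent_on UNIV (\<lambda>n x. \<Sum>l<n. ?e l * (- (sin (?k l * x) * ?k l)))"
      by (rule Weierstrass_m_test'[OF _ M(1)]) (rule M')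
    show "((\<lambda>x. ?e l * cos (?k l * x)) has_real_derivative ?e l * (- (sin (?k l * x) * ?k l))) (at x within UNIV)" for l x
      by (rule derivative_eq_intros refl)+ simp
    show "summable (\<lambda>l. ?e l * cos (?k l * u))"
    proof (rule summable_comparison_test[OF _ M(1)], intro exI allI impI)
      fix l
      have "?e l * \<bar>cos (?k l * u)\<bar> \<le> ?e l * ?k l"
        by (intro mult_left_mono) (auto intro: order_trans[OF abs_cos_le_one])
      also have "\<dots> \<le> M l" using M(3)[of l] by (simp add: theta_weight_def sphere_coeff_def abs_mult)
      finally show "norm (?e l * cos (?k l * u)) \<le> M l" by (simp add: abs_mult)
    qed
  qed auto
  then have "((theta2 \<nu> t) has_real_derivative (\<Sum>l. ?e l * (- (sin (?k l * u) * ?k l)))) (at u)"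
    unfolding theta2_def[abs_def] .
  then have "deriv (theta2 \<nu> t) u = (\<Sum>l. ?e l * (- (sin (?k l * u) * ?k l)))" by (rule DERIV_imp_deriv)
  also have "\<dots> = (\<Sum>l. - sin u * (theta_weight \<nu> t l * cheb (l + \<nu>) (cos u)))"
  proof -
    have "?e l * (- (sin (?k l * u) * ?k l)) = - sin u * (theta_weight \<nu> t l * cheb (l + \<nu>) (cos u))" for l
      using sin_odd_multiple[of "l + \<nu>" u] by (simp add: theta_weight_def sphere_coeff_def)
    then show ?thesis by simp
  qed
  also have "\<dots> = - sin u * theta_kernel \<nu> t (cos u)"
    unfolding theta_kernel_def
  proof (rule suminf_mult)
    show "summable (\<lambda>l. theta_weight \<nu> t l * cheb (l + \<nu>) (cos u))"
      by (rule summable_comparison_test[OF _ M(1)], intro exI allI impI, rule M(2)) simp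
  qed
  finally show ?thesis .
qed

text \<open>Termwise \<open>has_integral_cheb_cos\<close>. The factor
  \<open>exp (real \<nu> * t)\<close> compensates for the summand \<open>real \<nu>\<close> that
  \<open>mono_eigenvalue\<close> has and the exponents of \<open>theta2\<close> do not.\<close>

lemma integral_theta_kernel:
  assumes t: "t > 0" and c: "\<bar>c\<bar> \<le> 1"
  shows "integral {0..pi / 2} (\<lambda>\<phi>. theta_kernel \<nu> t (c * cos \<phi>) * cos (2 * real \<nu> * \<phi>))
     = pi / 2 * (c ^ (2 * \<nu>) * (exp (real \<nu> * t) * sphere_profile \<nu> t (c\<^sup>2)))"
proof -
  have cc: "c * cos \<phi> \<in> {-1..1}" for \<phi>
  proof -
    have "\<bar>c * cos \<phi>\<bar> \<le> 1 * 1" unfolding abs_mult using c by (intro mult_mono) auto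
    then show ?thesis by (auto simp: abs_le_iff)
  qed
  let ?S = "\<lambda>n \<phi>. \<Sum>l<n. theta_weight \<nu> t l * (cheb (l + \<nu>) (c * cos \<phi>) * cos (2 * real \<nu> * \<phi>))"
  have u: "uniform_limit {0..pi / 2} ?S (\<lambda>\<phi>. theta_kernel \<nu> t (c * cos \<phi>) * cos (2 * real \<nu> * \<phi>)) sequentially"
  proof (rule uniform_limitI)
    fix e :: real assume "e > 0"
    with uniform_limit_theta_kernel[OF t, of \<nu>]
    have "eventually (\<lambda>n. \<forall>x\<in>{-1..1}. dist (\<Sum>l<n. theta_weight \<nu> t l * cheb (l + \<nu>) x) (theta_kernel \<nu> t x) < e) sequentially"
      by (rule uniform_limitD)
    then show "eventually (\<lambda>n. \<forall>\<phi>\<in>{0..pi / 2}. dist (?S n \<phi>) (theta_kernel \<nu> t (c * cos \<phi>) * cos (2 * real \<nu> * \<phi>)) < e) sequentially"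
    proof eventually_elim
      case (elim n)
      show ?case
      proof
        fix \<phi> :: real
        let ?D = "(\<Sum>l<n. theta_weight \<nu> t l * cheb (l + \<nu>) (c * cos \<phi>)) - theta_kernel \<nu> t (c * cos \<phi>)"
        have "?S n \<phi> - theta_kernel \<nu> t (c * cos \<phi>) * cos (2 * real \<nu> * \<phi>) = ?D * cos (2 * real \<nu> * \<phi>)"
          by (simp add: sum_distrib_right left_diff_distrib mult.assoc)
        then have "dist (?S n \<phi>) (theta_kernel \<nu> t (c * cos \<phi>) * cos (2 * real \<nu> * \<phi>)) = \<bar>?D\<bar> * \<bar>cos (2 * real \<nu> * \<phi>)\<bar>"
          by (simp add: dist_real_def abs_mult)
        also have "\<dots> \<le> \<bar>?D\<bar> * 1" by (intro mult_left_mono) auto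
        also have "\<dots> < e" using bspec[OF elim cc, of \<phi>] by (simp add: dist_real_def)
        finally show "dist (?S n \<phi>) (theta_kernel \<nu> t (c * cos \<phi>) * cos (2 * real \<nu> * \<phi>)) < e" .
      qed
    qed
  qed
  obtain I J where IJ: "\<And>n. (?S n has_integral I n) {0..pi / 2}"
    "((\<lambda>\<phi>. theta_kernel \<nu> t (c * cos \<phi>) * cos (2 * real \<nu> * \<phi>)) has_integral J) {0..pi / 2}" "I \<longlonglongrightarrow> J"
    by (rule uniform_limit_integral[OF u]) (auto intro!: continuous_intros simp: cheb_def)
  have I: "I n = (\<Sum>l<n. theta_weight \<nu> t l * (pi / 2 * (c ^ (2 * \<nu>) * poly (jacobi (2 * \<nu>) l) (c\<^sup>2))))" for n
    by (rule has_integral_unique[OF IJ(1)]) (intro has_integral_sum has_integral_mult_right has_integral_cheb_cos finite_lessThan)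
  have "c\<^sup>2 \<le> 1" using c by (simp add: abs_square_le_1)
  then have c2: "\<bar>c\<^sup>2\<bar> \<le> 2" by simp
  have "(\<lambda>l. exp (- mono_eigenvalue \<nu> l * t) * poly (weighted_jacobi \<nu> (sphere_coeff \<nu>) l) (c\<^sup>2)) sums sphere_profile \<nu> t (c\<^sup>2)"
    unfolding heat_profile_def heat_series_def
    by (rule summable_sums[OF summable_heat_series[OF geo_polys_weighted_jacobi[OF geo_coeffs_sphere] mono_eigenvalue_ge t c2]])
  note sums = this
  have "(\<lambda>l. theta_weight \<nu> t l * (pi / 2 * (c ^ (2 * \<nu>) * poly (jacobi (2 * \<nu>) l) (c\<^sup>2)))) sums
     (pi / 2 * (c ^ (2 * \<nu>) * exp (real \<nu> * t)) * sphere_profile \<nu> t (c\<^sup>2))"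
  proof -
    have "pi / 2 * (c ^ (2 * \<nu>) * exp (real \<nu> * t)) * (exp (- mono_eigenvalue \<nu> l * t) * poly (weighted_jacobi \<nu> (sphere_coeff \<nu>) l) (c\<^sup>2))
       = theta_weight \<nu> t l * (pi / 2 * (c ^ (2 * \<nu>) * poly (jacobi (2 * \<nu>) l) (c\<^sup>2)))" for l
    proof -
      have "exp (real \<nu> * t) * exp (- mono_eigenvalue \<nu> l * t) = exp (- (real l * (real l + 2 * real \<nu> + 1) * t))"
        by (simp add: exp_add[symmetric] mono_eigenvalue_def algebra_simps)
      then show ?thesis by (simp add: theta_weight_def weighted_jacobi_def mult_ac)
    qed
    with sums_mult[OF sums, of "pi / 2 * (c ^ (2 * \<nu>) * exp (real \<nu> * t))"] show ?thesis by (simp only:)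
  qed
  then have "I \<longlonglongrightarrow> pi / 2 * (c ^ (2 * \<nu>) * exp (real \<nu> * t)) * sphere_profile \<nu> t (c\<^sup>2)"
    unfolding sums_def I[abs_def] .
  then have "J = pi / 2 * (c ^ (2 * \<nu>) * exp (real \<nu> * t)) * sphere_profile \<nu> t (c\<^sup>2)"
    using IJ(3) LIMSEQ_unique by blast
  then show ?thesis using integral_unique[OF IJ(2)] by (simp only: mult.assoc)
qed

text \<open>The substitution \<open>u = arccos (cos d * cos \<phi>)\<close> resolves the inverse
  square root at \<open>u = d\<close>. It is carried out on open intervals, away from the endpoint
  singularities.\<close>

lemma singular_integral_substitution:
  fixes H :: "real \<Rightarrow> real"
  assumes d: "0 \<le> d" "d < pi / 2" and H: "continuous_on {d<..<pi / 2} H"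
    and G: "continuous_on {0..pi / 2} G" and HG: "\<And>\<phi>. \<phi> \<in> {0<..<pi / 2} \<Longrightarrow>
      H (arccos (cos d * cos \<phi>)) * (cos d * sin \<phi> / sqrt (1 - (cos d * cos \<phi>)\<^sup>2)) = G \<phi>"
  shows "(LBINT u=d..pi/2. H u) = integral {0..pi / 2} G"
proof -
  define c where "c = cos d"
  define g where "g = (\<lambda>\<phi>. arccos (c * cos \<phi>))"
  define g' where "g' = (\<lambda>\<phi>. c * sin \<phi> / sqrt (1 - (c * cos \<phi>)\<^sup>2))"
  have c: "0 < c" "c \<le> 1" unfolding c_def using d by (auto intro: cos_gt_zero_pi)
  have arg: "0 < c * cos \<phi>" "c * cos \<phi> < c" "c * cos \<phi> < 1" if "\<phi> \<in> {0<..<pi / 2}" for \<phi>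
  proof -
    have 1: "0 < cos \<phi>" using that by (intro cos_gt_zero) auto
    have 2: "cos \<phi> < 1" using that cos_monotone_0_pi[of 0 \<phi>] by auto
    show "0 < c * cos \<phi>" using c 1 by simp
    show "c * cos \<phi> < c" using c 2 by simp
    then show "c * cos \<phi> < 1" using c by linarith
  qed
  have der: "(g has_field_derivative g' \<phi>) (at \<phi> within {0<..<pi / 2})" if \<phi>: "\<phi> \<in> {0<..<pi / 2}" for \<phi>
  proof -
    have a: "-1 < c * cos \<phi>" "c * cos \<phi> < 1" using arg[OF \<phi>] by linarith+
    have i: "((\<lambda>\<phi>. c * cos \<phi>) has_field_derivative c * (- sin \<phi>)) (at \<phi> within {0<..<pi / 2})"
      by (rule DERIV_cmult[OF has_field_derivative_at_within[OF DERIV_cos]])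
    have "((\<lambda>\<phi>. arccos (c * cos \<phi>)) has_field_derivative
        inverse (- sqrt (1 - (c * cos \<phi>)\<^sup>2)) * (c * (- sin \<phi>))) (at \<phi> within {0<..<pi / 2})"
      by (rule DERIV_chain2[OF DERIV_arccos[OF a] i])
    moreover have "inverse (- sqrt (1 - (c * cos \<phi>)\<^sup>2)) * (c * (- sin \<phi>)) = g' \<phi>"
      unfolding g'_def inverse_minus_eq divide_inverse mult_minus_left mult_minus_right minus_minus by (rule mult.commute)
    ultimately show ?thesis unfolding g_def by (simp only:)
  qed
  have g'pos: "g' \<phi> \<ge> 0" if \<phi>: "\<phi> \<in> {0<..<pi / 2}" for \<phi>
  proof -
    have "0 \<le> sin \<phi>" using \<phi> by (intro sin_ge_zero) auto
    moreover have "(c * cos \<phi>)\<^sup>2 \<le> 1" using arg[OF \<phi>] by (intro power_le_one) linarith+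
    ultimately show ?thesis unfolding g'_def using c by (intro divide_nonneg_nonneg mult_nonneg_nonneg) simp_all
  qed
  have cosg: "cos (g \<phi>) = c * cos \<phi>" if "\<phi> \<in> {0<..<pi / 2}" for \<phi>
    unfolding g_def using arg[OF that] by (intro cos_arccos) auto
  have inj: "inj_on g {0<..<pi / 2}"
  proof (rule inj_onI)
    fix x y assume xy: "x \<in> {0<..<pi / 2}" "y \<in> {0<..<pi / 2}" "g x = g y"
    then have "cos x = cos y" using cosg[OF xy(1)] cosg[OF xy(2)] c by simp
    then show "x = y" using xy cos_inj_pi[of x y] by auto
  qed
  have img: "g ` {0<..<pi / 2} = {d<..<pi / 2}"
  proof (intro equalityI subsetI)
    fix u assume "u \<in> g ` {0<..<pi / 2}"
    then obtain \<phi> where \<phi>: "\<phi> \<in> {0<..<pi / 2}" "u = g \<phi>" by blast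
    have "arccos c < arccos (c * cos \<phi>)" using arg[OF \<phi>(1)] c by (intro arccos_less_arccos) auto
    moreover have "arccos c = d" unfolding c_def using d by (intro arccos_cos) auto
    moreover have "arccos (c * cos \<phi>) < arccos 0" using arg[OF \<phi>(1)] by (intro arccos_less_arccos) auto
    ultimately show "u \<in> {d<..<pi / 2}" by (simp add: \<phi>(2) g_def)
  next
    fix u assume u: "u \<in> {d<..<pi / 2}"
    have cu: "0 < cos u" "cos u < c" unfolding c_def using u d by (auto intro: cos_gt_zero cos_monotone_0_pi)
    define \<phi> where "\<phi> = arccos (cos u / c)"
    have q: "0 < cos u / c" "cos u / c < 1" using cu c by auto
    have "arccos 1 < \<phi>" unfolding \<phi>_def by (rule arccos_less_arccos) (use q in auto)
    moreover have "\<phi> < arccos 0" unfolding \<phi>_def by (rule arccos_less_arccos) (use q in auto)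
    ultimately have "\<phi> \<in> {0<..<pi / 2}" by simp
    moreover have "g \<phi> = u"
      unfolding g_def \<phi>_def using q c u d by (simp add: cos_arccos arccos_cos)
    ultimately show "u \<in> g ` {0<..<pi / 2}" by blast
  qed
  have eq: "\<bar>g' \<phi>\<bar> * H (g \<phi>) = G \<phi>" if "\<phi> \<in> {0<..<pi / 2}" for \<phi>
    unfolding abs_of_nonneg[OF g'pos[OF that]] HG[OF that, symmetric] by (simp only: g_def g'_def c_def mult.commute)
  \<comment> \<open>Integrability travels backwards: the continuous \<open>G\<close> provides it,
    and the change of variables hands it to the singular \<open>H\<close>.\<close>
  have "G absolutely_integrable_on {0..pi / 2}" by (rule absolutely_integrable_continuous_real[OF G])
  then have "G absolutely_integrable_on {0<..<pi / 2}" by (simp add: absolutely_integrable_on_def integrable_on_open_interval_real)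
  then have "(\<lambda>\<phi>. \<bar>g' \<phi>\<bar> * H (g \<phi>)) absolutely_integrable_on {0<..<pi / 2}"
    using eq by (subst absolutely_integrable_spike_eq) auto
  moreover have "integral {0<..<pi / 2} (\<lambda>\<phi>. \<bar>g' \<phi>\<bar> * H (g \<phi>)) = integral {0..pi / 2} G"
  proof -
    have "integral {0<..<pi / 2} (\<lambda>\<phi>. \<bar>g' \<phi>\<bar> * H (g \<phi>)) = integral {0<..<pi / 2} G"
      by (rule Henstock_Kurzweil_Integration.integral_cong) (rule eq)
    then show ?thesis by (simp add: integral_open_interval_real)
  qed
  ultimately have Hint: "H absolutely_integrable_on {d<..<pi / 2}" "integral {d<..<pi / 2} H = integral {0..pi / 2} G"
    using has_absolute_integral_change_of_variables_1'[of "{0<..<pi / 2}" g g' H "integral {0..pi / 2} G"] der inj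
    unfolding img by auto
  have m: "(\<lambda>x. indicator {d<..<pi / 2} x *\<^sub>R H x) \<in> borel_measurable borel"
    by (rule borel_measurable_continuous_on_indicator[OF _ H]) simp
  have "(LBINT u=d..pi/2. H u) = (LINT u:{d<..<pi / 2}|lborel. H u)"
    using d by (simp add: interval_lebesgue_integral_def)
  also have "\<dots> = (LINT u:{d<..<pi / 2}|lebesgue. H u)"
    unfolding set_lebesgue_integral_def by (rule integral_completion[symmetric]) (use m in simp)
  also have "\<dots> = integral {d<..<pi / 2} H" by (rule set_lebesgue_integral_eq_integral(2)[OF Hint(1)])
  finally show ?thesis unfolding Hint(2) .
qed

lemma sphere_kernel_representation:
  assumes \<nu>: "\<nu> > 0" and t: "t > 0"
  shows "sphere_kernel \<nu> t z w =
      (let d = sphere_dist z w in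
        - (2 * (1 + z * cnj w) ^ (2 * \<nu>) * of_real (exp (- (real \<nu> * t)))
           / of_real (pi * (1 + (norm z)\<^sup>2) ^ \<nu> * (1 + (norm w)\<^sup>2) ^ \<nu> * cos d ^ (2 * \<nu>)))
        * of_real (LBINT u=d..pi/2.
            deriv (\<lambda>x. theta2 \<nu> t x) u / sqrt ((cos d)\<^sup>2 - (cos u)\<^sup>2)
            * hypergeo_2F1 (- 2 * real \<nu>) (2 * real \<nu>) (1 / 2) ((cos d - cos u) / (2 * cos d))))"
proof -
  define N where "N = 1 + z * cnj w"
  define R S where "R = 1 + (norm z)\<^sup>2" and "S = 1 + (norm w)\<^sup>2"
  have RS: "R > 0" "S > 0" unfolding R_def S_def by (rule one_plus_norm_pos)+
  define c where "c = norm N / (sqrt R * sqrt S)"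
  define d where "d = sphere_dist z w"
  have c2: "c\<^sup>2 = overlap 1 (cnj w) z"
    using RS by (simp add: c_def overlap_def power_divide power_mult_distrib N_def R_def S_def mult.commute)
  have c0: "0 \<le> c" using RS by (simp add: c_def)
  have c1: "c \<le> 1" by (rule power2_le_imp_le) (use c2 overlap_bounds(2)[of 1 "cnj w" z] in auto)
  have d_eq: "d = arccos c" by (simp add: d_def sphere_dist_def c_def N_def R_def S_def)
  have cd: "cos d = c" unfolding d_eq using c0 c1 by (intro cos_arccos) auto
  define \<Phi> where "\<Phi> = sphere_profile \<nu> t (c\<^sup>2)"
  have E: "sphere_kernel \<nu> t z w = N ^ (2 * \<nu>) * (1 / of_real R) ^ \<nu> * (1 / of_real S) ^ \<nu> * of_real \<Phi>"
  proof -
    have "sig 1 (cnj w) = of_real S" by (simp add: sig_altdef S_def)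
    then show ?thesis
      by (simp only: sphere_kernel_def mono_kernel_def bundle_factor_def rho_altdef R_def[symmetric] c2[symmetric] \<Phi>_def[symmetric] N_def mult.commute[of "cnj w" z])
  qed
  define H where "H = (\<lambda>u. deriv (\<lambda>x. theta2 \<nu> t x) u / sqrt ((cos d)\<^sup>2 - (cos u)\<^sup>2)
            * hypergeo_2F1 (- 2 * real \<nu>) (2 * real \<nu>) (1 / 2) ((cos d - cos u) / (2 * cos d)))"
  have "N ^ (2 * \<nu>) * (1 / of_real R) ^ \<nu> * (1 / of_real S) ^ \<nu> * of_real \<Phi>
    = - (2 * N ^ (2 * \<nu>) * of_real (exp (- (real \<nu> * t))) / of_real (pi * R ^ \<nu> * S ^ \<nu> * c ^ (2 * \<nu>))) * of_real (LBINT u=d..pi/2. H u)"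
  \<comment> \<open>Antipodal points: there \<open>N = 0\<close>, and both sides carry the factor
    \<open>N ^ (2 * \<nu>)\<close>, which is 0 because \<open>\<nu> > 0\<close>.\<close>
  proof (cases "c = 0")
    case True
    then have "N = 0" using RS by (simp add: c_def)
    then have z: "N ^ (2 * \<nu>) = 0" using \<nu> by simp
    show ?thesis unfolding z by simp
  next
    case False
    then have cpos: "c > 0" using c0 by simp
    have d: "0 \<le> d" "d < pi / 2"
      using arccos_less_arccos[of 0 c] arccos_lbound[of c] cpos c1 by (auto simp: d_eq)
    define G where "G = (\<lambda>\<phi>. - (theta_kernel \<nu> t (c * cos \<phi>) * cos (2 * real \<nu> * \<phi>)))"
    have hyp: "hypergeo_2F1 (- 2 * real \<nu>) (2 * real \<nu>) (1 / 2) = hypergeo_2F1 (- real (2 * \<nu>)) (real (2 * \<nu>)) (1 / 2)"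
      by simp
    have "(LBINT u=d..pi/2. H u) = integral {0..pi / 2} G"
    proof (rule singular_integral_substitution[OF d])
      have ct: "continuous_on {d<..<pi / 2} (\<lambda>u. theta_kernel \<nu> t (cos u))"
        by (rule continuous_on_compose2[OF continuous_on_theta_kernel[OF t]]) (auto intro: continuous_on_cos continuous_on_id)
      have "sqrt (c\<^sup>2 - (cos u)\<^sup>2) \<noteq> 0" if "u \<in> {d<..<pi / 2}" for u
      proof -
        have "cos u < c" unfolding cd[symmetric] using that d by (intro cos_monotone_0_pi) auto
        moreover have "0 \<le> cos u" using that d by (intro cos_ge_zero) auto
        ultimately have "(cos u)\<^sup>2 < c\<^sup>2" by (intro power_strict_mono) auto
        then show ?thesis by simp
      qed
      then show "continuous_on {d<..<pi / 2} H"
        unfolding H_def hyp hypergeo_2F1_finite deriv_theta2[OF t] cd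
        using cpos by (intro continuous_on_mult continuous_on_divide continuous_on_minus continuous_on_sum continuous_on_power
          continuous_on_real_sqrt continuous_on_diff continuous_on_const continuous_on_id continuous_on_sin continuous_on_cos ct ballI) auto
      have "c * cos \<phi> \<in> {-1..1}" for \<phi>
      proof -
        have "\<bar>c * cos \<phi>\<bar> \<le> 1 * 1" unfolding abs_mult using c0 c1 by (intro mult_mono) auto
        then show ?thesis by auto
      qed
      then show "continuous_on {0..pi / 2} G"
        unfolding G_def by (intro continuous_on_minus continuous_on_mult continuous_on_compose2[OF continuous_on_theta_kernel[OF t]]
          continuous_on_cos continuous_on_const continuous_on_id) auto
      fix \<phi> assume \<phi>: "\<phi> \<in> {0<..<pi / 2}"
      have sp: "sin \<phi> > 0" using \<phi> by (intro sin_gt_zero) auto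
      have co: "0 < cos \<phi>" "cos \<phi> < 1" using \<phi> cos_monotone_0_pi[of 0 \<phi>] by (auto intro: cos_gt_zero)
      have x: "0 < c * cos \<phi>" "c * cos \<phi> < 1" using cpos c1 co mult_le_less_imp_less[of c 1 "cos \<phi>" 1] by auto
      define u where "u = arccos (c * cos \<phi>)"
      have cu: "cos u = c * cos \<phi>" unfolding u_def using x by (intro cos_arccos) auto
      have su: "sin u = sqrt (1 - (c * cos \<phi>)\<^sup>2)" unfolding u_def using x by (intro sin_arccos) auto
      have sq: "sqrt (c\<^sup>2 - (c * cos \<phi>)\<^sup>2) = c * sin \<phi>"
      proof -
        have "c\<^sup>2 - (c * cos \<phi>)\<^sup>2 = (c * sin \<phi>)\<^sup>2" by (simp add: power_mult_distrib sin_squared_eq algebra_simps)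
        then show ?thesis using cpos sp by simp
      qed
      have "(c * cos \<phi>)\<^sup>2 < 1" using x by (simp add: power_less_one_iff abs_square_less_1)
      then have spos: "sqrt (1 - (c * cos \<phi>)\<^sup>2) > 0" by simp
      have "(c - c * cos \<phi>) / (2 * c) = (1 - cos \<phi>) / 2" using cpos by (simp add: field_simps)
      then have "H u = - sqrt (1 - (c * cos \<phi>)\<^sup>2) * theta_kernel \<nu> t (c * cos \<phi>) / (c * sin \<phi>) * cos (real (2 * \<nu>) * \<phi>)"
        unfolding H_def hyp deriv_theta2[OF t] cd cu su sq by (simp only: hypergeo_2F1_cos)
      \<comment> \<open>Both \<open>sin u\<close>, written as a square root, and
        \<open>c * sin \<phi>\<close> cancel between the integrand and the Jacobian.\<close>
      moreover have "- a * b / p * q * (p / a) = - (b * q)" if "a > 0" "p > 0" for a b p q :: real using that by simp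
      ultimately have "H u * (c * sin \<phi> / sqrt (1 - (c * cos \<phi>)\<^sup>2)) = - (theta_kernel \<nu> t (c * cos \<phi>) * cos (real (2 * \<nu>) * \<phi>))"
        using spos cpos sp by (simp only: mult_pos_pos)
      then show "H (arccos (cos d * cos \<phi>)) * (cos d * sin \<phi> / sqrt (1 - (cos d * cos \<phi>)\<^sup>2)) = G \<phi>"
        by (simp add: G_def cd u_def)
    qed
    also have "\<dots> = - (pi / 2 * (c ^ (2 * \<nu>) * (exp (real \<nu> * t) * \<Phi>)))"
      unfolding G_def integral_neg using integral_theta_kernel[OF t, of c \<nu>] c0 c1 by (simp add: \<Phi>_def)
    finally have I: "(LBINT u=d..pi/2. H u) = - (pi / 2 * (c ^ (2 * \<nu>) * (exp (real \<nu> * t) * \<Phi>)))" .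
    have "n * (1 / r) ^ \<nu> * (1 / s) ^ \<nu> * f = - (2 * n * e / (p * r ^ \<nu> * s ^ \<nu> * k)) * - (p / 2 * (k * (e' * f)))"
      if "p \<noteq> 0" "k \<noteq> 0" "e * e' = 1" "r \<noteq> 0" "s \<noteq> 0" for n r s f e e' p k :: complex
      using that by (simp add: field_simps)
    note key = this
    have e1: "complex_of_real (- (pi / 2 * (c ^ (2 * \<nu>) * (exp (real \<nu> * t) * \<Phi>))))
       = - (of_real pi / 2 * (of_real (c ^ (2 * \<nu>)) * (of_real (exp (real \<nu> * t)) * of_real \<Phi>)))" by simp
    have e2: "complex_of_real (pi * R ^ \<nu> * S ^ \<nu> * c ^ (2 * \<nu>))
       = of_real pi * of_real R ^ \<nu> * of_real S ^ \<nu> * of_real (c ^ (2 * \<nu>))" by simp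
    have e3: "complex_of_real (exp (- (real \<nu> * t))) * of_real (exp (real \<nu> * t)) = 1"
      by (simp flip: of_real_mult exp_add)
    show ?thesis unfolding I e1 e2 by (rule key) (use e3 cpos RS in simp_all)
  qed
  then show ?thesis unfolding E Let_def d_def[symmetric] H_def cd N_def R_def S_def .
qed

section \<open>Kernels acting on sections\<close>

text \<open>All directional derivatives stay in the class, so the induction on the order never
  leaves it.\<close>

lemma (in kernel_coeffs) kernel_fun_C_k:
  assumes "t > 0"
  shows "\<F> f \<Longrightarrow> C_k k (\<lambda>z. f t z w)"
proof (induction k arbitrary: f)
  case 0
  have "continuous_on UNIV (\<lambda>z. (\<lambda>(t, z, w). f t z w) (t, z, w))"
    by (rule continuous_on_compose2[OF kernel_fun_continuous[OF 0]]) (use assms in \<open>auto intro!: continuous_intros\<close>)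
  then show ?case by simp
next
  case (Suc k)
  obtain a b where ab: "\<F> a" "\<F> b" "\<And>z. has_wirtinger (\<lambda>z. f t z w) (a t z w) (b t z w) z"
    using kernel_fun_wirtinger[OF Suc.prems] assms by blast
  have "C_k k (dir_deriv (\<lambda>z. f t z w) v)" for v
  proof -
    have "\<F> (\<lambda>t z w. a t z w * v + b t z w * cnj v)"
      by (intro kernel_fun.add kernel_fun.mult ab kernel_fun_const)
    from Suc.IH[OF this] have "C_k k (\<lambda>z. a t z w * v + b t z w * cnj v)" .
    moreover have "dir_deriv (\<lambda>z. f t z w) v = (\<lambda>z. a t z w * v + b t z w * cnj v)"
      by (rule ext) (rule has_wirtinger_dir_deriv[OF ab(3)])
    ultimately show ?thesis by (simp only:)
  qed
  then show ?case using has_wirtinger_differentiable[OF ab(3)] by simp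
qed

lemma smooth_mono_kernel:
  assumes t: "t > 0" and c: "geo_coeffs c" and nz: "\<alpha> \<noteq> 0 \<or> \<beta> \<noteq> 0"
  shows "smooth (mono_kernel \<nu> c t \<alpha> \<beta>)"
proof -
  interpret kernel_coeffs "\<lambda>_. \<alpha>" "\<lambda>_. \<beta>" "mono_eigenvalue \<nu>"
    by standard (use nz mono_eigenvalue_ge in auto)
  have b: "\<F> (\<lambda>t z w. bundle_factor \<nu> \<alpha> \<beta> z)"
    unfolding bundle_factor_def
    by (intro kernel_fun.mult kernel_fun_power kernel_fun.add kernel_fun.var kernel_fun.inv_rho kernel_fun_coeffs)
  have "\<F> (\<lambda>t z w. mono_kernel \<nu> c t \<alpha> \<beta> z)"
    unfolding mono_kernel_def heat_profile_def
    by (intro kernel_fun.mult[OF b] kernel_fun.profile geo_polys_weighted_jacobi c)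
  from kernel_fun_C_k[OF t this] show ?thesis unfolding smooth_def by simp
qed

text \<open>This makes the candidate an admissible test section in the initial condition of an
  arbitrary heat kernel; its expression at infinity is the swapped pair.\<close>

lemma smooth_section_sphere_kernel:
  assumes "t > 0"
  shows "smooth_section \<nu> (\<lambda>w. sphere_kernel \<nu> t w y)"
  unfolding smooth_section_def sphere_kernel_def
proof (intro conjI exI allI impI)
  show "smooth (mono_kernel \<nu> (sphere_coeff \<nu>) t 1 (cnj y))"
    by (rule smooth_mono_kernel[OF assms geo_coeffs_sphere]) simp
  show "smooth (mono_kernel \<nu> (sphere_coeff \<nu>) t (cnj y) 1)"
    by (rule smooth_mono_kernel[OF assms geo_coeffs_sphere]) simp
qed (simp add: mono_kernel_chart_z)

text \<open>Dominated convergence for the remainders of the difference quotients; a constant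
  majorant is integrable for a finite measure.\<close>

lemma has_vector_derivative_integral:
  fixes F :: "real \<Rightarrow> 'a \<Rightarrow> complex"
  assumes M: "finite_measure M" and d: "d > 0"
    and int: "\<And>s. s \<in> ball x d \<Longrightarrow> integrable M (F s)" and int': "integrable M (F' x)"
    and der: "\<And>s w. s \<in> ball x d \<Longrightarrow> ((\<lambda>s. F s w) has_vector_derivative F' s w) (at s)"
    and bd: "\<And>s w. s \<in> ball x d \<Longrightarrow> norm (F' s w) \<le> B"
  shows "((\<lambda>s. \<integral>w. F s w \<partial>M) has_vector_derivative (\<integral>w. F' x w \<partial>M)) (at x)"
proof -
  have x: "x \<in> ball x d" using d by simp
  have atw: "at x within ball x d = at x" by (rule at_within_open[OF x]) simp
  have lin: "bounded_linear (\<lambda>h. h *\<^sub>R c)" for c :: complex by (rule bounded_linear_scaleR_left)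
  have "((\<lambda>y. (1 / norm (y - x)) *\<^sub>R ((\<integral>w. F y w \<partial>M) - ((\<integral>w. F x w \<partial>M) + (y - x) *\<^sub>R (\<integral>w. F' x w \<partial>M)))) \<longlongrightarrow> 0) (at x within ball x d)"
    unfolding tendsto_at_iff_sequentially comp_def
  proof (intro allI impI)
    fix X :: "nat \<Rightarrow> real" assume X: "\<forall>i. X i \<in> ball x d - {x}" "X \<longlonglongrightarrow> x"
    define g where "g i w = (1 / norm (X i - x)) *\<^sub>R (F (X i) w - (F x w + (X i - x) *\<^sub>R F' x w))" for i w
    have Xi: "X i \<in> ball x d" "X i \<noteq> x" for i using X(1) by auto
    have lim: "(\<lambda>i. g i w) \<longlonglongrightarrow> 0" for w
    proof -
      have "((\<lambda>s. F s w) has_derivative (\<lambda>h. h *\<^sub>R F' x w)) (at x)"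
        using der[OF x, of w] by (simp add: has_vector_derivative_def)
      then have "((\<lambda>y. (1 / norm (y - x)) *\<^sub>R (F y w - (F x w + (y - x) *\<^sub>R F' x w))) \<longlongrightarrow> 0) (at x within ball x d)"
        unfolding has_derivative_at2 atw by blast
      then show ?thesis using X unfolding tendsto_at_iff_sequentially comp_def g_def by blast
    qed
    \<comment> \<open>One \<open>B\<close> comes from the mean value inequality and one from the
      derivative itself.\<close>
    have bound: "norm (g i w) \<le> 2 * B" for i w
    proof -
      have "norm (F (X i) w - F x w) \<le> B * norm (X i - x)"
      proof (rule differentiable_bound[of "ball x d" "\<lambda>s. F s w" "\<lambda>s h. h *\<^sub>R F' s w"])
        fix s assume s: "s \<in> ball x d"
        show "((\<lambda>s. F s w) has_derivative (\<lambda>h. h *\<^sub>R F' s w)) (at s within ball x d)"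
          using der[OF s, of w] has_derivative_at_withinI unfolding has_vector_derivative_def by blast
        show "onorm (\<lambda>h. h *\<^sub>R F' s w) \<le> B"
        proof (rule onorm_le)
          fix h :: real
          show "norm (h *\<^sub>R F' s w) \<le> B * norm h"
            using mult_right_mono[OF bd[OF s, of w] norm_ge_zero[of h]] by (simp only: norm_scaleR real_norm_def mult.commute)
        qed
      qed (use Xi[of i] x in auto)
      moreover have "norm ((X i - x) *\<^sub>R F' x w) \<le> B * norm (X i - x)"
        using mult_right_mono[OF bd[OF x, of w] norm_ge_zero[of "X i - x"]] by (simp only: norm_scaleR real_norm_def mult.commute)
      ultimately have "norm (F (X i) w - F x w - (X i - x) *\<^sub>R F' x w) \<le> 2 * B * norm (X i - x)"
        using norm_triangle_ineq4[of "F (X i) w - F x w" "(X i - x) *\<^sub>R F' x w"] by simp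
      moreover have "norm (X i - x) > 0" using Xi(2) by simp
      ultimately show ?thesis unfolding g_def norm_scaleR by (simp add: diff_diff_eq divide_le_eq)
    qed
    have ig: "integrable M (g i)" for i
      unfolding g_def using int[OF Xi(1)] int[OF x] int'
      by (intro integrable_scaleR_right Bochner_Integration.integrable_diff Bochner_Integration.integrable_add)
    have eq: "(\<integral>w. g i w \<partial>M) = (1 / norm (X i - x)) *\<^sub>R ((\<integral>w. F (X i) w \<partial>M) - ((\<integral>w. F x w \<partial>M) + (X i - x) *\<^sub>R (\<integral>w. F' x w \<partial>M)))" for i
      unfolding g_def using int[OF Xi(1), of i] int[OF x] int' by simp
    interpret finite_measure M by (rule M)
    have "(\<lambda>i. \<integral>w. g i w \<partial>M) \<longlonglongrightarrow> (\<integral>w. 0 \<partial>M)"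
      by (rule integral_dominated_convergence[where w = "\<lambda>_. 2 * B"]) (use ig lim bound in auto)
    then show "(\<lambda>i. (1 / norm (X i - x)) *\<^sub>R ((\<integral>w. F (X i) w \<partial>M) - ((\<integral>w. F x w \<partial>M) + (X i - x) *\<^sub>R (\<integral>w. F' x w \<partial>M)))) \<longlonglongrightarrow> 0"
      unfolding eq by simp
  qed
  then show ?thesis unfolding has_vector_derivative_def has_derivative_at2 atw using lin by blast
qed

definition jointly_continuous :: "(real \<Rightarrow> complex \<Rightarrow> complex \<Rightarrow> complex) \<Rightarrow> bool" where
  "jointly_continuous P \<longleftrightarrow> continuous_on ({0<..} \<times> UNIV \<times> UNIV) (\<lambda>(t, z, w). P t z w)"

text \<open>Comparing moduli is enough at \<open>w = \<infinity>\<close>, as transition factors are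
  unimodular. The purpose is a bound uniform in \<open>w\<close> over compact sets of
  \<open>(t, z)\<close>.\<close>

definition compactly_continuous :: "(real \<Rightarrow> complex \<Rightarrow> complex \<Rightarrow> complex) \<Rightarrow> bool" where
  "compactly_continuous P \<longleftrightarrow> jointly_continuous P \<and>
     (\<exists>P'. jointly_continuous P' \<and> (\<forall>t>0. \<forall>z \<eta>. \<eta> \<noteq> 0 \<longrightarrow> norm (P' t z \<eta>) = norm (P t z (1 / \<eta>))))"

lemma jointly_continuous_compose:
  assumes "jointly_continuous P" "continuous_on S a" "continuous_on S b" "continuous_on S c" "\<And>x. x \<in> S \<Longrightarrow> a x > 0"
  shows "continuous_on S (\<lambda>x. P (a x) (b x) (c x))"
proof -
  have "continuous_on S (\<lambda>x. (\<lambda>(t, z, w). P t z w) (a x, b x, c x))"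
    by (rule continuous_on_compose2[OF assms(1)[unfolded jointly_continuous_def]])
      (use assms in \<open>auto intro!: continuous_on_Pair\<close>)
  then show ?thesis by simp
qed

lemma jointly_continuous_bound:
  assumes P: "jointly_continuous P" and C: "compact C" "C \<subseteq> {0<..} \<times> UNIV"
  shows "\<exists>B. \<forall>t z w. (t, z) \<in> C \<longrightarrow> norm w \<le> 1 \<longrightarrow> norm (P t z w) \<le> B"
proof -
  let ?D = "C \<times> (cball 0 1 :: complex set)" and ?P = "\<lambda>x. P (fst (fst x)) (snd (fst x)) (snd x)"
  have "compact ?D" by (intro compact_Times C compact_cball)
  moreover have "continuous_on ?D ?P"
    by (rule jointly_continuous_compose[OF P]) (use C(2) in \<open>auto intro!: continuous_intros\<close>)
  ultimately have "bounded (?P ` ?D)"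
    using compact_continuous_image compact_imp_bounded by blast
  then obtain B where B: "\<forall>y \<in> ?P ` ?D. norm y \<le> B"
    unfolding bounded_iff by blast
  have "norm (P t z w) \<le> B" if "(t, z) \<in> C" "norm w \<le> 1" for t z w
    using that by (intro B[rule_format] image_eqI[of _ _ "((t, z), w)"]) auto
  then show ?thesis by blast
qed

lemma large_norm: "\<not> norm (w :: complex) \<le> 1 \<Longrightarrow> w \<noteq> 0 \<and> norm (1 / w) \<le> 1"
  by (auto simp: norm_divide divide_le_eq_1)

lemma compactly_continuous_bound:
  assumes P: "compactly_continuous P" and C: "compact C" "C \<subseteq> {0<..} \<times> UNIV"
  shows "\<exists>B. \<forall>t z w. (t, z) \<in> C \<longrightarrow> norm (P t z w) \<le> B"
proof -
  obtain P' where P': "jointly_continuous P" "jointly_continuous P'" "\<And>t z \<eta>. t > 0 \<Longrightarrow> \<eta> \<noteq> 0 \<Longrightarrow> norm (P' t z \<eta>) = norm (P t z (1 / \<eta>))"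
    using P unfolding compactly_continuous_def by blast
  obtain B where B: "\<And>t z w. (t, z) \<in> C \<Longrightarrow> norm w \<le> 1 \<Longrightarrow> norm (P t z w) \<le> B"
    using jointly_continuous_bound[OF P'(1) C] by blast
  obtain B' where B': "\<And>t z w. (t, z) \<in> C \<Longrightarrow> norm w \<le> 1 \<Longrightarrow> norm (P' t z w) \<le> B'"
    using jointly_continuous_bound[OF P'(2) C] by blast
  have "norm (P t z w) \<le> max B B'" if C': "(t, z) \<in> C" for t z w
  proof (cases "norm w \<le> 1")
    case True
    then show ?thesis using B[OF C'] by (simp add: le_max_iff_disj)
  next
    case False
    then have "w \<noteq> 0" "norm (1 / w) \<le> 1" using large_norm by blast+
    moreover have "t > 0" using C' C(2) by blast
    ultimately show ?thesis using B'[OF C', of "1 / w"] P'(3)[of t "1 / w" z] by (simp add: le_max_iff_disj)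
  qed
  then show ?thesis by blast
qed

locale kernel_action =
  fixes f :: "complex \<Rightarrow> complex" and A :: real
  assumes cont_f: "continuous_on UNIV f" and bound_f: "\<And>w. norm (f w) \<le> A"
begin

definition act :: "(real \<Rightarrow> complex \<Rightarrow> complex \<Rightarrow> complex) \<Rightarrow> real \<Rightarrow> complex \<Rightarrow> complex" where
  "act P t z = (\<integral>w. P t z w * f w \<partial>sphere_measure)"

lemma norm_mult_bound: "norm p \<le> B \<Longrightarrow> norm (p * f w) \<le> B * A"
  unfolding norm_mult using bound_f[of w] order_trans[OF norm_ge_zero] by (intro mult_mono) auto

lemma integrable_act:
  assumes P: "compactly_continuous P" and t: "t > 0"
  shows "integrable sphere_measure (\<lambda>w. P t z w * f w)"
proof -
  have "{(t, z)} \<subseteq> {0<..} \<times> UNIV" using t by simp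
  then obtain B where B: "\<And>s x w. (s, x) \<in> {(t, z)} \<Longrightarrow> norm (P s x w) \<le> B"
    using compactly_continuous_bound[OF P compact_sing] by blast
  show ?thesis
  proof (rule integrable_sphere_continuous)
    have "jointly_continuous P" using P unfolding compactly_continuous_def by blast
    then have "continuous_on UNIV (\<lambda>w. P t z w)"
      by (rule jointly_continuous_compose[OF _ continuous_on_const continuous_on_const continuous_on_id]) (rule t)
    then show "continuous_on UNIV (\<lambda>w. P t z w * f w)" by (rule continuous_on_mult[OF _ cont_f])
    show "norm (P t z w * f w) \<le> B * A" for w by (rule norm_mult_bound) (use B in auto)
  qed
qed

text \<open>A convergent sequence together with its limit is compact, which gives the constant
  needed for dominated convergence.\<close>

lemma continuous_on_act:
  assumes P: "compactly_continuous P"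
  shows "continuous_on ({0<..} \<times> UNIV) (\<lambda>(t, z). act P t z)"
  unfolding continuous_on_sequentially
proof (intro allI ballI impI, elim conjE)
  fix X :: "nat \<Rightarrow> real \<times> complex" and a assume a: "a \<in> {0<..} \<times> UNIV" and X: "\<forall>n. X n \<in> {0<..} \<times> UNIV" "X \<longlonglongrightarrow> a"
  have "insert a (range X) \<subseteq> {0<..} \<times> UNIV" using a X(1) by blast
  then obtain B where B: "\<And>t z w. (t, z) \<in> insert a (range X) \<Longrightarrow> norm (P t z w) \<le> B"
    using compactly_continuous_bound[OF P compact_sequence_with_limit[OF X(2)]] by blast
  have "(\<lambda>n. \<integral>w. P (fst (X n)) (snd (X n)) w * f w \<partial>sphere_measure) \<longlonglongrightarrow> (\<integral>w. P (fst a) (snd a) w * f w \<partial>sphere_measure)"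
  proof (rule integral_dominated_convergence[where w = "\<lambda>_. B * A"])
    interpret finite_measure sphere_measure by (rule finite_measure_sphere)
    show "integrable sphere_measure (\<lambda>_. B * A)" by simp
    show "(\<lambda>w. P (fst a) (snd a) w * f w) \<in> borel_measurable sphere_measure"
      by (rule borel_measurable_integrable[OF integrable_act[OF P]]) (use a in auto)
    show "(\<lambda>w. P (fst (X n)) (snd (X n)) w * f w) \<in> borel_measurable sphere_measure" for n
      by (rule borel_measurable_integrable[OF integrable_act[OF P]]) (use X(1)[rule_format, of n] in auto)
    have "(\<lambda>n. P (fst (X n)) (snd (X n)) w * f w) \<longlonglongrightarrow> P (fst a) (snd a) w * f w" for w
    proof -
      have "jointly_continuous P" using P unfolding compactly_continuous_def by blast
      then have "continuous_on ({0<..} \<times> UNIV) (\<lambda>p. P (fst p) (snd p) w)"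
        by (rule jointly_continuous_compose[OF _ continuous_on_fst[OF continuous_on_id] continuous_on_snd[OF continuous_on_id] continuous_on_const]) auto
      then have "(\<lambda>n. P (fst (X n)) (snd (X n)) w) \<longlonglongrightarrow> P (fst a) (snd a) w"
        using a X unfolding continuous_on_sequentially comp_def by blast
      then show ?thesis by (intro tendsto_mult tendsto_const)
    qed
    then show "AE w in sphere_measure. (\<lambda>n. P (fst (X n)) (snd (X n)) w * f w) \<longlonglongrightarrow> P (fst a) (snd a) w * f w" by simp
    have "norm (P (fst (X n)) (snd (X n)) w) \<le> B" for n w by (rule B) simp
    then show "AE w in sphere_measure. norm (P (fst (X n)) (snd (X n)) w * f w) \<le> B * A" for n
      by (simp add: norm_mult_bound)
  qed
  then show "((\<lambda>(t, z). act P t z) \<circ> X) \<longlonglongrightarrow> (\<lambda>(t, z). act P t z) a"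
    by (simp add: comp_def case_prod_unfold act_def)
qed

text \<open>Formulated along a curve in \<open>(t, z)\<close>, so that one statement covers the time
  derivative and the derivatives along all lines in the plane.\<close>

lemma act_curve_derivative:
  assumes P: "compactly_continuous P" and Q: "compactly_continuous Q"
    and \<tau>: "continuous_on UNIV \<tau>" "\<tau> s0 > 0" and \<zeta>: "continuous_on UNIV \<zeta>"
    and der: "\<And>s w. \<tau> s > 0 \<Longrightarrow> ((\<lambda>s. P (\<tau> s) (\<zeta> s) w) has_vector_derivative Q (\<tau> s) (\<zeta> s) w) (at s)"
  shows "((\<lambda>s. act P (\<tau> s) (\<zeta> s)) has_vector_derivative act Q (\<tau> s0) (\<zeta> s0)) (at s0)"
proof -
  have "open {s. 0 < \<tau> s}" by (intro open_Collect_less \<tau> continuous_on_const)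
  then obtain d where d: "d > 0" "cball s0 d \<subseteq> {s. 0 < \<tau> s}"
    using \<tau>(2) unfolding open_contains_cball by blast
  define C where "C = (\<lambda>s. (\<tau> s, \<zeta> s)) ` cball s0 d"
  have "compact C" unfolding C_def
    by (intro compact_continuous_image continuous_on_Pair compact_cball continuous_on_subset[OF \<tau>(1)] continuous_on_subset[OF \<zeta>]) auto
  moreover have "C \<subseteq> {0<..} \<times> UNIV" using d(2) by (auto simp: C_def)
  ultimately obtain B where B: "\<And>t z w. (t, z) \<in> C \<Longrightarrow> norm (Q t z w) \<le> B"
    using compactly_continuous_bound[OF Q] by meson
  show ?thesis
    unfolding act_def
  proof (rule has_vector_derivative_integral[OF finite_measure_sphere d(1), where B = "B * A"])
    fix s assume s: "s \<in> ball s0 d"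
    then have s': "s \<in> cball s0 d" by simp
    then have "\<tau> s > 0" using d(2) by blast
    then show "integrable sphere_measure (\<lambda>w. P (\<tau> s) (\<zeta> s) w * f w)" by (rule integrable_act[OF P])
    fix w
    show "((\<lambda>s. P (\<tau> s) (\<zeta> s) w * f w) has_vector_derivative Q (\<tau> s) (\<zeta> s) w * f w) (at s)"
      by (rule has_vector_derivative_mult_left[OF der[OF \<open>\<tau> s > 0\<close>]])
    have "(\<tau> s, \<zeta> s) \<in> C" unfolding C_def using s' by (rule imageI)
    then show "norm (Q (\<tau> s) (\<zeta> s) w * f w) \<le> B * A" by (rule norm_mult_bound[OF B])
  next
    show "integrable sphere_measure (\<lambda>w. Q (\<tau> s0) (\<zeta> s0) w * f w)" by (rule integrable_act[OF Q \<tau>(2)])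
  qed
qed

end

section \<open>Uniqueness\<close>

lemma dir_deriv_cmult:
  assumes "f differentiable (at z)"
  shows "dir_deriv (\<lambda>x. c * f x) v z = c * dir_deriv f v z"
proof -
  have "(f has_derivative frechet_derivative f (at z)) (at z)" using assms frechet_derivative_works by blast
  from has_derivative_mult_right[OF this, of c] have "((\<lambda>x. c * f x) has_derivative (\<lambda>h. c * frechet_derivative f (at z) h)) (at z)" .
  from fun_cong[OF frechet_derivative_at[OF this], of v] show ?thesis by (simp add: dir_deriv_def)
qed

lemma heat_regular_jointly_continuous:
  assumes "heat_regular K"
  shows "jointly_continuous K" "jointly_continuous (\<lambda>t z w. vector_derivative (\<lambda>s. K s z w) (at t))"
    "jointly_continuous (\<lambda>t z w. dir_deriv (\<lambda>x. K t x w) v z)"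
    "jointly_continuous (\<lambda>t z w. dir_deriv (dir_deriv (\<lambda>x. K t x w) v) v' z)"
proof -
  note h = assms[unfolded heat_regular_def]
  show "jointly_continuous K" unfolding jointly_continuous_def by (rule conjunct1[OF h])
  note h = conjunct2[OF conjunct2[OF h]]
  show "jointly_continuous (\<lambda>t z w. vector_derivative (\<lambda>s. K s z w) (at t))"
    unfolding jointly_continuous_def by (rule conjunct1[OF h])
  note h = conjunct2[OF conjunct2[OF h]]
  show "jointly_continuous (\<lambda>t z w. dir_deriv (\<lambda>x. K t x w) v z)"
    unfolding jointly_continuous_def by (rule spec[OF conjunct1[OF h]])
  note h = conjunct2[OF conjunct2[OF h]]
  show "jointly_continuous (\<lambda>t z w. dir_deriv (dir_deriv (\<lambda>x. K t x w) v) v' z)"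
    unfolding jointly_continuous_def by (rule spec[OF spec[OF h]])
qed

lemma heat_regular_differentiable:
  assumes "heat_regular K" "t > 0"
  shows "(\<lambda>s. K s z w) differentiable (at t)" "(\<lambda>x. K t x w) differentiable (at z)"
    "dir_deriv (\<lambda>x. K t x w) v differentiable (at z)"
  using assms by (simp_all add: heat_regular_def)

text \<open>The transition factor in \<open>w\<close> depends on neither \<open>t\<close> nor
  \<open>z\<close>, so every derivative of the kernel passes to the chart at infinity in the same
  way as the kernel.\<close>

lemma compactly_continuous_derivatives:
  assumes E: "heat_regular E" and K: "heat_regular K"
    and eq: "\<And>t z \<eta>. t > 0 \<Longrightarrow> \<eta> \<noteq> 0 \<Longrightarrow> K t z \<eta> = (cnj \<eta> / \<eta>) ^ \<nu> * E t z (1 / \<eta>)"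
  shows "compactly_continuous E" "compactly_continuous (\<lambda>t z w. vector_derivative (\<lambda>s. E s z w) (at t))"
    "compactly_continuous (\<lambda>t z w. dir_deriv (\<lambda>x. E t x w) v z)"
    "compactly_continuous (\<lambda>t z w. dir_deriv (dir_deriv (\<lambda>x. E t x w) v) v' z)"
proof -
  note jE = heat_regular_jointly_continuous[OF E] and jK = heat_regular_jointly_continuous[OF K]
  have n: "norm ((cnj \<eta> / \<eta>) ^ \<nu> * p) = norm p" if "\<eta> \<noteq> 0" for \<eta> p :: complex
    using unimodular_quotient(2)[OF that] by (simp add: norm_mult norm_power)
  have I: "compactly_continuous P"
    if "jointly_continuous P" "jointly_continuous P'" "\<And>t z \<eta>. t > 0 \<Longrightarrow> \<eta> \<noteq> 0 \<Longrightarrow> P' t z \<eta> = (cnj \<eta> / \<eta>) ^ \<nu> * P t z (1 / \<eta>)" for P P'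
    unfolding compactly_continuous_def using that(1)
  proof (intro conjI exI allI impI)
    show "jointly_continuous P'" by (rule that(2))
    show "norm (P' t z \<eta>) = norm (P t z (1 / \<eta>))" if "t > 0" "\<eta> \<noteq> 0" for t z \<eta>
      unfolding \<open>\<And>t z \<eta>. t > 0 \<Longrightarrow> \<eta> \<noteq> 0 \<Longrightarrow> P' t z \<eta> = (cnj \<eta> / \<eta>) ^ \<nu> * P t z (1 / \<eta>)\<close>[OF that] by (rule n[OF that(2)])
  qed
  show "compactly_continuous E" by (rule I[OF jE(1) jK(1) eq])
  show "compactly_continuous (\<lambda>t z w. vector_derivative (\<lambda>s. E s z w) (at t))"
  proof (rule I[OF jE(2) jK(2)])
    fix t :: real and z \<eta> :: complex assume t: "t > 0" and \<eta>: "\<eta> \<noteq> 0"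
    have "((\<lambda>s. E s z (1 / \<eta>)) has_vector_derivative vector_derivative (\<lambda>s. E s z (1 / \<eta>)) (at t)) (at t)"
      using heat_regular_differentiable(1)[OF E t] vector_derivative_works by blast
    then have "((\<lambda>s. (cnj \<eta> / \<eta>) ^ \<nu> * E s z (1 / \<eta>)) has_vector_derivative (cnj \<eta> / \<eta>) ^ \<nu> * vector_derivative (\<lambda>s. E s z (1 / \<eta>)) (at t)) (at t)"
      by (rule has_vector_derivative_mult_right)
    then have "((\<lambda>s. K s z \<eta>) has_vector_derivative (cnj \<eta> / \<eta>) ^ \<nu> * vector_derivative (\<lambda>s. E s z (1 / \<eta>)) (at t)) (at t)"
      by (rule has_vector_derivative_transform_within_open[of _ _ _ "{0<..}"]) (use t \<eta> eq in auto)
    then show "vector_derivative (\<lambda>s. K s z \<eta>) (at t) = (cnj \<eta> / \<eta>) ^ \<nu> * vector_derivative (\<lambda>s. E s z (1 / \<eta>)) (at t)"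
      by (rule vector_derivative_at)
  qed
  have d: "dir_deriv (\<lambda>x. K t x \<eta>) v = (\<lambda>z. (cnj \<eta> / \<eta>) ^ \<nu> * dir_deriv (\<lambda>x. E t x (1 / \<eta>)) v z)" if "t > 0" "\<eta> \<noteq> 0" for t \<eta> v
    unfolding eq[OF that] by (rule ext) (rule dir_deriv_cmult[OF heat_regular_differentiable(2)[OF E that(1)]])
  show "compactly_continuous (\<lambda>t z w. dir_deriv (\<lambda>x. E t x w) v z)"
    by (rule I[OF jE(3)[where v = v] jK(3)[where v = v]]) (erule (1) d[THEN fun_cong])
  show "compactly_continuous (\<lambda>t z w. dir_deriv (dir_deriv (\<lambda>x. E t x w) v) v' z)"
    by (rule I[OF jE(4)[where v = v and v' = v'] jK(4)[where v = v and v' = v']]) (subst d, assumption+, rule dir_deriv_cmult[OF heat_regular_differentiable(3)[OF E]], assumption)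
qed

text \<open>Each variable lies in the closed unit disc of one of the two charts, so the four local
  compactness bounds cover all points.\<close>

lemma regular_section_kernel_bound:
  assumes E: "regular_section_kernel \<nu> E" and a: "a > 0"
  shows "\<exists>B. \<forall>t z w. a \<le> t \<longrightarrow> t \<le> b \<longrightarrow> norm (E t z w) \<le> B"
proof -
  have local: "\<exists>B. \<forall>t z w. a \<le> t \<longrightarrow> t \<le> b \<longrightarrow> norm z \<le> 1 \<longrightarrow> norm w \<le> 1 \<longrightarrow> norm (K t z w) \<le> B" if K: "heat_regular K" for K
  proof -
    have "compact ({a..b} \<times> (cball 0 1 :: complex set))" by (intro compact_Times compact_Icc compact_cball)
    moreover have "{a..b} \<times> (cball 0 1 :: complex set) \<subseteq> {0<..} \<times> UNIV" using a by auto
    ultimately obtain B where "\<And>t z w. (t, z) \<in> {a..b} \<times> (cball 0 1 :: complex set) \<Longrightarrow> norm w \<le> 1 \<Longrightarrow> norm (K t z w) \<le> B"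
      using jointly_continuous_bound[OF heat_regular_jointly_continuous(1)[OF K]] by meson
    then show ?thesis by (intro exI[of _ B]) simp
  qed
  note E = E[unfolded regular_section_kernel_def]
  from conjunct1[OF conjunct2[OF E]] obtain K2 where
    K2: "heat_regular K2 \<and> (\<forall>t>0. \<forall>\<zeta> w. \<zeta> \<noteq> 0 \<longrightarrow> K2 t \<zeta> w = (\<zeta> / cnj \<zeta>) ^ \<nu> * E t (1 / \<zeta>) w)" ..
  note K2 = conjunct1[OF K2] conjunct2[OF K2, rule_format]
  from conjunct1[OF conjunct2[OF conjunct2[OF E]]] obtain K3 where
    K3: "heat_regular K3 \<and> (\<forall>t>0. \<forall>z \<eta>. \<eta> \<noteq> 0 \<longrightarrow> K3 t z \<eta> = (cnj \<eta> / \<eta>) ^ \<nu> * E t z (1 / \<eta>))" ..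
  note K3 = conjunct1[OF K3] conjunct2[OF K3, rule_format]
  from conjunct2[OF conjunct2[OF conjunct2[OF E]]] obtain K4 where
    K4: "heat_regular K4 \<and> (\<forall>t>0. \<forall>\<zeta> \<eta>. \<zeta> \<noteq> 0 \<longrightarrow> \<eta> \<noteq> 0 \<longrightarrow>
      K4 t \<zeta> \<eta> = (\<zeta> / cnj \<zeta>) ^ \<nu> * (cnj \<eta> / \<eta>) ^ \<nu> * E t (1 / \<zeta>) (1 / \<eta>))" ..
  note K4 = conjunct1[OF K4] conjunct2[OF K4, rule_format]
  obtain B1 where B1: "\<And>t z w. a \<le> t \<Longrightarrow> t \<le> b \<Longrightarrow> norm z \<le> 1 \<Longrightarrow> norm w \<le> 1 \<Longrightarrow> norm (E t z w) \<le> B1"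
    using local[OF conjunct1[OF E]] by blast
  obtain B2 where B2: "\<And>t z w. a \<le> t \<Longrightarrow> t \<le> b \<Longrightarrow> norm z \<le> 1 \<Longrightarrow> norm w \<le> 1 \<Longrightarrow> norm (K2 t z w) \<le> B2"
    using local[OF K2(1)] by blast
  obtain B3 where B3: "\<And>t z w. a \<le> t \<Longrightarrow> t \<le> b \<Longrightarrow> norm z \<le> 1 \<Longrightarrow> norm w \<le> 1 \<Longrightarrow> norm (K3 t z w) \<le> B3"
    using local[OF K3(1)] by blast
  obtain B4 where B4: "\<And>t z w. a \<le> t \<Longrightarrow> t \<le> b \<Longrightarrow> norm z \<le> 1 \<Longrightarrow> norm w \<le> 1 \<Longrightarrow> norm (K4 t z w) \<le> B4"
    using local[OF K4(1)] by blast
  have n: "norm ((\<eta> / cnj \<eta>) ^ \<nu>) = 1" "norm ((cnj \<eta> / \<eta>) ^ \<nu>) = 1" if "\<eta> \<noteq> 0" for \<eta> :: complex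
    using unimodular_quotient[OF that] by (simp_all add: norm_power)
  have "norm (E t z w) \<le> max (max B1 B2) (max B3 B4)" if t: "a \<le> t" "t \<le> b" for t z w
  proof -
    have t0: "t > 0" using t a by simp
    consider "norm z \<le> 1" "norm w \<le> 1" | "\<not> norm z \<le> 1" "norm w \<le> 1" | "norm z \<le> 1" "\<not> norm w \<le> 1" | "\<not> norm z \<le> 1" "\<not> norm w \<le> 1" by blast
    then show ?thesis
    proof cases
      case 1
      then show ?thesis using B1[OF t 1] by (simp add: le_max_iff_disj)
    next
      case 2
      then have z: "z \<noteq> 0" "norm (1 / z) \<le> 1" using large_norm by blast+
      have "norm (K2 t (1 / z) w) = norm (E t z w)" 
      proof -
        have nz: "1 / z \<noteq> 0" using z(1) by simp
        show ?thesis unfolding K2(2)[OF t0 nz] norm_mult n(1)[OF nz] by simp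
      qed
      then show ?thesis using B2[OF t z(2) 2(2)] by (simp add: le_max_iff_disj)
    next
      case 3
      then have w: "w \<noteq> 0" "norm (1 / w) \<le> 1" using large_norm by blast+
      have "norm (K3 t z (1 / w)) = norm (E t z w)" 
      proof -
        have nz: "1 / w \<noteq> 0" using w(1) by simp
        show ?thesis unfolding K3(2)[OF t0 nz] norm_mult n(2)[OF nz] by simp
      qed
      then show ?thesis using B3[OF t 3(1) w(2)] by (simp add: le_max_iff_disj)
    next
      case 4
      then have z: "z \<noteq> 0" "norm (1 / z) \<le> 1" and w: "w \<noteq> 0" "norm (1 / w) \<le> 1" using large_norm by blast+
      have "norm (K4 t (1 / z) (1 / w)) = norm (E t z w)" 
      proof -
        have nz: "1 / z \<noteq> 0" "1 / w \<noteq> 0" using z(1) w(1) by simp_all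
        show ?thesis unfolding K4(2)[OF t0 nz] norm_mult n(1)[OF nz(1)] n(2)[OF nz(2)] by simp
      qed
      then show ?thesis using B4[OF t z(2) w(2)] by (simp add: le_max_iff_disj)
    qed
  qed
  then show ?thesis by blast
qed

lemma regular_sphere_kernel: "regular_section_kernel \<nu> (sphere_kernel \<nu>)"
  by (rule regular_section_kernel_sphere_kernel) simp

lemma heat_regular_sphere_kernel: "heat_regular (sphere_kernel \<nu>)"
  using regular_sphere_kernel unfolding regular_section_kernel_def by blast

lemma sphere_kernel_heat_equation:
  assumes "t > 0"
  shows "((\<lambda>s. sphere_kernel \<nu> s z w) has_vector_derivative - magnetic_laplacian \<nu> (\<lambda>x. sphere_kernel \<nu> t x w) z) (at t)"
  unfolding sphere_kernel_def by (rule mono_kernel_heat_equation[OF geo_coeffs_sphere assms]) simp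

text \<open>The profile is uniformly continuous on a compact rectangle of times and overlaps, and
  the bundle factor has modulus at most 1.\<close>

lemma sphere_kernel_uniform_continuity:
  assumes s: "s > 0"
  shows "uniform_limit UNIV (\<lambda>t z. sphere_kernel \<nu> (t + s) z y) (\<lambda>z. sphere_kernel \<nu> s z y) (at_right 0)"
proof (rule uniform_limitI)
  fix e :: real assume e: "e > 0"
  have "continuous_on ({0<..} \<times> {-2<..<2}) (\<lambda>(t, x). sphere_profile \<nu> t x)"
    unfolding heat_profile_def
    by (rule continuous_on_heat_series[OF geo_polys_weighted_jacobi[OF geo_coeffs_sphere] mono_eigenvalue_ge])
  then have "continuous_on ({s..s + 1} \<times> {0..1}) (\<lambda>(t, x). sphere_profile \<nu> t x)"
    by (rule continuous_on_subset) (use s in auto)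
  moreover have "compact ({s..s + 1} \<times> {0..1::real})" by (intro compact_Times compact_Icc)
  ultimately have "uniformly_continuous_on ({s..s + 1} \<times> {0..1}) (\<lambda>(t, x). sphere_profile \<nu> t x)"
    by (rule compact_uniformly_continuous)
  then obtain d where d: "d > 0" "\<And>p q. p \<in> {s..s + 1} \<times> {0..1} \<Longrightarrow> q \<in> {s..s + 1} \<times> {0..1} \<Longrightarrow> dist q p < d \<Longrightarrow>
      dist (case q of (t, x) \<Rightarrow> sphere_profile \<nu> t x) (case p of (t, x) \<Rightarrow> sphere_profile \<nu> t x) < e"
    using e unfolding uniformly_continuous_on_def by meson
  have "dist (sphere_kernel \<nu> (t + s) z y) (sphere_kernel \<nu> s z y) < e" if t: "0 < t" "t < min d 1" for t z
  proof -
    define x where "x = overlap 1 (cnj y) z"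
    have x: "0 \<le> x" "x \<le> 1" unfolding x_def by (rule overlap_bounds)+
    have "\<bar>sphere_profile \<nu> (t + s) x - sphere_profile \<nu> s x\<bar> < e"
      using d(2)[of "(s, x)" "(t + s, x)"] t x by (simp add: dist_Pair_Pair dist_real_def)
    moreover have "dist (sphere_kernel \<nu> (t + s) z y) (sphere_kernel \<nu> s z y) = x ^ \<nu> * \<bar>sphere_profile \<nu> (t + s) x - sphere_profile \<nu> s x\<bar>"
      unfolding dist_norm sphere_kernel_def mono_kernel_def right_diff_distrib[symmetric] norm_mult norm_bundle_factor of_real_diff[symmetric] norm_of_real x_def ..
    moreover have "x ^ \<nu> * \<bar>sphere_profile \<nu> (t + s) x - sphere_profile \<nu> s x\<bar> \<le> 1 * \<bar>sphere_profile \<nu> (t + s) x - sphere_profile \<nu> s x\<bar>"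
      using x by (intro mult_right_mono power_le_one) auto
    ultimately show ?thesis by simp
  qed
  then show "\<forall>\<^sub>F t in at_right 0. \<forall>z\<in>UNIV. dist (sphere_kernel \<nu> (t + s) z y) (sphere_kernel \<nu> s z y) < e"
    unfolding eventually_at_right_field using d(1) by (intro exI[of _ "min d 1"]) simp
qed

lemma integral_linear_combination:
  fixes P Q R S U :: "'a \<Rightarrow> complex"
  assumes "integrable M P" "integrable M Q" "integrable M R" "integrable M S" "integrable M U"
  shows "(\<integral>w. a * (P w + Q w) + b * (c * R w - d * S w) - e * U w \<partial>M)
    = a * (integral\<^sup>L M P + integral\<^sup>L M Q) + b * (c * integral\<^sup>L M R - d * integral\<^sup>L M S) - e * integral\<^sup>L M U"
  using assms by simp

lemma smooth_section_imp_continuous_section: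
  assumes "smooth_section \<nu> f"
  shows "continuous_section \<nu> f"
proof -
  have c: "continuous_on UNIV g" if "smooth g" for g
    using that[unfolded smooth_def, THEN spec[of _ 0]] by simp
  show ?thesis
    using assms c unfolding smooth_section_def continuous_section_def by blast
qed

lemma regular_section_kernel_dual_chart:
  assumes "regular_section_kernel \<nu> E"
  shows "heat_regular E"
    "\<exists>K. heat_regular K \<and> (\<forall>t>0. \<forall>z \<eta>. \<eta> \<noteq> 0 \<longrightarrow> K t z \<eta> = (cnj \<eta> / \<eta>) ^ \<nu> * E t z (1 / \<eta>))"
proof -
  note R = assms[unfolded regular_section_kernel_def]
  show "heat_regular E" by (rule conjunct1[OF R])
  show "\<exists>K. heat_regular K \<and> (\<forall>t>0. \<forall>z \<eta>. \<eta> \<noteq> 0 \<longrightarrow> K t z \<eta> = (cnj \<eta> / \<eta>) ^ \<nu> * E t z (1 / \<eta>))"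
    by (rule conjunct1[OF conjunct2[OF conjunct2[OF R]]])
qed

text \<open>The difference of the two sides is a bounded solution of the heat equation. At time 0
  both sides tend uniformly to the candidate at time \<open>s\<close>, so the maximum principle with
  \<open>M = 0\<close> applies.\<close>

lemma heat_kernel_semigroup:
  assumes E: "is_heat_kernel \<nu> E" and s: "s > 0" and T: "T > 0"
  shows "(\<integral>w. E T z w * sphere_kernel \<nu> s w y \<partial>sphere_measure) = sphere_kernel \<nu> (T + s) z y"
proof -
  define f where "f = (\<lambda>w. sphere_kernel \<nu> s w y)"
  have sf: "smooth_section \<nu> f" unfolding f_def by (rule smooth_section_sphere_kernel[OF s])
  have cs: "continuous_section \<nu> f" by (rule smooth_section_imp_continuous_section[OF sf])
  obtain A where A: "\<And>w. norm (f w) \<le> A" by (rule continuous_section_bounded[OF cs]) (rule that; blast)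
  interpret kernel_action f A
  proof
    show "continuous_on UNIV f" using cs unfolding continuous_section_def by (rule conjunct1)
  qed (rule A)
  note E' = E[unfolded is_heat_kernel_def]
  have rE: "regular_section_kernel \<nu> E" by (rule conjunct1[OF E'])
  note HE = regular_section_kernel_dual_chart(1)[OF rE]
  obtain K where KK: "heat_regular K \<and> (\<forall>t>0. \<forall>z \<eta>. \<eta> \<noteq> 0 \<longrightarrow> K t z \<eta> = (cnj \<eta> / \<eta>) ^ \<nu> * E t z (1 / \<eta>))"
    using regular_section_kernel_dual_chart(2)[OF rE] ..
  note K = conjunct1[OF KK] conjunct2[OF KK, rule_format]
  have pdeE: "((\<lambda>s. E s z w) has_vector_derivative - magnetic_laplacian \<nu> (\<lambda>x. E t x w) z) (at t)" if "t > 0" for t z w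
    using conjunct1[OF conjunct2[OF E']] that by blast
  define Et where "Et = (\<lambda>t z w. vector_derivative (\<lambda>s. E s z w) (at t))"
  define Ed where "Ed v = (\<lambda>t z w. dir_deriv (\<lambda>x. E t x w) v z)" for v
  define Edd where "Edd v v' = (\<lambda>t z w. dir_deriv (dir_deriv (\<lambda>x. E t x w) v) v' z)" for v v'
  note cc = compactly_continuous_derivatives[OF HE K, folded Et_def Ed_def Edd_def]
  define U where "U = (\<lambda>t z. sphere_kernel \<nu> (t + s) z y)"
  have C2U: "C2 (U t)" if "t > 0" for t
    unfolding U_def using heat_regular_C2[OF heat_regular_sphere_kernel, of "t + s" \<nu> y] that s by simp
  have C2E: "C2 (\<lambda>x. E t x w)" if "t > 0" for t w by (rule heat_regular_C2[OF HE that])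
  have cline: "continuous_on UNIV (\<lambda>r. z + complex_of_real r * e)" for z e by (intro continuous_intros)
  have line: "((\<lambda>r. act E t (z + of_real r * e) - U t (z + of_real r * e)) has_vector_derivative
      act (Ed e) t (z + of_real r * e) - dir_deriv (U t) e (z + of_real r * e)) (at r)"
    "((\<lambda>r. act (Ed v) t (z + of_real r * e) - dir_deriv (U t) v (z + of_real r * e)) has_vector_derivative
      act (Edd v e) t (z + of_real r * e) - dir_deriv (dir_deriv (U t) v) e (z + of_real r * e)) (at r)"
    if t: "t > 0" for t z e v r
  proof -
    show "((\<lambda>r. act E t (z + of_real r * e) - U t (z + of_real r * e)) has_vector_derivative
      act (Ed e) t (z + of_real r * e) - dir_deriv (U t) e (z + of_real r * e)) (at r)"
    proof (rule has_vector_derivative_diff[OF act_curve_derivative[OF cc(1) cc(3) continuous_on_const t cline] C2_lines(1)[OF C2U[OF t]]])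
      show "((\<lambda>r. E t (z + of_real r * e) w) has_vector_derivative Ed e t (z + of_real r * e) w) (at r)" for r w
        unfolding Ed_def by (rule C2_lines(1)[OF C2E[OF t]])
    qed
    show "((\<lambda>r. act (Ed v) t (z + of_real r * e) - dir_deriv (U t) v (z + of_real r * e)) has_vector_derivative
      act (Edd v e) t (z + of_real r * e) - dir_deriv (dir_deriv (U t) v) e (z + of_real r * e)) (at r)"
    proof (rule has_vector_derivative_diff[OF act_curve_derivative[OF cc(3) cc(4) continuous_on_const t cline] C2_lines(2)[OF C2U[OF t]]])
      show "((\<lambda>r. Ed v t (z + of_real r * e) w) has_vector_derivative Edd v e t (z + of_real r * e) w) (at r)" for r w
        unfolding Ed_def Edd_def by (rule C2_lines(2)[OF C2E[OF t]])
    qed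
  qed
  have time: "((\<lambda>r. act E r z - U r z) has_vector_derivative act Et t z - (- magnetic_laplacian \<nu> (U t) z)) (at t)"
    if t: "t > 0" for t z
  proof (rule has_vector_derivative_diff)
    show "((\<lambda>r. act E r z) has_vector_derivative act Et t z) (at t)"
    proof (rule act_curve_derivative[OF cc(1) cc(2) continuous_on_id t continuous_on_const])
      show "((\<lambda>r. E r z w) has_vector_derivative Et r z w) (at r)" if "r > 0" for r w
        unfolding Et_def using heat_regular_differentiable(1)[OF HE that] vector_derivative_works by blast
    qed
    have "((\<lambda>r. r + s) has_vector_derivative 1) (at t)"
      by (auto intro!: derivative_eq_intros simp flip: has_real_derivative_iff_has_vector_derivative)
    moreover have "((\<lambda>r. sphere_kernel \<nu> r z y) has_vector_derivative - magnetic_laplacian \<nu> (U t) z) (at (t + s))"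
      unfolding U_def by (rule sphere_kernel_heat_equation) (use t s in simp)
    ultimately show "((\<lambda>r. U r z) has_vector_derivative - magnetic_laplacian \<nu> (U t) z) (at t)"
      using vector_diff_chain_at[of "\<lambda>r. r + s" 1 t "\<lambda>r. sphere_kernel \<nu> r z y"] by (simp add: U_def comp_def)
  qed
  have uni: "\<exists>\<delta>>0. \<forall>t z. 0 < t \<longrightarrow> t < \<delta> \<longrightarrow> norm (act E t z - U t z) \<le> 0 + e" if e: "e > 0" for e
  proof -
    have "uniform_limit UNIV (\<lambda>t z. act E t z) f (at_right 0)"
      unfolding act_def using conjunct2[OF conjunct2[OF E']] sf by blast
    from uniform_limitD[OF this half_gt_zero[OF e]]
    have "\<forall>\<^sub>F t in at_right 0. \<forall>z\<in>UNIV. dist (act E t z) (f z) < e / 2" .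
    moreover have "\<forall>\<^sub>F t in at_right 0. \<forall>z\<in>UNIV. dist (U t z) (f z) < e / 2"
      unfolding U_def f_def by (rule uniform_limitD[OF sphere_kernel_uniform_continuity[OF s] half_gt_zero[OF e]])
    ultimately have "\<forall>\<^sub>F t in at_right 0. \<forall>z. norm (act E t z - U t z) \<le> 0 + e"
    proof eventually_elim
      case (elim t)
      show ?case
      proof
        fix z
        have "dist (act E t z) (U t z) < e / 2 + e / 2"
          by (rule dist_triangle_half_r[where y = "f z", simplified]) (use elim in \<open>auto simp: dist_commute\<close>)
        then show "norm (act E t z - U t z) \<le> 0 + e" by (simp add: dist_norm)
      qed
    qed
    then show ?thesis unfolding eventually_at_right_field by auto
  qed
  \<comment> \<open>The bound \<open>C\<close> is put together from two ranges: for short times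
    uniform convergence bounds the difference by 1, and from \<open>\<delta>\<close> on the kernels
    are bounded by compactness.\<close>
  obtain \<delta> where \<delta>: "\<delta> > 0" "\<And>t z. 0 < t \<Longrightarrow> t < \<delta> \<Longrightarrow> norm (act E t z - U t z) \<le> 0 + 1"
    using uni[of 1] by auto
  obtain B where B: "\<And>t z w. \<delta> \<le> t \<Longrightarrow> t \<le> T \<Longrightarrow> norm (E t z w) \<le> B"
    using regular_section_kernel_bound[OF rE \<delta>(1)] by blast
  obtain B' where B': "\<And>t z w. s \<le> t \<Longrightarrow> t \<le> T + s \<Longrightarrow> norm (sphere_kernel \<nu> t z w) \<le> B'"
    using regular_section_kernel_bound[OF regular_sphere_kernel s] by blast
  define C where "C = max 1 (B * A + B')"
  have bdd: "norm (act E t z - U t z) \<le> C" if t: "0 < t" "t \<le> T" for t z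
  proof (cases "t < \<delta>")
    case True
    then show ?thesis using \<delta>(2)[OF t(1), of z] by (simp add: C_def)
  next
    case False
    have "norm (act E t z) \<le> B * A"
      unfolding act_def
    proof (rule integral_sphere_norm_bound)
      show "(\<lambda>w. E t z w * f w) \<in> borel_measurable borel"
        using borel_measurable_integrable[OF integrable_act[OF cc(1) t(1), of z]] by simp
      show "norm (E t z w * f w) \<le> B * A" for w by (rule norm_mult_bound) (use B False t in simp)
    qed
    moreover have "norm (U t z) \<le> B'" unfolding U_def by (rule B') (use t in auto)
    ultimately show ?thesis using norm_triangle_ineq4[of "act E t z" "U t z"] by (simp add: C_def)
  qed
  \<comment> \<open>The equation passes under the integral because, for each \<open>w\<close>, it is
    a linear relation with coefficients depending only on \<open>z\<close>.\<close>
  have pde: "act Et t z - (- magnetic_laplacian \<nu> (U t) z) = of_real ((1 + (norm z)\<^sup>2)\<^sup>2 / 4) *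
        ((act (Edd 1 1) t z - dir_deriv (dir_deriv (U t) 1) 1 z) + (act (Edd \<i> \<i>) t z - dir_deriv (dir_deriv (U t) \<i>) \<i> z))
        + of_nat \<nu> * of_real (1 + (norm z)\<^sup>2) * \<i> * (of_real (Im z) * (act (Ed 1) t z - dir_deriv (U t) 1 z) - of_real (Re z) * (act (Ed \<i>) t z - dir_deriv (U t) \<i> z))
        - of_real ((real \<nu>)\<^sup>2 * (norm z)\<^sup>2) * (act E t z - U t z)" if t: "t > 0" for t z
  proof -
    define a where "a = complex_of_real ((1 + (norm z)\<^sup>2)\<^sup>2 / 4)"
    define b where "b = of_nat \<nu> * complex_of_real (1 + (norm z)\<^sup>2) * \<i>"
    define k where "k = complex_of_real ((real \<nu>)\<^sup>2 * (norm z)\<^sup>2)"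
    have "Et t z w * f w = a * (Edd 1 1 t z w * f w + Edd \<i> \<i> t z w * f w)
       + b * (of_real (Im z) * (Ed 1 t z w * f w) - of_real (Re z) * (Ed \<i> t z w * f w)) - k * (E t z w * f w)" for w
    proof -
      have "Et t z w = - magnetic_laplacian \<nu> (\<lambda>x. E t x w) z"
        unfolding Et_def by (rule vector_derivative_at[OF pdeE[OF t]])
      also have "\<dots> = a * (Edd 1 1 t z w + Edd \<i> \<i> t z w)
       + b * (of_real (Im z) * Ed 1 t z w - of_real (Re z) * Ed \<i> t z w) - k * E t z w"
        unfolding magnetic_laplacian_C2[OF C2E[OF t]] a_def b_def k_def Ed_def Edd_def ..
      finally show ?thesis by (simp only: distrib_right left_diff_distrib mult.assoc)
    qed
    then have 1: "act Et t z = a * (act (Edd 1 1) t z + act (Edd \<i> \<i>) t z)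
       + b * (of_real (Im z) * act (Ed 1) t z - of_real (Re z) * act (Ed \<i>) t z) - k * act E t z"
      unfolding act_def by (simp only:) (rule integral_linear_combination[OF integrable_act[OF cc(4) t] integrable_act[OF cc(4) t]
          integrable_act[OF cc(3) t] integrable_act[OF cc(3) t] integrable_act[OF cc(1) t]])
    have 2: "- magnetic_laplacian \<nu> (U t) z = a * (dir_deriv (dir_deriv (U t) 1) 1 z + dir_deriv (dir_deriv (U t) \<i>) \<i> z)
       + b * (of_real (Im z) * dir_deriv (U t) 1 z - of_real (Re z) * dir_deriv (U t) \<i> z) - k * U t z"
      unfolding magnetic_laplacian_C2[OF C2U[OF t]] a_def b_def k_def ..
    show ?thesis unfolding 1 2 a_def[symmetric] b_def[symmetric] k_def[symmetric] by (simp add: algebra_simps)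
  qed
  interpret bounded_heat_solution "\<lambda>t z. act E t z - U t z" "\<lambda>t z. act Et t z - (- magnetic_laplacian \<nu> (U t) z)"
    "\<lambda>t z. act (Ed 1) t z - dir_deriv (U t) 1 z" "\<lambda>t z. act (Ed \<i>) t z - dir_deriv (U t) \<i> z"
    "\<lambda>t z. act (Edd 1 1) t z - dir_deriv (dir_deriv (U t) 1) 1 z" "\<lambda>t z. act (Edd \<i> \<i>) t z - dir_deriv (dir_deriv (U t) \<i>) \<i> z" \<nu> T 0 C
  proof
    have "continuous_on ({0<..T} \<times> UNIV) (\<lambda>p. act E (fst p) (snd p))"
      by (rule continuous_on_subset[OF continuous_on_act[OF cc(1), unfolded case_prod_unfold]]) auto
    moreover have "continuous_on ({0<..T} \<times> UNIV) (\<lambda>p. sphere_kernel \<nu> (fst p + s) (snd p) y)"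
      by (rule jointly_continuous_compose[OF heat_regular_jointly_continuous(1)[OF heat_regular_sphere_kernel]])
        (use s in \<open>auto intro!: continuous_intros\<close>)
    ultimately have "continuous_on ({0<..T} \<times> UNIV) (\<lambda>p. act E (fst p) (snd p) - U (fst p) (snd p))"
      unfolding U_def by (rule continuous_on_diff)
    then show "continuous_on ({0<..T} \<times> UNIV) (\<lambda>(t, z). act E t z - U t z)" by (simp only: case_prod_unfold)
    show "norm (act E t z - U t z) \<le> C" if "0 < t" "t \<le> T" for t z by (rule bdd[OF that])
    show "\<exists>\<delta>>0. \<forall>t z. 0 < t \<longrightarrow> t < \<delta> \<longrightarrow> norm (act E t z - U t z) \<le> 0 + e" if "e > 0" for e by (rule uni[OF that])
    show "(0::real) \<le> 0" by simp
    fix t :: real and z :: complex and r :: real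
    assume t: "0 < t"
    show "((\<lambda>r. act E r z - U r z) has_vector_derivative act Et t z - (- magnetic_laplacian \<nu> (U t) z)) (at t)"
      by (rule time[OF t])
    show "((\<lambda>r. act E t (z + of_real r) - U t (z + of_real r)) has_vector_derivative
        act (Ed 1) t (z + of_real r) - dir_deriv (U t) 1 (z + of_real r)) (at r)"
      using line(1)[OF t, of z 1 r] by simp
    show "((\<lambda>r. act E t (z + of_real r * \<i>) - U t (z + of_real r * \<i>)) has_vector_derivative
        act (Ed \<i>) t (z + of_real r * \<i>) - dir_deriv (U t) \<i> (z + of_real r * \<i>)) (at r)"
      by (rule line(1)[OF t])
    show "((\<lambda>r. act (Ed 1) t (z + of_real r) - dir_deriv (U t) 1 (z + of_real r)) has_vector_derivative
        act (Edd 1 1) t z - dir_deriv (dir_deriv (U t) 1) 1 z) (at 0)"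
      using line(2)[OF t, of 1 z 1 0] by simp
    show "((\<lambda>r. act (Ed \<i>) t (z + of_real r * \<i>) - dir_deriv (U t) \<i> (z + of_real r * \<i>)) has_vector_derivative
        act (Edd \<i> \<i>) t z - dir_deriv (dir_deriv (U t) \<i>) \<i> z) (at 0)"
      using line(2)[OF t, of \<i> z \<i> 0] by simp
    show "act Et t z - (- magnetic_laplacian \<nu> (U t) z) = of_real ((1 + (norm z)\<^sup>2)\<^sup>2 / 4) *
        ((act (Edd 1 1) t z - dir_deriv (dir_deriv (U t) 1) 1 z) + (act (Edd \<i> \<i>) t z - dir_deriv (dir_deriv (U t) \<i>) \<i> z))
        + of_nat \<nu> * of_real (1 + (norm z)\<^sup>2) * \<i> * (of_real (Im z) * (act (Ed 1) t z - dir_deriv (U t) 1 z) - of_real (Re z) * (act (Ed \<i>) t z - dir_deriv (U t) \<i> z))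
        - of_real ((real \<nu>)\<^sup>2 * (norm z)\<^sup>2) * (act E t z - U t z)"
      by (rule pde[OF t])
  qed
  have "norm (act E T z - U T z) \<le> 0" by (rule max_principle[OF T order_refl])
  then have "act E T z = U T z" by simp
  then show ?thesis unfolding act_def by (simp only: f_def U_def)
qed

text \<open>Letting \<open>s\<close> tend to 0 in the semigroup identity requires the candidate as
  an approximate identity in its second variable, whereas the identity integrates over its first.
  Conjugation and \<open>sphere_kernel_swap\<close> exchange the roles.\<close>

lemma heat_kernel_unique:
  assumes \<nu>: "\<nu> > 0" and E: "is_heat_kernel \<nu> E" and t: "t > 0"
  shows "E t z y = sphere_kernel \<nu> t z y"
proof -
  \<comment> \<open>As a function of \<open>w\<close> the kernel is a section of the dual bundle;
    its conjugate is a section of the bundle itself.\<close>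
  define D where "D = (\<lambda>w. cnj (E t z w))"
  note HE = regular_section_kernel_dual_chart(1)[OF conjunct1[OF E[unfolded is_heat_kernel_def]]]
  obtain K where KK: "heat_regular K \<and> (\<forall>t>0. \<forall>z \<eta>. \<eta> \<noteq> 0 \<longrightarrow> K t z \<eta> = (cnj \<eta> / \<eta>) ^ \<nu> * E t z (1 / \<eta>))"
    using regular_section_kernel_dual_chart(2)[OF conjunct1[OF E[unfolded is_heat_kernel_def]]] ..
  note K = conjunct1[OF KK] conjunct2[OF KK, rule_format]
  have c: "continuous_on UNIV (\<lambda>w. cnj (P t z w))" if "heat_regular P" for P
    by (intro continuous_on_cnj jointly_continuous_compose[OF heat_regular_jointly_continuous(1)[OF that]] continuous_on_const continuous_on_id t)
  have "continuous_section \<nu> D"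
    unfolding continuous_section_def D_def
  proof (intro conjI exI allI impI)
    show "cnj (K t z \<zeta>) = (\<zeta> / cnj \<zeta>) ^ \<nu> * cnj (E t z (1 / \<zeta>))" if "\<zeta> \<noteq> 0" for \<zeta>
      by (simp add: K(2)[OF t that])
  qed (rule c[OF HE] c[OF K(1)])+
  from sphere_kernel_approximate_identity[OF \<nu> this]
  have "((\<lambda>s. \<integral>w. sphere_kernel \<nu> s y w * D w \<partial>sphere_measure) \<longlongrightarrow> D y) (at_right 0)"
    by (rule tendsto_uniform_limitI) simp
  moreover have "\<forall>\<^sub>F s in at_right 0. (\<integral>w. sphere_kernel \<nu> s y w * D w \<partial>sphere_measure) = cnj (sphere_kernel \<nu> (s + t) z y)"
    using eventually_at_right_less[of "0::real"]
  proof eventually_elim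
    case (elim s)
    have "sphere_kernel \<nu> s y w * D w = cnj (E t z w * sphere_kernel \<nu> s w y)" for w
      by (simp add: D_def sphere_kernel_swap[of \<nu> s y w] mult.commute)
    then show ?case by (simp only: Bochner_Integration.integral_cnj heat_kernel_semigroup[OF E elim t] add.commute)
  qed
  ultimately have "((\<lambda>s. cnj (sphere_kernel \<nu> (s + t) z y)) \<longlongrightarrow> D y) (at_right 0)"
    by (rule Lim_transform_eventually)
  moreover have "((\<lambda>s. cnj (sphere_kernel \<nu> (s + t) z y)) \<longlongrightarrow> cnj (sphere_kernel \<nu> t z y)) (at_right 0)"
    by (rule tendsto_cnj, rule tendsto_uniform_limitI[OF sphere_kernel_uniform_continuity[OF t]]) simp
  ultimately have "D y = cnj (sphere_kernel \<nu> t z y)"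
    by (rule tendsto_unique[OF trivial_limit_at_right_real])
  then show ?thesis by (simp add: D_def)
qed

lemma is_heat_kernel_sphere_kernel:
  assumes \<nu>: "\<nu> > 0" and E: "\<And>t z w. t > 0 \<Longrightarrow> E t z w = sphere_kernel \<nu> t z w"
  shows "is_heat_kernel \<nu> E"
  unfolding is_heat_kernel_def
proof (intro conjI allI impI)
  show "regular_section_kernel \<nu> E" by (rule regular_section_kernel_sphere_kernel[OF E])
  show "((\<lambda>s. E s z w) has_vector_derivative - magnetic_laplacian \<nu> (\<lambda>x. E t x w) z) (at t)" if t: "t > 0" for t z w
    unfolding E[OF t]
    by (rule has_vector_derivative_transform_within_open[OF sphere_kernel_heat_equation[OF t], of "{0<..}"]) (use t E in auto)
  show "uniform_limit UNIV (\<lambda>t z. \<integral>w. E t z w * f w \<partial>sphere_measure) f (at_right 0)" if f: "smooth_section \<nu> f" for f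
  proof (rule uniform_limitI)
    fix e :: real assume "e > 0"
    from uniform_limitD[OF sphere_kernel_approximate_identity[OF \<nu> smooth_section_imp_continuous_section[OF f]] this] eventually_at_right_less[of "0::real"]
    show "\<forall>\<^sub>F t in at_right 0. \<forall>z\<in>UNIV. dist (\<integral>w. E t z w * f w \<partial>sphere_measure) (f z) < e"
      by eventually_elim (simp add: E)
  qed
qed

text \<open>Both directions pass through \<open>sphere_kernel\<close>, by uniqueness and by
  existence. Only positive times are determined, since \<open>is_heat_kernel\<close> constrains no
  others.\<close>

theorem theorem3p3:
  fixes \<nu> :: nat and E :: "real \<Rightarrow> complex \<Rightarrow> complex \<Rightarrow> complex"
  assumes "\<nu> > 0"
  shows "is_heat_kernel \<nu> E \<longleftrightarrow> (\<forall>t>0. \<forall>z w.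
    E t z w =
      (let d = sphere_dist z w in
        - (2 * (1 + z * cnj w) ^ (2 * \<nu>) * of_real (exp (- (real \<nu> * t)))
           / of_real (pi * (1 + (norm z)\<^sup>2) ^ \<nu> * (1 + (norm w)\<^sup>2) ^ \<nu> * cos d ^ (2 * \<nu>)))
        * of_real (LBINT u=d..pi/2.
            deriv (\<lambda>x. theta2 \<nu> t x) u / sqrt ((cos d)\<^sup>2 - (cos u)\<^sup>2)
            * hypergeo_2F1 (- 2 * real \<nu>) (2 * real \<nu>) (1 / 2) ((cos d - cos u) / (2 * cos d)))))"
    (is "_ \<longleftrightarrow> (\<forall>t>0. \<forall>z w. E t z w = ?F t z w)")
proof
  assume E: "is_heat_kernel \<nu> E"
  show "\<forall>t>0. \<forall>z w. E t z w = ?F t z w"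
  proof (intro allI impI)
    fix t :: real and z w :: complex assume t: "t > 0"
    show "E t z w = ?F t z w"
      by (rule trans[OF heat_kernel_unique[OF assms E t] sphere_kernel_representation[OF assms t]])
  qed
next
  assume F: "\<forall>t>0. \<forall>z w. E t z w = ?F t z w"
  show "is_heat_kernel \<nu> E"
  proof (rule is_heat_kernel_sphere_kernel[OF assms])
    fix t :: real and z w :: complex assume t: "t > 0"
    show "E t z w = sphere_kernel \<nu> t z w"
      by (rule trans[OF F[rule_format, OF t] sphere_kernel_representation[OF assms t, symmetric]])
  qed
qed

end
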